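(* Let $\alpha\in(0,1]$, and let $\Phi$ be a Young function which is of lower type $p_0$ and of upper type $p_1$ with $1<p_0\le p_1<\infty$. Let $\varphi_1,\varphi_2$ be positive measurable functions on $\mathbb{R}^n\times(0,\infty)$ such that there is a constant $C$, independent of $x$ and $r$, with $$\int_{r}^{\infty} \Big(\operatorname*{ess\,inf}_{t<s<\infty}\frac{\varphi_1(x,s)}{\Phi^{-1}(s^{-n})}\Big)\, \Phi^{-1}(t^{-n})\,\frac{dt}{t} \le C \, \varphi_2(x,r)\qquad\text{for all }x\in\mathbb{R}^n,\ r>0.$$ Then for every $\lambda>3+\frac{2\alpha}{n}$ the operator $g^{*}_{\lambda,\alpha}$ is bounded from $M^{\Phi,\varphi_1}(\mathbb{R}^n)$ to $M^{\Phi,\varphi_2}(\mathbb{R}^n)$, i.e. there is a constant $C'$ such that $\|g^{*}_{\lambda,\alpha} f\|_{M^{\Phi,\varphi_2}}\le C'\|f\|_{M^{\Phi,\varphi_1}}$ for all $f\in M^{\Phi,\varphi_1}(\mathbb{R}^n)$.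
   Context: A Young function is a convex, left-continuous $\Phi:[0,\infty)\to[0,\infty]$ with $\lim_{r\to+0}\Phi(r)=\Phi(0)=0$ and $\lim_{r\to\infty}\Phi(r)=\infty$. Its generalized inverse is $\Phi^{-1}(s)=\inf\{r\ge 0:\Phi(r)>s\}$ ($\inf\emptyset=+\infty$). $\Phi$ is of upper type $p$ (resp. lower type $p$) if there is a positive constant $C$ such that $\Phi(st)\le Ct^p\Phi(s)$ for all $t\in[1,\infty)$ (resp. $t\in[0,1]$) and all $s\in[0,\infty)$. Luxemburg norm: $\|f\|_{L^{\Phi}}=\inf\{\mu>0:\int_{\mathbb{R}^n}\Phi(|f(x)|/\mu)\,dx\le 1\}$. For a ball $B$, $\|f\|_{L^\Phi(B)}=\|f\chi_B\|_{L^\Phi}$. $L^\Phi_{\rm loc}(\mathbb{R}^n)$ is the set of $f$ with $f\chi_B\in L^\Phi(\mathbb{R}^n)$ for every ball $B$, where $L^\Phi(\mathbb{R}^n)$ is the set of locally integrable $f$ with $\int_{\mathbb{R}^n}\Phi(k|f|)<\infty$ for some $k>0$. $B(x,r)$ is the ball of center $x$ and radius $r$. Generalized Orlicz-Morrey space: for a positive measurable $\varphi$ on $\mathbb{R}^n\times(0,\infty)$, $M^{\Phi,\varphi}(\mathbb{R}^n)$ is the set of $f\in L^\Phi_{\rm loc}(\mathbb{R}^n)$ with $\|f\|_{M^{\Phi,\varphi}}=\sup_{x\in\mathbb{R}^n,r>0}\varphi(x,r)^{-1}\Phi^{-1}(r^{-n})\|f\|_{L^\Phi(B(x,r))}<\infty$.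 Intrinsic $g^*_\lambda$ function: for $0<\alpha\le1$, $C_\alpha$ is the family of $\phi:\mathbb{R}^n\to\mathbb{R}$ supported in $\{|x|\le1\}$ with $\int\phi\,dx=0$ and $|\phi(x)-\phi(x')|\le|x-x'|^\alpha$ for all $x,x'\in\mathbb{R}^n$. Put $\phi_t(y)=t^{-n}\phi(y/t)$. For $f\in L^1_{\rm loc}(\mathbb{R}^n)$ and $(y,t)\in\mathbb{R}^{n+1}_+=\mathbb{R}^n\times(0,\infty)$ let $A_\alpha f(t,y)=\sup_{\phi\in C_\alpha}|f*\phi_t(y)|$, and $$g^{*}_{\lambda,\alpha}f(x)=\Big(\iint_{\mathbb{R}^{n+1}_+}\Big(\frac{t}{t+|x-y|}\Big)^{n\lambda}(A_\alpha f(t,y))^2\frac{dy\,dt}{t^{n+1}}\Big)^{1/2}.$$ *)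

theory Defs
  imports "HOL-Analysis.Analysis"
begin

section \<open>Young functions\<close>

text \<open>
  A function from $[0,\infty)$ to $[0,\infty]$ is a \<^typ>\<open>real \<Rightarrow> ennreal\<close> whose values at
  negative arguments are never used.
\<close>

definition young_function :: "(real \<Rightarrow> ennreal) \<Rightarrow> bool" where
  "young_function \<Phi> \<longleftrightarrow>
     (\<forall>x\<ge>0. \<forall>y\<ge>0. \<forall>u\<in>{0<..<1}.
        \<Phi> ((1 - u) * x + u * y) \<le> ennreal (1 - u) * \<Phi> x + ennreal u * \<Phi> y) \<and>
     (\<forall>r>0. continuous (at_left r) \<Phi>) \<and>
     (\<Phi> \<longlongrightarrow> 0) (at_right 0) \<and> \<Phi> 0 = 0 \<and>
     (\<Phi> \<longlongrightarrow> \<infinity>) at_top"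

definition young_inv :: "(real \<Rightarrow> ennreal) \<Rightarrow> ennreal \<Rightarrow> ennreal" where
  "young_inv \<Phi> s = (INF r\<in>{r. 0 \<le> r \<and> s < \<Phi> r}. ennreal r)"

definition upper_type :: "(real \<Rightarrow> ennreal) \<Rightarrow> real \<Rightarrow> bool" where
  "upper_type \<Phi> p \<longleftrightarrow>
     (\<exists>C>0. \<forall>t\<ge>1. \<forall>s\<ge>0. \<Phi> (s * t) \<le> ennreal (C * t powr p) * \<Phi> s)"

definition lower_type :: "(real \<Rightarrow> ennreal) \<Rightarrow> real \<Rightarrow> bool" where
  "lower_type \<Phi> p \<longleftrightarrow>
     (\<exists>C>0. \<forall>t\<in>{0..1}. \<forall>s\<ge>0. \<Phi> (s * t) \<le> ennreal (C * t powr p) * \<Phi> s)"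


section \<open>Orlicz and generalized Orlicz-Morrey spaces\<close>

definition locally_integrable :: "(real ^ 'n \<Rightarrow> real) \<Rightarrow> bool" where
  "locally_integrable f \<longleftrightarrow> (\<forall>K. compact K \<longrightarrow> f absolutely_integrable_on K)"

definition orlicz_space :: "(real \<Rightarrow> ennreal) \<Rightarrow> (real ^ 'n \<Rightarrow> real) set" where
  "orlicz_space \<Phi> =
     {f. locally_integrable f \<and> (\<exists>k>0. (\<integral>\<^sup>+ x. \<Phi> (k * \<bar>f x\<bar>) \<partial>lebesgue) < \<infinity>)}"

definition luxemburg_norm :: "(real \<Rightarrow> ennreal) \<Rightarrow> (real ^ 'n \<Rightarrow> real) \<Rightarrow> ennreal" where
  "luxemburg_norm \<Phi> f =
     (INF \<mu>\<in>{\<mu>. 0 < \<mu> \<and> (\<integral>\<^sup>+ x. \<Phi> (\<bar>f x\<bar> / \<mu>) \<partial>lebesgue) \<le> 1}. ennreal \<mu>)"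

definition orlicz_loc :: "(real \<Rightarrow> ennreal) \<Rightarrow> (real ^ 'n \<Rightarrow> real) set" where
  "orlicz_loc \<Phi> = {f. \<forall>x. \<forall>r>0. (\<lambda>y. f y * indicator (ball x r) y) \<in> orlicz_space \<Phi>}"

definition orlicz_morrey_norm ::
  "(real \<Rightarrow> ennreal) \<Rightarrow> (real ^ 'n \<Rightarrow> real \<Rightarrow> real) \<Rightarrow> (real ^ 'n \<Rightarrow> real) \<Rightarrow> ennreal" where
  "orlicz_morrey_norm \<Phi> \<phi> f =
     (SUP (x, r) \<in> UNIV \<times> {0<..}.
        ennreal (inverse (\<phi> x r)) * young_inv \<Phi> (ennreal (r powi (- int CARD('n)))) *
        luxemburg_norm \<Phi> (\<lambda>y. f y * indicator (ball x r) y))"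

definition orlicz_morrey_space ::
  "(real \<Rightarrow> ennreal) \<Rightarrow> (real ^ 'n \<Rightarrow> real \<Rightarrow> real) \<Rightarrow> (real ^ 'n \<Rightarrow> real) set" where
  "orlicz_morrey_space \<Phi> \<phi> = {f \<in> orlicz_loc \<Phi>. orlicz_morrey_norm \<Phi> \<phi> f < \<infinity>}"

definition positive_measurable :: "(real ^ 'n \<Rightarrow> real \<Rightarrow> real) \<Rightarrow> bool" where
  "positive_measurable \<phi> \<longleftrightarrow>
     (\<forall>x. \<forall>r>0. 0 < \<phi> x r) \<and>
     case_prod \<phi> \<in> borel_measurable (lebesgue_on (UNIV \<times> {0<..}))"

text \<open>
  The essential infimum of an arbitrary function, as its largest essential lower bound. No
  measurability is required, since the sections of a measurable function of \<open>(x, r)\<close> are in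
  general measurable for almost every \<open>x\<close> only.
\<close>

definition ess_inf_on :: "real set \<Rightarrow> (real \<Rightarrow> ennreal) \<Rightarrow> ennreal" where
  "ess_inf_on S h = Sup {c. AE s in lebesgue. s \<in> S \<longrightarrow> c \<le> h s}"


section \<open>The intrinsic square function\<close>

definition intrinsic_family :: "real \<Rightarrow> (real ^ 'n \<Rightarrow> real) set" where
  "intrinsic_family \<alpha> =
     {\<psi>. (\<forall>x. 1 < norm x \<longrightarrow> \<psi> x = 0) \<and> (LINT x|lebesgue. \<psi> x) = 0 \<and>
         (\<forall>x x'. \<bar>\<psi> x - \<psi> x'\<bar> \<le> norm (x - x') powr \<alpha>)}"

definition dilate :: "real \<Rightarrow> (real ^ 'n \<Rightarrow> real) \<Rightarrow> real ^ 'n \<Rightarrow> real" where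
  "dilate t \<psi> y = t powi (- int CARD('n)) * \<psi> (y /\<^sub>R t)"

definition convolution :: "(real ^ 'n \<Rightarrow> real) \<Rightarrow> (real ^ 'n \<Rightarrow> real) \<Rightarrow> real ^ 'n \<Rightarrow> real" where
  "convolution f g y = (LINT z|lebesgue. f z * g (y - z))"

definition intrinsic_sup :: "real \<Rightarrow> (real ^ 'n \<Rightarrow> real) \<Rightarrow> real \<Rightarrow> real ^ 'n \<Rightarrow> ennreal" where
  "intrinsic_sup \<alpha> f t y =
     (SUP \<psi>\<in>intrinsic_family \<alpha>. ennreal \<bar>convolution f (dilate t \<psi>) y\<bar>)"

definition ennreal_sqrt :: "ennreal \<Rightarrow> ennreal" where
  "ennreal_sqrt a = (if a = \<infinity> then \<infinity> else ennreal (sqrt (enn2real a)))"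

definition intrinsic_gstar ::
  "real \<Rightarrow> real \<Rightarrow> (real ^ 'n \<Rightarrow> real) \<Rightarrow> real ^ 'n \<Rightarrow> ennreal" where
  "intrinsic_gstar l \<alpha> f x = ennreal_sqrt
     (\<integral>\<^sup>+ (y, t) \<in> UNIV \<times> {0<..}.
        ennreal ((t / (t + norm (x - y))) powr (real CARD('n) * l)) *
        (intrinsic_sup \<alpha> f t y)\<^sup>2 / ennreal (t ^ (CARD('n) + 1)) \<partial>lebesgue)"

end

theory Submission
  imports Defs
begin

text \<open>
  Cutting the half space into Whitney boxes over dyadic cubes of side \<open>\<tau>\<close> and corner \<open>c\<close> bounds
  \<open>(g\<^sup>*f(x))\<^sup>2\<close> pointwise by a constant times \<open>(S f(x))\<^sup>2\<close>, the sum over all cubes of the squared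
  supremum of \<open>f\<close> tested against Hoelder bumps adapted to the cube, weighted by the square of
  \<open>(\<tau> / (\<tau> + |x - c|)) powr (n + 1/2)\<close>; this needs only \<open>n l \<ge> 2 n + 1\<close>.

  Almost orthogonality of the bumps gives the \<open>L\<^sup>2\<close> estimate for \<open>S\<close>, and a Calderon-Zygmund
  decomposition the weak type (1,1). For large exponents, the \<open>L\<^sup>2\<close> estimate on level sets of a maximal
  function \<open>M v\<close> gives a weighted inequality of the form \<open>\<integral>(S f)\<^sup>2 v \<le> C \<integral>f\<^sup>2 M v\<close>; choosing for \<open>v\<close>
  a power of a truncation of \<open>S f\<close> lets the left-hand side absorb the right-hand side. Interpolation between
  the two endpoints yields the modular inequality \<open>\<integral>\<Phi>(S f) \<le> C \<integral>\<Phi>(|f|)\<close>.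

  On a ball of radius \<open>r\<close> split \<open>f\<close> into its part on the doubled ball, controlled by the modular
  inequality, and the rest, where \<open>S\<close> is controlled by \<open>\<integral>|f(z)| / |z - x|\<^sup>n dz\<close>. Both are bounded by
  \<open>\<integral>\<^sub>r \<parallel>f\<parallel>(t) \<Phi>\<^sup>-\<^sup>1(t\<^sup>-\<^sup>n) dt/t\<close>, where \<open>\<parallel>f\<parallel>(t)\<close> is the Orlicz norm on the ball of radius \<open>t\<close>. As
  \<open>\<parallel>f\<parallel>(t)\<close> increases with \<open>t\<close>, it is at most the Morrey norm of \<open>f\<close> times the essential infimum in
  the hypothesis, which then finishes the proof.
\<close>

text \<open>The supremum over test functions sits inside every coefficient, so no operator here is
  linear. This is harmless because all estimates are uniform in the choice of one bump per cube: the
  L^2 bound picks near-maximal bumps and runs a TT-star argument whose matrix decays by cancellation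
  and Hoelder continuity alone. The exponent n + 1/2 is the one whose double is 2 n + 1; being above
  n it makes the weights integrable and summable even without squares, so l^2 sums over cubes may be
  replaced by l^1 sums for the bad part and for the far part. The main obstacle is that S f may be
  infinite and no finiteness is known beforehand. Absorption is therefore carried out on finite sums
  of cubes, and \<open>layers\<close> gives infinite values an infinite modular, so that the modular
  bound itself yields finiteness almost everywhere. As \<Phi> is known only through its types,
  interpolation needs endpoints strictly outside the interval from \<open>p\<^sub>0\<close> to
  \<open>p\<^sub>1\<close>: 1 and some q above \<open>p\<^sub>1\<close>. Convexity then turns a
  modular inequality with a large constant into a norm inequality, by shrinking the
  argument.\<close>

abbreviation nsum :: "('i \<Rightarrow> ennreal) \<Rightarrow> ennreal"  (binder \<open>\<Sum>\<^sup>+\<close> 10) where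
  "nsum f \<equiv> nn_integral (count_space UNIV) f"

lemma nsum_mono: "(\<And>i. f i \<le> g i) \<Longrightarrow> (\<Sum>\<^sup>+i. f i) \<le> (\<Sum>\<^sup>+i. g i)"
  by (rule nn_integral_mono) auto

lemma nsum_upper: "f i \<le> (\<Sum>\<^sup>+i. f i)"
proof -
  have "f i = (\<Sum>\<^sup>+j. f j * indicator {i} j)"
    by (subst nn_integral_count_space'[of "{i}"]) (auto simp: indicator_def)
  also have "\<dots> \<le> (\<Sum>\<^sup>+i. f i)"
    by (rule nsum_mono) (auto simp: indicator_def)
  finally show ?thesis .
qed

text \<open>The l^2 norm is at most the l^1 norm: one factor of each square is bounded by the whole
  sum. This is what replaces a square function by a linear sum that can be interchanged with
  integrals.\<close>

lemma nsum_square_le: "(\<Sum>\<^sup>+i. (f i)\<^sup>2) \<le> (\<Sum>\<^sup>+i. f i)\<^sup>2"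
proof -
  have "(\<Sum>\<^sup>+i. (f i)\<^sup>2) \<le> (\<Sum>\<^sup>+i. f i * (\<Sum>\<^sup>+j. f j))"
    by (rule nsum_mono) (auto simp: power2_eq_square intro!: mult_mono nsum_upper)
  also have "\<dots> = (\<Sum>\<^sup>+i. f i)\<^sup>2"
    by (simp add: nn_integral_multc power2_eq_square)
  finally show ?thesis .
qed

lemma nsum_pair: "(\<Sum>\<^sup>+p. f p) = (\<Sum>\<^sup>+(k::'a::countable). \<Sum>\<^sup>+(m::'b::countable). f (k, m))"
  by (rule nn_integral_fst_count_space[symmetric])

lemma nsum_swap: "(\<Sum>\<^sup>+(i::'a::countable). \<Sum>\<^sup>+(j::'b::countable). f i j) = (\<Sum>\<^sup>+j. \<Sum>\<^sup>+i. f i j)"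
  by (rule nn_integral_count_space_nn_integral[symmetric]) auto

lemma nn_integral_nsum:
  fixes f :: "'i::countable \<Rightarrow> 'a \<Rightarrow> ennreal"
  assumes "\<And>i. f i \<in> borel_measurable M"
  shows "(\<integral>\<^sup>+x. (\<Sum>\<^sup>+i. f i x) \<partial>M) = (\<Sum>\<^sup>+i. \<integral>\<^sup>+x. f i x \<partial>M)"
  by (rule nn_integral_count_space_nn_integral) (use assms in auto)

text \<open>Enumerates the index type by \<open>to_nat\<close>, padding with zeros outside its
  range, so that measurability and partial-sum arguments for series carry over to sums over
  cubes.\<close>

lemma nsum_suminf:
  fixes f :: "'i::countable \<Rightarrow> ennreal"
  shows "(\<Sum>\<^sup>+i. f i) = (\<Sum>n. if n \<in> range (to_nat :: 'i \<Rightarrow> nat) then f (from_nat n) else 0)"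
proof -
  have "(\<Sum>\<^sup>+i. f i) = (\<Sum>\<^sup>+i. f (from_nat (to_nat (i::'i))))" by (simp only: from_nat_to_nat)
  also have "\<dots> = (\<integral>\<^sup>+n. f (from_nat n) \<partial>count_space (range (to_nat :: 'i \<Rightarrow> nat)))"
    by (rule nn_integral_bij_count_space) (auto intro: bij_betw_imageI inj_onI)
  also have "\<dots> = (\<Sum>\<^sup>+n. f (from_nat n) * indicator (range (to_nat :: 'i \<Rightarrow> nat)) n)"
    by (subst nn_integral_count_space_indicator) auto
  also have "\<dots> = (\<Sum>n. f (from_nat n) * indicator (range (to_nat :: 'i \<Rightarrow> nat)) n)"
    by (rule nn_integral_count_space_nat)
  also have "\<dots> = (\<Sum>n. if n \<in> range (to_nat :: 'i \<Rightarrow> nat) then f (from_nat n) else 0)"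
    by (intro arg_cong[where f=suminf] ext) (auto simp: indicator_def)
  finally show ?thesis .
qed

lemma borel_measurable_nsum:
  fixes f :: "'i::countable \<Rightarrow> 'a \<Rightarrow> ennreal"
  assumes "\<And>i. f i \<in> borel_measurable M"
  shows "(\<lambda>x. (\<Sum>\<^sup>+i. f i x)) \<in> borel_measurable M"
  unfolding nsum_suminf using assms by (intro borel_measurable_suminf_order) auto

text \<open>Initial segments of the enumeration are finite sets. This is how estimates for finitely
  many cubes are completed to all cubes.\<close>

lemma nsum_le_finite:
  fixes f :: "'i::countable \<Rightarrow> ennreal"
  assumes "\<And>F. finite F \<Longrightarrow> (\<Sum>i\<in>F. f i) \<le> c"
  shows "(\<Sum>\<^sup>+i. f i) \<le> c"
  unfolding nsum_suminf suminf_eq_SUP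
proof (rule SUP_least)
  fix n
  define F where "F = {i :: 'i. to_nat i < n}"
  have fin: "finite F"
    using finite_vimageI[of "{..<n}" "to_nat :: 'i \<Rightarrow> nat"] by (simp add: F_def vimage_def)
  have "(\<Sum>i<n. if i \<in> range (to_nat :: 'i \<Rightarrow> nat) then f (from_nat i) else 0)
      = (\<Sum>i\<in>to_nat ` F. f (from_nat i))"
    by (intro sum.mono_neutral_cong_right) (auto simp: F_def)
  also have "\<dots> = (\<Sum>i\<in>F. f i)" by (subst sum.reindex) (auto intro: inj_onI)
  also have "\<dots> \<le> c" using fin by (rule assms)
  finally show "(\<Sum>i<n. if i \<in> range (to_nat :: 'i \<Rightarrow> nat) then f (from_nat i) else 0) \<le> c" .
qed

lemma sum_le_nsum:
  assumes "finite F" shows "(\<Sum>i\<in>F. f i) \<le> (\<Sum>\<^sup>+i. f i)"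
proof -
  have "(\<Sum>i\<in>F. f i) = (\<Sum>\<^sup>+i. f i * indicator F i)"
    using assms by (subst nn_integral_count_space'[of F]) (auto simp: indicator_def)
  also have "\<dots> \<le> (\<Sum>\<^sup>+i. f i)" by (rule nsum_mono) (auto simp: indicator_def)
  finally show ?thesis .
qed

section \<open>Dyadic scales\<close>

text \<open>A real power with integer exponent: scales below and above 1 are treated alike, and
  fractional powers of a side combine by the \<open>powr\<close> laws.\<close>

definition sz :: "int \<Rightarrow> real" where "sz k = 2 powr real_of_int k"

lemma sz_pos [simp]: "0 < sz k" and sz_nonneg [simp]: "0 \<le> sz k" and sz_neq_0 [simp]: "sz k \<noteq> 0"
  by (auto simp: sz_def)

lemma sz_add: "sz (a + b) = sz a * sz b" by (simp add: sz_def powr_add)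
lemma sz_diff: "sz (a - b) = sz a / sz b" by (simp add: sz_def powr_diff)
lemma sz_minus: "sz (- a) = 1 / sz a" by (simp add: sz_def powr_minus_divide)
lemma sz_0 [simp]: "sz 0 = 1" by (simp add: sz_def)
lemma sz_1 [simp]: "sz 1 = 2" by (simp add: sz_def)
lemma sz_Suc: "sz (k + 1) = 2 * sz k" by (simp add: sz_add)
lemma sz_pred: "sz (k - 1) = sz k / 2" by (simp add: sz_diff)
lemma sz_le_iff [simp]: "sz a \<le> sz b \<longleftrightarrow> a \<le> b" by (simp add: sz_def)
lemma sz_less_iff [simp]: "sz a < sz b \<longleftrightarrow> a < b" by (simp add: sz_def)
lemma sz_of_nat: "sz (int j) = 2 ^ j" by (simp add: sz_def powr_realpow)

lemma sz_bracket:
  assumes "0 < d" obtains k where "sz k \<le> d" "d < 2 * sz k"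
proof
  have *: "sz \<lfloor>log 2 d\<rfloor> \<le> 2 powr (log 2 d)" "2 powr (log 2 d) < sz (\<lfloor>log 2 d\<rfloor> + 1)"
    unfolding sz_def by (simp_all, linarith?)
  then show "sz \<lfloor>log 2 d\<rfloor> \<le> d" "d < 2 * sz \<lfloor>log 2 d\<rfloor>"
    using assms by (simp_all add: sz_Suc)
qed

text \<open>With \<open>sz K\<close> the largest dyadic number not exceeding d, the substitution k =
  K - j turns the sum into a geometric series of ratio \<open>2 powr - e\<close>, headed by a term
  at most \<open>d powr e\<close>.\<close>

lemma geometric_sum_below:
  assumes "0 < e"
  obtains C where "0 \<le> C" "\<And>d. 0 < d \<Longrightarrow>
    (\<Sum>\<^sup>+k. ennreal (sz k powr e) * indicator {k. sz k \<le> d} k) \<le> ennreal (C * d powr e)"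
proof
  define C where "C = 1 / (1 - 2 powr - e)"
  have q: "0 < 2 powr - e" "2 powr - e < 1" using assms powr_less_one by auto
  show "0 \<le> C" unfolding C_def using q by simp
  fix d :: real assume "0 < d"
  then obtain K where K: "sz K \<le> d" "d < 2 * sz K" by (rule sz_bracket)
  have set: "{k. sz k \<le> d} = {..K}"
  proof safe
    fix k assume "sz k \<le> d"
    with K have "sz k < sz (K + 1)" by (simp add: sz_Suc)
    then show "k \<le> K" by simp
  next
    fix k assume "k \<le> K" then have "sz k \<le> sz K" by simp
    then show "sz k \<le> d" using K by linarith
  qed
  have "(\<Sum>\<^sup>+k. ennreal (sz k powr e) * indicator {k. sz k \<le> d} k) =
      (\<integral>\<^sup>+k. ennreal (sz k powr e) \<partial>count_space {..K})"
    unfolding set by (simp add: nn_integral_count_space_indicator)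
  also have "\<dots> = (\<Sum>\<^sup>+j. ennreal (sz (K - int j) powr e))"
    by (rule nn_integral_bij_count_space[symmetric])
       (auto intro!: bij_betwI[where g="\<lambda>k. nat (K - k)"])
  also have "\<dots> = (\<Sum>j. ennreal (sz K powr e * (2 powr - e) ^ j))"
    unfolding nn_integral_count_space_nat
    by (intro arg_cong[where f=suminf] ext arg_cong[where f=ennreal])
       (simp add: sz_def powr_powr flip: powr_realpow powr_add, simp add: algebra_simps)
  also have "\<dots> = ennreal (sz K powr e * C)"
  proof (rule suminf_ennreal_eq)
    show "(\<lambda>j. sz K powr e * (2 powr - e) ^ j) sums (sz K powr e * C)"
      unfolding C_def by (intro sums_mult geometric_sums) (use q in auto)
  qed simp
  also have "\<dots> \<le> ennreal (C * d powr e)"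
    using K assms \<open>0 \<le> C\<close> by (subst mult.commute) (intro ennreal_leI mult_left_mono powr_mono2, auto)
  finally show "(\<Sum>\<^sup>+k. ennreal (sz k powr e) * indicator {k. sz k \<le> d} k) \<le> ennreal (C * d powr e)" .
qed

text \<open>The reflection of k to -k exchanges large and small scales and reduces this to the
  previous sum at 1 / d.\<close>

lemma geometric_sum_above:
  assumes "0 < e"
  obtains C where "0 \<le> C" "\<And>d. 0 < d \<Longrightarrow>
    (\<Sum>\<^sup>+k. ennreal (sz k powr - e) * indicator {k. d \<le> sz k} k) \<le> ennreal (C * d powr - e)"
proof -
  from geometric_sum_below[OF assms] obtain C where C: "0 \<le> C"
    "\<And>d. 0 < d \<Longrightarrow> (\<Sum>\<^sup>+k. ennreal (sz k powr e) * indicator {k. sz k \<le> d} k) \<le> ennreal (C * d powr e)"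
    by metis
  have "(\<Sum>\<^sup>+k. ennreal (sz k powr - e) * indicator {k. d \<le> sz k} k) \<le> ennreal (C * d powr - e)"
    if "0 < d" for d
  proof -
    have "(\<Sum>\<^sup>+k. ennreal (sz k powr - e) * indicator {k. d \<le> sz k} k) =
       (\<Sum>\<^sup>+k. ennreal (sz (- k) powr - e) * indicator {k. d \<le> sz k} (- k))"
      by (rule nn_integral_bij_count_space[symmetric]) (auto intro!: bij_betwI[where g=uminus])
    also have "\<dots> = (\<Sum>\<^sup>+k. ennreal (sz k powr e) * indicator {k. sz k \<le> 1 / d} k)"
      using that by (intro nn_integral_cong arg_cong2[where f="(*)"])
         (auto simp: sz_minus powr_minus_divide powr_divide indicator_def field_simps)
    also have "\<dots> \<le> ennreal (C * (1 / d) powr e)" using that by (intro C) auto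
    also have "(1 / d) powr e = d powr - e" using that by (simp add: powr_divide powr_minus_divide)
    finally show ?thesis .
  qed
  then show ?thesis using C(1) that by blast
qed

text \<open>Upper half of a dyadic layer-cake formula. By density it suffices to treat a finite
  positive b below a, and then the single term with \<open>sz k \<le> b < 2 * sz k\<close> is large
  enough; this also covers infinite a.\<close>

lemma dyadic_layer_upper:
  fixes a :: ennreal
  shows "a \<le> (\<Sum>\<^sup>+k. ennreal (sz (k + 1)) * indicator {k. ennreal (sz k) < a} k)" (is "_ \<le> ?S")
proof -
  have *: "ennreal (sz (k + 1)) \<le> ?S" if "ennreal (sz k) < a" for k
    using nsum_upper[of "\<lambda>k. ennreal (sz (k + 1)) * indicator {k. ennreal (sz k) < a} k" k] that by simp
  show ?thesis
  proof (rule dense_le)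
    fix b assume "b < a"
    show "b \<le> ?S"
    proof (cases "b = 0")
      case False
      from \<open>b < a\<close> have "b \<noteq> top" by auto
      with False obtain r where r: "b = ennreal r" "0 < r"
        by (cases b) (auto simp: less_le)
      obtain k where k: "sz k \<le> r" "r < 2 * sz k" using r(2) by (rule sz_bracket)
      have "ennreal (sz k) < a" using \<open>b < a\<close> r k by (meson ennreal_leI le_less_trans)
      from *[OF this] have "ennreal (2 * sz k) \<le> ?S" by (simp add: sz_Suc)
      moreover have "b \<le> ennreal (2 * sz k)" using r k by (auto intro: ennreal_leI)
      ultimately show ?thesis by (rule order_trans[rotated])
    qed simp
  qed
qed

text \<open>The terms with \<open>sz k < a\<close> form a geometric sum of order a. The additional 1
  in the constant \<open>2 * C + 1\<close> keeps it positive, so that the right-hand side is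
  infinite when a is.\<close>

lemma dyadic_layer_lower:
  obtains C where "0 \<le> C"
    "\<And>a. (\<Sum>\<^sup>+k. ennreal (sz (k + 1)) * indicator {k. ennreal (sz k) < a} k) \<le> ennreal C * a"
proof -
  obtain C where C: "0 \<le> C"
    "\<And>d. 0 < d \<Longrightarrow> (\<Sum>\<^sup>+k. ennreal (sz k powr 1) * indicator {k. sz k \<le> d} k) \<le> ennreal (C * d powr 1)"
    by (rule geometric_sum_below[of 1]) auto
  have "(\<Sum>\<^sup>+k. ennreal (sz (k + 1)) * indicator {k. ennreal (sz k) < a} k) \<le> ennreal (2 * C + 1) * a" for a
  proof (cases "a = top \<or> a = 0")
    case True
    then show ?thesis using C(1) by (auto simp: ennreal_mult_top)
  next
    case False
    then obtain r where r: "a = ennreal r" "0 < r" by (cases a) (auto simp: less_le)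
    have "(\<Sum>\<^sup>+k. ennreal (sz (k + 1)) * indicator {k. ennreal (sz k) < a} k)
        \<le> (\<Sum>\<^sup>+k. 2 * (ennreal (sz k powr 1) * indicator {k. sz k \<le> r} k))"
      using r by (intro nsum_mono) (auto simp: indicator_def sz_Suc ennreal_mult ennreal_less_iff)
    also have "\<dots> = 2 * (\<Sum>\<^sup>+k. ennreal (sz k powr 1) * indicator {k. sz k \<le> r} k)"
      by (rule nn_integral_cmult) auto
    also have "\<dots> \<le> 2 * ennreal (C * r powr 1)" using r by (intro mult_left_mono C) auto
    also have "\<dots> \<le> ennreal ((2 * C + 1) * r)" using r C(1)
      by (simp add: ennreal_mult'[symmetric] numeral_mult_ennreal algebra_simps)
    also have "\<dots> = ennreal (2 * C + 1) * a" using r C(1) by (simp add: ennreal_mult)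
    finally show ?thesis .
  qed
  then show ?thesis using C(1) by (intro that[of "2 * C + 1"]) auto
qed

section \<open>Dyadic cubes\<close>

definition corner :: "int \<Rightarrow> int ^ 'n \<Rightarrow> real ^ 'n" where
  "corner k m = (\<chi> i. sz k * real_of_int (m $ i))"

definition cidx :: "int \<Rightarrow> real ^ 'n \<Rightarrow> int ^ 'n" where
  "cidx k x = (\<chi> i. \<lfloor>x $ i / sz k\<rfloor>)"

text \<open>A fibre of \<open>cidx k\<close>, so that the cubes of one scale partition the space by
  construction; they are half open.\<close>

definition dcube :: "int \<Rightarrow> int ^ 'n \<Rightarrow> (real ^ 'n) set" where
  "dcube k m = {x. cidx k x = m}"

lemma cidx_corner [simp]: "cidx k (corner k m) = m"
  by (simp add: cidx_def corner_def vec_eq_iff)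

lemma corner_in_dcube [simp]: "corner k m \<in> dcube k m"
  by (simp add: dcube_def)

lemma mem_dcube_iff: "x \<in> dcube k m \<longleftrightarrow> (\<forall>i. sz k * m $ i \<le> x $ i \<and> x $ i < sz k * (m $ i + 1))"
  unfolding dcube_def cidx_def
  by (auto simp: vec_eq_iff floor_eq_iff field_simps)

text \<open>Rounding at the coarse scale j is the integer quotient, by a power of two, of rounding
  at the fine scale k. The coarse index is thus a function of the fine one, which is the nesting of
  dyadic cubes.\<close>

lemma cidx_mono:
  assumes "cidx k x = cidx k y" "k \<le> j"
  shows "cidx j x = cidx j y"
proof -
  obtain d where d: "j = k + int d" using assms(2) zle_iff_zadd by auto
  have *: "cidx j z $ i = cidx k z $ i div 2 ^ d" for z :: "real ^ 'n" and i
  proof -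
    have "z $ i / sz j = (z $ i / sz k) / real_of_int (2 ^ d)"
      by (simp add: d sz_add sz_of_nat)
    also have "\<lfloor>\<dots>\<rfloor> = \<lfloor>z $ i / sz k\<rfloor> div 2 ^ d"
      by (rule floor_divide_real_eq_div) simp
    finally show ?thesis by (simp add: cidx_def)
  qed
  show ?thesis unfolding vec_eq_iff * assms(1) by simp
qed

lemma dcube_ancestor:
  assumes "k \<le> j" shows "dcube k m \<subseteq> dcube j (cidx j (corner k m))"
proof
  fix x assume "x \<in> dcube k m"
  then have "cidx k x = cidx k (corner k m)" by (simp add: dcube_def)
  then have "cidx j x = cidx j (corner k m)" using assms by (rule cidx_mono)
  then show "x \<in> dcube j (cidx j (corner k m))" by (simp add: dcube_def)
qed

lemma dcube_dist:
  fixes x y :: "real ^ 'n"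
  assumes "x \<in> dcube k m" "y \<in> dcube k m"
  shows "norm (x - y) \<le> real CARD('n) * sz k"
proof -
  have "norm (x - y) \<le> (\<Sum>i\<in>UNIV. \<bar>(x - y) $ i\<bar>)" by (rule norm_le_l1_cart)
  also have "\<dots> \<le> (\<Sum>i\<in>(UNIV::'n set). sz k)"
  proof (rule sum_mono)
    fix i
    show "\<bar>(x - y) $ i\<bar> \<le> sz k"
      using assms[unfolded mem_dcube_iff, rule_format, of i] by (auto simp: algebra_simps abs_le_iff)
  qed
  finally show ?thesis by simp
qed

lemma borel_dcube [measurable]: "dcube k m \<in> sets borel"
proof -
  have "dcube k m = (\<Inter>i. {x. sz k * m $ i \<le> x $ i} \<inter> {x. x $ i < sz k * (m $ i + 1)})"
    by (auto simp: mem_dcube_iff)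
  also have "\<dots> \<in> sets borel" by measurable
  finally show ?thesis .
qed

lemma lebesgue_of_borel: "A \<in> sets borel \<Longrightarrow> A \<in> sets lebesgue"
  using sets_completionI_sets[of A lborel] by auto

lemma lebesgue_dcube [measurable]: "dcube k m \<in> sets lebesgue"
  by (intro lebesgue_of_borel borel_dcube)

text \<open>The half-open cube lies between an open and a closed box with the same sides.\<close>

lemma emeasure_dcube: "emeasure lebesgue (dcube k (m :: int ^ 'n)) = ennreal (sz k ^ CARD('n))"
proof -
  define u where "u = corner k m + sz k *\<^sub>R One"
  have u: "u $ i = sz k * (m $ i + 1)" for i
  proof -
    have "(One :: real ^ 'n) $ i = 1"
      using inner_sum_Basis[of "axis i 1 :: real ^ 'n"] by (simp add: axis_in_Basis_iff inner_commute cart_eq_inner_axis)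
    then show ?thesis by (simp add: u_def corner_def algebra_simps)
  qed
  have prod: "(\<Prod>b\<in>Basis. (u - corner k m) \<bullet> b) = sz k ^ CARD('n)"
    by (simp add: u_def inner_sum_Basis)
  have le: "corner k m \<bullet> b \<le> u \<bullet> b" if "b \<in> Basis" for b
    using that by (simp add: u_def inner_add_left inner_sum_Basis)
  have 1: "emeasure lborel (dcube k m) \<le> ennreal (sz k ^ CARD('n))"
  proof -
    have "dcube k m \<subseteq> cbox (corner k m) u"
      unfolding mem_dcube_iff subset_iff mem_box_cart u by (simp add: corner_def less_imp_le)
    then have "emeasure lborel (dcube k m) \<le> emeasure lborel (cbox (corner k m) u)"
      by (intro emeasure_mono) auto
    then show ?thesis using prod le by (simp add: emeasure_lborel_cbox)
  qed
  have 2: "ennreal (sz k ^ CARD('n)) \<le> emeasure lborel (dcube k m)"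
  proof -
    have "box (corner k m) u \<subseteq> dcube k m"
      unfolding mem_dcube_iff subset_iff mem_box_cart u by (simp add: corner_def less_imp_le)
    then have "emeasure lborel (box (corner k m) u) \<le> emeasure lborel (dcube k m)"
      by (intro emeasure_mono) auto
    then show ?thesis using prod le by (simp add: emeasure_lborel_box)
  qed
  from 1 2 show ?thesis by (simp add: emeasure_completion)
qed

lemma nn_integral_dcubes:
  fixes h :: "real ^ 'n \<Rightarrow> ennreal"
  assumes [measurable]: "h \<in> borel_measurable lebesgue"
  shows "(\<Sum>\<^sup>+m. \<integral>\<^sup>+x\<in>dcube k m. h x \<partial>lebesgue) = (\<integral>\<^sup>+x. h x \<partial>lebesgue)"
proof -
  have *: "(\<Sum>\<^sup>+m. h x * indicator (dcube k m) x) = h x" for x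
  proof -
    have "(\<Sum>\<^sup>+m. h x * indicator (dcube k m) x) = (\<Sum>\<^sup>+m. h x * indicator {cidx k x} m)"
      by (rule nn_integral_cong) (auto simp: indicator_def dcube_def)
    then show ?thesis by (simp add: nn_integral_cmult)
  qed
  show ?thesis by (subst nn_integral_nsum[symmetric]) (auto simp: *)
qed

text \<open>The cubes with these corners are disjoint and lie in a ball of radius
  \<open>\<rho> + n * sz k\<close>, n being the dimension, so their total volume is at most that of
  the ball.\<close>

lemma corner_count:
  obtains C where "0 \<le> C" "\<And>k (x :: real ^ 'n) \<rho>. 0 \<le> \<rho> \<Longrightarrow>
    (\<Sum>\<^sup>+m. indicator {m. norm (corner k m - x) \<le> \<rho>} m * ennreal (sz k ^ CARD('n)))
      \<le> ennreal (C * (\<rho> + sz k) ^ CARD('n))"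
proof
  define V where "V = unit_ball_vol (real CARD('n))"
  have V: "0 \<le> V" by (simp add: V_def unit_ball_vol_nonneg)
  show "0 \<le> V * real CARD('n) ^ CARD('n)" using V by simp
  fix k and x :: "real ^ 'n" and \<rho> :: real assume \<rho>: "0 \<le> \<rho>"
  have n1: "1 \<le> real CARD('n)" by (simp add: Suc_leI)
  have "(\<Sum>\<^sup>+m. indicator {m. norm (corner k m - x) \<le> \<rho>} m * ennreal (sz k ^ CARD('n)))
      = (\<Sum>\<^sup>+m. indicator {m. norm (corner k m - x) \<le> \<rho>} m * emeasure lebesgue (dcube k m))"
    by (simp add: emeasure_dcube)
  also have "\<dots> \<le> (\<Sum>\<^sup>+m. \<integral>\<^sup>+y\<in>dcube k m. indicator (cball x (\<rho> + real CARD('n) * sz k)) y \<partial>lebesgue)"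
  proof (rule nsum_mono)
    fix m :: "int ^ 'n"
    show "indicator {m. norm (corner k m - x) \<le> \<rho>} m * emeasure lebesgue (dcube k m) \<le>
       (\<integral>\<^sup>+y\<in>dcube k m. indicator (cball x (\<rho> + real CARD('n) * sz k)) y \<partial>lebesgue)"
    proof (cases "norm (corner k m - x) \<le> \<rho>")
      case True
      have "y \<in> cball x (\<rho> + real CARD('n) * sz k)" if "y \<in> dcube k m" for y
      proof -
        have "norm (y - x) \<le> norm (y - corner k m) + norm (corner k m - x)" using norm_triangle_ineq[of "y - corner k m" "corner k m - x"] by simp
        also have "norm (y - corner k m) \<le> real CARD('n) * sz k" using that by (rule dcube_dist) simp
        finally show ?thesis using True by (simp add: dist_norm norm_minus_commute)
      qed
      then have "(\<integral>\<^sup>+y\<in>dcube k m. indicator (cball x (\<rho> + real CARD('n) * sz k)) y \<partial>lebesgue)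
         = (\<integral>\<^sup>+y. indicator (dcube k m) y \<partial>lebesgue)"
        by (intro nn_integral_cong) (auto simp: indicator_def)
      then show ?thesis using True by simp
    qed simp
  qed
  also have "\<dots> = (\<integral>\<^sup>+y. indicator (cball x (\<rho> + real CARD('n) * sz k)) y \<partial>lebesgue)"
    by (intro nn_integral_dcubes borel_measurable_indicator lebesgue_of_borel) simp
  also have "\<dots> = emeasure lborel (cball x (\<rho> + real CARD('n) * sz k))"
    by (simp add: emeasure_completion)
  also have "\<dots> = ennreal (V * (\<rho> + real CARD('n) * sz k) ^ CARD('n))"
    using \<rho> by (subst emeasure_cball) (auto simp: V_def)
  also have "\<dots> \<le> ennreal (V * (real CARD('n) * (\<rho> + sz k)) ^ CARD('n))"
  proof (intro ennreal_leI mult_left_mono power_mono)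
    have "1 * \<rho> \<le> real CARD('n) * \<rho>" using \<rho> n1 by (intro mult_right_mono)
    then show "\<rho> + real CARD('n) * sz k \<le> real CARD('n) * (\<rho> + sz k)" by (simp add: algebra_simps)
  qed (use V \<rho> in auto)
  also have "V * (real CARD('n) * (\<rho> + sz k)) ^ CARD('n) = V * real CARD('n) ^ CARD('n) * (\<rho> + sz k) ^ CARD('n)"
    by (simp add: power_mult_distrib)
  finally show "(\<Sum>\<^sup>+m. indicator {m. norm (corner k m - x) \<le> \<rho>} m * ennreal (sz k ^ CARD('n)))
      \<le> ennreal (V * real CARD('n) ^ CARD('n) * (\<rho> + sz k) ^ CARD('n))" .
qed

section \<open>Stopping cubes\<close>

text \<open>Since dyadic cubes are nested, maximality only has to be tested along the chain of
  ancestors, found by locating the corner of the cube at coarser scales.\<close>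

definition maximal_cubes :: "(int \<times> (int ^ 'n)) set \<Rightarrow> (int \<times> (int ^ 'n)) set" where
  "maximal_cubes S = {(k, m) \<in> S. \<forall>j>k. (j, cidx j (corner k m)) \<notin> S}"

definition cube_union :: "(int \<times> (int ^ 'n)) set \<Rightarrow> (real ^ 'n) set" where
  "cube_union S = (\<Union>(k, m)\<in>S. dcube k m)"

lemma mem_maximal_cubes:
  "(k, m) \<in> maximal_cubes S \<longleftrightarrow> (k, m) \<in> S \<and> (\<forall>j>k. (j, cidx j (corner k m)) \<notin> S)"
  by (simp add: maximal_cubes_def)

lemma maximal_cubes_unique:
  assumes "(k, m) \<in> maximal_cubes S" "(l, m') \<in> maximal_cubes S" "x \<in> dcube k m" "x \<in> dcube l m'"
  shows "k = l \<and> m = m'"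
proof -
  have *: "\<not> k < l" if "(k, m) \<in> maximal_cubes S" "(l, m') \<in> maximal_cubes S" "x \<in> dcube k m" "x \<in> dcube l m'"
    for k m l m'
  proof
    assume "k < l"
    have "cidx k (corner k m) = cidx k x" using that(3) by (simp add: dcube_def)
    then have "cidx l (corner k m) = cidx l x"
      using less_imp_le[OF \<open>k < l\<close>] by (rule cidx_mono)
    also have "\<dots> = m'" using that(4) by (simp add: dcube_def)
    finally have e: "cidx l (corner k m) = m'" .
    have "(l, m') \<in> S" using that(2) unfolding mem_maximal_cubes by (rule conjunct1)
    moreover have "(l, cidx l (corner k m)) \<notin> S"
      using that(1) \<open>k < l\<close> unfolding mem_maximal_cubes by iprover
    ultimately show False unfolding e by iprover
  qed
  from *[OF assms] *[OF assms(2,1,4,3)] have "k = l" by (meson linorder_neqE)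
  moreover have "m = cidx k x" "m' = cidx l x" using assms(3,4) unfolding dcube_def by blast+
  ultimately show ?thesis by metis
qed

text \<open>The ancestors of the given cube that belong to S have scales between k and K; the
  largest of these finitely many scales works.\<close>

lemma maximal_cubes_above:
  assumes "\<And>k m. (k, m) \<in> S \<Longrightarrow> k \<le> K" "(k, m) \<in> S"
  obtains l where "k \<le> l" "(l, cidx l (corner k m)) \<in> maximal_cubes S"
proof -
  define A where "A = {l. k \<le> l \<and> (l, cidx l (corner k m)) \<in> S}"
  have "k \<in> A" using assms(2) by (simp add: A_def)
  have "finite A" by (rule finite_subset[of _ "{k..K}"]) (use assms(1) in \<open>auto simp: A_def\<close>)
  define l where "l = Max A"
  have l: "l \<in> A" unfolding l_def using \<open>k \<in> A\<close> \<open>finite A\<close> by (intro Max_in) auto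
  have "(j, cidx j (corner l (cidx l (corner k m)))) \<notin> S" if "l < j" for j
  proof
    assume *: "(j, cidx j (corner l (cidx l (corner k m)))) \<in> S"
    have e: "cidx j (corner l (cidx l (corner k m))) = cidx j (corner k m)"
      using cidx_corner less_imp_le[OF that] by (rule cidx_mono)
    have "(j, cidx j (corner k m)) \<in> S" using * unfolding e .
    moreover have "k \<le> j" using l that unfolding A_def by simp
    ultimately have "j \<in> A" unfolding A_def by simp
    then have "j \<le> l" unfolding l_def using \<open>finite A\<close> by simp
    with that show False by simp
  qed
  then have "(l, cidx l (corner k m)) \<in> maximal_cubes S"
    using l unfolding A_def mem_maximal_cubes by blast
  moreover have "k \<le> l" using l by (simp add: A_def)
  ultimately show ?thesis by (rule that[rotated])
qed

lemma cube_union_maximal: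
  assumes "\<And>k m. (k, m) \<in> S \<Longrightarrow> k \<le> K"
  shows "cube_union (maximal_cubes S) = cube_union S"
proof
  show "cube_union (maximal_cubes S) \<subseteq> cube_union S"
    by (auto simp: cube_union_def maximal_cubes_def)
  show "cube_union S \<subseteq> cube_union (maximal_cubes S)"
  proof
    fix x assume "x \<in> cube_union S"
    then obtain k m where km: "(k, m) \<in> S" "x \<in> dcube k m" by (auto simp: cube_union_def)
    obtain l where l: "k \<le> l" "(l, cidx l (corner k m)) \<in> maximal_cubes S"
      using maximal_cubes_above[OF assms km(1)] .
    have "x \<in> dcube l (cidx l (corner k m))" using dcube_ancestor[OF l(1)] km(2) by (rule subsetD)
    with l(2) show "x \<in> cube_union (maximal_cubes S)" unfolding cube_union_def by blast
  qed
qed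

lemma borel_cube_union [measurable]: "cube_union S \<in> sets borel"
  unfolding cube_union_def by (rule sets.countable_UN'') auto

lemma lebesgue_cube_union [measurable]: "cube_union S \<in> sets lebesgue"
  by (intro lebesgue_of_borel borel_cube_union)

lemma nsum_indicator_maximal_cubes:
  "(\<Sum>\<^sup>+p. indicator (maximal_cubes S) p * indicator (dcube (fst p) (snd p)) x)
     = (indicator (cube_union (maximal_cubes S)) x :: ennreal)"
proof (cases "x \<in> cube_union (maximal_cubes S)")
  case True
  then obtain k m where km: "(k, m) \<in> maximal_cubes S" "x \<in> dcube k m" by (auto simp: cube_union_def)
  have "(\<Sum>\<^sup>+p. indicator (maximal_cubes S) p * indicator (dcube (fst p) (snd p)) x)
      = (\<Sum>\<^sup>+p. (indicator {(k, m)} p :: ennreal))"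
  proof (rule nn_integral_cong)
    fix p :: "int \<times> (int^'a)"
    have "p \<in> maximal_cubes S \<and> x \<in> dcube (fst p) (snd p) \<longleftrightarrow> p = (k, m)"
      using maximal_cubes_unique[of "fst p" "snd p" S k m x] km by (metis prod.collapse fst_conv snd_conv)
    then show "indicator (maximal_cubes S) p * indicator (dcube (fst p) (snd p)) x = (indicator {(k, m)} p :: ennreal)"
      using km by (auto simp: indicator_def)
  qed
  then show ?thesis using True by simp
next
  case False
  then have "(\<Sum>\<^sup>+p. indicator (maximal_cubes S) p * indicator (dcube (fst p) (snd p)) x)
      = (\<Sum>\<^sup>+(p::int \<times> (int^'a)). (0 :: ennreal))"
    by (intro nn_integral_cong) (auto simp: indicator_def cube_union_def)
  then show ?thesis using False by simp
qed

lemma nn_integral_maximal_cubes: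
  fixes h :: "real ^ 'n \<Rightarrow> ennreal"
  assumes [measurable]: "h \<in> borel_measurable lebesgue"
  shows "(\<Sum>\<^sup>+p. indicator (maximal_cubes S) p * (\<integral>\<^sup>+x\<in>dcube (fst p) (snd p). h x \<partial>lebesgue))
       = (\<integral>\<^sup>+x\<in>cube_union (maximal_cubes S). h x \<partial>lebesgue)"
proof -
  have "(\<Sum>\<^sup>+p. indicator (maximal_cubes S) p * (\<integral>\<^sup>+x\<in>dcube (fst p) (snd p). h x \<partial>lebesgue))
     = (\<Sum>\<^sup>+p. \<integral>\<^sup>+x. h x * (indicator (maximal_cubes S) p * indicator (dcube (fst p) (snd p)) x) \<partial>lebesgue)"
    by (intro nn_integral_cong) (simp split: split_indicator)
  also have "\<dots> = (\<integral>\<^sup>+x. (\<Sum>\<^sup>+p. h x * (indicator (maximal_cubes S) p * indicator (dcube (fst p) (snd p)) x)) \<partial>lebesgue)"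
    by (rule nn_integral_nsum[symmetric]) auto
  also have "\<dots> = (\<integral>\<^sup>+x. h x * (\<Sum>\<^sup>+p. indicator (maximal_cubes S) p * indicator (dcube (fst p) (snd p)) x) \<partial>lebesgue)"
    by (intro nn_integral_cong nn_integral_cmult) auto
  finally show ?thesis by (simp add: nsum_indicator_maximal_cubes)
qed

text \<open>Small cubes around each point fit into T. The cap \<open>k \<le> 0\<close> guarantees
  that every such cube lies below a maximal one; without it the whole space would have no maximal
  cubes.\<close>

lemma open_cube_union:
  fixes T :: "(real ^ 'n) set"
  assumes "open T"
  defines "S \<equiv> {(k, m). k \<le> 0 \<and> dcube k m \<subseteq> T}"
  shows "cube_union (maximal_cubes S) = T"
proof -
  have "cube_union (maximal_cubes S) = cube_union S"
    by (rule cube_union_maximal[of _ 0]) (auto simp: S_def)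
  also have "\<dots> = T"
  proof
    show "cube_union S \<subseteq> T" by (auto simp: cube_union_def S_def)
    show "T \<subseteq> cube_union S"
    proof
      fix x assume "x \<in> T"
      then obtain e where e: "0 < e" "ball x e \<subseteq> T" using assms(1) open_contains_ball by metis
      define d where "d = min 1 (e / (2 * real CARD('n)))"
      have "0 < d" using e by (simp add: d_def)
      then obtain k where k: "sz k \<le> d" by (rule sz_bracket)
      then have "sz k \<le> sz 0" by (simp add: d_def)
      then have "k \<le> 0" unfolding sz_le_iff .
      have "real CARD('n) * sz k \<le> real CARD('n) * (e / (2 * real CARD('n)))"
        using k by (intro mult_left_mono) (auto simp: d_def)
      then have *: "real CARD('n) * sz k < e" using e by simp
      have "dcube k (cidx k x) \<subseteq> ball x e"
      proof
        fix y assume "y \<in> dcube k (cidx k x)"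
        then have "norm (x - y) \<le> real CARD('n) * sz k" by (intro dcube_dist) (auto simp: dcube_def)
        with * show "y \<in> ball x e" by (simp add: dist_norm)
      qed
      with e \<open>k \<le> 0\<close> have "(k, cidx k x) \<in> S" by (auto simp: S_def)
      then show "x \<in> cube_union S" by (force simp: cube_union_def dcube_def)
    qed
  qed
  finally show ?thesis .
qed

text \<open>Dominated convergence passes from finitely many pieces of a countable partition to all
  of them. The application is to the product of a bad function with a function that is constant on
  each stopping cube.\<close>

lemma integral_zero_pieces:
  fixes h :: "'a \<Rightarrow> real" and J :: "'a \<Rightarrow> 'i :: countable"
  assumes h: "integrable M h" and J [measurable]: "J \<in> measurable M (count_space UNIV)"
    and zero: "\<And>p. (LINT x|M. h x * indicator {x. J x = p} x) = 0"
  shows "(LINT x|M. h x) = 0"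
proof -
  define s where "s N x = h x * indicator {x. to_nat (J x) < N} x" for N :: nat and x
  have [measurable]: "h \<in> borel_measurable M" using h by auto
  have 1: "(\<lambda>N. LINT x|M. s N x) \<longlonglongrightarrow> (LINT x|M. h x)"
  proof (rule integral_dominated_convergence[where w="\<lambda>x. \<bar>h x\<bar>"])
    show "AE x in M. (\<lambda>N. s N x) \<longlonglongrightarrow> h x"
    proof (rule AE_I2, rule tendsto_eventually)
      fix x show "\<forall>\<^sub>F N in sequentially. s N x = h x"
        using eventually_gt_at_top[of "to_nat (J x)"] by eventually_elim (simp add: s_def)
    qed
  qed (use h in \<open>auto simp: s_def indicator_def\<close>)
  have int: "integrable M (\<lambda>x. h x * indicator {x. P (J x)} x)" for P
    by (rule Bochner_Integration.integrable_bound[OF h]) (auto simp: indicator_def)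
  have "(LINT x|M. s N x) = 0" for N
  proof (induction N)
    case (Suc N)
    have "(LINT x|M. s (Suc N) x) = (LINT x|M. s N x + h x * indicator {x. to_nat (J x) = N} x)"
      by (rule Bochner_Integration.integral_cong) (auto simp: s_def indicator_def)
    also have "\<dots> = (LINT x|M. s N x) + (LINT x|M. h x * indicator {x. to_nat (J x) = N} x)"
      unfolding s_def by (rule Bochner_Integration.integral_add) (rule int)+
    also have "(LINT x|M. h x * indicator {x. to_nat (J x) = N} x) = 0"
    proof (cases "N \<in> range (to_nat :: 'i \<Rightarrow> nat)")
      case True
      then obtain p :: 'i where "N = to_nat p" by auto
      then show ?thesis using zero[of p] by simp
    next
      case False
      then have "{x. to_nat (J x) = N} = {}" by auto
      then show ?thesis by simp
    qed
    finally show ?case using Suc by simp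
  qed (simp add: s_def)
  with 1 show ?thesis by (simp add: LIMSEQ_const_iff)
qed

section \<open>Cubes on which a weight has a large average\<close>

definition bad_cubes :: "(real ^ 'n \<Rightarrow> ennreal) \<Rightarrow> real \<Rightarrow> (int \<times> (int ^ 'n)) set" where
  "bad_cubes v s = {(k, m). ennreal (s * sz k ^ CARD('n)) < (\<integral>\<^sup>+x\<in>dcube k m. v x \<partial>lebesgue)}"

abbreviation stopping_cubes :: "(real ^ 'n \<Rightarrow> ennreal) \<Rightarrow> real \<Rightarrow> (int \<times> (int ^ 'n)) set" where
  "stopping_cubes v s \<equiv> maximal_cubes (bad_cubes v s)"

lemma bad_cubes_bounded:
  fixes v :: "real ^ 'n \<Rightarrow> ennreal"
  assumes "(\<integral>\<^sup>+x. v x \<partial>lebesgue) < \<infinity>" "0 < s"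
  obtains K where "\<And>k m. (k, m) \<in> bad_cubes v s \<Longrightarrow> k \<le> K"
proof -
  obtain F where F: "(\<integral>\<^sup>+x. v x \<partial>lebesgue) = ennreal F" "0 \<le> F"
    using assms(1) by (cases "\<integral>\<^sup>+x. v x \<partial>lebesgue") auto
  \<comment> \<open>With the maximum, a cube of scale above K has side greater than 1, so its side
    is at most its volume, which F / s controls.\<close>
  have "0 < max 1 (F / s)" by simp
  then obtain K where K: "max 1 (F / s) < 2 * sz K" by (rule sz_bracket)
  have "k \<le> K" if "(k, m) \<in> bad_cubes v s" for k and m :: "int ^ 'n"
  proof (rule ccontr)
    assume "\<not> k \<le> K"
    then have "sz (K + 1) \<le> sz k" by (simp only: sz_le_iff)
    then have *: "max 1 (F / s) < sz k" using K by (simp add: sz_Suc)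
    have "ennreal (s * sz k ^ CARD('n)) < (\<integral>\<^sup>+x\<in>dcube k m. v x \<partial>lebesgue)"
      using that by (simp add: bad_cubes_def)
    also have "\<dots> \<le> (\<integral>\<^sup>+x. v x \<partial>lebesgue)" by (rule nn_integral_mono) (simp split: split_indicator)
    finally have "s * sz k ^ CARD('n) < F" using F assms(2) by (simp add: ennreal_less_iff)
    moreover have "sz k \<le> sz k ^ CARD('n)" using * by (intro self_le_power) auto
    ultimately have "s * sz k < F" using assms(2) by (smt (verit) mult_left_mono)
    with * assms(2) show False by (simp add: field_simps)
  qed
  then show ?thesis by (rule that)
qed

lemma stopping_cubes_measure:
  fixes v :: "real ^ 'n \<Rightarrow> ennreal"
  assumes [measurable]: "v \<in> borel_measurable lebesgue"
  shows "(\<Sum>\<^sup>+p. indicator (stopping_cubes v s) p * ennreal (s * sz (fst p) ^ CARD('n)))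
     \<le> (\<integral>\<^sup>+x. v x \<partial>lebesgue)"
proof -
  have "(\<Sum>\<^sup>+p. indicator (stopping_cubes v s) p * ennreal (s * sz (fst p) ^ CARD('n)))
    \<le> (\<Sum>\<^sup>+p. indicator (stopping_cubes v s) p * (\<integral>\<^sup>+x\<in>dcube (fst p) (snd p). v x \<partial>lebesgue))"
    by (rule nsum_mono) (auto simp: maximal_cubes_def bad_cubes_def intro!: less_imp_le split: split_indicator)
  also have "\<dots> = (\<integral>\<^sup>+x\<in>cube_union (stopping_cubes v s). v x \<partial>lebesgue)"
    by (rule nn_integral_maximal_cubes) simp
  also have "\<dots> \<le> (\<integral>\<^sup>+x. v x \<partial>lebesgue)" by (rule nn_integral_mono) (simp split: split_indicator)
  finally show ?thesis .
qed

text \<open>The dyadic parent of a maximal bad cube is not bad, and its volume is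
  \<open>2 ^ n\<close> times larger; this is the price of stopping.\<close>

lemma stopping_cubes_average:
  fixes v :: "real ^ 'n \<Rightarrow> ennreal"
  assumes "(k, m) \<in> stopping_cubes v s"
  shows "(\<integral>\<^sup>+x\<in>dcube k m. v x \<partial>lebesgue) \<le> ennreal (2 ^ CARD('n) * s * sz k ^ CARD('n))"
proof -
  define m' where "m' = cidx (k + 1) (corner k m)"
  have sub: "dcube k m \<subseteq> dcube (k + 1) m'" unfolding m'_def by (rule dcube_ancestor) simp
  have "(\<integral>\<^sup>+x\<in>dcube k m. v x \<partial>lebesgue) \<le> (\<integral>\<^sup>+x\<in>dcube (k + 1) m'. v x \<partial>lebesgue)"
    using sub by (intro nn_integral_mono) (auto split: split_indicator)
  also have "(k + 1, m') \<notin> bad_cubes v s"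
    using assms unfolding m'_def mem_maximal_cubes by simp
  then have "(\<integral>\<^sup>+x\<in>dcube (k + 1) m'. v x \<partial>lebesgue) \<le> ennreal (s * sz (k + 1) ^ CARD('n))"
    by (simp add: bad_cubes_def not_less)
  finally show ?thesis by (simp add: sz_Suc power_mult_distrib mult_ac)
qed

text \<open>Takes the place of the Lebesgue differentiation theorem. The exceptional set Z is
  covered by an open T of nearly the same measure, and T is cut into dyadic cubes. A cube meeting Z
  is not bad, so v integrates over it to at most s times its volume. Hence v integrates over Z to at
  most s times the measure of Z although v exceeds s there, and Z is a null set.\<close>

lemma le_outside_bad_cubes:
  fixes v :: "real ^ 'n \<Rightarrow> ennreal"
  assumes v [measurable]: "v \<in> borel_measurable lebesgue"
    and fin: "(\<integral>\<^sup>+x. v x \<partial>lebesgue) < \<infinity>" and s: "0 < s"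
  shows "AE x in lebesgue. x \<notin> cube_union (bad_cubes v s) \<longrightarrow> v x \<le> ennreal s"
proof -
  define Z where "Z = {x. x \<notin> cube_union (bad_cubes v s) \<and> ennreal s < v x}"
  have [measurable]: "Z \<in> sets lebesgue"
  proof -
    have "{x \<in> space lebesgue. x \<notin> cube_union (bad_cubes v s) \<and> ennreal s < v x} \<in> sets lebesgue"
      by measurable
    then show ?thesis by (simp add: Z_def)
  qed
  have Zs: "ennreal s * emeasure lebesgue Z \<le> (\<integral>\<^sup>+x. v x \<partial>lebesgue)"
  proof -
    have "ennreal s * emeasure lebesgue Z = (\<integral>\<^sup>+x. ennreal s * indicator Z x \<partial>lebesgue)"
      by (subst nn_integral_cmult) auto
    also have "\<dots> \<le> (\<integral>\<^sup>+x. v x \<partial>lebesgue)"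
      by (rule nn_integral_mono) (auto simp: Z_def split: split_indicator)
    finally show ?thesis .
  qed
  have Zfin: "emeasure lebesgue Z < \<infinity>"
    using Zs fin s by (cases "emeasure lebesgue Z") (auto simp: ennreal_mult_top top_unique)
  have up: "(\<integral>\<^sup>+x\<in>Z. v x \<partial>lebesgue) \<le> ennreal s * (emeasure lebesgue Z + ennreal e)" if e: "0 < e" for e
  proof -
    obtain T where T: "open T" "Z \<subseteq> T" "T - Z \<in> lmeasurable" "emeasure lebesgue (T - Z) < ennreal e"
      using sets_lebesgue_outer_open[of Z e] e by auto
    define S where "S = {(k, m). k \<le> 0 \<and> dcube k m \<subseteq> T}"
    have ST: "cube_union (maximal_cubes S) = T" unfolding S_def by (rule open_cube_union) fact
    have "(\<integral>\<^sup>+x\<in>Z. v x \<partial>lebesgue) = (\<integral>\<^sup>+x\<in>cube_union (maximal_cubes S). v x * indicator Z x \<partial>lebesgue)"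
      unfolding ST using T(2) by (intro nn_integral_cong) (auto split: split_indicator)
    also have "\<dots> = (\<Sum>\<^sup>+p. indicator (maximal_cubes S) p *
        (\<integral>\<^sup>+x\<in>dcube (fst p) (snd p). v x * indicator Z x \<partial>lebesgue))"
      by (rule nn_integral_maximal_cubes[symmetric]) auto
    also have "\<dots> \<le> (\<Sum>\<^sup>+p. indicator (maximal_cubes S) p *
        (\<integral>\<^sup>+x\<in>dcube (fst p) (snd p). ennreal s \<partial>lebesgue))"
    proof (intro nsum_mono mult_left_mono)
      fix p :: "int \<times> (int ^ 'n)"
      obtain k m where p: "p = (k, m)" by (cases p)
      show "(\<integral>\<^sup>+x\<in>dcube (fst p) (snd p). v x * indicator Z x \<partial>lebesgue)
         \<le> (\<integral>\<^sup>+x\<in>dcube (fst p) (snd p). ennreal s \<partial>lebesgue)"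
      proof (cases "dcube k m \<inter> Z = {}")
        case True
        then have "(\<integral>\<^sup>+x\<in>dcube (fst p) (snd p). v x * indicator Z x \<partial>lebesgue) = (\<integral>\<^sup>+(x::real^'n). 0 \<partial>lebesgue)"
          unfolding p by (intro nn_integral_cong_AE AE_I2) (auto split: split_indicator)
        then show ?thesis by simp
      next
        case False
        then obtain x where "x \<in> dcube k m" "x \<in> Z" by auto
        then have "(k, m) \<notin> bad_cubes v s" by (auto simp: Z_def cube_union_def)
        then have le: "(\<integral>\<^sup>+x\<in>dcube k m. v x \<partial>lebesgue) \<le> ennreal (s * sz k ^ CARD('n))"
          by (simp add: bad_cubes_def not_less)
        have "(\<integral>\<^sup>+x\<in>dcube k m. v x * indicator Z x \<partial>lebesgue) \<le> (\<integral>\<^sup>+x\<in>dcube k m. v x \<partial>lebesgue)"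
          by (rule nn_integral_mono) (auto split: split_indicator)
        also note le
        also have "ennreal (s * sz k ^ CARD('n)) = (\<integral>\<^sup>+x\<in>dcube k m. ennreal s \<partial>lebesgue)"
          using s by (simp add: nn_integral_cmult_indicator emeasure_dcube ennreal_mult)
        finally show ?thesis by (simp add: p)
      qed
    qed simp
    also have "\<dots> = (\<integral>\<^sup>+x\<in>cube_union (maximal_cubes S). ennreal s \<partial>lebesgue)"
      by (rule nn_integral_maximal_cubes) auto
    also have "\<dots> = ennreal s * emeasure lebesgue T"
      unfolding ST using T(1) by (intro nn_integral_cmult_indicator lebesgue_of_borel) auto
    also have "emeasure lebesgue T = emeasure lebesgue Z + emeasure lebesgue (T - Z)"
    proof -
      have "Z \<union> (T - Z) = T" using T(2) by auto
      moreover have "T - Z \<in> sets lebesgue" using T(3) by (rule fmeasurableD)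
      ultimately show ?thesis using plus_emeasure[of Z lebesgue "T - Z"] by simp
    qed
    also have "\<dots> \<le> emeasure lebesgue Z + ennreal e" using T by (intro add_mono) auto
    finally show ?thesis by (simp add: mult_left_mono)
  qed
  have "(\<integral>\<^sup>+x\<in>Z. v x \<partial>lebesgue) \<le> ennreal s * emeasure lebesgue Z"
  proof (rule ennreal_le_epsilon)
    fix e :: real assume e: "0 < e"
    have "(\<integral>\<^sup>+x\<in>Z. v x \<partial>lebesgue) \<le> ennreal s * (emeasure lebesgue Z + ennreal (e / s))"
      using e s by (intro up) simp
    also have "\<dots> = ennreal s * emeasure lebesgue Z + ennreal e"
      using e s by (simp add: distrib_left ennreal_mult[symmetric])
    finally show "(\<integral>\<^sup>+x\<in>Z. v x \<partial>lebesgue) \<le> ennreal s * emeasure lebesgue Z + ennreal e" .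
  qed
  also have "ennreal s * emeasure lebesgue Z = (\<integral>\<^sup>+x. ennreal s * indicator Z x \<partial>lebesgue)"
    by (subst nn_integral_cmult) auto
  finally have le: "(\<integral>\<^sup>+x\<in>Z. v x \<partial>lebesgue) \<le> (\<integral>\<^sup>+x. ennreal s * indicator Z x \<partial>lebesgue)" .
  have "AE x in lebesgue. v x * indicator Z x \<le> ennreal s * indicator Z x"
  proof -
    \<comment> \<open>\<open>nn_integral_less\<close> in contrapositive form: on Z the function v is
      above s everywhere, so this order of the integrals forces equality almost everywhere, which
      the strict inequality defining Z rules out on a set of positive measure.\<close>
    have "\<not> (\<integral>\<^sup>+x. ennreal s * indicator Z x \<partial>lebesgue) < (\<integral>\<^sup>+x\<in>Z. v x \<partial>lebesgue)"
      using le by simp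
    then show ?thesis
    proof (rule contrapos_np, intro nn_integral_less)
      show "(\<integral>\<^sup>+x. ennreal s * indicator Z x \<partial>lebesgue) \<noteq> \<infinity>"
        using Zs fin by (subst nn_integral_cmult) (auto simp: top_unique)
      show "AE x in lebesgue. ennreal s * indicator Z x \<le> v x * indicator Z x"
        by (intro AE_I2) (auto simp: Z_def split: split_indicator)
    qed auto
  qed
  then show ?thesis
    by eventually_elim (auto simp: Z_def not_le split: split_indicator_asm)
qed

section \<open>Enlarged stopping cubes and the Calderon-Zygmund decomposition\<close>

lemma emeasure_lebesgue_cball:
  "0 \<le> r \<Longrightarrow> emeasure lebesgue (cball (x :: real ^ 'n) r) = ennreal (unit_ball_vol (real CARD('n)) * r ^ CARD('n))"
  by (simp add: emeasure_completion emeasure_cball)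

text \<open>The factor 3 leaves room for a chain of three displacements, each at most n + 1 sides.
  It captures the superlevel sets of the maximal function, and it keeps the complement at least one
  side away from the smaller cubes whose bumps reach the stopping cube.\<close>

definition star :: "int \<times> (int ^ 'n) \<Rightarrow> (real ^ 'n) set" where
  "star p = cball (corner (fst p) (snd p)) (3 * (real CARD('n) + 1) * sz (fst p))"

lemma lebesgue_star [measurable]: "star p \<in> sets lebesgue"
  unfolding star_def by (intro lebesgue_of_borel) simp

lemma emeasure_star: "emeasure lebesgue (star (p :: int \<times> (int ^ 'n))) =
    ennreal (unit_ball_vol (real CARD('n)) * (3 * (real CARD('n) + 1) * sz (fst p)) ^ CARD('n))"
  unfolding star_def by (rule emeasure_lebesgue_cball) simp

lemma lebesgue_star_union [measurable]: "(\<Union>p\<in>S. star p) \<in> sets lebesgue"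
  for S :: "(int \<times> (int ^ 'n)) set"
  by (rule sets.countable_UN'') auto

text \<open>Each star has a fixed multiple of the volume of its cube, so a union bound suffices: the
  stars may overlap, but the stopping cubes themselves are disjoint.\<close>

lemma star_union_measure:
  obtains C where "0 \<le> C" "\<And>(v :: real ^ 'n \<Rightarrow> ennreal) s. v \<in> borel_measurable lebesgue \<Longrightarrow> 0 < s \<Longrightarrow>
    ennreal s * emeasure lebesgue (\<Union>p\<in>stopping_cubes v s. star p) \<le> ennreal C * (\<integral>\<^sup>+x. v x \<partial>lebesgue)"
proof
  define C where "C = unit_ball_vol (real CARD('n)) * (3 * (real CARD('n) + 1)) ^ CARD('n)"
  show C: "0 \<le> C" by (simp add: C_def unit_ball_vol_nonneg)
  fix v :: "real ^ 'n \<Rightarrow> ennreal" and s :: real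
  assume [measurable]: "v \<in> borel_measurable lebesgue" and s: "0 < s"
  let ?S = "stopping_cubes v s"
  have "emeasure lebesgue (\<Union>p\<in>?S. star p) = (\<integral>\<^sup>+x. indicator (\<Union>p\<in>?S. star p) x \<partial>lebesgue)"
    by simp
  also have "\<dots> \<le> (\<integral>\<^sup>+x. (\<Sum>\<^sup>+p. indicator ?S p * indicator (star p) x) \<partial>lebesgue)"
  proof (rule nn_integral_mono)
    fix x :: "real ^ 'n"
    show "indicator (\<Union>p\<in>?S. star p) x \<le> (\<Sum>\<^sup>+p. (indicator ?S p * indicator (star p) x :: ennreal))"
    proof (cases "x \<in> (\<Union>p\<in>?S. star p)")
      case True
      then obtain p where "p \<in> ?S" "x \<in> star p" by auto
      then show ?thesis
        using nsum_upper[of "\<lambda>p. indicator ?S p * indicator (star p) x :: ennreal" p] by (simp split: split_indicator)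
    qed simp
  qed
  also have "\<dots> = (\<Sum>\<^sup>+p. \<integral>\<^sup>+x. indicator ?S p * indicator (star p) x \<partial>lebesgue)"
    by (rule nn_integral_nsum) simp
  also have "\<dots> = (\<Sum>\<^sup>+p. indicator ?S p * ennreal (C * sz (fst p) ^ CARD('n)))"
    by (intro nn_integral_cong, subst nn_integral_cmult)
       (simp_all add: emeasure_star C_def power_mult_distrib mult_ac)
  finally have "ennreal s * emeasure lebesgue (\<Union>p\<in>?S. star p)
      \<le> ennreal s * (\<Sum>\<^sup>+p. indicator ?S p * ennreal (C * sz (fst p) ^ CARD('n)))"
    by (rule mult_left_mono) simp
  also have "\<dots> = (\<Sum>\<^sup>+p. ennreal C * (indicator ?S p * ennreal (s * sz (fst p) ^ CARD('n))))"
    using s C by (subst nn_integral_cmult[symmetric]) (auto simp: ennreal_mult mult_ac)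
  also have "\<dots> \<le> ennreal C * (\<integral>\<^sup>+x. v x \<partial>lebesgue)"
    by (subst nn_integral_cmult) (auto intro!: mult_left_mono stopping_cubes_measure)
  finally show "ennreal s * emeasure lebesgue (\<Union>p\<in>?S. star p) \<le> ennreal C * (\<integral>\<^sup>+x. v x \<partial>lebesgue)" .
qed

text \<open>Encodes the partition into stopping cubes and their complement as a function with
  countably many values. Functions defined cube by cube become compositions with J, so their
  measurability and their integrals over pieces need no separate argument.\<close>

lemma stopping_index:
  fixes S :: "(int \<times> (int ^ 'n)) set"
  obtains J where "J \<in> lebesgue \<rightarrow>\<^sub>M count_space (UNIV :: (int \<times> (int ^ 'n)) option set)"
    "\<And>x p. J x = Some p \<longleftrightarrow> p \<in> maximal_cubes S \<and> x \<in> dcube (fst p) (snd p)"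
proof
  define J where "J x = (if \<exists>p\<in>maximal_cubes S. x \<in> dcube (fst p) (snd p)
    then Some (SOME p. p \<in> maximal_cubes S \<and> x \<in> dcube (fst p) (snd p)) else None)" for x
  have *: "J x = Some p \<longleftrightarrow> p \<in> maximal_cubes S \<and> x \<in> dcube (fst p) (snd p)" (is "_ \<longleftrightarrow> ?P p") for x p
  proof
    assume "J x = Some p"
    then have *: "(if \<exists>p\<in>maximal_cubes S. x \<in> dcube (fst p) (snd p) then Some (SOME p. ?P p) else None) = Some p"
      unfolding J_def .
    then have ex: "\<exists>p\<in>maximal_cubes S. x \<in> dcube (fst p) (snd p)" by (metis option.distinct(1))
    have p: "p = (SOME p. ?P p)" using * unfolding if_P[OF ex] option.inject by (rule sym)
    have "?P (SOME p. ?P p)" using ex unfolding Bex_def by (rule someI_ex)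
    then show "?P p" unfolding p[symmetric] .
  next
    assume p: "?P p"
    then have q: "?P (SOME p. ?P p)" by (rule someI)
    have e: "(SOME p. ?P p) = p"
      using maximal_cubes_unique[of "fst (SOME p. ?P p)" "snd (SOME p. ?P p)" S "fst p" "snd p" x] p q
      by (simp add: prod_eq_iff)
    have ex: "\<exists>p\<in>maximal_cubes S. x \<in> dcube (fst p) (snd p)" using p by (intro bexI[of _ p]) auto
    show "J x = Some p" unfolding J_def if_P[OF ex] e ..
  qed
  show "J x = Some p \<longleftrightarrow> p \<in> maximal_cubes S \<and> x \<in> dcube (fst p) (snd p)" for x p by (rule *)
  show "J \<in> lebesgue \<rightarrow>\<^sub>M count_space UNIV"
  proof (subst measurable_count_space_eq2_countable, safe)
    fix q :: "(int \<times> (int ^ 'n)) option"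
    show "J -` {q} \<inter> space lebesgue \<in> sets lebesgue"
    proof (cases q)
      case (Some p)
      have "J -` {q} = (if p \<in> maximal_cubes S then dcube (fst p) (snd p) else {})"
        using *[of _ p] Some by auto
      then show ?thesis by simp
    next
      case None
      have "J x = None \<longleftrightarrow> \<not> (\<exists>p\<in>maximal_cubes S. x \<in> dcube (fst p) (snd p))" for x
        unfolding J_def by simp
      then have "J -` {q} = - cube_union (maximal_cubes S)"
        unfolding None cube_union_def case_prod_beta by blast
      then show ?thesis using lebesgue_cube_union[of "maximal_cubes S"] by (simp add: sets.compl_sets Compl_eq_Diff_UNIV)
    qed
  qed auto
qed

text \<open>g is f off the stopping cubes and the mean of f on each of them. Off the cubes the
  square of f is at most s |f|; on them the mean is at most \<open>2 ^ n * s\<close>, and their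
  total measure is at most the integral of |f| divided by s. Together this gives the factor
  \<open>1 + 4 ^ n\<close>, and the L^1 bound of b in the same way.\<close>

lemma calderon_zygmund:
  fixes f :: "real ^ 'n \<Rightarrow> real"
  assumes f: "integrable lebesgue f" and s: "0 < s"
  obtains g b and J :: "real ^ 'n \<Rightarrow> (int \<times> (int ^ 'n)) option" where
    "\<And>x. f x = g x + b x" "g \<in> borel_measurable lebesgue" "integrable lebesgue b"
    "J \<in> lebesgue \<rightarrow>\<^sub>M count_space UNIV"
    "\<And>x p. J x = Some p \<longleftrightarrow> p \<in> stopping_cubes (\<lambda>x. ennreal \<bar>f x\<bar>) s \<and> x \<in> dcube (fst p) (snd p)"
    "\<And>x. J x = None \<Longrightarrow> b x = 0"
    "\<And>p. (LINT x|lebesgue. b x * indicator {x. J x = Some p} x) = 0"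
    "(\<integral>\<^sup>+x. ennreal ((g x)\<^sup>2) \<partial>lebesgue) \<le> ennreal ((1 + 4 ^ CARD('n)) * s) * (\<integral>\<^sup>+x. ennreal \<bar>f x\<bar> \<partial>lebesgue)"
    "(\<integral>\<^sup>+x. ennreal \<bar>b x\<bar> \<partial>lebesgue) \<le> ennreal (1 + 2 ^ CARD('n)) * (\<integral>\<^sup>+x. ennreal \<bar>f x\<bar> \<partial>lebesgue)"
proof -
  let ?n = "CARD('n)"
  define v where "v x = ennreal \<bar>f x\<bar>" for x
  define \<Omega> where "\<Omega> = cube_union (stopping_cubes v s)"
  have [measurable]: "f \<in> borel_measurable lebesgue" using f by auto
  have [measurable]: "v \<in> borel_measurable lebesgue" unfolding v_def by measurable
  have [measurable]: "\<Omega> \<in> sets lebesgue" unfolding \<Omega>_def by measurable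
  have vfin: "(\<integral>\<^sup>+x. v x \<partial>lebesgue) < \<infinity>"
    using f unfolding v_def integrable_iff_bounded by (simp add: less_top)
  obtain J where J [measurable]: "J \<in> lebesgue \<rightarrow>\<^sub>M count_space (UNIV :: (int \<times> (int ^ 'n)) option set)"
    and J_iff: "\<And>x p. J x = Some p \<longleftrightarrow> p \<in> stopping_cubes v s \<and> x \<in> dcube (fst p) (snd p)"
    using stopping_index[of "bad_cubes v s"] by metis
  define avg where "avg p = (LINT x|lebesgue. f x * indicator (dcube (fst p) (snd p)) x) / sz (fst p) ^ ?n"
    for p :: "int \<times> (int ^ 'n)"
  have avg: "\<bar>avg p\<bar> \<le> 2 ^ ?n * s" if "p \<in> stopping_cubes v s" for p
  proof -
    have "ennreal \<bar>LINT x|lebesgue. f x * indicator (dcube (fst p) (snd p)) x\<bar> \<le>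
        (\<integral>\<^sup>+x. ennreal \<bar>f x * indicator (dcube (fst p) (snd p)) x\<bar> \<partial>lebesgue)"
      using integral_norm_bound_ennreal[of lebesgue "\<lambda>x. f x * indicator (dcube (fst p) (snd p)) x"]
      using integrable_real_mult_indicator[OF lebesgue_dcube f] by (simp add: mult.commute)
    also have "\<dots> = (\<integral>\<^sup>+x\<in>dcube (fst p) (snd p). v x \<partial>lebesgue)"
      by (intro nn_integral_cong) (auto simp: v_def split: split_indicator)
    also have "\<dots> \<le> ennreal (2 ^ ?n * s * sz (fst p) ^ ?n)"
      using that by (intro stopping_cubes_average) simp
    finally have "\<bar>LINT x|lebesgue. f x * indicator (dcube (fst p) (snd p)) x\<bar> \<le> 2 ^ ?n * s * sz (fst p) ^ ?n"
      using s by (subst (asm) ennreal_le_iff) auto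
    then show ?thesis by (simp add: avg_def abs_divide divide_le_eq)
  qed
  define t where "t = case_option 0 avg"
  define g where "g x = (if J x = None then f x else t (J x))" for x
  define b where "b x = f x - g x" for x
  have [measurable]: "t \<in> count_space UNIV \<rightarrow>\<^sub>M borel" by simp
  have g_meas [measurable]: "g \<in> borel_measurable lebesgue" unfolding g_def by measurable
  have [measurable]: "b \<in> borel_measurable lebesgue" unfolding b_def by measurable
  have JN: "J x = None \<longleftrightarrow> x \<notin> \<Omega>" for x
    using J_iff[of x] unfolding \<Omega>_def cube_union_def by (cases "J x") (auto, fastforce)
  have g_in: "\<bar>g x\<bar> \<le> 2 ^ ?n * s" if x: "x \<in> \<Omega>" for x
  proof -
    obtain p where p: "J x = Some p" using x JN by (cases "J x") auto
    then have "p \<in> stopping_cubes v s" using J_iff by simp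
    with p avg show ?thesis by (simp add: g_def t_def)
  qed
  have \<Omega>_meas: "ennreal s * emeasure lebesgue \<Omega> \<le> (\<integral>\<^sup>+x. v x \<partial>lebesgue)"
  proof -
    have "ennreal s * emeasure lebesgue \<Omega> = (\<integral>\<^sup>+x\<in>\<Omega>. ennreal s \<partial>lebesgue)"
      by (subst nn_integral_cmult) auto
    also have "\<dots> = (\<Sum>\<^sup>+p. indicator (stopping_cubes v s) p * ennreal (s * sz (fst p) ^ ?n))"
      unfolding \<Omega>_def using s
      by (subst nn_integral_maximal_cubes[symmetric])
         (auto simp: nn_integral_cmult_indicator emeasure_dcube ennreal_mult)
    also have "\<dots> \<le> (\<integral>\<^sup>+x. v x \<partial>lebesgue)" by (rule stopping_cubes_measure) measurable
    finally show ?thesis .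
  qed
  have out: "AE x in lebesgue. x \<notin> \<Omega> \<longrightarrow> \<bar>f x\<bar> \<le> s"
  proof -
    obtain K where "\<And>k m. (k, m) \<in> bad_cubes v s \<Longrightarrow> k \<le> K" using bad_cubes_bounded[OF vfin s] by metis
    then have "cube_union (bad_cubes v s) = \<Omega>" unfolding \<Omega>_def by (rule cube_union_maximal[symmetric])
    then show ?thesis using le_outside_bad_cubes[OF _ vfin s] s by (simp add: v_def[abs_def])
  qed
  have g2: "(\<integral>\<^sup>+x. ennreal ((g x)\<^sup>2) \<partial>lebesgue) \<le> ennreal ((1 + 4 ^ ?n) * s) * (\<integral>\<^sup>+x. v x \<partial>lebesgue)"
  proof -
    have "(\<integral>\<^sup>+x. ennreal ((g x)\<^sup>2) \<partial>lebesgue) \<le> (\<integral>\<^sup>+x. ennreal s * v x + ennreal (4 ^ ?n * s\<^sup>2) * indicator \<Omega> x \<partial>lebesgue)"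
    proof (rule nn_integral_mono_AE)
      show "AE x in lebesgue. ennreal ((g x)\<^sup>2) \<le> ennreal s * v x + ennreal (4 ^ ?n * s\<^sup>2) * indicator \<Omega> x"
        using out
      proof eventually_elim
        fix x assume x: "x \<notin> \<Omega> \<longrightarrow> \<bar>f x\<bar> \<le> s"
        show "ennreal ((g x)\<^sup>2) \<le> ennreal s * v x + ennreal (4 ^ ?n * s\<^sup>2) * indicator \<Omega> x"
        proof (cases "x \<in> \<Omega>")
          case True
          have "(g x)\<^sup>2 \<le> (2 ^ ?n * s)\<^sup>2" using g_in[OF True] s by (intro abs_le_square_iff[THEN iffD1]) simp
          also have "\<dots> = 4 ^ ?n * s\<^sup>2" by (simp add: power_mult_distrib power2_eq_square flip: power_mult_distrib)
          finally have "ennreal ((g x)\<^sup>2) \<le> ennreal (4 ^ ?n * s\<^sup>2)" by (rule ennreal_leI)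
          then show ?thesis using True by (simp add: add_increasing)
        next
          case False
          then have "g x = f x" by (simp add: g_def JN)
          moreover have "(f x)\<^sup>2 \<le> s * \<bar>f x\<bar>"
            using x False by (metis abs_ge_zero mult_right_mono power2_abs power2_eq_square)
          ultimately have "ennreal ((g x)\<^sup>2) \<le> ennreal s * v x"
            using s by (simp add: v_def ennreal_mult'[symmetric] ennreal_leI)
          then show ?thesis using False by simp
        qed
      qed
    qed
    also have "\<dots> = ennreal s * (\<integral>\<^sup>+x. v x \<partial>lebesgue) + ennreal (4 ^ ?n * s) * (ennreal s * emeasure lebesgue \<Omega>)"
      using s by (subst nn_integral_add) (auto simp: nn_integral_cmult ennreal_mult'[symmetric] mult.assoc[symmetric] power2_eq_square)
    also have "\<dots> \<le> ennreal s * (\<integral>\<^sup>+x. v x \<partial>lebesgue) + ennreal (4 ^ ?n * s) * (\<integral>\<^sup>+x. v x \<partial>lebesgue)"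
      by (intro add_mono mult_left_mono \<Omega>_meas) auto
    also have "\<dots> = ennreal ((1 + 4 ^ ?n) * s) * (\<integral>\<^sup>+x. v x \<partial>lebesgue)"
      using s by (simp add: distrib_right[symmetric] ennreal_plus[symmetric] distrib_right del: ennreal_plus)
    finally show ?thesis .
  qed
  have b1: "(\<integral>\<^sup>+x. ennreal \<bar>b x\<bar> \<partial>lebesgue) \<le> ennreal (1 + 2 ^ ?n) * (\<integral>\<^sup>+x. v x \<partial>lebesgue)"
  proof -
    have "(\<integral>\<^sup>+x. ennreal \<bar>b x\<bar> \<partial>lebesgue) \<le> (\<integral>\<^sup>+x. v x + ennreal (2 ^ ?n * s) * indicator \<Omega> x \<partial>lebesgue)"
    proof (rule nn_integral_mono)
      fix x
      show "ennreal \<bar>b x\<bar> \<le> v x + ennreal (2 ^ ?n * s) * indicator \<Omega> x"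
      proof (cases "x \<in> \<Omega>")
        case True
        have "\<bar>b x\<bar> \<le> \<bar>f x\<bar> + 2 ^ ?n * s" using g_in[OF True] by (simp add: b_def)
        then have "ennreal \<bar>b x\<bar> \<le> ennreal (\<bar>f x\<bar> + 2 ^ ?n * s)" by (rule ennreal_leI)
        then show ?thesis using True s by (simp add: v_def)
      next
        case False
        then show ?thesis by (simp add: b_def g_def JN)
      qed
    qed
    also have "\<dots> = (\<integral>\<^sup>+x. v x \<partial>lebesgue) + ennreal (2 ^ ?n) * (ennreal s * emeasure lebesgue \<Omega>)"
      using s by (subst nn_integral_add) (auto simp: nn_integral_cmult ennreal_mult mult.assoc)
    also have "\<dots> \<le> (\<integral>\<^sup>+x. v x \<partial>lebesgue) + ennreal (2 ^ ?n) * (\<integral>\<^sup>+x. v x \<partial>lebesgue)"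
      by (intro add_mono mult_left_mono \<Omega>_meas) auto
    also have "\<dots> = ennreal (1 + 2 ^ ?n) * (\<integral>\<^sup>+x. v x \<partial>lebesgue)"
      by (simp add: distrib_right)
    finally show ?thesis .
  qed
  have b_int: "integrable lebesgue b"
    unfolding integrable_iff_bounded
  proof
    have "(\<integral>\<^sup>+x. ennreal (norm (b x)) \<partial>lebesgue) \<le> ennreal (1 + 2 ^ ?n) * (\<integral>\<^sup>+x. v x \<partial>lebesgue)"
      using b1 by simp
    also have "\<dots> < \<infinity>" using vfin by (simp add: ennreal_mult_less_top less_top)
    finally show "(\<integral>\<^sup>+x. ennreal (norm (b x)) \<partial>lebesgue) < \<infinity>" .
  qed measurable
  have b0: "(LINT x|lebesgue. b x * indicator {x. J x = Some p} x) = 0" for p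
  proof (cases "p \<in> stopping_cubes v s")
    case False
    then have "{x. J x = Some p} = {}" using J_iff by auto
    then show ?thesis by simp
  next
    case True
    have int: "integrable lebesgue (\<lambda>x. c * indicator (dcube (fst p) (snd p)) x)" for c :: real
      using emeasure_dcube[of "fst p" "snd p"] by (intro integrable_mult_right integrable_real_indicator) auto
    have "(LINT x|lebesgue. b x * indicator {x. J x = Some p} x) =
      (LINT x|lebesgue. f x * indicator (dcube (fst p) (snd p)) x - avg p * indicator (dcube (fst p) (snd p)) x)"
    proof (rule Bochner_Integration.integral_cong[OF refl])
      fix x
      have "J x = Some p \<longleftrightarrow> x \<in> dcube (fst p) (snd p)" using J_iff True by blast
      then show "b x * indicator {x. J x = Some p} x =
          f x * indicator (dcube (fst p) (snd p)) x - avg p * indicator (dcube (fst p) (snd p)) x"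
        by (cases "J x = Some p") (auto simp: b_def g_def t_def)
    qed
    also have "\<dots> = (LINT x|lebesgue. f x * indicator (dcube (fst p) (snd p)) x) - avg p * sz (fst p) ^ ?n"
      using integrable_real_mult_indicator[OF lebesgue_dcube f, of "fst p" "snd p"] int[of "avg p"]
      by (subst Bochner_Integration.integral_diff) (auto simp: mult.commute measure_def emeasure_dcube)
    also have "\<dots> = 0" by (simp add: avg_def)
    finally show ?thesis .
  qed
  show ?thesis
  proof (rule that[of g b J])
    show "f x = g x + b x" for x by (simp add: b_def)
    show "J x = Some p \<longleftrightarrow> p \<in> stopping_cubes (\<lambda>x. ennreal \<bar>f x\<bar>) s \<and> x \<in> dcube (fst p) (snd p)" for x p
      using J_iff by (simp add: v_def[abs_def])
    show "b x = 0" if "J x = None" for x using that by (simp add: b_def g_def)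
  qed (use g2 b1 b0 b_int J g_meas in \<open>auto simp: v_def\<close>)
qed

section \<open>Bumps adapted to dyadic cubes\<close>

text \<open>The radius of the support and the bounds are such that, up to a constant, a dilated and translated
  test function of \<open>intrinsic_sup \<alpha> f t y\<close> is a bump for the cube \<open>p\<close> whenever \<open>y\<close> lies in \<open>p\<close>
  and \<open>t\<close> is between half the side of \<open>p\<close> and the side.\<close>

definition bump :: "real \<Rightarrow> int \<times> (int ^ 'n) \<Rightarrow> (real ^ 'n \<Rightarrow> real) set" where
  "bump \<alpha> p = {\<psi>.
     (\<forall>z. (real CARD('n) + 1) * sz (fst p) < norm (z - corner (fst p) (snd p)) \<longrightarrow> \<psi> z = 0) \<and>
     (\<forall>z. \<bar>\<psi> z\<bar> \<le> 1 / sz (fst p) ^ CARD('n)) \<and>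
     (\<forall>z z'. \<bar>\<psi> z - \<psi> z'\<bar> \<le> (norm (z - z') / sz (fst p)) powr \<alpha> / sz (fst p) ^ CARD('n)) \<and>
     (LINT z|lebesgue. \<psi> z) = 0}"

definition supp :: "int \<times> (int ^ 'n) \<Rightarrow> (real ^ 'n) set" where
  "supp p = cball (corner (fst p) (snd p)) ((real CARD('n) + 1) * sz (fst p))"

text \<open>The discrete counterpart of \<open>intrinsic_sup\<close>, one number for each Whitney
  box.\<close>

definition coef :: "real \<Rightarrow> (real ^ 'n \<Rightarrow> real) \<Rightarrow> int \<times> (int ^ 'n) \<Rightarrow> ennreal" where
  "coef \<alpha> f p = (SUP \<psi>\<in>bump \<alpha> p. ennreal \<bar>LINT z|lebesgue. f z * \<psi> z\<bar>)"

lemma lebesgue_supp [measurable]: "supp p \<in> sets lebesgue"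
  unfolding supp_def by (intro lebesgue_of_borel) simp

lemma emeasure_supp: "emeasure lebesgue (supp (p :: int \<times> (int ^ 'n))) =
    ennreal (unit_ball_vol (real CARD('n)) * ((real CARD('n) + 1) * sz (fst p)) ^ CARD('n))"
  unfolding supp_def by (rule emeasure_lebesgue_cball) simp

lemma bump_zero [simp]: "(\<lambda>z. 0) \<in> bump \<alpha> p"
  by (simp add: bump_def)

lemma bump_outside: "\<psi> \<in> bump \<alpha> p \<Longrightarrow> z \<notin> supp p \<Longrightarrow> \<psi> z = 0"
  by (auto simp: bump_def supp_def dist_norm norm_minus_commute not_le)

lemma bump_bound: "\<psi> \<in> bump \<alpha> (p :: int \<times> (int ^ 'n)) \<Longrightarrow> \<bar>\<psi> z\<bar> \<le> 1 / sz (fst p) ^ CARD('n)"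
  by (simp add: bump_def)

lemma bump_holder: "\<psi> \<in> bump \<alpha> (p :: int \<times> (int ^ 'n)) \<Longrightarrow>
    \<bar>\<psi> z - \<psi> z'\<bar> \<le> (norm (z - z') / sz (fst p)) powr \<alpha> / sz (fst p) ^ CARD('n)"
  by (simp add: bump_def)

lemma bump_integral: "\<psi> \<in> bump \<alpha> p \<Longrightarrow> (LINT z|lebesgue. \<psi> z) = 0"
  by (simp add: bump_def)

lemma holder_continuous:
  fixes \<psi> :: "'a::real_normed_vector \<Rightarrow> real"
  assumes "0 < \<alpha>" "0 < s" "\<And>z z'. \<bar>\<psi> z - \<psi> z'\<bar> \<le> (norm (z - z') / s) powr \<alpha> * c"
  shows "continuous_on UNIV \<psi>"
  unfolding continuous_on_def
proof
  fix z0 :: 'a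
  have "((\<lambda>z. norm (z - z0) / s) \<longlongrightarrow> 0) (at z0)"
    by (rule tendsto_divide_zero, rule tendsto_norm_zero, rule LIM_zero, rule tendsto_ident_at)
  then have "((\<lambda>z. (norm (z - z0) / s) powr \<alpha>) \<longlongrightarrow> 0) (at z0)"
    by (rule tendsto_zero_powrI[OF _ tendsto_const]) (use assms(1,2) in auto)
  then have lim: "((\<lambda>z. (norm (z - z0) / s) powr \<alpha> * c) \<longlongrightarrow> 0) (at z0)"
    by (rule tendsto_mult_left_zero)
  have "((\<lambda>z. \<psi> z - \<psi> z0) \<longlongrightarrow> 0) (at z0)"
    by (rule Lim_null_comparison[OF _ lim], rule always_eventually) (simp add: assms(3))
  then show "(\<psi> \<longlongrightarrow> \<psi> z0) (at z0 within UNIV)" by (simp add: LIM_zero_iff)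
qed

lemma borel_measurable_lebesgue: "f \<in> borel_measurable borel \<Longrightarrow> f \<in> borel_measurable lebesgue"
  by (metis measurable_completion measurable_lborel2)

lemma bump_continuous:
  assumes "0 < \<alpha>" "\<psi> \<in> bump \<alpha> (p :: int \<times> (int ^ 'n))" shows "continuous_on UNIV \<psi>"
  by (rule holder_continuous[where s="sz (fst p)" and c="1 / sz (fst p) ^ CARD('n)", OF assms(1) sz_pos])
     (use bump_holder[OF assms(2)] in simp)

lemma bump_measurable:
  assumes "0 < \<alpha>" "\<psi> \<in> bump \<alpha> p" shows "\<psi> \<in> borel_measurable lebesgue"
  by (intro borel_measurable_lebesgue borel_measurable_continuous_onI bump_continuous[OF assms])

text \<open>Compact sets lie in closed balls, so balls decide integrability; measurability on the
  whole space is recovered as a limit of truncations to growing balls.\<close>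

lemma locally_integrable_iff:
  "locally_integrable (f :: real ^ 'n \<Rightarrow> real) \<longleftrightarrow>
     f \<in> borel_measurable lebesgue \<and> (\<forall>x r. (\<integral>\<^sup>+z\<in>cball x r. ennreal \<bar>f z\<bar> \<partial>lebesgue) < \<infinity>)"
proof safe
  assume f: "locally_integrable f"
  have int: "integrable lebesgue (\<lambda>z. indicator K z * f z)" if "compact K" for K
    using f that unfolding locally_integrable_def set_integrable_def by simp
  show "f \<in> borel_measurable lebesgue"
  proof (rule borel_measurable_LIMSEQ_real)
    show "(\<lambda>z. indicator (cball 0 (real j)) z * f z) \<in> borel_measurable lebesgue" for j
      using int[of "cball 0 (real j)"] by auto
    fix z :: "real ^ 'n"
    obtain j0 where "norm z \<le> real j0" using real_arch_simple by blast
    then show "(\<lambda>j. indicator (cball 0 (real j)) z * f z) \<longlonglongrightarrow> f z"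
      by (intro tendsto_eventually) (auto intro!: eventually_sequentiallyI[of j0])
  qed
  fix x :: "real ^ 'n" and r
  have "(\<integral>\<^sup>+z\<in>cball x r. ennreal \<bar>f z\<bar> \<partial>lebesgue) = (\<integral>\<^sup>+z. ennreal (norm (indicator (cball x r) z * f z)) \<partial>lebesgue)"
    by (intro nn_integral_cong) (auto split: split_indicator)
  also have "\<dots> < \<infinity>" using int[of "cball x r"] by (simp add: integrable_iff_bounded)
  finally show "(\<integral>\<^sup>+z\<in>cball x r. ennreal \<bar>f z\<bar> \<partial>lebesgue) < \<infinity>" .
next
  assume f [measurable]: "f \<in> borel_measurable lebesgue"
    and fin: "\<forall>x r. (\<integral>\<^sup>+z\<in>cball x r. ennreal \<bar>f z\<bar> \<partial>lebesgue) < \<infinity>"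
  show "locally_integrable f"
    unfolding locally_integrable_def set_integrable_def integrable_iff_bounded
  proof safe
    fix K :: "(real ^ 'n) set" assume K: "compact K"
    then have [measurable]: "K \<in> sets lebesgue" by (intro lebesgue_of_borel borel_compact)
    show "(\<lambda>x. indicator K x *\<^sub>R f x) \<in> borel_measurable lebesgue" by measurable
    obtain r where r: "K \<subseteq> cball 0 r"
      using bounded_subset_ballD[OF compact_imp_bounded[OF K], of 0] ball_subset_cball by blast
    have "(\<integral>\<^sup>+z. ennreal (norm (indicator K z *\<^sub>R f z)) \<partial>lebesgue) \<le> (\<integral>\<^sup>+z\<in>cball 0 r. ennreal \<bar>f z\<bar> \<partial>lebesgue)"
      using r by (intro nn_integral_mono) (auto split: split_indicator)
    with fin show "(\<integral>\<^sup>+z. ennreal (norm (indicator K z *\<^sub>R f z)) \<partial>lebesgue) < \<infinity>" by (meson le_less_trans)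
  qed
qed

lemma locally_integrable_bound:
  fixes f g :: "real ^ 'n \<Rightarrow> real"
  assumes "locally_integrable f" "g \<in> borel_measurable lebesgue" "\<And>x. \<bar>g x\<bar> \<le> \<bar>f x\<bar>"
  shows "locally_integrable g"
  unfolding locally_integrable_iff
proof safe
  fix x :: "real ^ 'n" and r
  have "(\<integral>\<^sup>+z\<in>cball x r. ennreal \<bar>g z\<bar> \<partial>lebesgue) \<le> (\<integral>\<^sup>+z\<in>cball x r. ennreal \<bar>f z\<bar> \<partial>lebesgue)"
    using assms(3) by (intro nn_integral_mono mult_right_mono ennreal_leI) auto
  also have "\<dots> < \<infinity>" using assms(1) unfolding locally_integrable_iff by blast
  finally show "(\<integral>\<^sup>+z\<in>cball x r. ennreal \<bar>g z\<bar> \<partial>lebesgue) < \<infinity>" .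
qed fact

lemma locally_integrable_L1:
  assumes "integrable lebesgue (f :: real ^ 'n \<Rightarrow> real)"
  shows "locally_integrable f"
  unfolding locally_integrable_def set_integrable_def
proof safe
  fix K :: "(real ^ 'n) set" assume "compact K"
  then have "K \<in> sets lebesgue" by (intro lebesgue_of_borel borel_compact)
  then show "integrable lebesgue (\<lambda>x. indicator K x *\<^sub>R f x)" using assms by (rule integrable_mult_indicator)
qed

text \<open>Rests on |f| being at most 1 plus its q-th power, and on the finite measure of
  balls.\<close>

lemma locally_integrable_power:
  fixes f :: "real ^ 'n \<Rightarrow> real"
  assumes f: "f \<in> borel_measurable lebesgue" and q: "1 \<le> q"
    and fin: "(\<integral>\<^sup>+z. ennreal (\<bar>f z\<bar> powr q) \<partial>lebesgue) < \<infinity>"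
  shows "locally_integrable f"
  unfolding locally_integrable_iff
proof safe
  note [measurable] = f
  fix x :: "real ^ 'n" and r
  have [measurable]: "cball x r \<in> sets lebesgue" by (intro lebesgue_of_borel) simp
  have "(\<integral>\<^sup>+z\<in>cball x r. ennreal \<bar>f z\<bar> \<partial>lebesgue)
      \<le> (\<integral>\<^sup>+z. indicator (cball x r) z + ennreal (\<bar>f z\<bar> powr q) \<partial>lebesgue)"
  proof (rule nn_integral_mono)
    fix z
    have "\<bar>f z\<bar> \<le> 1 + \<bar>f z\<bar> powr q"
    proof (cases "\<bar>f z\<bar> \<le> 1")
      case False
      then have "\<bar>f z\<bar> powr 1 \<le> \<bar>f z\<bar> powr q" using q by (intro powr_mono) auto
      then show ?thesis using False by simp
    qed (simp add: add_increasing2)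
    then have "ennreal \<bar>f z\<bar> \<le> 1 + ennreal (\<bar>f z\<bar> powr q)"
      by (metis ennreal_1 ennreal_leI ennreal_plus powr_ge_zero zero_le_one)
    then show "ennreal \<bar>f z\<bar> * indicator (cball x r) z \<le> indicator (cball x r) z + ennreal (\<bar>f z\<bar> powr q)"
      by (simp split: split_indicator)
  qed
  also have "\<dots> = emeasure lebesgue (cball x r) + (\<integral>\<^sup>+z. ennreal (\<bar>f z\<bar> powr q) \<partial>lebesgue)"
    by (subst nn_integral_add) auto
  also have "\<dots> < \<infinity>" using fin emeasure_lborel_cball_finite[of x r] by (simp add: emeasure_completion)
  finally show "(\<integral>\<^sup>+z\<in>cball x r. ennreal \<bar>f z\<bar> \<partial>lebesgue) < \<infinity>" .
qed (rule f)

lemma integrable_bump: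
  assumes f: "locally_integrable (f :: real ^ 'n \<Rightarrow> real)" and \<psi>: "0 < \<alpha>" "\<psi> \<in> bump \<alpha> p"
  shows "integrable lebesgue (\<lambda>z. f z * \<psi> z)"
  unfolding integrable_iff_bounded
proof
  have [measurable]: "f \<in> borel_measurable lebesgue" using f by (simp add: locally_integrable_iff)
  have [measurable]: "\<psi> \<in> borel_measurable lebesgue" using \<psi> by (rule bump_measurable)
  show "(\<lambda>z. f z * \<psi> z) \<in> borel_measurable lebesgue" by measurable
  have "(\<integral>\<^sup>+z. ennreal (norm (f z * \<psi> z)) \<partial>lebesgue)
     \<le> (\<integral>\<^sup>+z. ennreal (1 / sz (fst p) ^ CARD('n)) * (ennreal \<bar>f z\<bar> * indicator (supp p) z) \<partial>lebesgue)"
  proof (rule nn_integral_mono)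
    fix z
    show "ennreal (norm (f z * \<psi> z)) \<le> ennreal (1 / sz (fst p) ^ CARD('n)) * (ennreal \<bar>f z\<bar> * indicator (supp p) z)"
    proof (cases "z \<in> supp p")
      case True
      have "\<bar>f z * \<psi> z\<bar> \<le> (1 / sz (fst p) ^ CARD('n)) * \<bar>f z\<bar>"
        using mult_right_mono[OF bump_bound[OF \<psi>(2), of z], of "\<bar>f z\<bar>"] by (simp add: abs_mult mult.commute)
      then show ?thesis using True by (simp add: ennreal_mult'[symmetric] ennreal_leI)
    qed (use bump_outside[OF \<psi>(2)] in simp)
  qed
  also have "\<dots> = ennreal (1 / sz (fst p) ^ CARD('n)) * (\<integral>\<^sup>+z\<in>supp p. ennreal \<bar>f z\<bar> \<partial>lebesgue)"
    by (rule nn_integral_cmult) measurable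
  also have "\<dots> < \<infinity>"
    using f unfolding locally_integrable_iff supp_def by (simp add: ennreal_mult_less_top less_top)
  finally show "(\<integral>\<^sup>+z. ennreal (norm (f z * \<psi> z)) \<partial>lebesgue) < \<infinity>" .
qed

lemma coef_add:
  assumes "0 < \<alpha>" "locally_integrable f" "locally_integrable g"
  shows "coef \<alpha> (\<lambda>x. f x + g x) p \<le> coef \<alpha> f p + coef \<alpha> g p"
  unfolding coef_def
proof (rule SUP_least)
  fix \<psi> assume \<psi>: "\<psi> \<in> bump \<alpha> p"
  have "(LINT z|lebesgue. (f z + g z) * \<psi> z) = (LINT z|lebesgue. f z * \<psi> z) + (LINT z|lebesgue. g z * \<psi> z)"
    using integrable_bump[OF assms(2,1) \<psi>] integrable_bump[OF assms(3,1) \<psi>] by (simp add: distrib_right)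
  then have "ennreal \<bar>LINT z|lebesgue. (f z + g z) * \<psi> z\<bar>
     \<le> ennreal \<bar>LINT z|lebesgue. f z * \<psi> z\<bar> + ennreal \<bar>LINT z|lebesgue. g z * \<psi> z\<bar>"
    by (simp add: ennreal_plus[symmetric] ennreal_leI del: ennreal_plus)
  also have "\<dots> \<le> (SUP \<psi>\<in>bump \<alpha> p. ennreal \<bar>LINT z|lebesgue. f z * \<psi> z\<bar>) +
     (SUP \<psi>\<in>bump \<alpha> p. ennreal \<bar>LINT z|lebesgue. g z * \<psi> z\<bar>)"
    using \<psi> by (intro add_mono SUP_upper)
  finally show "ennreal \<bar>LINT z|lebesgue. (f z + g z) * \<psi> z\<bar> \<le>
    (SUP \<psi>\<in>bump \<alpha> p. ennreal \<bar>LINT z|lebesgue. f z * \<psi> z\<bar>) +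
     (SUP \<psi>\<in>bump \<alpha> p. ennreal \<bar>LINT z|lebesgue. g z * \<psi> z\<bar>)" .
qed

text \<open>Locality. It allows f to be cut off to a superlevel set of a maximal function without
  changing the coefficients of cubes whose support lies in that set.\<close>

lemma coef_cong:
  assumes "\<And>z. z \<in> supp p \<Longrightarrow> f z = g z"
  shows "coef \<alpha> f p = coef \<alpha> g p"
  unfolding coef_def
proof (intro SUP_cong refl arg_cong[where f="\<lambda>a. ennreal \<bar>a\<bar>"] Bochner_Integration.integral_cong)
  fix \<psi> z assume "\<psi> \<in> bump \<alpha> p"
  then show "f z * \<psi> z = g z * \<psi> z" using assms bump_outside[of \<psi> \<alpha> p z] by (cases "z \<in> supp p") auto
qed

text \<open>A function that is not integrable has Bochner integral 0, so the bound is trivial in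
  that case.\<close>

lemma ennreal_integral_le: "ennreal \<bar>LINT z|M. h z\<bar> \<le> (\<integral>\<^sup>+z. ennreal \<bar>h z\<bar> \<partial>M)"
  for h :: "'a \<Rightarrow> real"
proof (cases "integrable M h")
  case True
  from integral_norm_bound_ennreal[OF this] show ?thesis by simp
qed (simp add: not_integrable_integral_eq)

lemma coef_le:
  fixes f :: "real ^ 'n \<Rightarrow> real"
  assumes [measurable]: "f \<in> borel_measurable lebesgue"
  shows "coef \<alpha> f p \<le> (\<integral>\<^sup>+z. ennreal \<bar>f z\<bar> * (ennreal (1 / sz (fst p) ^ CARD('n)) * indicator (supp p) z) \<partial>lebesgue)"
  unfolding coef_def
proof (rule SUP_least)
  fix \<psi> assume \<psi>: "\<psi> \<in> bump \<alpha> p"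
  have "ennreal \<bar>LINT z|lebesgue. f z * \<psi> z\<bar> \<le> (\<integral>\<^sup>+z. ennreal \<bar>f z * \<psi> z\<bar> \<partial>lebesgue)"
    by (rule ennreal_integral_le)
  also have "\<dots> \<le> (\<integral>\<^sup>+z. ennreal \<bar>f z\<bar> * (ennreal (1 / sz (fst p) ^ CARD('n)) * indicator (supp p) z) \<partial>lebesgue)"
  proof (rule nn_integral_mono)
    fix z
    show "ennreal \<bar>f z * \<psi> z\<bar> \<le> ennreal \<bar>f z\<bar> * (ennreal (1 / sz (fst p) ^ CARD('n)) * indicator (supp p) z)"
    proof (cases "z \<in> supp p")
      case True
      have "\<bar>f z * \<psi> z\<bar> \<le> \<bar>f z\<bar> * (1 / sz (fst p) ^ CARD('n))"
        unfolding abs_mult by (intro mult_left_mono bump_bound[OF \<psi>]) simp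
      then show ?thesis using True by (simp add: ennreal_mult'[symmetric] ennreal_leI)
    qed (use bump_outside[OF \<psi>] in simp)
  qed
  finally show "ennreal \<bar>LINT z|lebesgue. f z * \<psi> z\<bar> \<le>
    (\<integral>\<^sup>+z. ennreal \<bar>f z\<bar> * (ennreal (1 / sz (fst p) ^ CARD('n)) * indicator (supp p) z) \<partial>lebesgue)" .
qed

lemma coef_finite:
  fixes f :: "real ^ 'n \<Rightarrow> real"
  assumes "locally_integrable f"
  shows "coef \<alpha> f p < \<infinity>"
proof -
  have [measurable]: "f \<in> borel_measurable lebesgue" using assms by (simp add: locally_integrable_iff)
  have "coef \<alpha> f p \<le> (\<integral>\<^sup>+z. ennreal (1 / sz (fst p) ^ CARD('n)) * (ennreal \<bar>f z\<bar> * indicator (supp p) z) \<partial>lebesgue)"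
    using coef_le[of f \<alpha> p] by (simp add: mult_ac)
  also have "\<dots> = ennreal (1 / sz (fst p) ^ CARD('n)) * (\<integral>\<^sup>+z\<in>supp p. ennreal \<bar>f z\<bar> \<partial>lebesgue)"
    by (rule nn_integral_cmult) measurable
  also have "\<dots> < \<infinity>"
    using assms unfolding locally_integrable_iff supp_def by (simp add: ennreal_mult_less_top less_top)
  finally show ?thesis .
qed

section \<open>Kernels\<close>

text \<open>A Poisson-type kernel, of order 1 near the cube and decaying like the distance to the
  power -(n + e). For e = 1/2 the square has decay 2 n + 1, which the weight of the g-star function
  provides, while the first power is still integrable.\<close>

definition ker :: "real \<Rightarrow> int \<times> (int ^ 'n) \<Rightarrow> real ^ 'n \<Rightarrow> real" where
  "ker e p x = (sz (fst p) / (sz (fst p) + norm (x - corner (fst p) (snd p)))) powr (real CARD('n) + e)"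

lemma ker_nonneg [simp]: "0 \<le> ker e p x" by (simp add: ker_def)

lemma sz_quotient: "0 < sz k / (sz k + norm x)" "sz k / (sz k + norm x) \<le> 1"
  by (auto intro!: divide_pos_pos add_pos_nonneg simp: divide_le_eq add_pos_nonneg)

lemma ker_le_1: "0 \<le> e \<Longrightarrow> ker e p x \<le> 1"
  unfolding ker_def using sz_quotient[of "fst p"] by (intro powr_le1) auto

lemma borel_measurable_ker [measurable]: "ker e p \<in> borel_measurable borel"
  unfolding ker_def by measurable

lemma borel_measurable_ker' [measurable]: "ker e p \<in> borel_measurable lebesgue"
  by (intro borel_measurable_lebesgue) measurable

text \<open>A point farther than one side from the corner lies in a ball of radius
  \<open>2 ^ j\<close> sides while its distance is at least half that radius; for nearer points j =
  0 serves. A single term therefore dominates, and the shift by one in the exponent pays for the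
  factor 2.\<close>

lemma ker_annuli:
  fixes p :: "int \<times> (int ^ 'n)"
  assumes e: "0 \<le> e"
  shows "ennreal (ker e p x) \<le> (\<Sum>\<^sup>+j::nat. ennreal (2 powr ((1 - real j) * (real CARD('n) + e))) *
     indicator (cball (corner (fst p) (snd p)) (2 ^ j * sz (fst p))) x)" (is "_ \<le> (\<Sum>\<^sup>+j. ?t j)")
proof -
  define d where "d = norm (x - corner (fst p) (snd p))"
  have "\<exists>j. ennreal (ker e p x) \<le> ?t j"
  proof (cases "d \<le> sz (fst p)")
    case True
    have "ker e p x \<le> 1" using e by (rule ker_le_1)
    also have "1 \<le> 2 powr (real CARD('n) + e)" using e by (intro ge_one_powr_ge_zero) auto
    finally have "ennreal (ker e p x) \<le> ?t 0"
      using True by (simp add: d_def dist_norm norm_minus_commute ennreal_leI)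
    then show ?thesis ..
  next
    case False
    then have "0 < d" using sz_pos[of "fst p"] by linarith
    then have "0 < d / sz (fst p)" by simp
    obtain i where i: "sz i \<le> d / sz (fst p)" "d / sz (fst p) < 2 * sz i"
      using \<open>0 < d / sz (fst p)\<close> by (rule sz_bracket)
    have "1 < d / sz (fst p)" using False by simp
    then have "sz 0 < sz (i + 1)" using i(2) unfolding sz_Suc sz_0 by linarith
    then have "0 \<le> i" unfolding sz_less_iff by simp
    then obtain j where j: "i = int j" by (metis nonneg_int_cases)
    have "d \<le> 2 ^ Suc j * sz (fst p)" using i by (simp add: j sz_of_nat field_simps)
    then have in_ball: "x \<in> cball (corner (fst p) (snd p)) (2 ^ Suc j * sz (fst p))"
      by (simp add: d_def dist_norm norm_minus_commute)
    have "sz (fst p) / (sz (fst p) + d) \<le> sz (fst p) / d"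
      using \<open>0 < d\<close> by (intro divide_left_mono mult_pos_pos add_pos_pos) auto
    also have "\<dots> \<le> 1 / sz i" using i(1) \<open>0 < d\<close> by (simp add: field_simps)
    also have "\<dots> = 2 powr (1 - real (Suc j))" by (simp add: sz_def j powr_minus_divide)
    finally have "ker e p x \<le> (2 powr (1 - real (Suc j))) powr (real CARD('n) + e)"
      unfolding ker_def d_def using e by (intro powr_mono2) auto
    also have "\<dots> = 2 powr ((1 - real (Suc j)) * (real CARD('n) + e))" by (simp add: powr_powr)
    finally have "ennreal (ker e p x) \<le> ?t (Suc j)"
      using in_ball by (simp add: ennreal_leI)
    then show ?thesis ..
  qed
  then obtain j where "ennreal (ker e p x) \<le> ?t j" ..
  also have "\<dots> \<le> (\<Sum>\<^sup>+j. ?t j)" by (rule nsum_upper)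
  finally show ?thesis .
qed

lemma geometric_nsum:
  assumes "0 < e"
  shows "(\<Sum>\<^sup>+j::nat. ennreal (2 powr (- real j * e))) = ennreal (1 / (1 - 2 powr - e))"
proof -
  have q: "0 < 2 powr - e" "2 powr - e < 1" using assms powr_less_one by auto
  have "(\<Sum>\<^sup>+j::nat. ennreal (2 powr (- real j * e))) = (\<Sum>j. ennreal ((2 powr - e) ^ j))"
    unfolding nn_integral_count_space_nat
    by (intro arg_cong[where f=suminf] ext arg_cong[where f=ennreal])
       (simp add: powr_powr mult.commute flip: powr_realpow)
  also have "\<dots> = ennreal (1 / (1 - 2 powr - e))"
    using q by (intro suminf_ennreal_eq geometric_sums) auto
  finally show ?thesis .
qed

text \<open>The ball with index j has volume of order \<open>2 ^ (j * n)\<close> times that of the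
  cube, against a coefficient of order \<open>2 powr (- j * (n + e))\<close>; what remains is a
  geometric series of ratio \<open>2 powr - e\<close>.\<close>

lemma ker_integral:
  assumes e: "0 < e"
  obtains C where "0 \<le> C"
    "\<And>p :: int \<times> (int ^ 'n). (\<integral>\<^sup>+x. ennreal (ker e p x) \<partial>lebesgue) \<le> ennreal (C * sz (fst p) ^ CARD('n))"
proof
  define A where "A = 2 powr (real CARD('n) + e) * unit_ball_vol (real CARD('n))"
  have A: "0 \<le> A" by (simp add: A_def unit_ball_vol_nonneg)
  have q: "0 \<le> 1 / (1 - 2 powr - e)" using e powr_less_one[of 2 "-e"] by auto
  show "0 \<le> A * (1 / (1 - 2 powr - e))" using A q by (intro mult_nonneg_nonneg)
  fix p :: "int \<times> (int ^ 'n)"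
  let ?B = "\<lambda>j::nat. cball (corner (fst p) (snd p)) (2 ^ j * sz (fst p))"
  have [measurable]: "?B j \<in> sets lebesgue" for j by (intro lebesgue_of_borel) simp
  have "(\<integral>\<^sup>+x. ennreal (ker e p x) \<partial>lebesgue) \<le>
      (\<integral>\<^sup>+x. (\<Sum>\<^sup>+j::nat. ennreal (2 powr ((1 - real j) * (real CARD('n) + e))) * indicator (?B j) x) \<partial>lebesgue)"
    using e by (intro nn_integral_mono ker_annuli) simp
  also have "\<dots> = (\<Sum>\<^sup>+j::nat. \<integral>\<^sup>+x. ennreal (2 powr ((1 - real j) * (real CARD('n) + e))) * indicator (?B j) x \<partial>lebesgue)"
    by (rule nn_integral_nsum) measurable
  also have "\<dots> = (\<Sum>\<^sup>+j::nat. ennreal (A * sz (fst p) ^ CARD('n)) * ennreal (2 powr (- real j * e)))"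
  proof (rule nn_integral_cong)
    fix j :: nat
    have "(\<integral>\<^sup>+x. ennreal (2 powr ((1 - real j) * (real CARD('n) + e))) * indicator (?B j) x \<partial>lebesgue)
       = ennreal (2 powr ((1 - real j) * (real CARD('n) + e))) *
          ennreal (unit_ball_vol (real CARD('n)) * (2 ^ j * sz (fst p)) ^ CARD('n))"
      by (subst nn_integral_cmult) (simp_all add: emeasure_lebesgue_cball del: emeasure_completion)
    also have "\<dots> = ennreal (2 powr ((1 - real j) * (real CARD('n) + e)) *
        (unit_ball_vol (real CARD('n)) * (2 ^ j * sz (fst p)) ^ CARD('n)))"
      by (rule ennreal_mult[symmetric]) (auto simp: unit_ball_vol_nonneg)
    also have "2 powr ((1 - real j) * (real CARD('n) + e)) * (unit_ball_vol (real CARD('n)) * (2 ^ j * sz (fst p)) ^ CARD('n))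
       = A * sz (fst p) ^ CARD('n) * (2 powr ((1 - real j) * (real CARD('n) + e) - (real CARD('n) + e) + real j * real CARD('n)))"
      by (simp add: A_def power_mult_distrib powr_add powr_diff powr_realpow powr_mult flip: power_mult of_nat_mult)
    also have "(1 - real j) * (real CARD('n) + e) - (real CARD('n) + e) + real j * real CARD('n) = - real j * e"
      by (simp add: algebra_simps)
    finally show "(\<integral>\<^sup>+x. ennreal (2 powr ((1 - real j) * (real CARD('n) + e))) * indicator (?B j) x \<partial>lebesgue)
      = ennreal (A * sz (fst p) ^ CARD('n)) * ennreal (2 powr (- real j * e))"
      using A by (simp add: ennreal_mult)
  qed
  also have "\<dots> = ennreal (A * sz (fst p) ^ CARD('n)) * ennreal (1 / (1 - 2 powr - e))"
    by (subst nn_integral_cmult) (simp_all add: geometric_nsum[OF e, simplified])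
  also have "\<dots> = ennreal (A * (1 / (1 - 2 powr - e)) * sz (fst p) ^ CARD('n))"
    using A q by (subst ennreal_mult[symmetric]) (auto simp: mult_ac)
  finally show "(\<integral>\<^sup>+x. ennreal (ker e p x) \<partial>lebesgue) \<le> ennreal (A * (1 / (1 - 2 powr - e)) * sz (fst p) ^ CARD('n))" .
qed

text \<open>The surplus decay 2 e is split: one half becomes the gain in terms of the distance r,
  the other half keeps the kernel integrable.\<close>

lemma ker_integral_off_ball:
  assumes e: "0 < e"
  obtains C where "0 \<le> C"
    "\<And>(p :: int \<times> (int ^ 'n)) r A. 0 < r \<Longrightarrow> (\<And>x. x \<in> A \<Longrightarrow> r \<le> norm (x - corner (fst p) (snd p))) \<Longrightarrow>
     (\<integral>\<^sup>+x\<in>A. ennreal (ker (2 * e) p x) \<partial>lebesgue) \<le> ennreal (C * sz (fst p) ^ CARD('n) * (sz (fst p) / r) powr e)"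
proof -
  obtain C where C: "0 \<le> C"
    "\<And>p :: int \<times> (int ^ 'n). (\<integral>\<^sup>+x. ennreal (ker e p x) \<partial>lebesgue) \<le> ennreal (C * sz (fst p) ^ CARD('n))"
    using ker_integral[OF e] by metis
  have "(\<integral>\<^sup>+x\<in>A. ennreal (ker (2 * e) p x) \<partial>lebesgue) \<le> ennreal (C * sz (fst p) ^ CARD('n) * (sz (fst p) / r) powr e)"
    if r: "0 < r" and A: "\<And>x. x \<in> A \<Longrightarrow> r \<le> norm (x - corner (fst p) (snd p))"
    for p :: "int \<times> (int ^ 'n)" and r A
  proof -
    have "(\<integral>\<^sup>+x\<in>A. ennreal (ker (2 * e) p x) \<partial>lebesgue)
        \<le> (\<integral>\<^sup>+x. ennreal ((sz (fst p) / r) powr e) * ennreal (ker e p x) \<partial>lebesgue)"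
    proof (rule nn_integral_mono)
      fix x
      show "ennreal (ker (2 * e) p x) * indicator A x \<le> ennreal ((sz (fst p) / r) powr e) * ennreal (ker e p x)"
      proof (cases "x \<in> A")
        case True
        let ?u = "sz (fst p) / (sz (fst p) + norm (x - corner (fst p) (snd p)))"
        have "?u \<le> sz (fst p) / r"
          using A[OF True] r by (intro divide_left_mono mult_pos_pos add_pos_nonneg) (auto intro: add_increasing)
        then have "?u powr e \<le> (sz (fst p) / r) powr e" using e by (intro powr_mono2) auto
        moreover have "ker (2 * e) p x = ?u powr e * ker e p x"
          unfolding ker_def by (simp add: powr_add[symmetric] algebra_simps)
        ultimately have "ker (2 * e) p x \<le> (sz (fst p) / r) powr e * ker e p x"
          by (simp add: mult_right_mono)
        then show ?thesis using True by (simp add: ennreal_mult[symmetric] ennreal_leI)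
      qed simp
    qed
    also have "\<dots> = ennreal ((sz (fst p) / r) powr e) * (\<integral>\<^sup>+x. ennreal (ker e p x) \<partial>lebesgue)"
      by (rule nn_integral_cmult) measurable
    also have "\<dots> \<le> ennreal ((sz (fst p) / r) powr e) * ennreal (C * sz (fst p) ^ CARD('n))"
      by (intro mult_left_mono C) simp
    also have "\<dots> = ennreal (C * sz (fst p) ^ CARD('n) * (sz (fst p) / r) powr e)"
      using C(1) by (subst ennreal_mult[symmetric]) (auto simp: mult_ac)
    finally show ?thesis .
  qed
  then show ?thesis using C(1) that by blast
qed

lemma near_count:
  assumes "0 \<le> B"
  obtains C where "0 \<le> C" "\<And>k (x :: real ^ 'n).
    (\<Sum>\<^sup>+m. indicator {m. norm (corner k m - x) \<le> B * sz k} m) \<le> ennreal C"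
proof -
  obtain C where C: "0 \<le> C" "\<And>k (x :: real ^ 'n) \<rho>. 0 \<le> \<rho> \<Longrightarrow>
    (\<Sum>\<^sup>+m. indicator {m. norm (corner k m - x) \<le> \<rho>} m * ennreal (sz k ^ CARD('n)))
      \<le> ennreal (C * (\<rho> + sz k) ^ CARD('n))"
    by (rule corner_count[where 'n='n], rule that)
  have "(\<Sum>\<^sup>+m. indicator {m. norm (corner k m - x) \<le> B * sz k} m) \<le> ennreal (C * (B + 1) ^ CARD('n))"
    for k and x :: "real ^ 'n"
  proof -
    have "ennreal (sz k ^ CARD('n)) * (\<Sum>\<^sup>+m. indicator {m. norm (corner k m - x) \<le> B * sz k} m)
        = (\<Sum>\<^sup>+m. indicator {m. norm (corner k m - x) \<le> B * sz k} m * ennreal (sz k ^ CARD('n)))"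
      by (subst nn_integral_cmult[symmetric]) (auto simp: mult.commute)
    also have "\<dots> \<le> ennreal (C * (B * sz k + sz k) ^ CARD('n))" using assms by (intro C) simp
    also have "B * sz k + sz k = sz k * (B + 1)" by (simp add: algebra_simps)
    also have "ennreal (C * (sz k * (B + 1)) ^ CARD('n)) = ennreal (sz k ^ CARD('n)) * ennreal (C * (B + 1) ^ CARD('n))"
      using C(1) assms by (subst ennreal_mult[symmetric]) (auto simp: power_mult_distrib mult_ac)
    finally show ?thesis by (subst (asm) ennreal_mult_le_mult_iff) auto
  qed
  then show ?thesis using C(1) assms by (intro that[of "C * (B + 1) ^ CARD('n)"]) auto
qed

section \<open>Almost orthogonality and the estimate on square integrable functions\<close>

lemma locally_integrable_continuous:
  assumes "continuous_on UNIV (g :: real ^ 'n \<Rightarrow> real)" shows "locally_integrable g"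
  unfolding locally_integrable_def
proof safe
  fix K :: "(real ^ 'n) set" assume K: "compact K"
  then obtain a b where "K \<subseteq> cbox a b" using bounded_subset_cbox_symmetric[OF compact_imp_bounded] by blast
  moreover have "g absolutely_integrable_on cbox a b"
    using assms by (intro absolutely_integrable_continuous) (auto intro: continuous_on_subset)
  ultimately show "g absolutely_integrable_on K"
    using K by (intro set_integrable_subset[of lebesgue "cbox a b" g K] lebesgue_of_borel borel_compact)
qed

text \<open>Since \<eta> has mean zero, \<psi> may be replaced by its difference from its value at
  the corner of q. Hoelder continuity on the support of \<eta> yields the gain, and the height of
  \<eta> cancels the volume of its support.\<close>

lemma bump_inner_le:
  fixes p q :: "int \<times> (int ^ 'n)"
  assumes \<alpha>: "0 < \<alpha>" and \<psi>: "\<psi> \<in> bump \<alpha> p" and \<eta>: "\<eta> \<in> bump \<alpha> q"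
  shows "\<bar>LINT z|lebesgue. \<psi> z * \<eta> z\<bar> \<le>
    unit_ball_vol (real CARD('n)) * (real CARD('n) + 1) ^ CARD('n) * (real CARD('n) + 1) powr \<alpha> *
    (sz (fst q) / sz (fst p)) powr \<alpha> / sz (fst p) ^ CARD('n)"
proof -
  let ?N = "real CARD('n) + 1" and ?V = "unit_ball_vol (real CARD('n))"
  define c where "c = corner (fst q) (snd q)"
  define A where "A = (?N * sz (fst q) / sz (fst p)) powr \<alpha> / sz (fst p) ^ CARD('n) / sz (fst q) ^ CARD('n)"
  have A: "0 \<le> A" by (simp add: A_def)
  have 1: "integrable lebesgue (\<lambda>z. \<psi> z * \<eta> z)"
    by (rule integrable_bump[OF locally_integrable_continuous[OF bump_continuous[OF \<alpha> \<psi>]] \<alpha> \<eta>])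
  have 2: "integrable lebesgue (\<lambda>z. \<psi> c * \<eta> z)"
    by (rule integrable_bump[OF locally_integrable_continuous[OF continuous_on_const] \<alpha> \<eta>])
  have "(LINT z|lebesgue. \<psi> z * \<eta> z) = (LINT z|lebesgue. \<psi> z * \<eta> z) - (LINT z|lebesgue. \<psi> c * \<eta> z)"
    using bump_integral[OF \<eta>] by simp
  also have "\<dots> = (LINT z|lebesgue. (\<psi> z - \<psi> c) * \<eta> z)"
    using 1 2 by (simp add: left_diff_distrib)
  finally have "ennreal \<bar>LINT z|lebesgue. \<psi> z * \<eta> z\<bar> \<le> (\<integral>\<^sup>+z. ennreal \<bar>(\<psi> z - \<psi> c) * \<eta> z\<bar> \<partial>lebesgue)"
    by (simp add: ennreal_integral_le)
  also have "\<dots> \<le> (\<integral>\<^sup>+z. ennreal A * indicator (supp q) z \<partial>lebesgue)"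
  proof (rule nn_integral_mono)
    fix z
    show "ennreal \<bar>(\<psi> z - \<psi> c) * \<eta> z\<bar> \<le> ennreal A * indicator (supp q) z"
    proof (cases "z \<in> supp q")
      case True
      have "\<bar>\<psi> z - \<psi> c\<bar> \<le> (norm (z - c) / sz (fst p)) powr \<alpha> / sz (fst p) ^ CARD('n)"
        by (rule bump_holder[OF \<psi>])
      also have "\<dots> \<le> (?N * sz (fst q) / sz (fst p)) powr \<alpha> / sz (fst p) ^ CARD('n)"
        using True \<alpha> by (intro divide_right_mono powr_mono2)
           (auto simp: supp_def c_def dist_norm norm_minus_commute)
      finally have "\<bar>\<psi> z - \<psi> c\<bar> * \<bar>\<eta> z\<bar> \<le> (?N * sz (fst q) / sz (fst p)) powr \<alpha> / sz (fst p) ^ CARD('n) * (1 / sz (fst q) ^ CARD('n))"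
        by (intro mult_mono bump_bound[OF \<eta>]) auto
      then show ?thesis using True by (simp add: A_def abs_mult ennreal_leI)
    qed (use bump_outside[OF \<eta>] in simp)
  qed
  also have "\<dots> = ennreal (A * (?V * (?N * sz (fst q)) ^ CARD('n)))"
    using A by (subst nn_integral_cmult)
       (simp_all add: emeasure_supp ennreal_mult unit_ball_vol_nonneg del: emeasure_completion)
  finally have "\<bar>LINT z|lebesgue. \<psi> z * \<eta> z\<bar> \<le> A * (?V * (?N * sz (fst q)) ^ CARD('n))"
    using A by (subst (asm) ennreal_le_iff) (auto simp: unit_ball_vol_nonneg)
  also have "A * (?V * (?N * sz (fst q)) ^ CARD('n)) =
      ?V * ?N ^ CARD('n) * (?N * (sz (fst q) / sz (fst p))) powr \<alpha> / sz (fst p) ^ CARD('n)"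
  proof -
    have "X / a / b * (?V * (?N ^ CARD('n) * b)) = ?V * ?N ^ CARD('n) * X / a" if "b \<noteq> 0" for X a b :: real
      using that by simp
    then show ?thesis unfolding A_def power_mult_distrib times_divide_eq_right by simp
  qed
  also have "(?N * (sz (fst q) / sz (fst p))) powr \<alpha> = ?N powr \<alpha> * (sz (fst q) / sz (fst p)) powr \<alpha>"
    by (rule powr_mult)
  finally show ?thesis by (simp add: mult.assoc)
qed

lemma bump_inner_far:
  fixes p q :: "int \<times> (int ^ 'n)"
  assumes \<psi>: "\<psi> \<in> bump \<alpha> p" and \<eta>: "\<eta> \<in> bump \<alpha> q" and le: "fst q \<le> fst p"
    and far: "2 * (real CARD('n) + 1) * sz (fst p) < norm (corner (fst q) (snd q) - corner (fst p) (snd p))"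
  shows "(LINT z|lebesgue. \<psi> z * \<eta> z) = 0"
proof -
  have "\<psi> z * \<eta> z = 0" for z
  proof (rule ccontr)
    assume "\<psi> z * \<eta> z \<noteq> 0"
    then have "z \<in> supp p" "z \<in> supp q" using bump_outside[OF \<psi>] bump_outside[OF \<eta>] by auto
    then have "norm (corner (fst q) (snd q) - corner (fst p) (snd p)) \<le>
        (real CARD('n) + 1) * sz (fst q) + (real CARD('n) + 1) * sz (fst p)"
      using norm_triangle_ineq[of "corner (fst q) (snd q) - z" "z - corner (fst p) (snd p)"]
      by (simp add: supp_def dist_norm norm_minus_commute)
    also have "\<dots> \<le> (real CARD('n) + 1) * sz (fst p) + (real CARD('n) + 1) * sz (fst p)"
      using le by (intro add_mono mult_left_mono) auto
    finally show False using far by (simp add: algebra_simps)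
  qed
  then have "(\<lambda>z. \<psi> z * \<eta> z) = (\<lambda>z. 0)" by blast
  then show ?thesis by (simp only: Bochner_Integration.integral_zero)
qed

text \<open>Up to a constant and the volume of p, a bound for the inner product of two bumps of
  which q is the smaller: zero when the supports are apart, the Hoelder gain otherwise. The next two
  lemmas bound the sums over either index, as a Schur test requires.\<close>

definition overlap :: "real \<Rightarrow> int \<times> (int ^ 'n) \<Rightarrow> int \<times> (int ^ 'n) \<Rightarrow> ennreal" where
  "overlap \<alpha> p q = indicator {q. fst q \<le> fst p \<and>
      norm (corner (fst q) (snd q) - corner (fst p) (snd p)) \<le> 2 * (real CARD('n) + 1) * sz (fst p)} q *
    ennreal ((sz (fst q) / sz (fst p)) powr \<alpha>)"

text \<open>At every scale not above that of p, the cubes q close to p have total volume at most a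
  constant times that of p. The Hoelder gain then sums geometrically over the scales.\<close>

lemma overlap_sum_small:
  assumes \<alpha>: "0 < \<alpha>"
  obtains C where "0 \<le> C" "\<And>p :: int \<times> (int ^ 'n).
    (\<Sum>\<^sup>+q. overlap \<alpha> p q * ennreal (sz (fst q) ^ CARD('n))) \<le> ennreal (C * sz (fst p) ^ CARD('n))"
proof -
  let ?N = "real CARD('n) + 1"
  obtain C1 where C1: "0 \<le> C1" "\<And>k (x :: real ^ 'n) \<rho>. 0 \<le> \<rho> \<Longrightarrow>
    (\<Sum>\<^sup>+m. indicator {m. norm (corner k m - x) \<le> \<rho>} m * ennreal (sz k ^ CARD('n)))
      \<le> ennreal (C1 * (\<rho> + sz k) ^ CARD('n))"
    by (rule corner_count[where 'n='n], rule that)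
  obtain C2 where C2: "0 \<le> C2" "\<And>d. 0 < d \<Longrightarrow>
    (\<Sum>\<^sup>+k. ennreal (sz k powr \<alpha>) * indicator {k. sz k \<le> d} k) \<le> ennreal (C2 * d powr \<alpha>)"
    by (rule geometric_sum_below[OF \<alpha>], rule that)
  define D where "D = C1 * (2 * ?N + 1) ^ CARD('n)"
  have D: "0 \<le> D" using C1 by (simp add: D_def)
  have "(\<Sum>\<^sup>+q. overlap \<alpha> p q * ennreal (sz (fst q) ^ CARD('n))) \<le> ennreal (D * C2 * sz (fst p) ^ CARD('n))"
    for p :: "int \<times> (int ^ 'n)"
  proof -
    obtain k m where p: "p = (k, m)" by (cases p)
    have "(\<Sum>\<^sup>+q. overlap \<alpha> p q * ennreal (sz (fst q) ^ CARD('n))) =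
      (\<Sum>\<^sup>+l. \<Sum>\<^sup>+m'. (ennreal ((sz l / sz k) powr \<alpha>) * indicator {l. sz l \<le> sz k} l) *
         (indicator {m'. norm (corner l m' - corner k m) \<le> 2 * ?N * sz k} m' * ennreal (sz l ^ CARD('n))))"
      unfolding nsum_pair by (intro nn_integral_cong) (auto simp: overlap_def p split: split_indicator)
    also have "\<dots> = (\<Sum>\<^sup>+l. (ennreal ((sz l / sz k) powr \<alpha>) * indicator {l. sz l \<le> sz k} l) *
         (\<Sum>\<^sup>+m'. indicator {m'. norm (corner l m' - corner k m) \<le> 2 * ?N * sz k} m' * ennreal (sz l ^ CARD('n))))"
      by (intro nn_integral_cong nn_integral_cmult) auto
    also have "\<dots> \<le> (\<Sum>\<^sup>+l. (ennreal ((sz l / sz k) powr \<alpha>) * indicator {l. sz l \<le> sz k} l) *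
         ennreal (D * sz k ^ CARD('n)))"
    proof (rule nsum_mono)
      fix l
      show "(ennreal ((sz l / sz k) powr \<alpha>) * indicator {l. sz l \<le> sz k} l) *
         (\<Sum>\<^sup>+m'. indicator {m'. norm (corner l m' - corner k m) \<le> 2 * ?N * sz k} m' * ennreal (sz l ^ CARD('n)))
         \<le> (ennreal ((sz l / sz k) powr \<alpha>) * indicator {l. sz l \<le> sz k} l) * ennreal (D * sz k ^ CARD('n))"
      proof (cases "sz l \<le> sz k")
        case True
        have "(\<Sum>\<^sup>+m'. indicator {m'. norm (corner l m' - corner k m) \<le> 2 * ?N * sz k} m' * ennreal (sz l ^ CARD('n)))
           \<le> ennreal (C1 * (2 * ?N * sz k + sz l) ^ CARD('n))" by (intro C1) simp
        also have "\<dots> \<le> ennreal (C1 * ((2 * ?N + 1) * sz k) ^ CARD('n))"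
          using C1(1) True by (intro ennreal_leI mult_left_mono power_mono) (auto simp: algebra_simps)
        finally show ?thesis by (intro mult_left_mono) (simp_all add: D_def power_mult_distrib mult.assoc)
      qed simp
    qed
    also have "\<dots> = ennreal (D * sz k ^ CARD('n)) * (ennreal (1 / sz k powr \<alpha>) *
         (\<Sum>\<^sup>+l. ennreal (sz l powr \<alpha>) * indicator {l. sz l \<le> sz k} l))"
    proof -
      have "ennreal ((sz l / sz k) powr \<alpha>) * indicator {l. sz l \<le> sz k} l =
          ennreal (1 / sz k powr \<alpha>) * (ennreal (sz l powr \<alpha>) * indicator {k'. sz k' \<le> sz k} l)" for l
        by (simp add: powr_divide ennreal_mult'[symmetric] split: split_indicator)
      then have "(\<Sum>\<^sup>+l. ennreal ((sz l / sz k) powr \<alpha>) * indicator {l. sz l \<le> sz k} l) =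
          (\<Sum>\<^sup>+l. ennreal (1 / sz k powr \<alpha>) * (ennreal (sz l powr \<alpha>) * indicator {l. sz l \<le> sz k} l))"
        by (simp only:)
      also have "\<dots> = ennreal (1 / sz k powr \<alpha>) * (\<Sum>\<^sup>+l. ennreal (sz l powr \<alpha>) * indicator {l. sz l \<le> sz k} l)"
        by (rule nn_integral_cmult) simp
      finally show ?thesis by (subst nn_integral_multc) (simp_all only: mult.commute, simp)
    qed
    also have "\<dots> \<le> ennreal (D * sz k ^ CARD('n)) * (ennreal (1 / sz k powr \<alpha>) * ennreal (C2 * sz k powr \<alpha>))"
      by (intro mult_left_mono C2) auto
    also have "\<dots> = ennreal (D * C2 * sz (fst p) ^ CARD('n))"
      using C2(1) D by (simp add: p ennreal_mult[symmetric] mult_ac)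
    finally show ?thesis .
  qed
  then show ?thesis using D C2(1) by (intro that[of "D * C2"]) auto
qed

text \<open>At every scale not below that of q only boundedly many cubes p are close enough, and the
  gain decays geometrically in the scale.\<close>

lemma overlap_sum_large:
  assumes \<alpha>: "0 < \<alpha>"
  obtains C where "0 \<le> C" "\<And>q :: int \<times> (int ^ 'n). (\<Sum>\<^sup>+p. overlap \<alpha> p q) \<le> ennreal C"
proof -
  let ?N = "real CARD('n) + 1"
  have N: "0 \<le> 2 * ?N" by simp
  obtain C1 where C1: "0 \<le> C1" "\<And>k (x :: real ^ 'n).
    (\<Sum>\<^sup>+m. indicator {m. norm (corner k m - x) \<le> 2 * ?N * sz k} m) \<le> ennreal C1"
    by (rule near_count[where 'n='n, OF N], rule that)
  obtain C2 where C2: "0 \<le> C2" "\<And>d. 0 < d \<Longrightarrow>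
    (\<Sum>\<^sup>+k. ennreal (sz k powr - \<alpha>) * indicator {k. d \<le> sz k} k) \<le> ennreal (C2 * d powr - \<alpha>)"
    by (rule geometric_sum_above[OF \<alpha>], rule that)
  have "(\<Sum>\<^sup>+p. overlap \<alpha> p q) \<le> ennreal (C1 * C2)" for q :: "int \<times> (int ^ 'n)"
  proof -
    obtain l m' where q: "q = (l, m')" by (cases q)
    have "(\<Sum>\<^sup>+p. overlap \<alpha> p q) =
      (\<Sum>\<^sup>+k. \<Sum>\<^sup>+m. (ennreal ((sz l / sz k) powr \<alpha>) * indicator {k. sz l \<le> sz k} k) *
         indicator {m. norm (corner k m - corner l m') \<le> 2 * ?N * sz k} m)"
      unfolding nsum_pair by (intro nn_integral_cong) (auto simp: overlap_def q norm_minus_commute split: split_indicator)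
    also have "\<dots> = (\<Sum>\<^sup>+k. (ennreal ((sz l / sz k) powr \<alpha>) * indicator {k. sz l \<le> sz k} k) *
         (\<Sum>\<^sup>+m. indicator {m. norm (corner k m - corner l m') \<le> 2 * ?N * sz k} m))"
      by (intro nn_integral_cong nn_integral_cmult) auto
    also have "\<dots> \<le> (\<Sum>\<^sup>+k. (ennreal ((sz l / sz k) powr \<alpha>) * indicator {k. sz l \<le> sz k} k) * ennreal C1)"
      by (intro nsum_mono mult_left_mono C1) simp
    also have "\<dots> = ennreal C1 * (ennreal (sz l powr \<alpha>) *
         (\<Sum>\<^sup>+k. ennreal (sz k powr - \<alpha>) * indicator {k. sz l \<le> sz k} k))"
    proof -
      have "ennreal ((sz l / sz k) powr \<alpha>) * indicator {k. sz l \<le> sz k} k =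
          ennreal (sz l powr \<alpha>) * (ennreal (sz k powr - \<alpha>) * indicator {k. sz l \<le> sz k} k)" for k
        by (simp add: powr_divide powr_minus_divide ennreal_mult'[symmetric] split: split_indicator)
      then have "(\<Sum>\<^sup>+k. ennreal ((sz l / sz k) powr \<alpha>) * indicator {k. sz l \<le> sz k} k) =
          (\<Sum>\<^sup>+k. ennreal (sz l powr \<alpha>) * (ennreal (sz k powr - \<alpha>) * indicator {k. sz l \<le> sz k} k))"
        by (simp only:)
      also have "\<dots> = ennreal (sz l powr \<alpha>) * (\<Sum>\<^sup>+k. ennreal (sz k powr - \<alpha>) * indicator {k. sz l \<le> sz k} k)"
        by (rule nn_integral_cmult) simp
      finally show ?thesis by (subst nn_integral_multc) (simp_all only: mult.commute, simp)
    qed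
    also have "\<dots> \<le> ennreal C1 * (ennreal (sz l powr \<alpha>) * ennreal (C2 * sz l powr - \<alpha>))"
      by (intro mult_left_mono C2) auto
    also have "\<dots> = ennreal (C1 * C2)"
      using C2(1) C1(1) by (simp add: ennreal_mult[symmetric] powr_minus)
    finally show ?thesis .
  qed
  then show ?thesis using C1(1) C2(1) by (intro that[of "C1 * C2"]) auto
qed

text \<open>The row sums of the Gram matrix of the bumps, weighted by cube volumes. Their uniformity
  in the family \<psi> is what later permits a supremum over bumps in every coefficient.\<close>

lemma almost_orthogonal:
  assumes \<alpha>: "0 < \<alpha>"
  obtains C where "0 \<le> C" "\<And>(\<psi> :: int \<times> (int ^ 'n) \<Rightarrow> real ^ 'n \<Rightarrow> real) F p. finite F \<Longrightarrow> \<forall>p. \<psi> p \<in> bump \<alpha> p \<Longrightarrow>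
     (\<Sum>q\<in>F. sz (fst q) ^ CARD('n) * \<bar>LINT z|lebesgue. \<psi> p z * \<psi> q z\<bar>) \<le> C"
proof -
  obtain C1 where C1: "0 \<le> C1" "\<And>p :: int \<times> (int ^ 'n).
    (\<Sum>\<^sup>+q. overlap \<alpha> p q * ennreal (sz (fst q) ^ CARD('n))) \<le> ennreal (C1 * sz (fst p) ^ CARD('n))"
    by (rule overlap_sum_small[where 'n='n, OF \<alpha>], rule that)
  obtain C2 where C2: "0 \<le> C2" "\<And>q :: int \<times> (int ^ 'n). (\<Sum>\<^sup>+p. overlap \<alpha> p q) \<le> ennreal C2"
    by (rule overlap_sum_large[where 'n='n, OF \<alpha>], rule that)
  define A where "A = unit_ball_vol (real CARD('n)) * (real CARD('n) + 1) ^ CARD('n) * (real CARD('n) + 1) powr \<alpha>"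
  have A: "0 \<le> A" by (simp add: A_def unit_ball_vol_nonneg)
  have "(\<Sum>q\<in>F. sz (fst q) ^ CARD('n) * \<bar>LINT z|lebesgue. \<psi> p z * \<psi> q z\<bar>) \<le> A * (C1 + C2)"
    if F: "finite F" and \<psi>': "\<forall>p. \<psi> p \<in> bump \<alpha> p" for \<psi> :: "int \<times> (int ^ 'n) \<Rightarrow> real ^ 'n \<Rightarrow> real" and F p
  proof -
    note \<psi> = \<psi>'[rule_format]
    let ?w = "\<lambda>p::int \<times> (int ^ 'n). sz (fst p) ^ CARD('n)"
    \<comment> \<open>Both alternatives are kept in one bound: the first summand serves the cubes q
      no larger than p, the second the larger ones, with the roles exchanged.\<close>
    have "ennreal (?w q * \<bar>LINT z|lebesgue. \<psi> p z * \<psi> q z\<bar>) \<le>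
      ennreal A * (ennreal (1 / ?w p) * (overlap \<alpha> p q * ennreal (?w q)) + overlap \<alpha> q p)" for q
    proof (cases "fst q \<le> fst p")
      case True
      show ?thesis
      proof (cases "norm (corner (fst q) (snd q) - corner (fst p) (snd p)) \<le> 2 * (real CARD('n) + 1) * sz (fst p)")
        case near: True
        have "?w q * \<bar>LINT z|lebesgue. \<psi> p z * \<psi> q z\<bar> \<le> ?w q * (A * (sz (fst q) / sz (fst p)) powr \<alpha> / ?w p)"
          using bump_inner_le[OF \<alpha> \<psi> \<psi>, of p q] by (intro mult_left_mono) (auto simp: A_def)
        also have "\<dots> = A * (1 / ?w p * ((sz (fst q) / sz (fst p)) powr \<alpha> * ?w q))" by simp
        finally have "ennreal (?w q * \<bar>LINT z|lebesgue. \<psi> p z * \<psi> q z\<bar>) \<le>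
            ennreal A * (ennreal (1 / ?w p) * (overlap \<alpha> p q * ennreal (?w q)))"
          using near True A by (simp add: overlap_def ennreal_mult'[symmetric] ennreal_leI)
        also have "\<dots> \<le> ennreal A * (ennreal (1 / ?w p) * (overlap \<alpha> p q * ennreal (?w q)) + overlap \<alpha> q p)"
          by (intro mult_left_mono) auto
        finally show ?thesis .
      next
        case False
        then show ?thesis using bump_inner_far[OF \<psi> \<psi> True] by simp
      qed
    next
      case False
      then have le: "fst p \<le> fst q" by simp
      have comm: "(LINT z|lebesgue. \<psi> p z * \<psi> q z) = (LINT z|lebesgue. \<psi> q z * \<psi> p z)"
        by (simp add: mult.commute)
      show ?thesis
      proof (cases "norm (corner (fst p) (snd p) - corner (fst q) (snd q)) \<le> 2 * (real CARD('n) + 1) * sz (fst q)")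
        case near: True
        have "?w q * \<bar>LINT z|lebesgue. \<psi> p z * \<psi> q z\<bar> \<le> ?w q * (A * (sz (fst p) / sz (fst q)) powr \<alpha> / ?w q)"
          unfolding comm using bump_inner_le[OF \<alpha> \<psi> \<psi>, of q p] by (intro mult_left_mono) (auto simp: A_def)
        also have "\<dots> = A * (sz (fst p) / sz (fst q)) powr \<alpha>" by simp
        finally have "ennreal (?w q * \<bar>LINT z|lebesgue. \<psi> p z * \<psi> q z\<bar>) \<le> ennreal A * overlap \<alpha> q p"
          using near le A by (simp add: overlap_def ennreal_mult'[symmetric] ennreal_leI)
        also have "\<dots> \<le> ennreal A * (ennreal (1 / ?w p) * (overlap \<alpha> p q * ennreal (?w q)) + overlap \<alpha> q p)"
          by (intro mult_left_mono) auto
        finally show ?thesis .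
      next
        case False
        then show ?thesis unfolding comm using bump_inner_far[OF \<psi> \<psi> le] by simp
      qed
    qed note tm = this
    have "ennreal (\<Sum>q\<in>F. ?w q * \<bar>LINT z|lebesgue. \<psi> p z * \<psi> q z\<bar>)
        = (\<Sum>q\<in>F. ennreal (?w q * \<bar>LINT z|lebesgue. \<psi> p z * \<psi> q z\<bar>))"
      by (rule sum_ennreal[symmetric]) simp
    also have "\<dots> \<le> (\<Sum>\<^sup>+q. ennreal (?w q * \<bar>LINT z|lebesgue. \<psi> p z * \<psi> q z\<bar>))" by (rule sum_le_nsum[OF F])
    also have "\<dots> \<le> (\<Sum>\<^sup>+q. ennreal A * (ennreal (1 / ?w p) * (overlap \<alpha> p q * ennreal (?w q)) + overlap \<alpha> q p))"
      by (rule nsum_mono) (rule tm)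
    also have "\<dots> = ennreal A * (ennreal (1 / ?w p) * (\<Sum>\<^sup>+q. overlap \<alpha> p q * ennreal (?w q)) + (\<Sum>\<^sup>+q. overlap \<alpha> q p))"
      by (simp add: nn_integral_cmult nn_integral_add)
    also have "\<dots> \<le> ennreal A * (ennreal (1 / ?w p) * ennreal (C1 * ?w p) + ennreal C2)"
      by (intro mult_left_mono add_mono C1 C2) auto
    also have "\<dots> = ennreal (A * (C1 + C2))"
      using A C1(1) C2(1) by (simp add: ennreal_mult[symmetric] ennreal_plus[symmetric] del: ennreal_plus)
    finally show ?thesis using A C1(1) C2(1) by (subst (asm) ennreal_le_iff) auto
  qed
  then show ?thesis using A C1(1) C2(1) by (intro that[of "A * (C1 + C2)"]) auto
qed

text \<open>A TT-star argument. The weighted sum T of squared coefficients is the pairing of f with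
  a combination G of the bumps, and the Schur test bounds the squared norm of G by C T.
  Cauchy-Schwarz then bounds the square of T by C T times the squared norm of f, and T may be
  cancelled because it is a finite real number.\<close>

lemma l2_bound_finite:
  assumes \<alpha>: "0 < \<alpha>"
  obtains C where "0 \<le> C" "\<And>(f :: real ^ 'n \<Rightarrow> real) \<psi> F. finite F \<Longrightarrow> \<forall>p. \<psi> p \<in> bump \<alpha> p \<Longrightarrow>
     f \<in> borel_measurable lebesgue \<Longrightarrow> integrable lebesgue (\<lambda>z. (f z)\<^sup>2) \<Longrightarrow>
     (\<Sum>p\<in>F. (LINT z|lebesgue. f z * \<psi> p z)\<^sup>2 * sz (fst p) ^ CARD('n)) \<le> C * (LINT z|lebesgue. (f z)\<^sup>2)"
proof -
  obtain C where C: "0 \<le> C" "\<And>(\<psi> :: int \<times> (int ^ 'n) \<Rightarrow> real ^ 'n \<Rightarrow> real) F p. finite F \<Longrightarrow> \<forall>p. \<psi> p \<in> bump \<alpha> p \<Longrightarrow>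
     (\<Sum>q\<in>F. sz (fst q) ^ CARD('n) * \<bar>LINT z|lebesgue. \<psi> p z * \<psi> q z\<bar>) \<le> C"
    by (rule almost_orthogonal[where 'n='n, OF \<alpha>], rule that)
  have "(\<Sum>p\<in>F. (LINT z|lebesgue. f z * \<psi> p z)\<^sup>2 * sz (fst p) ^ CARD('n)) \<le> C * (LINT z|lebesgue. (f z)\<^sup>2)"
    if F: "finite F" and \<psi>': "\<forall>p. \<psi> p \<in> bump \<alpha> p" and f [measurable]: "f \<in> borel_measurable lebesgue"
      and f2: "integrable lebesgue (\<lambda>z. (f z)\<^sup>2)" for f :: "real ^ 'n \<Rightarrow> real" and \<psi> F
  proof -
    note \<psi> = \<psi>'[rule_format]
    let ?w = "\<lambda>p::int \<times> (int ^ 'n). sz (fst p) ^ CARD('n)"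
    define a where "a p = (LINT z|lebesgue. f z * \<psi> p z)" for p
    define M where "M p q = (LINT z|lebesgue. \<psi> p z * \<psi> q z)" for p q
    define G where "G z = (\<Sum>p\<in>F. a p * ?w p * \<psi> p z)" for z
    define T where "T = (\<Sum>p\<in>F. (a p)\<^sup>2 * ?w p)"
    have T: "0 \<le> T" by (auto simp: T_def intro!: sum_nonneg)
    have fin2: "(\<integral>\<^sup>+z. ennreal (\<bar>f z\<bar> powr 2) \<partial>lebesgue) < \<infinity>"
      using f2 by (simp add: integrable_iff_bounded powr_numeral less_top)
    have li: "locally_integrable f" by (rule locally_integrable_power[OF f _ fin2]) simp
    have li': "locally_integrable (\<psi> p)" for p
      by (intro locally_integrable_continuous bump_continuous[OF \<alpha> \<psi>])
    have i1: "integrable lebesgue (\<lambda>z. f z * \<psi> p z)" for p by (rule integrable_bump[OF li \<alpha> \<psi>])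
    have i2: "integrable lebesgue (\<lambda>z. \<psi> p z * \<psi> q z)" for p q by (rule integrable_bump[OF li' \<alpha> \<psi>])
    have TfG: "T = (LINT z|lebesgue. f z * G z)"
    proof -
      have "(LINT z|lebesgue. f z * G z) = (LINT z|lebesgue. (\<Sum>p\<in>F. (a p * ?w p) * (f z * \<psi> p z)))"
        by (simp add: G_def sum_distrib_left mult_ac)
      also have "\<dots> = (\<Sum>p\<in>F. (a p * ?w p) * a p)"
        unfolding a_def using i1 by (subst Bochner_Integration.integral_sum) auto
      finally show ?thesis by (simp add: T_def power2_eq_square mult_ac)
    qed
    have GG: "(G z)\<^sup>2 = (\<Sum>p\<in>F. \<Sum>q\<in>F. (a p * ?w p * (a q * ?w q)) * (\<psi> p z * \<psi> q z))" for z
      by (simp add: G_def power2_eq_square sum_product mult_ac)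
    have iG: "integrable lebesgue (\<lambda>z. (G z)\<^sup>2)" unfolding GG using i2 by (intro Bochner_Integration.integrable_sum) auto
    have "(LINT z|lebesgue. (G z)\<^sup>2) = (\<Sum>p\<in>F. \<Sum>q\<in>F. (a p * ?w p * (a q * ?w q)) * M p q)"
      unfolding GG M_def using i2 by (subst Bochner_Integration.integral_sum, auto)+
    \<comment> \<open>The Schur test: a product of coefficients is at most half the sum of their
      squares, and the symmetry of M makes the two halves equal after summation.\<close>
    also have "\<dots> \<le> (\<Sum>p\<in>F. \<Sum>q\<in>F. ((a p)\<^sup>2 * ?w p * (?w q * \<bar>M p q\<bar>) + (a q)\<^sup>2 * ?w q * (?w p * \<bar>M q p\<bar>)) / 2)"
    proof (intro sum_mono)
      fix p q
      have sym: "M q p = M p q" by (simp add: M_def mult.commute)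
      have "(a p * ?w p * (a q * ?w q)) * M p q \<le> \<bar>a p * a q\<bar> * (?w p * ?w q * \<bar>M p q\<bar>)"
        using abs_ge_self[of "(a p * ?w p * (a q * ?w q)) * M p q"] by (simp add: abs_mult mult_ac)
      also have "\<bar>a p * a q\<bar> \<le> ((a p)\<^sup>2 + (a q)\<^sup>2) / 2"
        using sum_squares_bound[of "\<bar>a p\<bar>" "\<bar>a q\<bar>"] by (simp add: abs_mult)
      finally show "(a p * ?w p * (a q * ?w q)) * M p q \<le>
         ((a p)\<^sup>2 * ?w p * (?w q * \<bar>M p q\<bar>) + (a q)\<^sup>2 * ?w q * (?w p * \<bar>M q p\<bar>)) / 2"
        unfolding sym by (simp add: mult_right_mono algebra_simps)
    qed
    also have "\<dots> = (\<Sum>p\<in>F. (a p)\<^sup>2 * ?w p * (\<Sum>q\<in>F. ?w q * \<bar>M p q\<bar>))"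
    proof -
      let ?h = "\<lambda>p q. (a p)\<^sup>2 * ?w p * (?w q * \<bar>M p q\<bar>)"
      have "(\<Sum>p\<in>F. \<Sum>q\<in>F. (?h p q + ?h q p) / 2) = ((\<Sum>p\<in>F. \<Sum>q\<in>F. ?h p q) + (\<Sum>p\<in>F. \<Sum>q\<in>F. ?h q p)) / 2"
        by (simp add: sum.distrib sum_divide_distrib[symmetric])
      also have "(\<Sum>p\<in>F. \<Sum>q\<in>F. ?h q p) = (\<Sum>p\<in>F. \<Sum>q\<in>F. ?h p q)" by (rule sum.swap)
      also have "((\<Sum>p\<in>F. \<Sum>q\<in>F. ?h p q) + (\<Sum>p\<in>F. \<Sum>q\<in>F. ?h p q)) / 2 = (\<Sum>p\<in>F. \<Sum>q\<in>F. ?h p q)"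
        by simp
      finally show ?thesis by (simp only: sum_distrib_left)
    qed
    also have "\<dots> \<le> (\<Sum>p\<in>F. (a p)\<^sup>2 * ?w p * C)"
      unfolding M_def by (intro sum_mono mult_left_mono C(2)[OF F \<psi>']) auto
    also have "\<dots> = C * T" by (simp add: T_def sum_distrib_left mult_ac)
    finally have G2: "(LINT z|lebesgue. (G z)\<^sup>2) \<le> C * T" .
    have "T\<^sup>2 \<le> (LINT z|lebesgue. (f z)\<^sup>2) * (LINT z|lebesgue. (G z)\<^sup>2)"
    proof -
      have [measurable]: "G \<in> borel_measurable lebesgue"
        unfolding G_def using bump_measurable[OF \<alpha> \<psi>] by measurable
      have 1: "(LINT z|lebesgue. (f z)\<^sup>2) * (LINT z|lebesgue. (G z)\<^sup>2) \<ge> 0" by simp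
      have "ennreal T \<le> (\<integral>\<^sup>+z. ennreal \<bar>f z\<bar> * ennreal \<bar>G z\<bar> \<partial>lebesgue)"
        using ennreal_integral_le[of lebesgue "\<lambda>z. f z * G z"] T unfolding TfG
        by (simp add: abs_mult ennreal_mult)
      then have "(ennreal T)\<^sup>2 \<le> (\<integral>\<^sup>+z. ennreal \<bar>f z\<bar> * ennreal \<bar>G z\<bar> \<partial>lebesgue)\<^sup>2" by (rule power_mono) simp
      also have "\<dots> \<le> (\<integral>\<^sup>+z. (ennreal \<bar>f z\<bar>)\<^sup>2 \<partial>lebesgue) * (\<integral>\<^sup>+z. (ennreal \<bar>G z\<bar>)\<^sup>2 \<partial>lebesgue)"
        by (rule Cauchy_Schwarz_nn_integral) measurable
      also have "\<dots> = ennreal (LINT z|lebesgue. (f z)\<^sup>2) * ennreal (LINT z|lebesgue. (G z)\<^sup>2)"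
        using f2 iG by (simp add: ennreal_power nn_integral_eq_integral)
      also have "\<dots> = ennreal ((LINT z|lebesgue. (f z)\<^sup>2) * (LINT z|lebesgue. (G z)\<^sup>2))"
        by (simp add: ennreal_mult)
      finally show ?thesis using T 1 by (simp add: ennreal_power)
    qed
    also have "\<dots> \<le> (LINT z|lebesgue. (f z)\<^sup>2) * (C * T)" by (intro mult_left_mono G2) simp
    finally have "T * T \<le> (C * (LINT z|lebesgue. (f z)\<^sup>2)) * T" by (simp add: power2_eq_square mult_ac)
    then have "T \<le> C * (LINT z|lebesgue. (f z)\<^sup>2)"
      using T C(1) by (cases "T = 0") (auto simp: less_le)
    then show ?thesis by (simp add: T_def a_def)
  qed
  then show ?thesis using C(1) that by blast
qed

text \<open>A bump reaching at least half of each coefficient exists because coefficients are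
  finite, and the estimate for finite sums does not depend on that choice. Squaring the lost factor
  2 gives 4; the summand 1 keeps the constant positive for f outside L^2.\<close>

theorem l2_bound:
  assumes \<alpha>: "0 < \<alpha>"
  obtains C where "0 < C" "\<And>f :: real ^ 'n \<Rightarrow> real. f \<in> borel_measurable lebesgue \<Longrightarrow>
     (\<Sum>\<^sup>+p. (coef \<alpha> f p)\<^sup>2 * ennreal (sz (fst p) ^ CARD('n))) \<le> ennreal C * (\<integral>\<^sup>+z. ennreal ((f z)\<^sup>2) \<partial>lebesgue)"
proof -
  obtain C where C: "0 \<le> C" "\<And>(f :: real ^ 'n \<Rightarrow> real) \<psi> F. finite F \<Longrightarrow> \<forall>p. \<psi> p \<in> bump \<alpha> p \<Longrightarrow>
     f \<in> borel_measurable lebesgue \<Longrightarrow> integrable lebesgue (\<lambda>z. (f z)\<^sup>2) \<Longrightarrow>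
     (\<Sum>p\<in>F. (LINT z|lebesgue. f z * \<psi> p z)\<^sup>2 * sz (fst p) ^ CARD('n)) \<le> C * (LINT z|lebesgue. (f z)\<^sup>2)"
    by (rule l2_bound_finite[where 'n='n, OF \<alpha>], rule that)
  have "(\<Sum>\<^sup>+p. (coef \<alpha> f p)\<^sup>2 * ennreal (sz (fst p) ^ CARD('n))) \<le> ennreal (4 * C + 1) * (\<integral>\<^sup>+z. ennreal ((f z)\<^sup>2) \<partial>lebesgue)"
    if f [measurable]: "f \<in> borel_measurable lebesgue" for f :: "real ^ 'n \<Rightarrow> real"
  proof (cases "(\<integral>\<^sup>+z. ennreal ((f z)\<^sup>2) \<partial>lebesgue) < \<infinity>")
    case False
    then have "(\<integral>\<^sup>+z. ennreal ((f z)\<^sup>2) \<partial>lebesgue) = top" by (simp add: less_top[symmetric])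
    moreover have "ennreal (4 * C + 1) * top = top" using C(1) by (simp add: ennreal_mult_top)
    ultimately show ?thesis by simp
  next
    case True
    then have f2: "integrable lebesgue (\<lambda>z. (f z)\<^sup>2)" by (simp add: integrable_iff_bounded)
    have li: "locally_integrable f"
      by (rule locally_integrable_power[OF f, of 2]) (use True in \<open>simp_all add: powr_numeral\<close>)
    have "\<exists>\<psi>\<in>bump \<alpha> p. coef \<alpha> f p \<le> 2 * ennreal \<bar>LINT z|lebesgue. f z * \<psi> z\<bar>" for p
    proof (cases "coef \<alpha> f p = 0")
      case True
      then show ?thesis by (intro bexI[of _ "\<lambda>z. 0"]) auto
    next
      case False
      obtain r where r: "coef \<alpha> f p = ennreal r" "0 < r"
        using coef_finite[OF li, of \<alpha> p] False by (cases "coef \<alpha> f p") (auto simp: less_le)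
      then have "ennreal (r / 2) < coef \<alpha> f p" by (simp add: ennreal_less_iff)
      then obtain \<psi> where \<psi>: "\<psi> \<in> bump \<alpha> p" "ennreal (r / 2) < ennreal \<bar>LINT z|lebesgue. f z * \<psi> z\<bar>"
        unfolding coef_def less_SUP_iff by blast
      then have "r \<le> 2 * \<bar>LINT z|lebesgue. f z * \<psi> z\<bar>" using r(2) by (simp add: ennreal_less_iff)
      then have "ennreal r \<le> ennreal (2 * \<bar>LINT z|lebesgue. f z * \<psi> z\<bar>)" by (rule ennreal_leI)
      then show ?thesis using \<psi>(1) by (intro bexI[of _ \<psi>]) (auto simp: r(1) ennreal_mult)
    qed
    then obtain \<psi> where \<psi>: "\<And>p. \<psi> p \<in> bump \<alpha> p" "\<And>p. coef \<alpha> f p \<le> 2 * ennreal \<bar>LINT z|lebesgue. f z * \<psi> p z\<bar>"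
      by metis
    show ?thesis
    proof (rule nsum_le_finite)
      fix F :: "(int \<times> (int ^ 'n)) set" assume F: "finite F"
      have "(\<Sum>p\<in>F. (coef \<alpha> f p)\<^sup>2 * ennreal (sz (fst p) ^ CARD('n)))
        \<le> (\<Sum>p\<in>F. ennreal (4 * ((LINT z|lebesgue. f z * \<psi> p z)\<^sup>2 * sz (fst p) ^ CARD('n))))"
      proof (rule sum_mono)
        fix p
        have "(coef \<alpha> f p)\<^sup>2 \<le> (2 * ennreal \<bar>LINT z|lebesgue. f z * \<psi> p z\<bar>)\<^sup>2" by (rule power_mono[OF \<psi>(2)]) simp
        also have "\<dots> = ennreal (4 * (LINT z|lebesgue. f z * \<psi> p z)\<^sup>2)"
          by (simp add: power_mult_distrib ennreal_power ennreal_mult)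
        finally show "(coef \<alpha> f p)\<^sup>2 * ennreal (sz (fst p) ^ CARD('n))
          \<le> ennreal (4 * ((LINT z|lebesgue. f z * \<psi> p z)\<^sup>2 * sz (fst p) ^ CARD('n)))"
          by (simp add: mult_right_mono ennreal_mult mult.assoc[symmetric])
      qed
      also have "\<dots> = ennreal (4 * (\<Sum>p\<in>F. (LINT z|lebesgue. f z * \<psi> p z)\<^sup>2 * sz (fst p) ^ CARD('n)))"
        unfolding sum_distrib_left by (rule sum_ennreal) simp
      also have "\<dots> \<le> ennreal ((4 * C + 1) * (LINT z|lebesgue. (f z)\<^sup>2))"
      proof (rule ennreal_leI)
        have "4 * (\<Sum>p\<in>F. (LINT z|lebesgue. f z * \<psi> p z)\<^sup>2 * sz (fst p) ^ CARD('n)) \<le> 4 * (C * (LINT z|lebesgue. (f z)\<^sup>2))"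
          using C(2)[OF F allI[OF \<psi>(1)] f f2] by simp
        also have "\<dots> \<le> (4 * C + 1) * (LINT z|lebesgue. (f z)\<^sup>2)" by (simp add: distrib_right)
        finally show "4 * (\<Sum>p\<in>F. (LINT z|lebesgue. f z * \<psi> p z)\<^sup>2 * sz (fst p) ^ CARD('n))
            \<le> (4 * C + 1) * (LINT z|lebesgue. (f z)\<^sup>2)" .
      qed
      also have "\<dots> = ennreal (4 * C + 1) * (\<integral>\<^sup>+z. ennreal ((f z)\<^sup>2) \<partial>lebesgue)"
        using C(1) by (subst nn_integral_eq_integral[OF f2]) (auto simp: ennreal_mult)
      finally show "(\<Sum>p\<in>F. (coef \<alpha> f p)\<^sup>2 * ennreal (sz (fst p) ^ CARD('n)))
         \<le> ennreal (4 * C + 1) * (\<integral>\<^sup>+z. ennreal ((f z)\<^sup>2) \<partial>lebesgue)" .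
    qed
  qed
  then show ?thesis using C(1) by (intro that[of "4 * C + 1"]) auto
qed

section \<open>The discrete square function\<close>

text \<open>This is the square of S f from the overview, kept as a plain sum so that it can be
  integrated term by term; roots are taken by \<open>ennreal_sqrt\<close> where they are
  needed.\<close>

definition sq_fun :: "real \<Rightarrow> (real ^ 'n \<Rightarrow> real) \<Rightarrow> real ^ 'n \<Rightarrow> ennreal" where
  "sq_fun \<alpha> f x = (\<Sum>\<^sup>+p. (coef \<alpha> f p * ennreal (ker (1/2) p x))\<^sup>2)"

lemma borel_measurable_sq_fun [measurable]: "sq_fun \<alpha> f \<in> borel_measurable lebesgue"
  unfolding sq_fun_def by (intro borel_measurable_nsum) measurable

lemma ennreal_square_add: "((a::ennreal) + b)\<^sup>2 \<le> 2 * (a\<^sup>2 + b\<^sup>2)"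
proof (cases "a = top \<or> b = top")
  case True
  then show ?thesis by (auto simp: ennreal_mult_top)
next
  case False
  then obtain r s where "a = ennreal r" "0 \<le> r" "b = ennreal s" "0 \<le> s" by (cases a; cases b) auto
  moreover have "(r + s)\<^sup>2 \<le> 2 * (r\<^sup>2 + s\<^sup>2)" using sum_squares_bound[of r s] by (simp add: power2_sum)
  ultimately show ?thesis
    by (simp add: ennreal_power ennreal_plus[symmetric] numeral_mult_ennreal ennreal_leI del: ennreal_plus)
qed

lemma sq_fun_add:
  assumes "0 < \<alpha>" "locally_integrable f" "locally_integrable g"
  shows "sq_fun \<alpha> (\<lambda>x. f x + g x) x \<le> 2 * (sq_fun \<alpha> f x + sq_fun \<alpha> g x)"
proof -
  have "sq_fun \<alpha> (\<lambda>x. f x + g x) x \<le> (\<Sum>\<^sup>+p. 2 * ((coef \<alpha> f p * ennreal (ker (1/2) p x))\<^sup>2 + (coef \<alpha> g p * ennreal (ker (1/2) p x))\<^sup>2))"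
    unfolding sq_fun_def
  proof (rule nsum_mono)
    fix p
    have "coef \<alpha> (\<lambda>x. f x + g x) p * ennreal (ker (1/2) p x)
        \<le> coef \<alpha> f p * ennreal (ker (1/2) p x) + coef \<alpha> g p * ennreal (ker (1/2) p x)"
      using coef_add[OF assms, of p] by (simp add: distrib_right[symmetric] mult_right_mono)
    then have "(coef \<alpha> (\<lambda>x. f x + g x) p * ennreal (ker (1/2) p x))\<^sup>2
        \<le> (coef \<alpha> f p * ennreal (ker (1/2) p x) + coef \<alpha> g p * ennreal (ker (1/2) p x))\<^sup>2"
      by (rule power_mono) simp
    also note ennreal_square_add
    finally show "(coef \<alpha> (\<lambda>x. f x + g x) p * ennreal (ker (1/2) p x))\<^sup>2
      \<le> 2 * ((coef \<alpha> f p * ennreal (ker (1/2) p x))\<^sup>2 + (coef \<alpha> g p * ennreal (ker (1/2) p x))\<^sup>2)" .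
  qed
  also have "\<dots> = 2 * (sq_fun \<alpha> f x + sq_fun \<alpha> g x)"
    by (simp add: nn_integral_cmult nn_integral_add sq_fun_def)
  finally show ?thesis .
qed

lemma sq_fun_le_sum: "sq_fun \<alpha> f x \<le> (\<Sum>\<^sup>+p. coef \<alpha> f p * ennreal (ker (1/2) p x))\<^sup>2"
  unfolding sq_fun_def by (rule nsum_square_le)

lemma markov:
  assumes [measurable]: "u \<in> borel_measurable lebesgue"
  shows "c * emeasure lebesgue {x. c < u x} \<le> (\<integral>\<^sup>+x. u x \<partial>lebesgue)"
proof -
  have "{x \<in> space lebesgue. c < u x} \<in> sets lebesgue" by measurable
  then have [measurable]: "{x. c < u x} \<in> sets lebesgue" by simp
  have "c * emeasure lebesgue {x. c < u x} = (\<integral>\<^sup>+x. c * indicator {x. c < u x} x \<partial>lebesgue)"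
    by (subst nn_integral_cmult) auto
  also have "\<dots> \<le> (\<integral>\<^sup>+x. u x \<partial>lebesgue)"
    by (rule nn_integral_mono) (auto split: split_indicator)
  finally show ?thesis .
qed

text \<open>The kernel is at most 1, so its square is dominated by the kernel itself, whose integral
  is of the order of the cube volume: exactly the weight in the L^2 bound for coefficients.\<close>

lemma sq_fun_l2:
  assumes \<alpha>: "0 < \<alpha>"
  obtains C where "0 \<le> C" "\<And>f :: real ^ 'n \<Rightarrow> real. f \<in> borel_measurable lebesgue \<Longrightarrow>
     (\<integral>\<^sup>+x. sq_fun \<alpha> f x \<partial>lebesgue) \<le> ennreal C * (\<integral>\<^sup>+z. ennreal ((f z)\<^sup>2) \<partial>lebesgue)"
proof -
  obtain C1 where C1: "0 < C1" "\<And>f :: real ^ 'n \<Rightarrow> real. f \<in> borel_measurable lebesgue \<Longrightarrow>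
     (\<Sum>\<^sup>+p. (coef \<alpha> f p)\<^sup>2 * ennreal (sz (fst p) ^ CARD('n))) \<le> ennreal C1 * (\<integral>\<^sup>+z. ennreal ((f z)\<^sup>2) \<partial>lebesgue)"
    by (rule l2_bound[where 'n='n, OF \<alpha>], rule that)
  have half: "0 < (1/2 :: real)" by simp
  obtain C2 where C2: "0 \<le> C2"
    "\<And>p :: int \<times> (int ^ 'n). (\<integral>\<^sup>+x. ennreal (ker (1/2) p x) \<partial>lebesgue) \<le> ennreal (C2 * sz (fst p) ^ CARD('n))"
    by (rule ker_integral[where 'n='n, OF half], rule that)
  have "(\<integral>\<^sup>+x. sq_fun \<alpha> f x \<partial>lebesgue) \<le> ennreal (C2 * C1) * (\<integral>\<^sup>+z. ennreal ((f z)\<^sup>2) \<partial>lebesgue)"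
    if f: "f \<in> borel_measurable lebesgue" for f :: "real ^ 'n \<Rightarrow> real"
  proof -
    have "(\<integral>\<^sup>+x. sq_fun \<alpha> f x \<partial>lebesgue) = (\<Sum>\<^sup>+p. \<integral>\<^sup>+x. (coef \<alpha> f p * ennreal (ker (1/2) p x))\<^sup>2 \<partial>lebesgue)"
      unfolding sq_fun_def by (rule nn_integral_nsum) measurable
    also have "\<dots> \<le> (\<Sum>\<^sup>+p. ennreal C2 * ((coef \<alpha> f p)\<^sup>2 * ennreal (sz (fst p) ^ CARD('n))))"
    proof (rule nsum_mono)
      fix p :: "int \<times> (int ^ 'n)"
      have "(\<integral>\<^sup>+x. (coef \<alpha> f p * ennreal (ker (1/2) p x))\<^sup>2 \<partial>lebesgue)
         \<le> (\<integral>\<^sup>+x. (coef \<alpha> f p)\<^sup>2 * ennreal (ker (1/2) p x) \<partial>lebesgue)"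
      proof (rule nn_integral_mono)
        fix x
        have "(ker (1/2) p x)\<^sup>2 \<le> ker (1/2) p x"
          using ker_le_1[of "1/2" p x] by (simp add: power2_eq_square mult_left_le)
        then show "(coef \<alpha> f p * ennreal (ker (1/2) p x))\<^sup>2 \<le> (coef \<alpha> f p)\<^sup>2 * ennreal (ker (1/2) p x)"
          by (simp add: power_mult_distrib ennreal_power mult_left_mono ennreal_leI)
      qed
      also have "\<dots> = (coef \<alpha> f p)\<^sup>2 * (\<integral>\<^sup>+x. ennreal (ker (1/2) p x) \<partial>lebesgue)"
        by (rule nn_integral_cmult) measurable
      also have "\<dots> \<le> (coef \<alpha> f p)\<^sup>2 * ennreal (C2 * sz (fst p) ^ CARD('n))"
        by (rule mult_left_mono[OF C2(2)]) simp
      also have "\<dots> = ennreal C2 * ((coef \<alpha> f p)\<^sup>2 * ennreal (sz (fst p) ^ CARD('n)))"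
        using C2(1) by (simp add: ennreal_mult mult_ac)
      finally show "(\<integral>\<^sup>+x. (coef \<alpha> f p * ennreal (ker (1/2) p x))\<^sup>2 \<partial>lebesgue)
         \<le> ennreal C2 * ((coef \<alpha> f p)\<^sup>2 * ennreal (sz (fst p) ^ CARD('n)))" .
    qed
    also have "\<dots> = ennreal C2 * (\<Sum>\<^sup>+p. (coef \<alpha> f p)\<^sup>2 * ennreal (sz (fst p) ^ CARD('n)))"
      by (rule nn_integral_cmult) simp
    also have "\<dots> \<le> ennreal C2 * (ennreal C1 * (\<integral>\<^sup>+z. ennreal ((f z)\<^sup>2) \<partial>lebesgue))"
      by (intro mult_left_mono C1(2) f) simp
    also have "\<dots> = ennreal (C2 * C1) * (\<integral>\<^sup>+z. ennreal ((f z)\<^sup>2) \<partial>lebesgue)"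
      using C1(1) C2(1) by (simp add: ennreal_mult mult.assoc)
    finally show ?thesis .
  qed
  then show ?thesis using C1(1) C2(1) by (intro that[of "C2 * C1"]) auto
qed

section \<open>The weak type estimate\<close>

text \<open>The size of the oscillation of a bump for \<open>q\<close> on the cube \<open>p\<close> containing \<open>z\<close>; bumps
  that live at a smaller scale than \<open>p\<close> are not compared with a constant.\<close>

definition osc :: "real \<Rightarrow> int \<times> (int ^ 'n) \<Rightarrow> int \<times> (int ^ 'n) \<Rightarrow> real ^ 'n \<Rightarrow> real" where
  "osc \<alpha> p q z = (if fst p \<le> fst q then (real CARD('n) * sz (fst p) / sz (fst q)) powr \<alpha> else 1) /
     sz (fst q) ^ CARD('n) *
     indicator {z. norm (corner (fst q) (snd q) - z) \<le> 2 * (real CARD('n) + 1) * sz (fst q)} z"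

lemma borel_measurable_osc [measurable]: "osc \<alpha> p q \<in> borel_measurable lebesgue"
proof -
  have [measurable]: "{z. norm (corner (fst q) (snd q) - z) \<le> r} \<in> sets borel" for r
    by (intro borel_closed closed_Collect_le continuous_intros)
  show ?thesis unfolding osc_def by (intro borel_measurable_lebesgue) measurable
qed

lemma osc_nonneg [simp]: "0 \<le> osc \<alpha> p q z" by (auto simp: osc_def)

text \<open>Far from q the comparison value vanishes together with \<psi> z: the corner of p is
  within n sides of q from z when p is no larger than q. This is the reason for the factor 2 in the
  radius used by \<open>osc\<close>.\<close>

lemma bump_osc:
  fixes p q :: "int \<times> (int ^ 'n)"
  assumes \<alpha>: "0 < \<alpha>" and \<psi>: "\<psi> \<in> bump \<alpha> q" and z: "z \<in> dcube (fst p) (snd p)"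
  shows "\<bar>\<psi> z - (if fst p \<le> fst q then \<psi> (corner (fst p) (snd p)) else 0)\<bar> \<le> osc \<alpha> p q z"
proof -
  let ?N = "real CARD('n) + 1"
  let ?c = "corner (fst q) (snd q)" and ?d = "corner (fst p) (snd p)"
  have zd: "norm (z - ?d) \<le> real CARD('n) * sz (fst p)" using z by (rule dcube_dist) simp
  show ?thesis
  proof (cases "norm (?c - z) \<le> 2 * ?N * sz (fst q)")
    case near: True
    show ?thesis
    proof (cases "fst p \<le> fst q")
      case True
      have "\<bar>\<psi> z - \<psi> ?d\<bar> \<le> (norm (z - ?d) / sz (fst q)) powr \<alpha> / sz (fst q) ^ CARD('n)"
        by (rule bump_holder[OF \<psi>])
      also have "\<dots> \<le> (real CARD('n) * sz (fst p) / sz (fst q)) powr \<alpha> / sz (fst q) ^ CARD('n)"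
        using zd \<alpha> by (intro divide_right_mono powr_mono2) (auto simp: divide_right_mono)
      finally show ?thesis using True near by (simp add: osc_def)
    next
      case False
      then show ?thesis using bump_bound[OF \<psi>, of z] near by (simp add: osc_def)
    qed
  next
    case far: False
    have "0 < sz (fst q)" by simp
    then have "?N * sz (fst q) \<le> 2 * ?N * sz (fst q)" by simp
    then have "z \<notin> supp q" using far unfolding supp_def mem_cball dist_norm by linarith
    then have 0: "\<psi> z = 0" by (rule bump_outside[OF \<psi>])
    show ?thesis
    proof (cases "fst p \<le> fst q")
      case True
      have "real CARD('n) * sz (fst p) \<le> ?N * sz (fst q)" using True by (intro mult_mono) auto
      then have "norm (?c - z) \<le> norm (?c - ?d) + ?N * sz (fst q)"
        using norm_triangle_ineq[of "?c - ?d" "?d - z"] zd by (simp add: norm_minus_commute)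
      then have "?d \<notin> supp q" using far unfolding supp_def by (simp add: dist_norm algebra_simps)
      then have "\<psi> ?d = 0" by (rule bump_outside[OF \<psi>])
      with 0 show ?thesis by simp
    qed (simp add: 0)
  qed
qed

text \<open>There are two sources of decay. Bumps for cubes q at least as large as p oscillate
  little on p. For smaller q nothing cancels, but q is near z and hence away from A, and the tail of
  its kernel is small. Both gains are geometric in the scale, and only boundedly many q of each
  scale see z.\<close>

lemma osc_sum:
  assumes \<alpha>: "0 < \<alpha>"
  obtains C where "0 \<le> C" "\<And>(p :: int \<times> (int ^ 'n)) z A. z \<in> dcube (fst p) (snd p) \<Longrightarrow> A \<inter> star p = {} \<Longrightarrow>
     (\<Sum>\<^sup>+q. ennreal (osc \<alpha> p q z) * (\<integral>\<^sup>+x\<in>A. ennreal (ker (1/2) q x) \<partial>lebesgue)) \<le> ennreal C"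
proof -
  let ?N = "real CARD('n) + 1"
  \<comment> \<open>The kernel has surplus decay 1/2; the exponent 1/4 spends half of it on the
    distance to A.\<close>
  have half: "0 < (1/2 :: real)" and quarter: "0 < (1/4 :: real)" and N: "0 \<le> 2 * ?N" by simp_all
  obtain C0 where C0: "0 \<le> C0"
    "\<And>p :: int \<times> (int ^ 'n). (\<integral>\<^sup>+x. ennreal (ker (1/2) p x) \<partial>lebesgue) \<le> ennreal (C0 * sz (fst p) ^ CARD('n))"
    by (rule ker_integral[where 'n='n, OF half], rule that)
  obtain C3 where C3: "0 \<le> C3"
    "\<And>(p :: int \<times> (int ^ 'n)) r A. 0 < r \<Longrightarrow> (\<And>x. x \<in> A \<Longrightarrow> r \<le> norm (x - corner (fst p) (snd p))) \<Longrightarrow>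
     (\<integral>\<^sup>+x\<in>A. ennreal (ker (2 * (1/4)) p x) \<partial>lebesgue) \<le> ennreal (C3 * sz (fst p) ^ CARD('n) * (sz (fst p) / r) powr (1/4))"
    using ker_integral_off_ball[where 'n='n, OF quarter] by blast
  obtain C1 where C1: "0 \<le> C1" "\<And>k (x :: real ^ 'n).
    (\<Sum>\<^sup>+m. indicator {m. norm (corner k m - x) \<le> 2 * ?N * sz k} m) \<le> ennreal C1"
    by (rule near_count[where 'n='n, OF N], rule that)
  obtain Ca where Ca: "0 \<le> Ca" "\<And>d. 0 < d \<Longrightarrow>
    (\<Sum>\<^sup>+k. ennreal (sz k powr - \<alpha>) * indicator {k. d \<le> sz k} k) \<le> ennreal (Ca * d powr - \<alpha>)"
    by (rule geometric_sum_above[OF \<alpha>], rule that)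
  obtain Cb where Cb: "0 \<le> Cb" "\<And>d. 0 < d \<Longrightarrow>
    (\<Sum>\<^sup>+k. ennreal (sz k powr (1/4)) * indicator {k. sz k \<le> d} k) \<le> ennreal (Cb * d powr (1/4))"
    by (rule geometric_sum_below[OF quarter], rule that)
  define D where "D = C0 * real CARD('n) powr \<alpha>"
  have D: "0 \<le> D" using C0 by (simp add: D_def)
  define C where "C = C1 * (D * Ca + C3 * Cb)"
  have C: "0 \<le> C" using C1 D Ca C3 Cb by (simp add: C_def)
  have "(\<Sum>\<^sup>+q. ennreal (osc \<alpha> p q z) * (\<integral>\<^sup>+x\<in>A. ennreal (ker (1/2) q x) \<partial>lebesgue)) \<le> ennreal C"
    if z: "z \<in> dcube (fst p) (snd p)" and A: "A \<inter> star p = {}" for p :: "int \<times> (int ^ 'n)" and z A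
  proof -
    let ?l = "sz (fst p)"
    define t where "t k = ennreal (D * ?l powr \<alpha>) * (ennreal (sz k powr - \<alpha>) * indicator {k. ?l \<le> sz k} k) +
        ennreal (C3 * ?l powr - (1/4)) * (ennreal (sz k powr (1/4)) * indicator {k. sz k \<le> ?l} k)" for k
    have tm: "ennreal (osc \<alpha> p q z) * (\<integral>\<^sup>+x\<in>A. ennreal (ker (1/2) q x) \<partial>lebesgue)
       \<le> t (fst q) * indicator {m. norm (corner (fst q) m - z) \<le> 2 * ?N * sz (fst q)} (snd q)" for q
    proof (cases "norm (corner (fst q) (snd q) - z) \<le> 2 * ?N * sz (fst q)")
      case near: True
      let ?t = "sz (fst q)"
      have "ennreal (osc \<alpha> p q z) * (\<integral>\<^sup>+x\<in>A. ennreal (ker (1/2) q x) \<partial>lebesgue) \<le> t (fst q)"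
      proof (cases "fst p \<le> fst q")
        case True
        have osc: "osc \<alpha> p q z = (real CARD('n) * ?l / ?t) powr \<alpha> / ?t ^ CARD('n)"
          using True near by (simp add: osc_def)
        have "(\<integral>\<^sup>+x\<in>A. ennreal (ker (1/2) q x) \<partial>lebesgue) \<le> (\<integral>\<^sup>+x. ennreal (ker (1/2) q x) \<partial>lebesgue)"
          by (rule nn_integral_mono) (auto split: split_indicator)
        also have "\<dots> \<le> ennreal (C0 * ?t ^ CARD('n))" by (rule C0)
        finally have "ennreal (osc \<alpha> p q z) * (\<integral>\<^sup>+x\<in>A. ennreal (ker (1/2) q x) \<partial>lebesgue)
           \<le> ennreal (osc \<alpha> p q z) * ennreal (C0 * ?t ^ CARD('n))" by (rule mult_left_mono) simp
        also have "\<dots> = ennreal ((D * ?l powr \<alpha>) * ?t powr - \<alpha>)"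
          using C0(1) by (subst ennreal_mult[symmetric])
            (auto simp: osc D_def powr_divide powr_mult powr_minus_divide)
        also have "\<dots> \<le> t (fst q)"
          using D True by (simp add: t_def ennreal_mult)
        finally show ?thesis .
      next
        case False
        then have "sz (fst q + 1) \<le> ?l" by (simp only: sz_le_iff)
        then have tl: "2 * ?t \<le> ?l" by (simp add: sz_Suc)
        have osc: "osc \<alpha> p q z = 1 / ?t ^ CARD('n)" using False near by (simp add: osc_def)
        \<comment> \<open>Of the radius 3 (n + 1) of the star, at most n + 1 sides are lost between
          the corner of q and z, and at most n between z and the corner of p; n + 2 sides
          remain.\<close>
        have far: "?l \<le> norm (x - corner (fst q) (snd q))" if "x \<in> A" for x
        proof -
          have "x \<notin> star p" using that A by auto
          then have 1: "3 * ?N * ?l < norm (x - corner (fst p) (snd p))"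
            by (simp add: star_def dist_norm norm_minus_commute)
          have 2: "norm (z - corner (fst p) (snd p)) \<le> real CARD('n) * ?l"
            using z by (rule dcube_dist) simp
          have "2 * ?N * ?t \<le> ?N * ?l" 
          proof -
            have "2 * ?N * ?t = ?N * (2 * ?t)" by (simp only: mult_ac)
            also have "\<dots> \<le> ?N * ?l" using tl by (rule mult_left_mono) simp
            finally show ?thesis .
          qed
          then have 3: "norm (corner (fst q) (snd q) - z) \<le> ?N * ?l" using near by linarith
          have "norm (x - corner (fst p) (snd p)) \<le> norm (x - corner (fst q) (snd q)) +
              (norm (corner (fst q) (snd q) - z) + norm (z - corner (fst p) (snd p)))"
            using norm_triangle_ineq[of "x - corner (fst q) (snd q)" "corner (fst q) (snd q) - corner (fst p) (snd p)"]
              norm_triangle_ineq[of "corner (fst q) (snd q) - z" "z - corner (fst p) (snd p)"] by simp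
          with 1 2 3 have "3 * ?N * ?l < norm (x - corner (fst q) (snd q)) + (?N * ?l + real CARD('n) * ?l)"
            by linarith
          then have "(real CARD('n) + 2) * ?l < norm (x - corner (fst q) (snd q))" by (simp add: algebra_simps)
          moreover have "1 * ?l \<le> (real CARD('n) + 2) * ?l" by (intro mult_right_mono) auto
          ultimately show ?thesis by linarith
        qed
        have "(\<integral>\<^sup>+x\<in>A. ennreal (ker (1/2) q x) \<partial>lebesgue) \<le> ennreal (C3 * ?t ^ CARD('n) * (?t / ?l) powr (1/4))"
          using C3(2)[where p=q and r="?l" and A=A, OF sz_pos far] by simp
        then have "ennreal (osc \<alpha> p q z) * (\<integral>\<^sup>+x\<in>A. ennreal (ker (1/2) q x) \<partial>lebesgue)
           \<le> ennreal (osc \<alpha> p q z) * ennreal (C3 * ?t ^ CARD('n) * (?t / ?l) powr (1/4))"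
          by (rule mult_left_mono) simp
        also have "\<dots> = ennreal ((C3 * ?l powr - (1/4)) * ?t powr (1/4))"
          using C3(1) by (subst ennreal_mult[symmetric])
            (auto simp: osc powr_divide powr_minus_divide)
        also have "\<dots> \<le> t (fst q)"
          using C3(1) False by (simp add: t_def ennreal_mult)
        finally show ?thesis .
      qed
      then show ?thesis using near by simp
    next
      case False
      then have "osc \<alpha> p q z = 0" by (simp add: osc_def)
      then show ?thesis by simp
    qed
    have "(\<Sum>\<^sup>+q. ennreal (osc \<alpha> p q z) * (\<integral>\<^sup>+x\<in>A. ennreal (ker (1/2) q x) \<partial>lebesgue))
      \<le> (\<Sum>\<^sup>+q::int \<times> (int ^ 'n). t (fst q) * indicator {m. norm (corner (fst q) m - z) \<le> 2 * ?N * sz (fst q)} (snd q))"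
      by (rule nsum_mono) (rule tm)
    also have "\<dots> = (\<Sum>\<^sup>+k. \<Sum>\<^sup>+m. t k * indicator {m. norm (corner k m - z) \<le> 2 * ?N * sz k} m)"
      by (simp add: nsum_pair)
    also have "\<dots> = (\<Sum>\<^sup>+k. t k * (\<Sum>\<^sup>+m. indicator {m. norm (corner k m - z) \<le> 2 * ?N * sz k} m))"
      by (intro nn_integral_cong nn_integral_cmult) simp
    also have "\<dots> \<le> (\<Sum>\<^sup>+k. t k * ennreal C1)"
      by (intro nsum_mono mult_left_mono C1) simp
    also have "\<dots> = (\<Sum>\<^sup>+k. t k) * ennreal C1" by (rule nn_integral_multc) simp
    also have "(\<Sum>\<^sup>+k. t k) = ennreal (D * ?l powr \<alpha>) * (\<Sum>\<^sup>+k. ennreal (sz k powr - \<alpha>) * indicator {k. ?l \<le> sz k} k) +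
        ennreal (C3 * ?l powr - (1/4)) * (\<Sum>\<^sup>+k. ennreal (sz k powr (1/4)) * indicator {k. sz k \<le> ?l} k)"
      unfolding t_def by (subst nn_integral_add) (simp_all add: nn_integral_cmult del: sz_le_iff)
    also have "\<dots> * ennreal C1 \<le> (ennreal (D * ?l powr \<alpha>) * ennreal (Ca * ?l powr - \<alpha>) +
        ennreal (C3 * ?l powr - (1/4)) * ennreal (Cb * ?l powr (1/4))) * ennreal C1"
      by (intro mult_right_mono add_mono mult_left_mono Ca Cb) auto
    also have "\<dots> = ennreal C"
      using D C1(1) Ca(1) Cb(1) C3(1)
      by (simp add: ennreal_mult[symmetric] ennreal_plus[symmetric] C_def powr_minus field_simps del: ennreal_plus)
    finally show ?thesis .
  qed
  then show ?thesis using C by (intro that[of C]) auto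
qed

text \<open>The function \<theta>, constant on every piece of the partition J, is orthogonal to b
  because b has mean zero on each piece. Subtracting it from \<psi> leaves only the oscillation of
  \<psi> on the stopping cubes.\<close>

lemma bad_part_bound:
  fixes b :: "real ^ 'n \<Rightarrow> real" and J :: "real ^ 'n \<Rightarrow> (int \<times> (int ^ 'n)) option"
  assumes \<alpha>: "0 < \<alpha>" and b: "integrable lebesgue b" and J [measurable]: "J \<in> lebesgue \<rightarrow>\<^sub>M count_space UNIV"
    and J_cube: "\<And>x p. J x = Some p \<Longrightarrow> x \<in> dcube (fst p) (snd p)"
    and J_None: "\<And>x. J x = None \<Longrightarrow> b x = 0"
    and mean: "\<And>p. (LINT x|lebesgue. b x * indicator {x. J x = Some p} x) = 0"
  shows "coef \<alpha> b q \<le> (\<integral>\<^sup>+z. ennreal \<bar>b z\<bar> * case_option 0 (\<lambda>p. ennreal (osc \<alpha> p q z)) (J z) \<partial>lebesgue)"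
  unfolding coef_def
proof (rule SUP_least)
  fix \<psi> assume \<psi>: "\<psi> \<in> bump \<alpha> q"
  define t where "t = case_option 0 (\<lambda>p. if fst p \<le> fst q then \<psi> (corner (fst p) (snd p)) else 0)"
  define \<theta> where "\<theta> z = t (J z)" for z
  have [measurable]: "b \<in> borel_measurable lebesgue" using b by auto
  have [measurable]: "t \<in> count_space UNIV \<rightarrow>\<^sub>M borel" by simp
  have [measurable]: "\<theta> \<in> borel_measurable lebesgue" unfolding \<theta>_def by measurable
  have t_bound: "\<bar>t i\<bar> \<le> 1 / sz (fst q) ^ CARD('n)" for i
    using bump_bound[OF \<psi>] by (cases i) (auto simp: t_def)
  have 1: "integrable lebesgue (\<lambda>z. b z * \<theta> z)"
  proof (rule Bochner_Integration.integrable_bound)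
    show "integrable lebesgue (\<lambda>z. (1 / sz (fst q) ^ CARD('n)) * b z)" using b by simp
    show "AE z in lebesgue. norm (b z * \<theta> z) \<le> norm ((1 / sz (fst q) ^ CARD('n)) * b z)"
    proof (rule AE_I2)
      fix z
      show "norm (b z * \<theta> z) \<le> norm ((1 / sz (fst q) ^ CARD('n)) * b z)"
        using mult_right_mono[OF t_bound[of "J z"], of "\<bar>b z\<bar>"] by (simp add: \<theta>_def abs_mult mult.commute)
    qed
  qed measurable
  have 2: "integrable lebesgue (\<lambda>z. b z * \<psi> z)" by (rule integrable_bump[OF locally_integrable_L1[OF b] \<alpha> \<psi>])
  have "(LINT z|lebesgue. b z * \<theta> z) = 0"
  proof (rule integral_zero_pieces[OF 1 J])
    fix i
    have "(LINT x|lebesgue. b x * \<theta> x * indicator {x. J x = i} x) =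
       (LINT x|lebesgue. t i * (b x * indicator {x. J x = i} x))"
      by (rule Bochner_Integration.integral_cong) (auto simp: \<theta>_def split: split_indicator)
    also have "\<dots> = 0"
    proof (cases i)
      case None
      then have "(\<lambda>x. t i * (b x * indicator {x. J x = i} x)) = (\<lambda>x. 0)" by (simp add: t_def)
      then show ?thesis by simp
    qed (use mean in simp)
    finally show "(LINT x|lebesgue. b x * \<theta> x * indicator {x. J x = i} x) = 0" .
  qed
  then have "(LINT z|lebesgue. b z * \<psi> z) = (LINT z|lebesgue. b z * (\<psi> z - \<theta> z))"
    using 1 2 by (simp add: right_diff_distrib)
  then have "ennreal \<bar>LINT z|lebesgue. b z * \<psi> z\<bar> \<le> (\<integral>\<^sup>+z. ennreal \<bar>b z * (\<psi> z - \<theta> z)\<bar> \<partial>lebesgue)"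
    by (simp add: ennreal_integral_le)
  also have "\<dots> \<le> (\<integral>\<^sup>+z. ennreal \<bar>b z\<bar> * case_option 0 (\<lambda>p. ennreal (osc \<alpha> p q z)) (J z) \<partial>lebesgue)"
  proof (rule nn_integral_mono)
    fix z
    show "ennreal \<bar>b z * (\<psi> z - \<theta> z)\<bar> \<le> ennreal \<bar>b z\<bar> * case_option 0 (\<lambda>p. ennreal (osc \<alpha> p q z)) (J z)"
    proof (cases "J z")
      case None
      then show ?thesis using J_None by simp
    next
      case (Some p)
      have "\<bar>\<psi> z - \<theta> z\<bar> \<le> osc \<alpha> p q z"
        using bump_osc[OF \<alpha> \<psi> J_cube[OF Some]] by (simp add: \<theta>_def t_def Some)
      then show ?thesis by (simp add: Some abs_mult ennreal_mult'[symmetric] ennreal_leI mult_left_mono)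
    qed
  qed
  finally show "ennreal \<bar>LINT z|lebesgue. b z * \<psi> z\<bar> \<le>
    (\<integral>\<^sup>+z. ennreal \<bar>b z\<bar> * case_option 0 (\<lambda>p. ennreal (osc \<alpha> p q z)) (J z) \<partial>lebesgue)" .
qed

text \<open>The good part falls to the L^2 bound, and the stars of the stopping cubes to their
  measure. Off the stars the bad part is estimated in L^1, after replacing the square function by
  the linear sum of coefficients: Tonelli then moves the sum under the integral in |b|, where
  \<open>osc_sum\<close> applies on each stopping cube.\<close>

theorem weak_type_1_1:
  assumes \<alpha>: "0 < \<alpha>"
  obtains C where "0 \<le> C" "\<And>(f :: real ^ 'n \<Rightarrow> real) s. integrable lebesgue f \<Longrightarrow> 0 < s \<Longrightarrow>
    ennreal s * emeasure lebesgue {x. ennreal (s\<^sup>2) < sq_fun \<alpha> f x} \<le> ennreal C * (\<integral>\<^sup>+z. ennreal \<bar>f z\<bar> \<partial>lebesgue)"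
proof -
  obtain C1 where C1: "0 \<le> C1" "\<And>f :: real ^ 'n \<Rightarrow> real. f \<in> borel_measurable lebesgue \<Longrightarrow>
     (\<integral>\<^sup>+x. sq_fun \<alpha> f x \<partial>lebesgue) \<le> ennreal C1 * (\<integral>\<^sup>+z. ennreal ((f z)\<^sup>2) \<partial>lebesgue)"
    by (rule sq_fun_l2[where 'n='n, OF \<alpha>], rule that)
  obtain C2 where C2: "0 \<le> C2" "\<And>(p :: int \<times> (int ^ 'n)) z A. z \<in> dcube (fst p) (snd p) \<Longrightarrow> A \<inter> star p = {} \<Longrightarrow>
     (\<Sum>\<^sup>+q. ennreal (osc \<alpha> p q z) * (\<integral>\<^sup>+x\<in>A. ennreal (ker (1/2) q x) \<partial>lebesgue)) \<le> ennreal C2"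
    by (rule osc_sum[where 'n='n, OF \<alpha>], rule that)
  obtain C3 where C3: "0 \<le> C3" "\<And>(v :: real ^ 'n \<Rightarrow> ennreal) s. v \<in> borel_measurable lebesgue \<Longrightarrow> 0 < s \<Longrightarrow>
    ennreal s * emeasure lebesgue (\<Union>p\<in>stopping_cubes v s. star p) \<le> ennreal C3 * (\<integral>\<^sup>+x. v x \<partial>lebesgue)"
    by (rule star_union_measure[where 'n='n], rule that)
  define C where "C = 4 * (C1 * (1 + 4 ^ CARD('n))) + C3 + 2 * (C2 * (1 + 2 ^ CARD('n)))"
  have C: "0 \<le> C" using C1 C2 C3 by (simp add: C_def)
  have "ennreal s * emeasure lebesgue {x. ennreal (s\<^sup>2) < sq_fun \<alpha> f x} \<le> ennreal C * (\<integral>\<^sup>+z. ennreal \<bar>f z\<bar> \<partial>lebesgue)"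
    if f: "integrable lebesgue f" and s: "0 < s" for f :: "real ^ 'n \<Rightarrow> real" and s
  proof -
    obtain g b and J :: "real ^ 'n \<Rightarrow> (int \<times> (int ^ 'n)) option" where
      fgb: "\<And>x. f x = g x + b x" and g [measurable]: "g \<in> borel_measurable lebesgue" and b: "integrable lebesgue b"
      and J [measurable]: "J \<in> lebesgue \<rightarrow>\<^sub>M count_space UNIV"
      and J_iff: "\<And>x p. J x = Some p \<longleftrightarrow> p \<in> stopping_cubes (\<lambda>x. ennreal \<bar>f x\<bar>) s \<and> x \<in> dcube (fst p) (snd p)"
      and J_None: "\<And>x. J x = None \<Longrightarrow> b x = 0"
      and mean: "\<And>p. (LINT x|lebesgue. b x * indicator {x. J x = Some p} x) = 0"
      and g2: "(\<integral>\<^sup>+x. ennreal ((g x)\<^sup>2) \<partial>lebesgue) \<le> ennreal ((1 + 4 ^ CARD('n)) * s) * (\<integral>\<^sup>+x. ennreal \<bar>f x\<bar> \<partial>lebesgue)"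
      and b1: "(\<integral>\<^sup>+x. ennreal \<bar>b x\<bar> \<partial>lebesgue) \<le> ennreal (1 + 2 ^ CARD('n)) * (\<integral>\<^sup>+x. ennreal \<bar>f x\<bar> \<partial>lebesgue)"
      by (rule calderon_zygmund[OF f s], rule that)
    have [measurable]: "f \<in> borel_measurable lebesgue" "b \<in> borel_measurable lebesgue" using f b by auto
    define F where "F = (\<integral>\<^sup>+x. ennreal \<bar>f x\<bar> \<partial>lebesgue)"
    define \<Omega> where "\<Omega> = (\<Union>p\<in>stopping_cubes (\<lambda>x. ennreal \<bar>f x\<bar>) s. star p)"
    have [measurable]: "\<Omega> \<in> sets lebesgue" unfolding \<Omega>_def by (rule lebesgue_star_union)
    \<comment> \<open>The linear majorant of the root of the bad square function, cut off to the
      complement of the stars.\<close>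
    define u where "u x = (\<Sum>\<^sup>+q. coef \<alpha> b q * ennreal (ker (1/2) q x)) * indicator (- \<Omega>) x" for x
    have [measurable]: "- \<Omega> \<in> sets lebesgue" using \<open>\<Omega> \<in> sets lebesgue\<close> by (simp add: Compl_eq_Diff_UNIV sets.Diff)
    have [measurable]: "u \<in> borel_measurable lebesgue"
    proof -
      have [measurable]: "(\<lambda>x. (\<Sum>\<^sup>+q. coef \<alpha> b q * ennreal (ker (1/2) q x))) \<in> borel_measurable lebesgue"
        by (intro borel_measurable_nsum) measurable
      show ?thesis unfolding u_def by measurable
    qed
    have sets: "{x. c < h x} \<in> sets lebesgue" if "h \<in> borel_measurable lebesgue" for c :: ennreal and h
    proof -
      have "{x \<in> space lebesgue. c < h x} \<in> sets lebesgue" using that by measurable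
      then show ?thesis by simp
    qed
    have li_b: "locally_integrable b" by (rule locally_integrable_L1[OF b])
    have g': "g = (\<lambda>x. f x + - b x)" using fgb by auto
    have li_g: "locally_integrable g"
      unfolding g' using f b by (intro locally_integrable_L1 Bochner_Integration.integrable_add Bochner_Integration.integrable_minus)
    \<comment> \<open>The levels fit the factor 2 in \<open>sq_fun_add\<close>: if both squares are
      at most s^2 / 4, the square for f is at most s^2. The linear sum is compared with s / 2
      because it dominates a root.\<close>
    have sub: "{x. ennreal (s\<^sup>2) < sq_fun \<alpha> f x} \<subseteq> {x. ennreal (s\<^sup>2 / 4) < sq_fun \<alpha> g x} \<union> \<Omega> \<union> {x. ennreal (s / 2) < u x}"
    proof
      fix x assume "x \<in> {x. ennreal (s\<^sup>2) < sq_fun \<alpha> f x}"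
      then have *: "ennreal (s\<^sup>2) < sq_fun \<alpha> f x" by simp
      show "x \<in> {x. ennreal (s\<^sup>2 / 4) < sq_fun \<alpha> g x} \<union> \<Omega> \<union> {x. ennreal (s / 2) < u x}"
      proof (rule ccontr)
        assume neg: "\<not> ?thesis"
        then have 1: "sq_fun \<alpha> g x \<le> ennreal (s\<^sup>2 / 4)" and "u x \<le> ennreal (s / 2)" "x \<notin> \<Omega>"
          by (auto simp: not_less)
        then have "(\<Sum>\<^sup>+q. coef \<alpha> b q * ennreal (ker (1/2) q x)) \<le> ennreal (s / 2)" by (simp add: u_def)
        then have "(\<Sum>\<^sup>+q. coef \<alpha> b q * ennreal (ker (1/2) q x))\<^sup>2 \<le> (ennreal (s / 2))\<^sup>2" by (rule power_mono) simp
        with sq_fun_le_sum[of \<alpha> b x] have 2: "sq_fun \<alpha> b x \<le> ennreal (s\<^sup>2 / 4)"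
          using s by (simp add: ennreal_power power_divide)
        have "sq_fun \<alpha> f x = sq_fun \<alpha> (\<lambda>x. g x + b x) x" using fgb by (intro arg_cong[where f="\<lambda>f. sq_fun \<alpha> f x"] ext)
        also have "\<dots> \<le> 2 * (sq_fun \<alpha> g x + sq_fun \<alpha> b x)" by (rule sq_fun_add[OF \<alpha> li_g li_b])
        also have "\<dots> \<le> 2 * (ennreal (s\<^sup>2 / 4) + ennreal (s\<^sup>2 / 4))" using 1 2 by (intro mult_left_mono add_mono) auto
        also have "\<dots> = ennreal (s\<^sup>2)" by (simp add: ennreal_plus[symmetric] numeral_mult_ennreal del: ennreal_plus)
        finally show False using * by simp
      qed
    qed
    have good: "ennreal s * emeasure lebesgue {x. ennreal (s\<^sup>2 / 4) < sq_fun \<alpha> g x} \<le> ennreal (4 * (C1 * (1 + 4 ^ CARD('n)))) * F"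
    proof -
      have "ennreal (s\<^sup>2 / 4) * emeasure lebesgue {x. ennreal (s\<^sup>2 / 4) < sq_fun \<alpha> g x} \<le> (\<integral>\<^sup>+x. sq_fun \<alpha> g x \<partial>lebesgue)"
        by (rule markov) measurable
      also have "\<dots> \<le> ennreal C1 * (\<integral>\<^sup>+z. ennreal ((g z)\<^sup>2) \<partial>lebesgue)" by (rule C1) measurable
      also have "\<dots> \<le> ennreal C1 * (ennreal ((1 + 4 ^ CARD('n)) * s) * F)"
        unfolding F_def by (intro mult_left_mono g2) simp
      finally have "ennreal (4 / s) * (ennreal (s\<^sup>2 / 4) * emeasure lebesgue {x. ennreal (s\<^sup>2 / 4) < sq_fun \<alpha> g x})
          \<le> ennreal (4 / s) * (ennreal C1 * (ennreal ((1 + 4 ^ CARD('n)) * s) * F))" by (rule mult_left_mono) simp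
      also have "ennreal (4 / s) * (ennreal C1 * (ennreal ((1 + 4 ^ CARD('n)) * s) * F)) = ennreal (4 * (C1 * (1 + 4 ^ CARD('n)))) * F"
        using s C1(1) by (simp add: mult.assoc[symmetric] ennreal_mult[symmetric])
      also have "ennreal (4 / s) * (ennreal (s\<^sup>2 / 4) * emeasure lebesgue {x. ennreal (s\<^sup>2 / 4) < sq_fun \<alpha> g x})
         = ennreal s * emeasure lebesgue {x. ennreal (s\<^sup>2 / 4) < sq_fun \<alpha> g x}"
        using s by (simp add: mult.assoc[symmetric] ennreal_mult[symmetric] power2_eq_square)
      finally show ?thesis .
    qed
    have excep: "ennreal s * emeasure lebesgue \<Omega> \<le> ennreal C3 * F"
      unfolding F_def \<Omega>_def by (rule C3(2)[OF _ s]) measurable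
    have u_int: "(\<integral>\<^sup>+x. u x \<partial>lebesgue) \<le> ennreal (C2 * (1 + 2 ^ CARD('n))) * F"
    proof -
      let ?I = "\<lambda>q. \<integral>\<^sup>+x\<in>-\<Omega>. ennreal (ker (1/2) q x) \<partial>lebesgue"
      let ?H = "\<lambda>q z. case_option 0 (\<lambda>p. ennreal (osc \<alpha> p q z)) (J z)"
      have [measurable]: "?H q \<in> borel_measurable lebesgue" for q
      proof (rule measurable_compose_countable[OF _ J])
        fix i :: "(int \<times> (int ^ 'n)) option"
        show "(\<lambda>z. case_option 0 (\<lambda>p. ennreal (osc \<alpha> p q z)) i) \<in> borel_measurable lebesgue"
        proof (cases i)
          case (Some p)
          have "(\<lambda>z. ennreal (osc \<alpha> p q z)) \<in> borel_measurable lebesgue" by measurable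
          then show ?thesis unfolding Some option.case .
        qed simp
      qed
      have "(\<integral>\<^sup>+x. u x \<partial>lebesgue) = (\<integral>\<^sup>+x. (\<Sum>\<^sup>+q. coef \<alpha> b q * (ennreal (ker (1/2) q x) * indicator (- \<Omega>) x)) \<partial>lebesgue)"
        unfolding u_def by (intro nn_integral_cong) (simp add: nn_integral_multc[symmetric] mult.assoc)
      also have "\<dots> = (\<Sum>\<^sup>+q. \<integral>\<^sup>+x. coef \<alpha> b q * (ennreal (ker (1/2) q x) * indicator (- \<Omega>) x) \<partial>lebesgue)"
        by (rule nn_integral_nsum) measurable
      also have "\<dots> = (\<Sum>\<^sup>+q. coef \<alpha> b q * ?I q)"
        by (intro nn_integral_cong nn_integral_cmult) measurable
      also have "\<dots> \<le> (\<Sum>\<^sup>+q. (\<integral>\<^sup>+z. ennreal \<bar>b z\<bar> * ?H q z \<partial>lebesgue) * ?I q)"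
        using J_iff J_None mean by (intro nsum_mono mult_right_mono bad_part_bound[OF \<alpha> b J]) auto
      also have "\<dots> = (\<Sum>\<^sup>+q. \<integral>\<^sup>+z. ennreal \<bar>b z\<bar> * ?H q z * ?I q \<partial>lebesgue)"
        by (intro nn_integral_cong nn_integral_multc[symmetric]) measurable
      also have "\<dots> = (\<integral>\<^sup>+z. (\<Sum>\<^sup>+q. ennreal \<bar>b z\<bar> * ?H q z * ?I q) \<partial>lebesgue)"
        by (rule nn_integral_nsum[symmetric]) measurable
      also have "\<dots> = (\<integral>\<^sup>+z. ennreal \<bar>b z\<bar> * (\<Sum>\<^sup>+q. ?H q z * ?I q) \<partial>lebesgue)"
        by (intro nn_integral_cong) (simp add: nn_integral_cmult[symmetric] mult.assoc)
      also have "\<dots> \<le> (\<integral>\<^sup>+z. ennreal \<bar>b z\<bar> * ennreal C2 \<partial>lebesgue)"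
      proof (intro nn_integral_mono mult_left_mono)
        fix z
        show "(\<Sum>\<^sup>+q. ?H q z * ?I q) \<le> ennreal C2"
        proof (cases "J z")
          case (Some p)
          then have "z \<in> dcube (fst p) (snd p)" "- \<Omega> \<inter> star p = {}" using J_iff[of z p] by (auto simp: \<Omega>_def)
          from C2(2)[OF this] show ?thesis by (simp add: Some)
        qed simp
      qed simp
      also have "\<dots> = (\<integral>\<^sup>+z. ennreal \<bar>b z\<bar> \<partial>lebesgue) * ennreal C2" by (rule nn_integral_multc) measurable
      also have "\<dots> \<le> (ennreal (1 + 2 ^ CARD('n)) * F) * ennreal C2"
        unfolding F_def by (intro mult_right_mono b1) simp
      also have "\<dots> = ennreal (C2 * (1 + 2 ^ CARD('n))) * F"
      proof -
        have "ennreal (C2 * (1 + 2 ^ CARD('n))) = ennreal (1 + 2 ^ CARD('n)) * ennreal C2"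
          using C2(1) by (subst ennreal_mult[symmetric]) (auto simp: mult.commute)
        then show ?thesis by (simp only: mult_ac)
      qed
      finally show ?thesis .
    qed
    have bad: "ennreal s * emeasure lebesgue {x. ennreal (s / 2) < u x} \<le> ennreal (2 * (C2 * (1 + 2 ^ CARD('n)))) * F"
    proof -
      have "ennreal s * emeasure lebesgue {x. ennreal (s / 2) < u x} = 2 * (ennreal (s / 2) * emeasure lebesgue {x. ennreal (s / 2) < u x})"
        using s by (simp add: mult.assoc[symmetric] numeral_mult_ennreal)
      also have "\<dots> \<le> 2 * (ennreal (C2 * (1 + 2 ^ CARD('n))) * F)"
        by (intro mult_left_mono order_trans[OF markov u_int]) auto
      also have "\<dots> = ennreal (2 * (C2 * (1 + 2 ^ CARD('n)))) * F"
        using C2(1) by (simp add: mult.assoc[symmetric] numeral_mult_ennreal)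
      finally show ?thesis .
    qed
    have "ennreal s * emeasure lebesgue {x. ennreal (s\<^sup>2) < sq_fun \<alpha> f x} \<le>
        ennreal s * (emeasure lebesgue {x. ennreal (s\<^sup>2 / 4) < sq_fun \<alpha> g x} + emeasure lebesgue \<Omega> +
          emeasure lebesgue {x. ennreal (s / 2) < u x})"
    proof (intro mult_left_mono)
      have "emeasure lebesgue {x. ennreal (s\<^sup>2) < sq_fun \<alpha> f x} \<le>
        emeasure lebesgue ({x. ennreal (s\<^sup>2 / 4) < sq_fun \<alpha> g x} \<union> \<Omega> \<union> {x. ennreal (s / 2) < u x})"
        by (intro emeasure_mono sub sets.Un sets borel_measurable_sq_fun) auto
      also have "\<dots> \<le> emeasure lebesgue ({x. ennreal (s\<^sup>2 / 4) < sq_fun \<alpha> g x} \<union> \<Omega>) + emeasure lebesgue {x. ennreal (s / 2) < u x}"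
        by (intro emeasure_subadditive sets.Un sets borel_measurable_sq_fun) auto
      also have "\<dots> \<le> emeasure lebesgue {x. ennreal (s\<^sup>2 / 4) < sq_fun \<alpha> g x} + emeasure lebesgue \<Omega> +
          emeasure lebesgue {x. ennreal (s / 2) < u x}"
        by (intro add_right_mono emeasure_subadditive sets borel_measurable_sq_fun) auto
      finally show "emeasure lebesgue {x. ennreal (s\<^sup>2) < sq_fun \<alpha> f x} \<le>
        emeasure lebesgue {x. ennreal (s\<^sup>2 / 4) < sq_fun \<alpha> g x} + emeasure lebesgue \<Omega> +
          emeasure lebesgue {x. ennreal (s / 2) < u x}" .
    qed simp
    also have "\<dots> \<le> ennreal (4 * (C1 * (1 + 4 ^ CARD('n)))) * F + ennreal C3 * F + ennreal (2 * (C2 * (1 + 2 ^ CARD('n)))) * F"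
      unfolding distrib_left[of "ennreal s"] by (intro add_mono good excep bad)
    also have "\<dots> = ennreal C * F"
      unfolding C_def using C1(1) C2(1) C3(1)
      by (simp add: distrib_right[symmetric] ennreal_plus[symmetric] del: ennreal_plus)
    finally show ?thesis by (simp add: F_def)
  qed
  then show ?thesis using C that by blast
qed

section \<open>Interpolation\<close>

text \<open>A dyadic majorant of \<open>\<Phi> a\<close> that is defined for every \<open>a\<close>, also for \<open>a = \<infinity>\<close>, and whose
  integral only involves the distribution function.\<close>

definition layers :: "(real \<Rightarrow> ennreal) \<Rightarrow> ennreal \<Rightarrow> ennreal" where
  "layers \<Phi> a = (\<Sum>\<^sup>+k. \<Phi> (sz (k + 1)) * indicator {k. ennreal (sz k) < a} k)"

lemma borel_measurable_layers:
  assumes [measurable]: "g \<in> borel_measurable lebesgue"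
  shows "(\<lambda>x. layers \<Phi> (g x)) \<in> borel_measurable lebesgue"
  unfolding layers_def
proof (rule borel_measurable_nsum)
  fix k
  have "(\<lambda>x. \<Phi> (sz (k + 1)) * indicator {k. ennreal (sz k) < g x} k) =
      (\<lambda>x. \<Phi> (sz (k + 1)) * indicator {x \<in> space lebesgue. ennreal (sz k) < g x} x)"
    by (auto simp: indicator_def)
  also have "\<dots> \<in> borel_measurable lebesgue" by measurable
  finally show "(\<lambda>x. \<Phi> (sz (k + 1)) * indicator {k. ennreal (sz k) < g x} k) \<in> borel_measurable lebesgue" .
qed

lemma type_dilation:
  assumes "lower_type \<Phi> p\<^sub>0" "upper_type \<Phi> p\<^sub>1" "0 < c"
  obtains D where "0 \<le> D" "\<And>a. 0 \<le> a \<Longrightarrow> \<Phi> (a * c) \<le> ennreal D * \<Phi> a"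
proof (cases "c \<le> 1")
  case True
  then show ?thesis using assms that unfolding lower_type_def
    by (metis atLeastAtMost_iff less_imp_le mult_nonneg_nonneg powr_ge_zero)
next
  case False
  then show ?thesis using assms that unfolding upper_type_def
    by (metis less_imp_le linorder_le_cases mult_nonneg_nonneg powr_ge_zero)
qed

text \<open>For fixed a the levels split at a / c. Below it, lower type leaves the power
  \<open>p\<^sub>0 - 1 > 0\<close> of \<open>sz k\<close>; above it, upper type leaves the power
  \<open>p\<^sub>1 - q < 0\<close>. Both geometric sums are controlled by the level near a / c,
  where \<Phi> is of the size \<Phi> a up to a constant.\<close>

lemma interpolation_pointwise:
  assumes lower: "lower_type \<Phi> p\<^sub>0" and upper: "upper_type \<Phi> p\<^sub>1"
    and p0: "1 < p\<^sub>0" and p1: "p\<^sub>1 < q" and c: "0 < c"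
  obtains C where "0 \<le> C" "\<And>a. 0 \<le> a \<Longrightarrow>
    (\<Sum>\<^sup>+k. \<Phi> (sz (k + 1)) * (ennreal (1 / sz k * a) * indicator {k. c * sz k < a} k +
       ennreal (sz k powr - q * a powr q) * indicator {k. a \<le> c * sz k} k)) \<le> ennreal C * \<Phi> a"
proof -
  obtain Cl where Cl: "0 < Cl" "\<And>t s. 0 \<le> t \<Longrightarrow> t \<le> 1 \<Longrightarrow> 0 \<le> s \<Longrightarrow> \<Phi> (s * t) \<le> ennreal (Cl * t powr p\<^sub>0) * \<Phi> s"
    using lower unfolding lower_type_def by auto
  obtain Cu where Cu: "0 < Cu" "\<And>t s. 1 \<le> t \<Longrightarrow> 0 \<le> s \<Longrightarrow> \<Phi> (s * t) \<le> ennreal (Cu * t powr p\<^sub>1) * \<Phi> s"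
    using upper unfolding upper_type_def by auto
  have dc: "0 < 2 / c" using c by simp
  obtain D where D: "0 \<le> D" "\<And>a. 0 \<le> a \<Longrightarrow> \<Phi> (a * (2 / c)) \<le> ennreal D * \<Phi> a"
    by (rule type_dilation[OF lower upper dc], rule that)
  have e0: "0 < p\<^sub>0 - 1" and e1: "0 < q - p\<^sub>1" using p0 p1 by auto
  obtain Ca where Ca: "0 \<le> Ca" "\<And>d. 0 < d \<Longrightarrow>
    (\<Sum>\<^sup>+k. ennreal (sz k powr (p\<^sub>0 - 1)) * indicator {k. sz k \<le> d} k) \<le> ennreal (Ca * d powr (p\<^sub>0 - 1))"
    by (rule geometric_sum_below[OF e0], rule that)
  obtain Cb where Cb: "0 \<le> Cb" "\<And>d. 0 < d \<Longrightarrow>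
    (\<Sum>\<^sup>+k. ennreal (sz k powr - (q - p\<^sub>1)) * indicator {k. d \<le> sz k} k) \<le> ennreal (Cb * d powr - (q - p\<^sub>1))"
    by (rule geometric_sum_above[OF e1], rule that)
  define E where "E = D * Cl * c * Ca + D * Cu * c powr q * Cb"
  have E: "0 \<le> E" using D Cl Ca Cu Cb c by (simp add: E_def)
  have "(\<Sum>\<^sup>+k. \<Phi> (sz (k + 1)) * (ennreal (1 / sz k * a) * indicator {k. c * sz k < a} k +
       ennreal (sz k powr - q * a powr q) * indicator {k. a \<le> c * sz k} k)) \<le> ennreal E * \<Phi> a"
    if a: "0 \<le> a" for a
  proof (cases "a = 0")
    case True
    have "\<not> c * sz k < 0" for k using c by (simp add: not_less)
    then show ?thesis by (simp add: True)
  next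
    case False
    with a have a: "0 < a" by simp
    define d where "d = a / c"
    have d: "0 < d" using a c by (simp add: d_def)
    have a_eq: "a = c * d" using c by (simp add: d_def)
    \<comment> \<open>The level is measured relative to the threshold d: the ratio
      \<open>sz k / d\<close> is fed into a type condition, and the fixed dilation by 2 / c is
      absorbed in D.\<close>
    have split: "sz (k + 1) = a * (2 / c) * (sz k / d)" for k
      using a c by (simp add: d_def sz_Suc)
    have tm: "\<Phi> (sz (k + 1)) * (ennreal (1 / sz k * a) * indicator {k. c * sz k < a} k +
       ennreal (sz k powr - q * a powr q) * indicator {k. a \<le> c * sz k} k)
       \<le> \<Phi> a * (ennreal (D * Cl * c * d powr - (p\<^sub>0 - 1)) * (ennreal (sz k powr (p\<^sub>0 - 1)) * indicator {k. sz k \<le> d} k) +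
         ennreal (D * Cu * c powr q * d powr (q - p\<^sub>1)) * (ennreal (sz k powr - (q - p\<^sub>1)) * indicator {k. d \<le> sz k} k))" for k
    proof (cases "sz k < d")
      case True
      then have ind: "c * sz k < a" "sz k \<le> d" using c by (simp_all add: a_eq)
      have "\<Phi> (sz (k + 1)) \<le> ennreal (Cl * (sz k / d) powr p\<^sub>0) * \<Phi> (a * (2 / c))"
        unfolding split using True a c d by (intro Cl) auto
      also have "\<dots> \<le> ennreal (Cl * (sz k / d) powr p\<^sub>0) * (ennreal D * \<Phi> a)"
        using a by (intro mult_left_mono D) auto
      finally have "\<Phi> (sz (k + 1)) * ennreal (1 / sz k * a) \<le> ennreal (Cl * (sz k / d) powr p\<^sub>0) * (ennreal D * \<Phi> a) * ennreal (1 / sz k * a)"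
        by (rule mult_right_mono) simp
      also have "\<dots> = \<Phi> a * (ennreal (Cl * (sz k / d) powr p\<^sub>0) * ennreal D * ennreal (1 / sz k * a))"
        by (simp only: mult_ac)
      also have "ennreal (Cl * (sz k / d) powr p\<^sub>0) * ennreal D * ennreal (1 / sz k * a)
         = ennreal (Cl * (sz k / d) powr p\<^sub>0 * D * (1 / sz k * a))"
        using Cl D a by (simp add: ennreal_mult[symmetric])
      also have "Cl * (sz k / d) powr p\<^sub>0 * D * (1 / sz k * a) = D * Cl * c * d powr - (p\<^sub>0 - 1) * sz k powr (p\<^sub>0 - 1)"
      proof -
        have "(sz k / d) powr p\<^sub>0 = (sz k / d) powr (p\<^sub>0 - 1) * (sz k / d)"
          using powr_add[of "sz k / d" "p\<^sub>0 - 1" 1] d by simp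
        also have "\<dots> = sz k powr (p\<^sub>0 - 1) * d powr - (p\<^sub>0 - 1) * (sz k / d)"
          using d by (subst powr_divide) (auto simp: powr_minus_divide[of d "p\<^sub>0 - 1"] simp del: minus_diff_eq)
        finally show ?thesis using d by (simp add: a_eq)
      qed
      finally show ?thesis using ind True d D Cl c
        by (simp add: ennreal_mult)
    next
      case False
      then have ind: "a \<le> c * sz k" "d \<le> sz k" "\<not> c * sz k < a" using c by (simp_all add: a_eq)
      have "\<Phi> (sz (k + 1)) \<le> ennreal (Cu * (sz k / d) powr p\<^sub>1) * \<Phi> (a * (2 / c))"
        unfolding split using False a c d by (intro Cu) auto
      also have "\<dots> \<le> ennreal (Cu * (sz k / d) powr p\<^sub>1) * (ennreal D * \<Phi> a)"
        using a by (intro mult_left_mono D) auto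
      finally have "\<Phi> (sz (k + 1)) * ennreal (sz k powr - q * a powr q)
          \<le> ennreal (Cu * (sz k / d) powr p\<^sub>1) * (ennreal D * \<Phi> a) * ennreal (sz k powr - q * a powr q)"
        by (rule mult_right_mono) simp
      also have "\<dots> = \<Phi> a * (ennreal (Cu * (sz k / d) powr p\<^sub>1) * ennreal D * ennreal (sz k powr - q * a powr q))"
        by (simp only: mult_ac)
      also have "ennreal (Cu * (sz k / d) powr p\<^sub>1) * ennreal D * ennreal (sz k powr - q * a powr q)
         = ennreal (Cu * (sz k / d) powr p\<^sub>1 * D * (sz k powr - q * a powr q))"
        using Cu D a by (simp add: ennreal_mult[symmetric])
      also have "Cu * (sz k / d) powr p\<^sub>1 * D * (sz k powr - q * a powr q)
          = D * Cu * c powr q * d powr (q - p\<^sub>1) * sz k powr - (q - p\<^sub>1)"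
        using d c by (simp add: a_eq powr_divide powr_mult powr_diff powr_minus_divide)
      finally have "\<Phi> (sz (k + 1)) * ennreal (sz k powr - q * a powr q) \<le> \<Phi> a *
          (ennreal (D * Cu * c powr q * d powr (q - p\<^sub>1)) * ennreal (sz k powr - (q - p\<^sub>1)))"
        using D Cu by (simp add: ennreal_mult)
      also have "\<dots> \<le> \<Phi> a * (ennreal (D * Cl * c * d powr - (p\<^sub>0 - 1)) * (ennreal (sz k powr (p\<^sub>0 - 1)) * indicator {k. sz k \<le> d} k) +
         ennreal (D * Cu * c powr q * d powr (q - p\<^sub>1)) * (ennreal (sz k powr - (q - p\<^sub>1)) * indicator {k. d \<le> sz k} k))"
        using ind by (intro mult_left_mono) auto
      finally show ?thesis using ind by simp
    qed
    have "(\<Sum>\<^sup>+k. \<Phi> (sz (k + 1)) * (ennreal (1 / sz k * a) * indicator {k. c * sz k < a} k +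
       ennreal (sz k powr - q * a powr q) * indicator {k. a \<le> c * sz k} k))
       \<le> (\<Sum>\<^sup>+k. \<Phi> a * (ennreal (D * Cl * c * d powr - (p\<^sub>0 - 1)) * (ennreal (sz k powr (p\<^sub>0 - 1)) * indicator {k. sz k \<le> d} k) +
         ennreal (D * Cu * c powr q * d powr (q - p\<^sub>1)) * (ennreal (sz k powr - (q - p\<^sub>1)) * indicator {k. d \<le> sz k} k)))"
      by (rule nsum_mono) (rule tm)
    also have "\<dots> = \<Phi> a * (ennreal (D * Cl * c * d powr - (p\<^sub>0 - 1)) * (\<Sum>\<^sup>+k. ennreal (sz k powr (p\<^sub>0 - 1)) * indicator {k. sz k \<le> d} k) +
         ennreal (D * Cu * c powr q * d powr (q - p\<^sub>1)) * (\<Sum>\<^sup>+k. ennreal (sz k powr - (q - p\<^sub>1)) * indicator {k. d \<le> sz k} k))"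
      by (simp add: nn_integral_cmult nn_integral_add)
    also have "\<dots> \<le> \<Phi> a * (ennreal (D * Cl * c * d powr - (p\<^sub>0 - 1)) * ennreal (Ca * d powr (p\<^sub>0 - 1)) +
         ennreal (D * Cu * c powr q * d powr (q - p\<^sub>1)) * ennreal (Cb * d powr - (q - p\<^sub>1)))"
      by (intro mult_left_mono add_mono Ca Cb d) auto
    also have "ennreal (D * Cl * c * d powr - (p\<^sub>0 - 1)) * ennreal (Ca * d powr (p\<^sub>0 - 1)) = ennreal (D * Cl * c * Ca)"
    proof -
      have "d powr - (p\<^sub>0 - 1) * d powr (p\<^sub>0 - 1) = 1" using d by (simp add: powr_add[symmetric])
      then have "(D * Cl * c * d powr - (p\<^sub>0 - 1)) * (Ca * d powr (p\<^sub>0 - 1)) = D * Cl * c * Ca"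
        by (metis (no_types, lifting) mult.assoc mult.commute mult.right_neutral)
      then show ?thesis using D Cl c Ca by (simp add: ennreal_mult[symmetric])
    qed
    also have "ennreal (D * Cu * c powr q * d powr (q - p\<^sub>1)) * ennreal (Cb * d powr - (q - p\<^sub>1)) = ennreal (D * Cu * c powr q * Cb)"
    proof -
      have "d powr (q - p\<^sub>1) * d powr - (q - p\<^sub>1) = 1" using d by (simp add: powr_add[symmetric])
      then have "(D * Cu * c powr q * d powr (q - p\<^sub>1)) * (Cb * d powr - (q - p\<^sub>1)) = D * Cu * c powr q * Cb"
        by (metis (no_types, lifting) mult.assoc mult.commute mult.right_neutral)
      then show ?thesis using D Cu c Cb by (simp add: ennreal_mult[symmetric])
    qed
    finally show ?thesis
      using D Cl c Ca Cu Cb by (simp add: E_def mult.commute)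
  qed
  then show ?thesis using E that by blast
qed

text \<open>Marcinkiewicz interpolation for modulars. The distributional hypothesis is what weak
  type (1,1) for the values of f above \<open>c * sz k\<close> and weak type (q,q) for the others
  provide. Summing over the levels and exchanging sum and integral reduces the claim to a pointwise
  sum; C depends neither on K nor on f.\<close>

theorem interpolation:
  assumes lower: "lower_type \<Phi> p\<^sub>0" and upper: "upper_type \<Phi> p\<^sub>1"
    and p0: "1 < p\<^sub>0" and p1: "p\<^sub>1 < q" and c: "0 < c"
  obtains C where "0 \<le> C" "\<And>K (g :: real ^ 'n \<Rightarrow> ennreal) (f :: real ^ 'n \<Rightarrow> real). 0 \<le> K \<Longrightarrow> g \<in> borel_measurable lebesgue \<Longrightarrow>
    f \<in> borel_measurable lebesgue \<Longrightarrow> (\<lambda>x. \<Phi> \<bar>f x\<bar>) \<in> borel_measurable lebesgue \<Longrightarrow>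
    \<forall>k. emeasure lebesgue {x. ennreal (sz k) < g x} \<le>
      ennreal K * ((\<integral>\<^sup>+x. ennreal (1 / sz k * \<bar>f x\<bar>) * indicator {x. c * sz k < \<bar>f x\<bar>} x \<partial>lebesgue) +
        (\<integral>\<^sup>+x. ennreal (sz k powr - q * \<bar>f x\<bar> powr q) * indicator {x. \<bar>f x\<bar> \<le> c * sz k} x \<partial>lebesgue)) \<Longrightarrow>
    (\<integral>\<^sup>+x. layers \<Phi> (g x) \<partial>lebesgue) \<le> ennreal (K * C) * (\<integral>\<^sup>+x. \<Phi> \<bar>f x\<bar> \<partial>lebesgue)"
proof -
  obtain C where C: "0 \<le> C" "\<And>a. 0 \<le> a \<Longrightarrow>
    (\<Sum>\<^sup>+k. \<Phi> (sz (k + 1)) * (ennreal (1 / sz k * a) * indicator {k. c * sz k < a} k +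
       ennreal (sz k powr - q * a powr q) * indicator {k. a \<le> c * sz k} k)) \<le> ennreal C * \<Phi> a"
    by (rule interpolation_pointwise[OF lower upper p0 p1 c], rule that)
  have "(\<integral>\<^sup>+x. layers \<Phi> (g x) \<partial>lebesgue) \<le> ennreal (K * C) * (\<integral>\<^sup>+x. \<Phi> \<bar>f x\<bar> \<partial>lebesgue)"
    if K: "0 \<le> K" and g [measurable]: "g \<in> borel_measurable lebesgue" and f [measurable]: "f \<in> borel_measurable lebesgue"
      and \<Phi>f: "(\<lambda>x. \<Phi> \<bar>f x\<bar>) \<in> borel_measurable lebesgue"
      and dist: "\<forall>k. emeasure lebesgue {x. ennreal (sz k) < g x} \<le>
      ennreal K * ((\<integral>\<^sup>+x. ennreal (1 / sz k * \<bar>f x\<bar>) * indicator {x. c * sz k < \<bar>f x\<bar>} x \<partial>lebesgue) +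
        (\<integral>\<^sup>+x. ennreal (sz k powr - q * \<bar>f x\<bar> powr q) * indicator {x. \<bar>f x\<bar> \<le> c * sz k} x \<partial>lebesgue))"
    for K and g :: "real ^ 'n \<Rightarrow> ennreal" and f :: "real ^ 'n \<Rightarrow> real"
  proof -
    have sets [measurable]: "{x. c * sz k < \<bar>f x\<bar>} \<in> sets lebesgue" "{x. \<bar>f x\<bar> \<le> c * sz k} \<in> sets lebesgue"
      "{x. ennreal (sz k) < g x} \<in> sets lebesgue" for k
    proof -
      have "{x \<in> space lebesgue. c * sz k < \<bar>f x\<bar>} \<in> sets lebesgue" "{x \<in> space lebesgue. \<bar>f x\<bar> \<le> c * sz k} \<in> sets lebesgue"
        "{x \<in> space lebesgue. ennreal (sz k) < g x} \<in> sets lebesgue" by measurable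
      then show "{x. c * sz k < \<bar>f x\<bar>} \<in> sets lebesgue" "{x. \<bar>f x\<bar> \<le> c * sz k} \<in> sets lebesgue"
        "{x. ennreal (sz k) < g x} \<in> sets lebesgue" by simp_all
    qed
    let ?h = "\<lambda>k x. ennreal (1 / sz k * \<bar>f x\<bar>) * indicator {x. c * sz k < \<bar>f x\<bar>} x +
        ennreal (sz k powr - q * \<bar>f x\<bar> powr q) * indicator {x. \<bar>f x\<bar> \<le> c * sz k} x"
    have "(\<integral>\<^sup>+x. layers \<Phi> (g x) \<partial>lebesgue) = (\<integral>\<^sup>+x. (\<Sum>\<^sup>+k. \<Phi> (sz (k + 1)) * indicator {x. ennreal (sz k) < g x} x) \<partial>lebesgue)"
      unfolding layers_def by (intro nn_integral_cong) (auto simp: indicator_def)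
    also have "\<dots> = (\<Sum>\<^sup>+k. \<integral>\<^sup>+x. \<Phi> (sz (k + 1)) * indicator {x. ennreal (sz k) < g x} x \<partial>lebesgue)"
      by (rule nn_integral_nsum) measurable
    also have "\<dots> = (\<Sum>\<^sup>+k. \<Phi> (sz (k + 1)) * emeasure lebesgue {x. ennreal (sz k) < g x})"
      by (intro nn_integral_cong nn_integral_cmult_indicator sets)
    also have "\<dots> \<le> (\<Sum>\<^sup>+k. \<Phi> (sz (k + 1)) * (ennreal K * (\<integral>\<^sup>+x. ?h k x \<partial>lebesgue)))"
      using dist by (intro nsum_mono mult_left_mono) (simp_all add: nn_integral_add)
    also have "\<dots> = (\<Sum>\<^sup>+k. \<integral>\<^sup>+x. ennreal K * (\<Phi> (sz (k + 1)) * ?h k x) \<partial>lebesgue)"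
      by (intro nn_integral_cong) (simp add: nn_integral_cmult mult_ac)
    also have "\<dots> = (\<integral>\<^sup>+x. (\<Sum>\<^sup>+k. ennreal K * (\<Phi> (sz (k + 1)) * ?h k x)) \<partial>lebesgue)"
      by (rule nn_integral_nsum[symmetric]) measurable
    also have "\<dots> \<le> (\<integral>\<^sup>+x. ennreal (K * C) * \<Phi> \<bar>f x\<bar> \<partial>lebesgue)"
    proof (rule nn_integral_mono)
      fix x
      have "(\<Sum>\<^sup>+k. ennreal K * (\<Phi> (sz (k + 1)) * ?h k x)) = ennreal K * (\<Sum>\<^sup>+k. \<Phi> (sz (k + 1)) * ?h k x)"
        by (rule nn_integral_cmult) simp
      also have "(\<Sum>\<^sup>+k. \<Phi> (sz (k + 1)) * ?h k x) = (\<Sum>\<^sup>+k. \<Phi> (sz (k + 1)) * (ennreal (1 / sz k * \<bar>f x\<bar>) * indicator {k. c * sz k < \<bar>f x\<bar>} k +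
         ennreal (sz k powr - q * \<bar>f x\<bar> powr q) * indicator {k. \<bar>f x\<bar> \<le> c * sz k} k))"
        by (intro nn_integral_cong) (auto simp: indicator_def)
      also have "ennreal K * \<dots> \<le> ennreal K * (ennreal C * \<Phi> \<bar>f x\<bar>)" by (intro mult_left_mono C) auto
      finally show "(\<Sum>\<^sup>+k. ennreal K * (\<Phi> (sz (k + 1)) * ?h k x)) \<le> ennreal (K * C) * \<Phi> \<bar>f x\<bar>"
        using K C(1) by (simp add: ennreal_mult mult.assoc)
    qed
    also have "\<dots> = ennreal (K * C) * (\<integral>\<^sup>+x. \<Phi> \<bar>f x\<bar> \<partial>lebesgue)"
      by (rule nn_integral_cmult[OF \<Phi>f])
    finally show ?thesis .
  qed
  then show ?thesis using C(1) that by blast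
qed

section \<open>The maximal operator\<close>

text \<open>Weighted by the kernel rather than taken over the cube: integrating one term of the
  square function against v leads to precisely this quantity, as the squared kernel is at most the
  kernel.\<close>

definition average :: "(real ^ 'n \<Rightarrow> ennreal) \<Rightarrow> int \<times> (int ^ 'n) \<Rightarrow> ennreal" where
  "average v q = ennreal (1 / sz (fst q) ^ CARD('n)) * (\<integral>\<^sup>+y. ennreal (ker (1/2) q y) * v y \<partial>lebesgue)"

text \<open>Uncentred over the balls \<open>supp q\<close>, so that every point reached by a bump
  for q sees the average of q. The index set is countable, which gives measurability at
  once.\<close>

definition maximal :: "(real ^ 'n \<Rightarrow> ennreal) \<Rightarrow> real ^ 'n \<Rightarrow> ennreal" where
  "maximal v x = (SUP q. average v q * indicator (supp q) x)"

lemma borel_measurable_maximal [measurable]: "maximal v \<in> borel_measurable lebesgue"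
  unfolding maximal_def by measurable

lemma average_le_maximal: "x \<in> supp q \<Longrightarrow> average v q \<le> maximal v x"
  unfolding maximal_def by (rule SUP_upper2[of q]) auto

lemma maximal_add:
  assumes [measurable]: "v \<in> borel_measurable lebesgue" "w \<in> borel_measurable lebesgue"
  shows "maximal (\<lambda>x. v x + w x) x \<le> maximal v x + maximal w x"
  unfolding maximal_def
proof (rule SUP_least)
  fix q
  have "average (\<lambda>x. v x + w x) q = average v q + average w q"
    unfolding average_def by (simp add: distrib_left nn_integral_add)
  then have "average (\<lambda>x. v x + w x) q * indicator (supp q) x =
      average v q * indicator (supp q) x + average w q * indicator (supp q) x"
    by (simp add: distrib_right)
  also have "\<dots> \<le> (SUP q. average v q * indicator (supp q) x) + (SUP q. average w q * indicator (supp q) x)"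
    by (intro add_mono SUP_upper) auto
  finally show "average (\<lambda>x. v x + w x) q * indicator (supp q) x \<le>
    (SUP q. average v q * indicator (supp q) x) + (SUP q. average w q * indicator (supp q) x)" .
qed

text \<open>The endpoint for bounded weights; it only involves the total mass of the kernel, which
  is of the order of the cube volume.\<close>

lemma maximal_bounded:
  obtains C where "0 \<le> C" "\<And>(v :: real ^ 'n \<Rightarrow> ennreal) c x. (\<And>y. v y \<le> c) \<Longrightarrow> maximal v x \<le> ennreal C * c"
proof -
  have half: "0 < (1/2 :: real)" by simp
  obtain C where C: "0 \<le> C"
    "\<And>p :: int \<times> (int ^ 'n). (\<integral>\<^sup>+x. ennreal (ker (1/2) p x) \<partial>lebesgue) \<le> ennreal (C * sz (fst p) ^ CARD('n))"
    by (rule ker_integral[where 'n='n, OF half], rule that)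
  have "maximal v x \<le> ennreal C * c" if v: "\<And>y. v y \<le> c" for v :: "real ^ 'n \<Rightarrow> ennreal" and c x
    unfolding maximal_def
  proof (rule SUP_least)
    fix q :: "int \<times> (int ^ 'n)"
    have "average v q * indicator (supp q) x \<le> average v q" by (simp split: split_indicator)
    also have "\<dots> \<le> ennreal (1 / sz (fst q) ^ CARD('n)) * (\<integral>\<^sup>+y. ennreal (ker (1/2) q y) * c \<partial>lebesgue)"
      unfolding average_def by (intro mult_left_mono nn_integral_mono v) auto
    also have "\<dots> = ennreal (1 / sz (fst q) ^ CARD('n)) * ((\<integral>\<^sup>+y. ennreal (ker (1/2) q y) \<partial>lebesgue) * c)"
      by (subst nn_integral_multc) auto
    also have "\<dots> \<le> ennreal (1 / sz (fst q) ^ CARD('n)) * (ennreal (C * sz (fst q) ^ CARD('n)) * c)"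
      by (intro mult_left_mono mult_right_mono C) auto
    also have "\<dots> = ennreal C * c"
      using C(1) by (simp add: mult.assoc[symmetric] ennreal_mult[symmetric])
    finally show "average v q * indicator (supp q) x \<le> ennreal C * c" .
  qed
  then show ?thesis using C(1) that by blast
qed

text \<open>The tail of the kernel reaches all coarser scales. If every nearby cube of every such
  scale had average at most s / A, summing over the dyadic balls of \<open>ker_annuli\<close> would
  bound the average by B s / A, which A = B + 1 keeps at most s.\<close>

lemma average_bad_cube:
  obtains A where "0 < A" "\<And>(v :: real ^ 'n \<Rightarrow> ennreal) s q. v \<in> borel_measurable lebesgue \<Longrightarrow> 0 < s \<Longrightarrow>
    ennreal s < average v q \<Longrightarrow> \<exists>j m. (fst q + int j, m) \<in> bad_cubes v (s / A) \<and>
      norm (corner (fst q + int j) m - corner (fst q) (snd q)) \<le> (real CARD('n) + 1) * sz (fst q + int j)"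
proof -
  let ?n = "real CARD('n)"
  have N: "0 \<le> ?n + 1" by simp
  obtain C1 where C1: "0 \<le> C1" "\<And>k (x :: real ^ 'n).
    (\<Sum>\<^sup>+m. indicator {m. norm (corner k m - x) \<le> (?n + 1) * sz k} m) \<le> ennreal C1"
    by (rule near_count[where 'n='n, OF N], rule that)
  define G where "G = 1 / (1 - 2 powr - (1/2 :: real))"
  have G: "0 \<le> G" unfolding G_def using powr_less_one[of 2 "-(1/2)"] by auto
  have half: "0 < (1/2 :: real)" by simp
  define B where "B = C1 * 2 powr (?n + 1/2) * G"
  define A where "A = B + 1"
  have B: "0 \<le> B" using C1 G by (simp add: B_def)
  have "\<exists>j m. (fst q + int j, m) \<in> bad_cubes v (s / A) \<and>
      norm (corner (fst q + int j) m - corner (fst q) (snd q)) \<le> (?n + 1) * sz (fst q + int j)"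
    if v [measurable]: "v \<in> borel_measurable lebesgue" and s: "0 < s" and less: "ennreal s < average v q"
    for v :: "real ^ 'n \<Rightarrow> ennreal" and s q
  proof (rule ccontr)
    assume neg: "\<not> ?thesis"
    define k where "k = fst q"
    define c where "c = corner (fst q) (snd q)"
    have szj: "sz (k + int j) = 2 ^ j * sz k" for j by (simp add: sz_add sz_of_nat)
    let ?B = "\<lambda>j::nat. cball c (2 ^ j * sz k)"
    have [measurable]: "?B j \<in> sets lebesgue" for j by (intro lebesgue_of_borel) simp
    have good: "(\<integral>\<^sup>+x\<in>dcube (k + int j) m. v x \<partial>lebesgue) \<le> ennreal (s / A * sz (k + int j) ^ CARD('n))"
      if "norm (corner (k + int j) m - c) \<le> (?n + 1) * sz (k + int j)" for j m
      using neg that by (auto simp: bad_cubes_def k_def c_def not_less)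
    have ball: "(\<integral>\<^sup>+x\<in>?B j. v x \<partial>lebesgue) \<le> ennreal (C1 * (s / A) * sz (k + int j) ^ CARD('n))" for j
    proof -
      have "(\<integral>\<^sup>+x\<in>?B j. v x \<partial>lebesgue) = (\<Sum>\<^sup>+m. \<integral>\<^sup>+x\<in>dcube (k + int j) m. v x * indicator (?B j) x \<partial>lebesgue)"
        by (rule nn_integral_dcubes[symmetric]) measurable
      also have "\<dots> \<le> (\<Sum>\<^sup>+m. ennreal (s / A * sz (k + int j) ^ CARD('n)) *
          indicator {m. norm (corner (k + int j) m - c) \<le> (?n + 1) * sz (k + int j)} m)"
      proof (rule nsum_mono)
        fix m :: "int ^ 'n"
        show "(\<integral>\<^sup>+x\<in>dcube (k + int j) m. v x * indicator (?B j) x \<partial>lebesgue) \<le> ennreal (s / A * sz (k + int j) ^ CARD('n)) *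
          indicator {m. norm (corner (k + int j) m - c) \<le> (?n + 1) * sz (k + int j)} m"
        proof (cases "norm (corner (k + int j) m - c) \<le> (?n + 1) * sz (k + int j)")
          case True
          have "(\<integral>\<^sup>+x\<in>dcube (k + int j) m. v x * indicator (?B j) x \<partial>lebesgue) \<le> (\<integral>\<^sup>+x\<in>dcube (k + int j) m. v x \<partial>lebesgue)"
            by (rule nn_integral_mono) (auto split: split_indicator)
          also note good[OF True]
          finally show ?thesis using True by simp
        next
          case False
          have "v x * indicator (?B j) x * indicator (dcube (k + int j) m) x = 0" for x
          proof (rule ccontr)
            assume "\<not> ?thesis"
            then have x: "x \<in> ?B j" "x \<in> dcube (k + int j) m" by (auto split: split_indicator_asm)
            have "norm (corner (k + int j) m - x) \<le> ?n * sz (k + int j)" using x(2) by (intro dcube_dist) auto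
            moreover have "norm (x - c) \<le> sz (k + int j)" using x(1) by (simp add: dist_norm norm_minus_commute szj)
            ultimately have "norm (corner (k + int j) m - c) \<le> (?n + 1) * sz (k + int j)"
              using norm_triangle_ineq[of "corner (k + int j) m - x" "x - c"] by (simp add: algebra_simps)
            with False show False by simp
          qed
          then have "(\<integral>\<^sup>+x\<in>dcube (k + int j) m. v x * indicator (?B j) x \<partial>lebesgue) = (\<integral>\<^sup>+(x::real^'n). 0 \<partial>lebesgue)"
            by (rule nn_integral_cong)
          then show ?thesis by simp
        qed
      qed
      also have "\<dots> = ennreal (s / A * sz (k + int j) ^ CARD('n)) * (\<Sum>\<^sup>+m. indicator {m. norm (corner (k + int j) m - c) \<le> (?n + 1) * sz (k + int j)} m)"
        by (rule nn_integral_cmult) simp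
      also have "\<dots> \<le> ennreal (s / A * sz (k + int j) ^ CARD('n)) * ennreal C1"
        by (intro mult_left_mono C1) simp
      also have "\<dots> = ennreal (C1 * (s / A) * sz (k + int j) ^ CARD('n))"
        using C1(1) B s by (simp add: ennreal_mult[symmetric] A_def mult_ac)
      finally show ?thesis .
    qed
    let ?e = "\<lambda>j::nat. 2 powr ((1 - real j) * (?n + 1/2))"
    have "(\<integral>\<^sup>+y. ennreal (ker (1/2) q y) * v y \<partial>lebesgue) \<le> (\<integral>\<^sup>+y. (\<Sum>\<^sup>+j. ennreal (?e j) * indicator (?B j) y) * v y \<partial>lebesgue)"
      unfolding k_def c_def by (intro nn_integral_mono mult_right_mono ker_annuli) auto
    also have "\<dots> = (\<integral>\<^sup>+y. (\<Sum>\<^sup>+j. ennreal (?e j) * (v y * indicator (?B j) y)) \<partial>lebesgue)"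
      by (intro nn_integral_cong) (subst nn_integral_multc[symmetric], simp, simp only: mult_ac)
    also have "\<dots> = (\<Sum>\<^sup>+j. \<integral>\<^sup>+y. ennreal (?e j) * (v y * indicator (?B j) y) \<partial>lebesgue)"
      by (rule nn_integral_nsum) measurable
    also have "\<dots> = (\<Sum>\<^sup>+j. ennreal (?e j) * (\<integral>\<^sup>+y\<in>?B j. v y \<partial>lebesgue))"
      by (intro nn_integral_cong nn_integral_cmult) measurable
    also have "\<dots> \<le> (\<Sum>\<^sup>+j. ennreal (?e j) * ennreal (C1 * (s / A) * sz (k + int j) ^ CARD('n)))"
      by (intro nsum_mono mult_left_mono ball) simp
    also have "\<dots> = (\<Sum>\<^sup>+j. ennreal (C1 * (s / A) * sz k ^ CARD('n) * 2 powr (?n + 1/2)) * ennreal (2 powr (- real j * (1/2))))"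
    proof (rule nn_integral_cong)
      fix j :: nat
      have "?e j * (C1 * (s / A) * sz (k + int j) ^ CARD('n)) =
          C1 * (s / A) * sz k ^ CARD('n) * (2 powr ((1 - real j) * (?n + 1/2)) * 2 powr (real j * ?n))"
        unfolding szj by (simp add: power_mult_distrib powr_realpow flip: power_mult of_nat_mult)
      also have "2 powr ((1 - real j) * (?n + 1/2)) * 2 powr (real j * ?n) = 2 powr (?n + 1/2) * 2 powr (- real j * (1/2))"
      proof -
        have "(1 - real j) * (?n + 1/2) + real j * ?n = ?n + 1/2 + - real j * (1/2)"
          by (simp add: field_simps)
        then show ?thesis unfolding powr_add[symmetric] by (rule arg_cong)
      qed
      finally show "ennreal (?e j) * ennreal (C1 * (s / A) * sz (k + int j) ^ CARD('n)) =
        ennreal (C1 * (s / A) * sz k ^ CARD('n) * 2 powr (?n + 1/2)) * ennreal (2 powr (- real j * (1/2)))"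
        using C1(1) s B by (simp add: ennreal_mult[symmetric] A_def mult_ac)
    qed
    also have "\<dots> = ennreal (C1 * (s / A) * sz k ^ CARD('n) * 2 powr (?n + 1/2)) * (\<Sum>\<^sup>+j::nat. ennreal (2 powr (- real j * (1/2))))"
      by (rule nn_integral_cmult) simp
    also have "(\<Sum>\<^sup>+j::nat. ennreal (2 powr (- real j * (1/2)))) = ennreal G"
      unfolding G_def by (rule geometric_nsum[OF half])
    also have "ennreal (C1 * (s / A) * sz k ^ CARD('n) * 2 powr (?n + 1/2)) * ennreal G = ennreal (B * (s / A) * sz k ^ CARD('n))"
      using C1(1) s B G by (simp add: ennreal_mult[symmetric] A_def B_def mult_ac)
    finally have "average v q \<le> ennreal (1 / sz k ^ CARD('n)) * ennreal (B * (s / A) * sz k ^ CARD('n))"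
      unfolding average_def k_def by (rule mult_left_mono) simp
    also have "\<dots> = ennreal (B * (s / A))" using B s by (simp add: ennreal_mult[symmetric] A_def)
    also have "\<dots> \<le> ennreal s" using B s by (intro ennreal_leI) (simp add: A_def field_simps)
    finally show False using less by simp
  qed
  then show ?thesis using B by (intro that[of A]) (auto simp: A_def)
qed

text \<open>The bad cube found for a large average has a stopping ancestor of some scale l. From x
  to the corner of q, on to the bad cube and on to the ancestor, each displacement is at most n + 1
  times \<open>sz l\<close>, so x lies in the star of the ancestor.\<close>

lemma maximal_weak_type:
  obtains C where "0 \<le> C" "\<And>(v :: real ^ 'n \<Rightarrow> ennreal) s. v \<in> borel_measurable lebesgue \<Longrightarrow> 0 < s \<Longrightarrow>
    ennreal s * emeasure lebesgue {x. ennreal s < maximal v x} \<le> ennreal C * (\<integral>\<^sup>+x. v x \<partial>lebesgue)"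
proof -
  let ?n = "real CARD('n)"
  obtain A where A: "0 < A" "\<And>(v :: real ^ 'n \<Rightarrow> ennreal) s q. v \<in> borel_measurable lebesgue \<Longrightarrow> 0 < s \<Longrightarrow>
    ennreal s < average v q \<Longrightarrow> \<exists>j m. (fst q + int j, m) \<in> bad_cubes v (s / A) \<and>
      norm (corner (fst q + int j) m - corner (fst q) (snd q)) \<le> (?n + 1) * sz (fst q + int j)"
    by (rule average_bad_cube[where 'n='n], rule that)
  obtain C3 where C3: "0 \<le> C3" "\<And>(v :: real ^ 'n \<Rightarrow> ennreal) s. v \<in> borel_measurable lebesgue \<Longrightarrow> 0 < s \<Longrightarrow>
    ennreal s * emeasure lebesgue (\<Union>p\<in>stopping_cubes v s. star p) \<le> ennreal C3 * (\<integral>\<^sup>+x. v x \<partial>lebesgue)"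
    by (rule star_union_measure[where 'n='n], rule that)
  have "ennreal s * emeasure lebesgue {x. ennreal s < maximal v x} \<le> ennreal (A * C3 + 1) * (\<integral>\<^sup>+x. v x \<partial>lebesgue)"
    if v [measurable]: "v \<in> borel_measurable lebesgue" and s: "0 < s" for v :: "real ^ 'n \<Rightarrow> ennreal" and s
  proof (cases "(\<integral>\<^sup>+x. v x \<partial>lebesgue) < \<infinity>")
    case False
    then have "(\<integral>\<^sup>+x. v x \<partial>lebesgue) = top" by (simp add: less_top[symmetric])
    moreover have "ennreal (A * C3 + 1) * top = top" using A(1) C3(1) by (simp add: ennreal_mult_top add_nonneg_eq_0_iff)
    ultimately show ?thesis by simp
  next
    case fin: True
    have sA: "0 < s / A" using s A by simp
    obtain K where K: "\<And>k m. (k, m) \<in> bad_cubes v (s / A) \<Longrightarrow> k \<le> K"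
      by (rule bad_cubes_bounded[OF fin sA], rule that)
    have "{x. ennreal s < maximal v x} \<subseteq> (\<Union>p\<in>stopping_cubes v (s / A). star p)"
    proof
      fix x assume "x \<in> {x. ennreal s < maximal v x}"
      then obtain q where "ennreal s < average v q * indicator (supp q) x" unfolding maximal_def less_SUP_iff by auto
      then have q: "x \<in> supp q" "ennreal s < average v q" by (auto split: split_indicator_asm)
      then obtain j m where jm: "(fst q + int j, m) \<in> bad_cubes v (s / A)"
        "norm (corner (fst q + int j) m - corner (fst q) (snd q)) \<le> (?n + 1) * sz (fst q + int j)"
        using A(2)[OF v s q(2)] by blast
      define k where "k = fst q + int j"
      obtain l where l: "k \<le> l" "(l, cidx l (corner k m)) \<in> stopping_cubes v (s / A)"
        by (rule maximal_cubes_above[OF K jm(1)[folded k_def]], assumption, rule that)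
      define p where "p = (l, cidx l (corner k m))"
      have "corner k m \<in> dcube l (cidx l (corner k m))" by (simp add: dcube_def)
      then have 1: "norm (corner k m - corner (fst p) (snd p)) \<le> ?n * sz l"
        unfolding p_def fst_conv snd_conv by (intro dcube_dist) auto
      have "(?n + 1) * sz k \<le> (?n + 1) * sz l" using l(1) by (intro mult_left_mono) auto
      with jm(2)[folded k_def] have "norm (corner k m - corner (fst q) (snd q)) \<le> (?n + 1) * sz l"
        by (rule order_trans)
      then have 2: "norm (corner (fst q) (snd q) - corner k m) \<le> (?n + 1) * sz l"
        by (subst norm_minus_commute)
      have "(?n + 1) * sz (fst q) \<le> (?n + 1) * sz l" using l(1) by (intro mult_left_mono) (auto simp: k_def)
      then have 3: "norm (x - corner (fst q) (snd q)) \<le> (?n + 1) * sz l"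
        using q(1) unfolding supp_def mem_cball dist_norm norm_minus_commute[of x] by linarith
      have "norm (x - corner (fst p) (snd p)) \<le> norm (x - corner (fst q) (snd q)) +
          (norm (corner (fst q) (snd q) - corner k m) + norm (corner k m - corner (fst p) (snd p)))"
        using norm_triangle_ineq[of "x - corner (fst q) (snd q)" "corner (fst q) (snd q) - corner (fst p) (snd p)"]
          norm_triangle_ineq[of "corner (fst q) (snd q) - corner k m" "corner k m - corner (fst p) (snd p)"] by simp
      also have "\<dots> \<le> (?n + 1) * sz l + ((?n + 1) * sz l + ?n * sz l)" using 1 2 3 by linarith
      also have "\<dots> \<le> 3 * (?n + 1) * sz l" by (simp add: algebra_simps)
      finally have "x \<in> star p" by (simp add: star_def p_def dist_norm norm_minus_commute)
      then show "x \<in> (\<Union>p\<in>stopping_cubes v (s / A). star p)" using l(2) unfolding p_def by blast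
    qed
    then have "emeasure lebesgue {x. ennreal s < maximal v x} \<le> emeasure lebesgue (\<Union>p\<in>stopping_cubes v (s / A). star p)"
      by (rule emeasure_mono) (rule lebesgue_star_union)
    then have "ennreal s * emeasure lebesgue {x. ennreal s < maximal v x} \<le>
        ennreal s * emeasure lebesgue (\<Union>p\<in>stopping_cubes v (s / A). star p)" by (rule mult_left_mono) simp
    also have "\<dots> = ennreal A * (ennreal (s / A) * emeasure lebesgue (\<Union>p\<in>stopping_cubes v (s / A). star p))"
      using A(1) s by (simp add: mult.assoc[symmetric] ennreal_mult[symmetric])
    also have "\<dots> \<le> ennreal A * (ennreal C3 * (\<integral>\<^sup>+x. v x \<partial>lebesgue))"
      by (intro mult_left_mono C3(2)[OF v sA]) simp
    also have "\<dots> = ennreal (A * C3) * (\<integral>\<^sup>+x. v x \<partial>lebesgue)"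
      using A(1) C3(1) by (simp add: ennreal_mult mult.assoc)
    also have "\<dots> \<le> ennreal (A * C3 + 1) * (\<integral>\<^sup>+x. v x \<partial>lebesgue)"
      by (intro mult_right_mono ennreal_leI) auto
    finally show ?thesis .
  qed
  then show ?thesis using A(1) C3(1) by (intro that[of "A * C3 + 1"]) auto
qed

lemma power_types:
  assumes "0 < r"
  shows "lower_type (\<lambda>t. ennreal (t powr r)) r" "upper_type (\<lambda>t. ennreal (t powr r)) r"
proof -
  have "ennreal ((s * t) powr r) = ennreal (1 * t powr r) * ennreal (s powr r)" for s t :: real
    by (simp add: powr_mult ennreal_mult mult.commute)
  then show "lower_type (\<lambda>t. ennreal (t powr r)) r" "upper_type (\<lambda>t. ennreal (t powr r)) r"
    unfolding lower_type_def upper_type_def by (intro exI[of _ 1]; simp)+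
qed

text \<open>At level \<open>sz k\<close> the part of v below \<open>c * sz k\<close> has maximal
  function at most half the level, so only the part above matters, and the weak type bound applies
  to it. The second integral in the interpolation hypothesis is simply added; r + 1 serves as an
  exponent above r.\<close>

theorem maximal_strong_type:
  assumes r: "1 < r"
  obtains C where "0 \<le> C" "\<And>v :: real ^ 'n \<Rightarrow> real. v \<in> borel_measurable lebesgue \<Longrightarrow> (\<And>x. 0 \<le> v x) \<Longrightarrow>
    (\<integral>\<^sup>+x. layers (\<lambda>t. ennreal (t powr r)) (maximal (\<lambda>x. ennreal (v x)) x) \<partial>lebesgue)
      \<le> ennreal C * (\<integral>\<^sup>+x. ennreal (v x powr r) \<partial>lebesgue)"
proof -
  obtain C1 where C1: "0 \<le> C1" "\<And>(v :: real ^ 'n \<Rightarrow> ennreal) c x. (\<And>y. v y \<le> c) \<Longrightarrow> maximal v x \<le> ennreal C1 * c"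
    using maximal_bounded[where 'n='n] by blast
  obtain C2 where C2: "0 \<le> C2" "\<And>(v :: real ^ 'n \<Rightarrow> ennreal) s. v \<in> borel_measurable lebesgue \<Longrightarrow> 0 < s \<Longrightarrow>
    ennreal s * emeasure lebesgue {x. ennreal s < maximal v x} \<le> ennreal C2 * (\<integral>\<^sup>+x. v x \<partial>lebesgue)"
    by (rule maximal_weak_type[where 'n='n], rule that)
  \<comment> \<open>Chosen to make \<open>C1 * c \<le> 1 / 2\<close>; the added 1 avoids division by
    zero.\<close>
  define c where "c = 1 / (2 * (C1 + 1))"
  have c: "0 < c" using C1 by (simp add: c_def)
  have cC: "C1 * c \<le> 1 / 2" using C1(1) by (simp add: c_def field_simps)
  have r0: "0 < r" and r1: "r < r + 1" using r by auto
  obtain C where C: "0 \<le> C" "\<And>K (g :: real ^ 'n \<Rightarrow> ennreal) (f :: real ^ 'n \<Rightarrow> real). 0 \<le> K \<Longrightarrow> g \<in> borel_measurable lebesgue \<Longrightarrow>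
    f \<in> borel_measurable lebesgue \<Longrightarrow> (\<lambda>x. ennreal (\<bar>f x\<bar> powr r)) \<in> borel_measurable lebesgue \<Longrightarrow>
    \<forall>k. emeasure lebesgue {x. ennreal (sz k) < g x} \<le>
      ennreal K * ((\<integral>\<^sup>+x. ennreal (1 / sz k * \<bar>f x\<bar>) * indicator {x. c * sz k < \<bar>f x\<bar>} x \<partial>lebesgue) +
        (\<integral>\<^sup>+x. ennreal (sz k powr - (r + 1) * \<bar>f x\<bar> powr (r + 1)) * indicator {x. \<bar>f x\<bar> \<le> c * sz k} x \<partial>lebesgue)) \<Longrightarrow>
    (\<integral>\<^sup>+x. layers (\<lambda>t. ennreal (t powr r)) (g x) \<partial>lebesgue) \<le> ennreal (K * C) * (\<integral>\<^sup>+x. ennreal (\<bar>f x\<bar> powr r) \<partial>lebesgue)"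
    by (rule interpolation[where 'n='n, OF power_types(1)[OF r0] power_types(2)[OF r0] r r1 c], rule that)
  have "(\<integral>\<^sup>+x. layers (\<lambda>t. ennreal (t powr r)) (maximal (\<lambda>x. ennreal (v x)) x) \<partial>lebesgue)
      \<le> ennreal (2 * C2 * C) * (\<integral>\<^sup>+x. ennreal (v x powr r) \<partial>lebesgue)"
    if v [measurable]: "v \<in> borel_measurable lebesgue" and pos: "\<And>x. 0 \<le> v x" for v :: "real ^ 'n \<Rightarrow> real"
  proof -
    have "emeasure lebesgue {x. ennreal (sz k) < maximal (\<lambda>x. ennreal (v x)) x} \<le>
      ennreal (2 * C2) * (\<integral>\<^sup>+x. ennreal (1 / sz k * \<bar>v x\<bar>) * indicator {x. c * sz k < \<bar>v x\<bar>} x \<partial>lebesgue)" for k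
    proof -
      let ?A = "{x. c * sz k < v x}"
      have "{x \<in> space lebesgue. c * sz k < v x} \<in> sets lebesgue" by measurable
      then have [measurable]: "?A \<in> sets lebesgue" by simp
      define v1 where "v1 x = ennreal (v x) * indicator ?A x" for x
      define v2 where "v2 x = ennreal (v x) * indicator (- ?A) x" for x
      have [measurable]: "- ?A \<in> sets lebesgue" using \<open>?A \<in> sets lebesgue\<close> by (simp add: Compl_eq_Diff_UNIV sets.Diff)
      have [measurable]: "v1 \<in> borel_measurable lebesgue" "v2 \<in> borel_measurable lebesgue"
        unfolding v1_def v2_def by measurable
      have v12: "(\<lambda>x. ennreal (v x)) = (\<lambda>x. v1 x + v2 x)" by (auto simp: v1_def v2_def split: split_indicator)
      have "v2 x \<le> ennreal (c * sz k)" for x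
        by (auto simp: v2_def not_less intro!: ennreal_leI split: split_indicator)
      then have v2: "maximal v2 x \<le> ennreal C1 * ennreal (c * sz k)" for x by (rule C1(2))
      have v2': "maximal v2 x \<le> ennreal (sz k / 2)" for x
      proof -
        have "ennreal C1 * ennreal (c * sz k) = ennreal (C1 * c * sz k)"
          using C1(1) c by (simp add: ennreal_mult[symmetric] mult.assoc)
        also have "\<dots> \<le> ennreal (1 / 2 * sz k)" using cC by (intro ennreal_leI mult_right_mono) auto
        finally show ?thesis using v2[of x] by (simp add: order_trans)
      qed
      have "{x. ennreal (sz k) < maximal (\<lambda>x. ennreal (v x)) x} \<subseteq> {x. ennreal (sz k / 2) < maximal v1 x}"
      proof safe
        fix x assume *: "ennreal (sz k) < maximal (\<lambda>x. ennreal (v x)) x"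
        show "ennreal (sz k / 2) < maximal v1 x"
        proof (rule ccontr)
          assume "\<not> ?thesis"
          then have "maximal v1 x + maximal v2 x \<le> ennreal (sz k / 2) + ennreal (sz k / 2)"
            using v2'[of x] by (intro add_mono) auto
          also have "\<dots> = ennreal (sz k)" by (simp add: ennreal_plus[symmetric] del: ennreal_plus)
          finally show False using * maximal_add[of v1 v2 x] unfolding v12 by simp
        qed
      qed
      then have "emeasure lebesgue {x. ennreal (sz k) < maximal (\<lambda>x. ennreal (v x)) x} \<le> emeasure lebesgue {x. ennreal (sz k / 2) < maximal v1 x}"
      proof (rule emeasure_mono)
        have "{x \<in> space lebesgue. ennreal (sz k / 2) < maximal v1 x} \<in> sets lebesgue" by measurable
        then show "{x. ennreal (sz k / 2) < maximal v1 x} \<in> sets lebesgue" by simp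
      qed
      also have "\<dots> = ennreal (2 / sz k) * (ennreal (sz k / 2) * emeasure lebesgue {x. ennreal (sz k / 2) < maximal v1 x})"
        by (simp add: mult.assoc[symmetric] ennreal_mult[symmetric])
      also have "\<dots> \<le> ennreal (2 / sz k) * (ennreal C2 * (\<integral>\<^sup>+x. v1 x \<partial>lebesgue))"
        by (intro mult_left_mono C2) auto
      also have "\<dots> = ennreal (2 * C2) * (ennreal (1 / sz k) * (\<integral>\<^sup>+x. v1 x \<partial>lebesgue))"
        using C2(1) by (simp add: mult.assoc[symmetric] ennreal_mult[symmetric])
      also have "ennreal (1 / sz k) * (\<integral>\<^sup>+x. v1 x \<partial>lebesgue) = (\<integral>\<^sup>+x. ennreal (1 / sz k) * v1 x \<partial>lebesgue)"
        by (rule nn_integral_cmult[symmetric]) measurable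
      also have "\<dots> = (\<integral>\<^sup>+x. ennreal (1 / sz k * \<bar>v x\<bar>) * indicator {x. c * sz k < \<bar>v x\<bar>} x \<partial>lebesgue)"
        using pos by (intro nn_integral_cong) (auto simp: v1_def ennreal_mult[symmetric] split: split_indicator)
      finally show ?thesis .
    qed
    then have "\<forall>k. emeasure lebesgue {x. ennreal (sz k) < maximal (\<lambda>x. ennreal (v x)) x} \<le>
      ennreal (2 * C2) * ((\<integral>\<^sup>+x. ennreal (1 / sz k * \<bar>v x\<bar>) * indicator {x. c * sz k < \<bar>v x\<bar>} x \<partial>lebesgue) +
        (\<integral>\<^sup>+x. ennreal (sz k powr - (r + 1) * \<bar>v x\<bar> powr (r + 1)) * indicator {x. \<bar>v x\<bar> \<le> c * sz k} x \<partial>lebesgue))"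
      unfolding distrib_left by (auto intro: add_increasing2)
    then have "(\<integral>\<^sup>+x. layers (\<lambda>t. ennreal (t powr r)) (maximal (\<lambda>x. ennreal (v x)) x) \<partial>lebesgue)
        \<le> ennreal (2 * C2 * C) * (\<integral>\<^sup>+x. ennreal (\<bar>v x\<bar> powr r) \<partial>lebesgue)"
      using C2(1) by (intro C(2)) (auto intro!: measurable_compose[OF v])
    then show ?thesis using pos by simp
  qed
  then show ?thesis using C2(1) C(1) by (intro that[of "2 * C2 * C"]) auto
qed

section \<open>Weighted estimates and large exponents\<close>

lemma superlevel_sets:
  fixes h :: "'a::euclidean_space \<Rightarrow> ennreal"
  assumes "h \<in> borel_measurable lebesgue"
  shows "{x. c < h x} \<in> sets lebesgue"
proof -
  have "{x \<in> space lebesgue. c < h x} \<in> sets lebesgue" using assms by measurable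
  then show ?thesis by simp
qed

text \<open>The cubes on which the average of the weight exceeds a level only see the part of \<open>f\<close> on the
  set where the maximal function of the weight exceeds that level.\<close>

theorem weighted_bound:
  assumes \<alpha>: "0 < \<alpha>"
  obtains C where "0 \<le> C" "\<And>(f :: real ^ 'n \<Rightarrow> real) v. f \<in> borel_measurable lebesgue \<Longrightarrow>
    (\<Sum>\<^sup>+q. (coef \<alpha> f q)\<^sup>2 * ennreal (sz (fst q) ^ CARD('n)) * average v q)
      \<le> ennreal C * (\<integral>\<^sup>+x. ennreal ((f x)\<^sup>2) * maximal v x \<partial>lebesgue)"
proof -
  obtain C1 where C1: "0 < C1" "\<And>f :: real ^ 'n \<Rightarrow> real. f \<in> borel_measurable lebesgue \<Longrightarrow>
     (\<Sum>\<^sup>+p. (coef \<alpha> f p)\<^sup>2 * ennreal (sz (fst p) ^ CARD('n))) \<le> ennreal C1 * (\<integral>\<^sup>+z. ennreal ((f z)\<^sup>2) \<partial>lebesgue)"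
    by (rule l2_bound[where 'n='n, OF \<alpha>], rule that)
  obtain C2 where C2: "0 \<le> C2"
    "\<And>a. (\<Sum>\<^sup>+k. ennreal (sz (k + 1)) * indicator {k. ennreal (sz k) < a} k) \<le> ennreal C2 * a"
    by (rule dyadic_layer_lower, rule that)
  have "(\<Sum>\<^sup>+q. (coef \<alpha> f q)\<^sup>2 * ennreal (sz (fst q) ^ CARD('n)) * average v q)
      \<le> ennreal (C1 * C2) * (\<integral>\<^sup>+x. ennreal ((f x)\<^sup>2) * maximal v x \<partial>lebesgue)"
    if f [measurable]: "f \<in> borel_measurable lebesgue" for f :: "real ^ 'n \<Rightarrow> real" and v
  proof -
    let ?w = "\<lambda>q. (coef \<alpha> f q)\<^sup>2 * ennreal (sz (fst q) ^ CARD('n))"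
    let ?E = "\<lambda>k. {x. ennreal (sz k) < maximal v x}"
    have [measurable]: "?E k \<in> sets lebesgue" for k
    proof -
      have "{x \<in> space lebesgue. ennreal (sz k) < maximal v x} \<in> sets lebesgue" by measurable
      then show ?thesis by simp
    qed
    \<comment> \<open>The averages are decomposed into dyadic layers. Each level is estimated here,
      and the levels are recombined into the maximal function by
      \<open>dyadic_layer_lower\<close>.\<close>
    have level: "(\<Sum>\<^sup>+q. ?w q * indicator {q. ennreal (sz k) < average v q} q)
        \<le> ennreal C1 * (\<integral>\<^sup>+x. ennreal ((f x)\<^sup>2) * indicator (?E k) x \<partial>lebesgue)" for k
    proof -
      let ?f = "\<lambda>x. f x * indicator (?E k) x"
      have "(\<Sum>\<^sup>+q. ?w q * indicator {q. ennreal (sz k) < average v q} q)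
         \<le> (\<Sum>\<^sup>+q. (coef \<alpha> ?f q)\<^sup>2 * ennreal (sz (fst q) ^ CARD('n)))"
      proof (rule nsum_mono)
        fix q :: "int \<times> (int ^ 'n)"
        show "?w q * indicator {q. ennreal (sz k) < average v q} q \<le> (coef \<alpha> ?f q)\<^sup>2 * ennreal (sz (fst q) ^ CARD('n))"
        proof (cases "ennreal (sz k) < average v q")
          case True
          have "coef \<alpha> f q = coef \<alpha> ?f q"
          proof (rule coef_cong)
            fix z assume "z \<in> supp q"
            then have "ennreal (sz k) < maximal v z" using True average_le_maximal[of z q v] by (rule_tac less_le_trans)
            then show "f z = f z * indicator (?E k) z" by simp
          qed
          then show ?thesis using True by simp
        qed simp
      qed
      also have "\<dots> \<le> ennreal C1 * (\<integral>\<^sup>+z. ennreal ((?f z)\<^sup>2) \<partial>lebesgue)" by (rule C1) measurable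
      also have "(\<integral>\<^sup>+z. ennreal ((?f z)\<^sup>2) \<partial>lebesgue) = (\<integral>\<^sup>+x. ennreal ((f x)\<^sup>2) * indicator (?E k) x \<partial>lebesgue)"
        by (intro nn_integral_cong) (auto split: split_indicator)
      finally show ?thesis .
    qed
    have "(\<Sum>\<^sup>+q. ?w q * average v q) \<le> (\<Sum>\<^sup>+q. \<Sum>\<^sup>+k. ennreal (sz (k + 1)) * (?w q * indicator {q. ennreal (sz k) < average v q} q))"
    proof (rule nsum_mono)
      fix q :: "int \<times> (int ^ 'n)"
      have "?w q * average v q \<le> ?w q * (\<Sum>\<^sup>+k. ennreal (sz (k + 1)) * indicator {k. ennreal (sz k) < average v q} k)"
        by (intro mult_left_mono dyadic_layer_upper) simp
      also have "\<dots> = (\<Sum>\<^sup>+k. ?w q * (ennreal (sz (k + 1)) * indicator {k. ennreal (sz k) < average v q} k))"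
        by (rule nn_integral_cmult[symmetric]) simp
      also have "\<dots> = (\<Sum>\<^sup>+k. ennreal (sz (k + 1)) * (?w q * indicator {q. ennreal (sz k) < average v q} q))"
        by (intro nn_integral_cong) (auto simp: mult_ac split: split_indicator)
      finally show "?w q * average v q \<le> (\<Sum>\<^sup>+k. ennreal (sz (k + 1)) * (?w q * indicator {q. ennreal (sz k) < average v q} q))" .
    qed
    also have "\<dots> = (\<Sum>\<^sup>+k. \<Sum>\<^sup>+q. ennreal (sz (k + 1)) * (?w q * indicator {q. ennreal (sz k) < average v q} q))"
      by (rule nsum_swap)
    also have "\<dots> = (\<Sum>\<^sup>+k. ennreal (sz (k + 1)) * (\<Sum>\<^sup>+q. ?w q * indicator {q. ennreal (sz k) < average v q} q))"
      by (intro nn_integral_cong nn_integral_cmult) simp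
    also have "\<dots> \<le> (\<Sum>\<^sup>+k. ennreal (sz (k + 1)) * (ennreal C1 * (\<integral>\<^sup>+x. ennreal ((f x)\<^sup>2) * indicator (?E k) x \<partial>lebesgue)))"
      by (intro nsum_mono mult_left_mono level) simp
    also have "\<dots> = (\<Sum>\<^sup>+k. \<integral>\<^sup>+x. ennreal C1 * ennreal ((f x)\<^sup>2) * (ennreal (sz (k + 1)) * indicator (?E k) x) \<partial>lebesgue)"
    proof (rule nn_integral_cong)
      fix k
      have "(\<integral>\<^sup>+x. ennreal C1 * ennreal ((f x)\<^sup>2) * (ennreal (sz (k + 1)) * indicator (?E k) x) \<partial>lebesgue)
         = (\<integral>\<^sup>+x. (ennreal (sz (k + 1)) * ennreal C1) * (ennreal ((f x)\<^sup>2) * indicator (?E k) x) \<partial>lebesgue)"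
        by (simp only: mult_ac)
      also have "\<dots> = (ennreal (sz (k + 1)) * ennreal C1) * (\<integral>\<^sup>+x. ennreal ((f x)\<^sup>2) * indicator (?E k) x \<partial>lebesgue)"
        by (rule nn_integral_cmult) measurable
      finally show "ennreal (sz (k + 1)) * (ennreal C1 * (\<integral>\<^sup>+x. ennreal ((f x)\<^sup>2) * indicator (?E k) x \<partial>lebesgue)) =
         (\<integral>\<^sup>+x. ennreal C1 * ennreal ((f x)\<^sup>2) * (ennreal (sz (k + 1)) * indicator (?E k) x) \<partial>lebesgue)"
        by (simp only: mult.assoc)
    qed
    also have "\<dots> = (\<integral>\<^sup>+x. (\<Sum>\<^sup>+k. ennreal C1 * ennreal ((f x)\<^sup>2) * (ennreal (sz (k + 1)) * indicator (?E k) x)) \<partial>lebesgue)"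
      by (rule nn_integral_nsum[symmetric]) measurable
    also have "\<dots> \<le> (\<integral>\<^sup>+x. ennreal (C1 * C2) * (ennreal ((f x)\<^sup>2) * maximal v x) \<partial>lebesgue)"
    proof (rule nn_integral_mono)
      fix x
      have "(\<Sum>\<^sup>+k. ennreal C1 * ennreal ((f x)\<^sup>2) * (ennreal (sz (k + 1)) * indicator (?E k) x))
         = (\<Sum>\<^sup>+k. ennreal C1 * ennreal ((f x)\<^sup>2) * (ennreal (sz (k + 1)) * indicator {k. ennreal (sz k) < maximal v x} k))"
        by (intro nn_integral_cong) (auto split: split_indicator)
      also have "\<dots> = ennreal C1 * ennreal ((f x)\<^sup>2) * (\<Sum>\<^sup>+k. ennreal (sz (k + 1)) * indicator {k. ennreal (sz k) < maximal v x} k)"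
        by (rule nn_integral_cmult) simp
      also have "\<dots> \<le> ennreal C1 * ennreal ((f x)\<^sup>2) * (ennreal C2 * maximal v x)"
        by (intro mult_left_mono C2) simp
      also have "\<dots> = ennreal C1 * ennreal C2 * (ennreal ((f x)\<^sup>2) * maximal v x)" by (simp only: mult_ac)
      finally show "(\<Sum>\<^sup>+k. ennreal C1 * ennreal ((f x)\<^sup>2) * (ennreal (sz (k + 1)) * indicator (?E k) x))
        \<le> ennreal (C1 * C2) * (ennreal ((f x)\<^sup>2) * maximal v x)"
        using C1(1) C2(1) by (simp only: ennreal_mult less_imp_le)
    qed
    also have "\<dots> = ennreal (C1 * C2) * (\<integral>\<^sup>+x. ennreal ((f x)\<^sup>2) * maximal v x \<partial>lebesgue)"
      by (rule nn_integral_cmult) measurable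
    finally show ?thesis .
  qed
  then show ?thesis using C1(1) C2(1) by (intro that[of "C1 * C2"]) auto
qed

text \<open>A scale with \<open>sz k < b \<le> sz (k + 1)\<close> gives one term that already
  dominates. The first inequality is strict because the indicator in \<open>layers\<close> is; this
  forces the lower choice of k when b is itself a power of two.\<close>

lemma layers_ge:
  assumes mono: "\<And>s t. 0 \<le> s \<Longrightarrow> s \<le> t \<Longrightarrow> \<Phi> s \<le> \<Phi> t" and b: "0 < b" "ennreal b \<le> a"
  shows "\<Phi> b \<le> layers \<Phi> a"
proof -
  obtain k where k: "sz k < b" "b \<le> sz (k + 1)"
  proof -
    obtain k where k: "sz k \<le> b" "b < 2 * sz k" using b(1) by (rule sz_bracket)
    show ?thesis
    proof (cases "sz k = b")
      case True
      then show ?thesis using b(1) by (intro that[of "k - 1"]) (auto simp: sz_pred)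
    next
      case False
      then show ?thesis using k by (intro that[of k]) (auto simp: sz_Suc)
    qed
  qed
  have "ennreal (sz k) < a" using k(1) b 
  proof -
    have "ennreal (sz k) < ennreal b" using k(1) b(1) by (simp add: ennreal_less_iff)
    also note b(2)
    finally show ?thesis .
  qed
  then have "\<Phi> (sz (k + 1)) = \<Phi> (sz (k + 1)) * indicator {k. ennreal (sz k) < a} k" by simp
  also have "\<dots> \<le> layers \<Phi> a" unfolding layers_def by (rule nsum_upper)
  finally show ?thesis using mono[OF _ k(2)] b(1) by (meson less_imp_le order_trans)
qed

text \<open>Makes a finite integral of \<open>layers\<close> imply that the argument is finite
  almost everywhere.\<close>

lemma layers_top:
  assumes mono: "\<And>s t. 0 \<le> s \<Longrightarrow> s \<le> t \<Longrightarrow> \<Phi> s \<le> \<Phi> t" and lim: "(\<Phi> \<longlongrightarrow> (top :: ennreal)) at_top"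
  shows "layers \<Phi> top = top"
proof (rule ccontr)
  assume "layers \<Phi> top \<noteq> top"
  then have "layers \<Phi> top < top" by (simp add: less_top)
  then have "\<forall>\<^sub>F t in at_top. layers \<Phi> top < \<Phi> t" using lim by (rule order_tendstoD(1)[rotated])
  then obtain t0 where t0: "\<And>t. t0 \<le> t \<Longrightarrow> layers \<Phi> top < \<Phi> t" by (auto simp: eventually_at_top_linorder)
  have "\<Phi> (max 1 t0) \<le> layers \<Phi> top" using mono by (rule layers_ge) auto
  with t0[of "max 1 t0"] show False by simp
qed

text \<open>Young's inequality with a small factor on the conjugate power, stated with
  \<open>layers\<close> in place of that power so that a may be infinite. Which term dominates
  depends on whether A is at most \<open>\<eta> * b powr (r - 1)\<close>; solving the opposite
  inequality for b yields K as a negative power of \<eta>.\<close>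

lemma young_absorb:
  assumes \<rho>: "1 < \<rho>" and \<eta>: "0 < \<eta>"
  obtains K where "0 \<le> K" "\<And>A a. 0 \<le> A \<Longrightarrow> ennreal A * a \<le> ennreal K * ennreal (A powr \<rho>) +
    ennreal \<eta> * layers (\<lambda>t. ennreal (t powr (\<rho> / (\<rho> - 1)))) a"
proof
  define r where "r = \<rho> / (\<rho> - 1)"
  have r: "0 < r" "r = 1 + 1 / (\<rho> - 1)" using \<rho> by (auto simp: r_def field_simps)
  define K where "K = \<eta> powr - (\<rho> - 1)"
  show "0 \<le> K" by (simp add: K_def)
  have mono: "ennreal (s powr r) \<le> ennreal (t powr r)" if "0 \<le> s" "s \<le> t" for s t
    using that r by (intro ennreal_leI powr_mono2) auto
  fix A :: real and a :: ennreal assume A: "0 \<le> A"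
  show "ennreal A * a \<le> ennreal K * ennreal (A powr \<rho>) + ennreal \<eta> * layers (\<lambda>t. ennreal (t powr (\<rho> / (\<rho> - 1)))) a"
    unfolding r_def[symmetric]
  proof (cases a)
    case (real b)
    show "ennreal A * a \<le> ennreal K * ennreal (A powr \<rho>) + ennreal \<eta> * layers (\<lambda>t. ennreal (t powr r)) a"
    proof (cases "b = 0 \<or> A = 0")
      case False
      then have b: "0 < b" and A: "0 < A" using real A by auto
      have L: "ennreal (b powr r) \<le> layers (\<lambda>t. ennreal (t powr r)) a"
        by (rule layers_ge[where \<Phi>="\<lambda>t. ennreal (t powr r)"]) (use mono b real in auto)
      have "A * b \<le> K * A powr \<rho> + \<eta> * b powr r"
      proof (cases "A \<le> \<eta> * b powr (r - 1)")
        case True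
        then have "A * b \<le> \<eta> * b powr (r - 1) * b" using b by simp
        also have "\<dots> = \<eta> * b powr r" using b by (simp add: powr_diff)
        finally show ?thesis by (simp add: K_def add_increasing)
      next
        case False
        then have "b powr (1 / (\<rho> - 1)) \<le> A / \<eta>" using \<eta> r by (simp add: field_simps)
        then have "(b powr (1 / (\<rho> - 1))) powr (\<rho> - 1) \<le> (A / \<eta>) powr (\<rho> - 1)"
          using \<rho> by (intro powr_mono2) auto
        then have "b \<le> (A / \<eta>) powr (\<rho> - 1)" using b \<rho> by (simp add: powr_powr)
        then have "A * b \<le> A * (A / \<eta>) powr (\<rho> - 1)" using A by simp
        also have "\<dots> = K * A powr \<rho>"
          using A \<eta> by (simp add: K_def powr_divide powr_minus_divide powr_diff)
        finally show ?thesis using \<eta> by (simp add: add_increasing2)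
      qed
      then have "ennreal (A * b) \<le> ennreal (K * A powr \<rho> + \<eta> * b powr r)" by (rule ennreal_leI)
      also have "\<dots> = ennreal K * ennreal (A powr \<rho>) + ennreal \<eta> * ennreal (b powr r)"
        using \<eta> by (simp add: K_def ennreal_mult)
      also have "\<dots> \<le> ennreal K * ennreal (A powr \<rho>) + ennreal \<eta> * layers (\<lambda>t. ennreal (t powr r)) a"
        by (intro add_left_mono mult_left_mono L) simp
      finally show ?thesis using A b by (simp add: real ennreal_mult)
    qed (auto simp: real)
  next
    case top
    have "((\<lambda>t. ennreal (t powr r)) \<longlongrightarrow> top) at_top"
      unfolding ennreal_tendsto_top_eq_at_top
    proof (rule filterlim_at_top_mono[OF filterlim_ident])
      show "\<forall>\<^sub>F t in at_top. t \<le> t powr r"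
        using eventually_ge_at_top[of 1]
      proof eventually_elim
        case (elim t)
        then have "t powr 1 \<le> t powr r" using r \<rho> by (intro powr_mono) auto
        then show ?case using elim by simp
      qed
    qed
    then have "layers (\<lambda>t. ennreal (t powr r)) a = top"
      unfolding top using mono by (intro layers_top)
    then show "ennreal A * a \<le> ennreal K * ennreal (A powr \<rho>) + ennreal \<eta> * layers (\<lambda>t. ennreal (t powr r)) a"
      using \<eta> by (simp add: ennreal_mult_top)
  qed
qed

text \<open>Only finitely many cubes are summed because absorption needs the left-hand side to be
  finite beforehand. The constant does not depend on F, so the bound survives the passage to all
  cubes.\<close>

lemma sq_fun_finite_sum:
  assumes \<alpha>: "0 < \<alpha>" and \<rho>: "1 < \<rho>"
  obtains C where "0 \<le> C" "\<And>(f :: real ^ 'n \<Rightarrow> real) F. finite F \<Longrightarrow> f \<in> borel_measurable lebesgue \<Longrightarrow>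
    (\<integral>\<^sup>+x. ennreal (\<bar>f x\<bar> powr (2 * \<rho>)) \<partial>lebesgue) < \<infinity> \<Longrightarrow>
    (\<integral>\<^sup>+x. ennreal ((\<Sum>p\<in>F. (enn2real (coef \<alpha> f p) * ker (1/2) p x)\<^sup>2) powr \<rho>) \<partial>lebesgue)
      \<le> ennreal C * (\<integral>\<^sup>+x. ennreal (\<bar>f x\<bar> powr (2 * \<rho>)) \<partial>lebesgue)"
proof -
  define r where "r = \<rho> / (\<rho> - 1)"
  have r: "1 < r" using \<rho> by (simp add: r_def)
  obtain C1 where C1: "0 \<le> C1" "\<And>(f :: real ^ 'n \<Rightarrow> real) v. f \<in> borel_measurable lebesgue \<Longrightarrow>
    (\<Sum>\<^sup>+q. (coef \<alpha> f q)\<^sup>2 * ennreal (sz (fst q) ^ CARD('n)) * average v q)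
      \<le> ennreal C1 * (\<integral>\<^sup>+x. ennreal ((f x)\<^sup>2) * maximal v x \<partial>lebesgue)"
    by (rule weighted_bound[where 'n='n, OF \<alpha>], rule that)
  obtain C2 where C2: "0 \<le> C2" "\<And>v :: real ^ 'n \<Rightarrow> real. v \<in> borel_measurable lebesgue \<Longrightarrow> (\<And>x. 0 \<le> v x) \<Longrightarrow>
    (\<integral>\<^sup>+x. layers (\<lambda>t. ennreal (t powr r)) (maximal (\<lambda>x. ennreal (v x)) x) \<partial>lebesgue)
      \<le> ennreal C2 * (\<integral>\<^sup>+x. ennreal (v x powr r) \<partial>lebesgue)"
    using maximal_strong_type[where 'n='n, OF r] by blast
  have half: "0 < (1/2 :: real)" by simp
  obtain C3 where C3: "0 \<le> C3"
    "\<And>p :: int \<times> (int ^ 'n). (\<integral>\<^sup>+x. ennreal (ker (1/2) p x) \<partial>lebesgue) \<le> ennreal (C3 * sz (fst p) ^ CARD('n))"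
    by (rule ker_integral[where 'n='n, OF half], rule that)
  \<comment> \<open>Chosen so that \<open>C1 * (\<eta> * C2) \<le> 1 / 2\<close>; half of X can then
    absorb the term with the maximal function.\<close>
  define \<eta> where "\<eta> = 1 / (2 * (C1 * C2 + 1))"
  have \<eta>: "0 < \<eta>" using C1(1) C2(1) by (auto simp: \<eta>_def intro!: add_nonneg_pos)
  have \<eta>_le: "C1 * (\<eta> * C2) \<le> 1 / 2"
  proof -
    have "0 < C1 * C2 + 1" using C1(1) C2(1) by (auto intro!: add_nonneg_pos)
    then show ?thesis by (simp add: \<eta>_def field_simps)
  qed
  obtain K where K: "0 \<le> K" "\<And>A a. 0 \<le> A \<Longrightarrow> ennreal A * a \<le> ennreal K * ennreal (A powr \<rho>) +
    ennreal \<eta> * layers (\<lambda>t. ennreal (t powr (\<rho> / (\<rho> - 1)))) a"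
    by (rule young_absorb[OF \<rho> \<eta>], rule that)
  have "(\<integral>\<^sup>+x. ennreal ((\<Sum>p\<in>F. (enn2real (coef \<alpha> f p) * ker (1/2) p x)\<^sup>2) powr \<rho>) \<partial>lebesgue)
      \<le> ennreal (2 * (C1 * K)) * (\<integral>\<^sup>+x. ennreal (\<bar>f x\<bar> powr (2 * \<rho>)) \<partial>lebesgue)"
    if F: "finite F" and f [measurable]: "f \<in> borel_measurable lebesgue"
      and fin: "(\<integral>\<^sup>+x. ennreal (\<bar>f x\<bar> powr (2 * \<rho>)) \<partial>lebesgue) < \<infinity>" for f :: "real ^ 'n \<Rightarrow> real" and F
  proof -
    have li: "locally_integrable f" by (rule locally_integrable_power[OF f _ fin]) (use \<rho> in simp)
    define a where "a p = enn2real (coef \<alpha> f p)" for p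
    have a: "coef \<alpha> f p = ennreal (a p)" for p
      using coef_finite[OF li, of \<alpha> p] by (simp add: a_def less_top)
    have a0 [simp]: "0 \<le> a p" for p by (simp add: a_def)
    define U where "U x = (\<Sum>p\<in>F. (a p * ker (1/2) p x)\<^sup>2)" for x
    have [measurable]: "U \<in> borel_measurable lebesgue" unfolding U_def by measurable
    have U0 [simp]: "0 \<le> U x" for x by (simp add: U_def sum_nonneg)
    define D where "D = (\<Sum>p\<in>F. (a p)\<^sup>2)"
    have UD: "U x \<le> D" for x
      unfolding U_def D_def
      by (intro sum_mono) (simp add: power_mult_distrib mult_left_le power_le_one ker_le_1)
    define X where "X = (\<integral>\<^sup>+x. ennreal (U x powr \<rho>) \<partial>lebesgue)"
    define I where "I = (\<integral>\<^sup>+x. ennreal (\<bar>f x\<bar> powr (2 * \<rho>)) \<partial>lebesgue)"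
    \<comment> \<open>With this exponent both U v and the r-th power of v equal the \<rho>-th power
      of U, so that the weighted left-hand side and the norm of the weight are the same integral
      X.\<close>
    define v where "v x = U x powr (\<rho> - 1)" for x
    have v_meas [measurable]: "v \<in> borel_measurable lebesgue" unfolding v_def by measurable
    have v0 [simp]: "0 \<le> v x" for x by (simp add: v_def)
    have Uv: "U x powr \<rho> = U x * v x" for x
      using powr_add[of "U x" 1 "\<rho> - 1"] by (simp add: v_def)
    have vr: "v x powr r = U x powr \<rho>" for x using \<rho> by (simp add: v_def r_def powr_powr)
    have split: "(\<integral>\<^sup>+x. ennreal (U x) * ennreal (h x) \<partial>lebesgue)
        = (\<Sum>p\<in>F. ennreal ((a p)\<^sup>2) * (\<integral>\<^sup>+x. ennreal ((ker (1/2) p x)\<^sup>2) * ennreal (h x) \<partial>lebesgue))"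
      if [measurable]: "h \<in> borel_measurable lebesgue" for h
    proof -
      have "(\<integral>\<^sup>+x. ennreal (U x) * ennreal (h x) \<partial>lebesgue)
         = (\<integral>\<^sup>+x. (\<Sum>p\<in>F. ennreal ((a p)\<^sup>2) * (ennreal ((ker (1/2) p x)\<^sup>2) * ennreal (h x))) \<partial>lebesgue)"
        unfolding U_def
        by (intro nn_integral_cong)
           (simp add: sum_ennreal[symmetric] sum_distrib_right power_mult_distrib ennreal_mult mult.assoc)
      also have "\<dots> = (\<Sum>p\<in>F. \<integral>\<^sup>+x. ennreal ((a p)\<^sup>2) * (ennreal ((ker (1/2) p x)\<^sup>2) * ennreal (h x)) \<partial>lebesgue)"
        by (rule nn_integral_sum) measurable
      also have "\<dots> = (\<Sum>p\<in>F. ennreal ((a p)\<^sup>2) * (\<integral>\<^sup>+x. ennreal ((ker (1/2) p x)\<^sup>2) * ennreal (h x) \<partial>lebesgue))"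
        by (intro sum.cong refl nn_integral_cmult) measurable
      finally show ?thesis .
    qed
    have ker2: "ennreal ((ker (1/2) p x)\<^sup>2) \<le> ennreal (ker (1/2) p x)" for p :: "int \<times> (int ^ 'n)" and x
      using ker_le_1[of "1/2" p x] by (intro ennreal_leI) (simp add: power2_eq_square mult_left_le)
    \<comment> \<open>Purely qualitative: U is bounded by D and integrable. D depends on F but does
      not enter the final constant.\<close>
    have Xfin: "X < \<infinity>"
    proof -
      have "X \<le> (\<integral>\<^sup>+x. ennreal (U x) * ennreal (D powr (\<rho> - 1)) \<partial>lebesgue)"
        unfolding X_def Uv v_def using \<rho> UD
        by (intro nn_integral_mono) (simp add: ennreal_mult[symmetric] ennreal_leI mult_left_mono powr_mono2)
      also have "\<dots> = (\<Sum>p\<in>F. ennreal ((a p)\<^sup>2) * (\<integral>\<^sup>+x. ennreal ((ker (1/2) p x)\<^sup>2) * ennreal (D powr (\<rho> - 1)) \<partial>lebesgue))"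
        by (rule split) simp
      also have "\<dots> < \<infinity>"
      proof -
        have "(\<integral>\<^sup>+x. ennreal ((ker (1/2) p x)\<^sup>2) * ennreal (D powr (\<rho> - 1)) \<partial>lebesgue) < \<infinity>" for p :: "int \<times> (int ^ 'n)"
        proof -
          have "(\<integral>\<^sup>+x. ennreal ((ker (1/2) p x)\<^sup>2) * ennreal (D powr (\<rho> - 1)) \<partial>lebesgue)
             \<le> (\<integral>\<^sup>+x. ennreal (ker (1/2) p x) * ennreal (D powr (\<rho> - 1)) \<partial>lebesgue)"
            by (intro nn_integral_mono mult_right_mono ker2) simp
          also have "\<dots> = (\<integral>\<^sup>+x. ennreal (ker (1/2) p x) \<partial>lebesgue) * ennreal (D powr (\<rho> - 1))"
            by (rule nn_integral_multc) measurable
          also have "\<dots> \<le> ennreal (C3 * sz (fst p) ^ CARD('n)) * ennreal (D powr (\<rho> - 1))"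
            by (intro mult_right_mono C3) simp
          also have "\<dots> < \<infinity>" by (simp add: ennreal_mult_less_top)
          finally show ?thesis .
        qed
        then have "ennreal ((a p)\<^sup>2) * (\<integral>\<^sup>+x. ennreal ((ker (1/2) p x)\<^sup>2) * ennreal (D powr (\<rho> - 1)) \<partial>lebesgue) < top" for p
          by (simp add: ennreal_mult_less_top)
        then show ?thesis using F by simp
      qed
      finally show ?thesis .
    qed
    have "X = (\<integral>\<^sup>+x. ennreal (U x) * ennreal (v x) \<partial>lebesgue)"
      unfolding X_def Uv by (intro nn_integral_cong) (simp add: ennreal_mult)
    also have "\<dots> = (\<Sum>p\<in>F. ennreal ((a p)\<^sup>2) * (\<integral>\<^sup>+x. ennreal ((ker (1/2) p x)\<^sup>2) * ennreal (v x) \<partial>lebesgue))"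
      by (rule split) measurable
    also have "\<dots> \<le> (\<Sum>p\<in>F. (coef \<alpha> f p)\<^sup>2 * ennreal (sz (fst p) ^ CARD('n)) * average (\<lambda>x. ennreal (v x)) p)"
    proof (rule sum_mono)
      fix p
      have "ennreal ((a p)\<^sup>2) * (\<integral>\<^sup>+x. ennreal ((ker (1/2) p x)\<^sup>2) * ennreal (v x) \<partial>lebesgue)
         \<le> ennreal ((a p)\<^sup>2) * (\<integral>\<^sup>+x. ennreal (ker (1/2) p x) * ennreal (v x) \<partial>lebesgue)"
        by (intro mult_left_mono nn_integral_mono mult_right_mono ker2) auto
      also have "\<dots> = (coef \<alpha> f p)\<^sup>2 * ennreal (sz (fst p) ^ CARD('n)) * average (\<lambda>x. ennreal (v x)) p"
        unfolding average_def a by (simp add: ennreal_power mult.assoc[symmetric] ennreal_mult[symmetric])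
      finally show "ennreal ((a p)\<^sup>2) * (\<integral>\<^sup>+x. ennreal ((ker (1/2) p x)\<^sup>2) * ennreal (v x) \<partial>lebesgue)
        \<le> (coef \<alpha> f p)\<^sup>2 * ennreal (sz (fst p) ^ CARD('n)) * average (\<lambda>x. ennreal (v x)) p" .
    qed
    also have "\<dots> \<le> (\<Sum>\<^sup>+p. (coef \<alpha> f p)\<^sup>2 * ennreal (sz (fst p) ^ CARD('n)) * average (\<lambda>x. ennreal (v x)) p)"
      by (rule sum_le_nsum[OF F])
    also have "\<dots> \<le> ennreal C1 * (\<integral>\<^sup>+x. ennreal ((f x)\<^sup>2) * maximal (\<lambda>x. ennreal (v x)) x \<partial>lebesgue)"
      by (rule C1(2)[OF f])
    also have "\<dots> \<le> ennreal C1 * (\<integral>\<^sup>+x. ennreal K * ennreal (\<bar>f x\<bar> powr (2 * \<rho>)) +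
        ennreal \<eta> * layers (\<lambda>t. ennreal (t powr r)) (maximal (\<lambda>x. ennreal (v x)) x) \<partial>lebesgue)"
    proof (intro mult_left_mono nn_integral_mono)
      fix x
      have "(f x)\<^sup>2 powr \<rho> = \<bar>f x\<bar> powr (2 * \<rho>)"
        using powr_powr[of "\<bar>f x\<bar>" 2 \<rho>] by (simp add: powr_numeral)
      then show "ennreal ((f x)\<^sup>2) * maximal (\<lambda>x. ennreal (v x)) x \<le> ennreal K * ennreal (\<bar>f x\<bar> powr (2 * \<rho>)) +
        ennreal \<eta> * layers (\<lambda>t. ennreal (t powr r)) (maximal (\<lambda>x. ennreal (v x)) x)"
        using K(2)[folded r_def, of "(f x)\<^sup>2" "maximal (\<lambda>x. ennreal (v x)) x"] by simp
    qed simp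
    also have "\<dots> = ennreal C1 * (ennreal K * I + ennreal \<eta> *
        (\<integral>\<^sup>+x. layers (\<lambda>t. ennreal (t powr r)) (maximal (\<lambda>x. ennreal (v x)) x) \<partial>lebesgue))"
    proof -
      have [measurable]: "(\<lambda>x. layers (\<lambda>t. ennreal (t powr r)) (maximal (\<lambda>x. ennreal (v x)) x)) \<in> borel_measurable lebesgue"
        by (rule borel_measurable_layers[OF borel_measurable_maximal])
      show ?thesis unfolding I_def by (subst nn_integral_add) (simp_all add: nn_integral_cmult)
    qed
    also have "\<dots> \<le> ennreal C1 * (ennreal K * I + ennreal \<eta> * (ennreal C2 * (\<integral>\<^sup>+x. ennreal (v x powr r) \<partial>lebesgue)))"
      by (intro mult_left_mono add_left_mono C2) auto
    also have "\<dots> = ennreal C1 * (ennreal K * I + ennreal \<eta> * (ennreal C2 * X))"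
      unfolding vr X_def ..
    finally have main: "X \<le> ennreal C1 * (ennreal K * I + ennreal \<eta> * (ennreal C2 * X))" .
    obtain x where x: "X = ennreal x" "0 \<le> x" using Xfin by (cases X) auto
    obtain i where i: "I = ennreal i" "0 \<le> i" using fin unfolding I_def[symmetric] by (cases I) auto
    have "x \<le> C1 * (K * i + \<eta> * (C2 * x))"
      using main C1(1) C2(1) K(1) \<eta> x(2) i(2)
      by (simp add: x(1) i(1) ennreal_mult[symmetric] ennreal_plus[symmetric] del: ennreal_plus)
    also have "\<dots> = C1 * K * i + C1 * (\<eta> * C2) * x" by (simp add: algebra_simps)
    also have "\<dots> \<le> C1 * K * i + 1 / 2 * x" using \<eta>_le x(2) by (intro add_left_mono mult_right_mono)
    finally have "x \<le> 2 * (C1 * K) * i" by simp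
    then have "X \<le> ennreal (2 * (C1 * K)) * I"
      using C1(1) K(1) i by (simp add: x(1) i(1) ennreal_mult[symmetric] ennreal_leI)
    then show ?thesis by (simp add: X_def I_def U_def a_def)
  qed
  then show ?thesis using C1(1) K(1) by (intro that[of "2 * (C1 * K)"]) auto
qed

text \<open>The sets where the partial sums exceed the level increase to the superlevel set of the
  full sum, so continuity of the measure carries the uniform bound over. The exponent is 2 \<rho>
  because \<open>sq_fun\<close> is already a square.\<close>

theorem weak_type_large:
  assumes \<alpha>: "0 < \<alpha>" and \<rho>: "1 < \<rho>"
  obtains C where "0 \<le> C" "\<And>(f :: real ^ 'n \<Rightarrow> real) s. f \<in> borel_measurable lebesgue \<Longrightarrow> 0 < s \<Longrightarrow>
    ennreal (s powr (2 * \<rho>)) * emeasure lebesgue {x. ennreal (s\<^sup>2) < sq_fun \<alpha> f x}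
      \<le> ennreal C * (\<integral>\<^sup>+x. ennreal (\<bar>f x\<bar> powr (2 * \<rho>)) \<partial>lebesgue)"
proof -
  obtain C where C: "0 \<le> C" "\<And>(f :: real ^ 'n \<Rightarrow> real) F. finite F \<Longrightarrow> f \<in> borel_measurable lebesgue \<Longrightarrow>
    (\<integral>\<^sup>+x. ennreal (\<bar>f x\<bar> powr (2 * \<rho>)) \<partial>lebesgue) < \<infinity> \<Longrightarrow>
    (\<integral>\<^sup>+x. ennreal ((\<Sum>p\<in>F. (enn2real (coef \<alpha> f p) * ker (1/2) p x)\<^sup>2) powr \<rho>) \<partial>lebesgue)
      \<le> ennreal C * (\<integral>\<^sup>+x. ennreal (\<bar>f x\<bar> powr (2 * \<rho>)) \<partial>lebesgue)"
    by (rule sq_fun_finite_sum[where 'n='n, OF \<alpha> \<rho>], rule that)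
  have "ennreal (s powr (2 * \<rho>)) * emeasure lebesgue {x. ennreal (s\<^sup>2) < sq_fun \<alpha> f x}
      \<le> ennreal (C + 1) * (\<integral>\<^sup>+x. ennreal (\<bar>f x\<bar> powr (2 * \<rho>)) \<partial>lebesgue)"
    if f [measurable]: "f \<in> borel_measurable lebesgue" and s: "0 < s" for f :: "real ^ 'n \<Rightarrow> real" and s
  proof (cases "(\<integral>\<^sup>+x. ennreal (\<bar>f x\<bar> powr (2 * \<rho>)) \<partial>lebesgue) < \<infinity>")
    case False
    then have "(\<integral>\<^sup>+x. ennreal (\<bar>f x\<bar> powr (2 * \<rho>)) \<partial>lebesgue) = top" by (simp add: less_top[symmetric])
    moreover have "ennreal (C + 1) * top = top" using C(1) by (simp add: ennreal_mult_top)
    ultimately show ?thesis by simp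
  next
    case fin: True
    have li: "locally_integrable f" by (rule locally_integrable_power[OF f _ fin]) (use \<rho> in simp)
    define F where "F N = {p :: int \<times> (int ^ 'n). to_nat p < N}" for N :: nat
    have finF: "finite (F N)" for N
      using finite_vimageI[of "{..<N}" "to_nat :: int \<times> (int ^ 'n) \<Rightarrow> nat"] by (simp add: F_def vimage_def)
    define a where "a p = enn2real (coef \<alpha> f p)" for p
    have a: "coef \<alpha> f p = ennreal (a p)" for p
      using coef_finite[OF li, of \<alpha> p] by (simp add: a_def less_top)
    define U where "U N x = (\<Sum>p\<in>F N. (a p * ker (1/2) p x)\<^sup>2)" for N x
    have [measurable]: "U N \<in> borel_measurable lebesgue" for N unfolding U_def by measurable
    have U0: "0 \<le> U N x" for N x by (simp add: U_def sum_nonneg)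
    have U_eq: "ennreal (U N x) = (\<Sum>p\<in>F N. (coef \<alpha> f p * ennreal (ker (1/2) p x))\<^sup>2)" for N x
    proof -
      have "(coef \<alpha> f p * ennreal (ker (1/2) p x))\<^sup>2 = ennreal ((a p * ker (1/2) p x)\<^sup>2)" for p
        unfolding a by (simp add: a_def ennreal_mult[symmetric] ennreal_power)
      then show ?thesis by (simp add: U_def sum_ennreal)
    qed
    define B where "B N = {x. s\<^sup>2 < U N x}" for N
    have B_sets: "B N \<in> sets lebesgue" for N
    proof -
      have "{x \<in> space lebesgue. s\<^sup>2 < U N x} \<in> sets lebesgue" by measurable
      then show ?thesis by (simp add: B_def)
    qed
    have incB: "incseq B"
      unfolding incseq_def B_def U_def
    proof safe
      fix M N :: nat and x assume "M \<le> N" "s\<^sup>2 < (\<Sum>p\<in>F M. (a p * ker (1/2) p x)\<^sup>2)"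
      moreover have "(\<Sum>p\<in>F M. (a p * ker (1/2) p x)\<^sup>2) \<le> (\<Sum>p\<in>F N. (a p * ker (1/2) p x)\<^sup>2)"
        using \<open>M \<le> N\<close> finF by (intro sum_mono2) (auto simp: F_def)
      ultimately show "s\<^sup>2 < (\<Sum>p\<in>F N. (a p * ker (1/2) p x)\<^sup>2)" by linarith
    qed
    have sub: "{x. ennreal (s\<^sup>2) < sq_fun \<alpha> f x} \<subseteq> (\<Union>N. B N)"
    proof
      fix x assume *: "x \<in> {x. ennreal (s\<^sup>2) < sq_fun \<alpha> f x}"
      show "x \<in> (\<Union>N. B N)"
      proof (rule ccontr)
        assume neg: "x \<notin> (\<Union>N. B N)"
        have "sq_fun \<alpha> f x \<le> ennreal (s\<^sup>2)"
          unfolding sq_fun_def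
        proof (rule nsum_le_finite)
          fix G :: "(int \<times> (int ^ 'n)) set" assume G: "finite G"
          have "G \<subseteq> F (Suc (Max (to_nat ` G)))"
            using G by (auto simp: F_def less_Suc_eq_le)
          then have "(\<Sum>p\<in>G. (coef \<alpha> f p * ennreal (ker (1/2) p x))\<^sup>2) \<le> ennreal (U (Suc (Max (to_nat ` G))) x)"
            unfolding U_eq using finF by (intro sum_mono2) auto
          also have "\<dots> \<le> ennreal (s\<^sup>2)" using neg by (intro ennreal_leI) (auto simp: B_def not_less)
          finally show "(\<Sum>p\<in>G. (coef \<alpha> f p * ennreal (ker (1/2) p x))\<^sup>2) \<le> ennreal (s\<^sup>2)" .
        qed
        with * show False by simp
      qed
    qed
    have each: "ennreal (s powr (2 * \<rho>)) * emeasure lebesgue (B N) \<le> ennreal C * (\<integral>\<^sup>+x. ennreal (\<bar>f x\<bar> powr (2 * \<rho>)) \<partial>lebesgue)" for N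
    proof -
      have "B N \<subseteq> {x. ennreal (s powr (2 * \<rho>)) < ennreal (U N x powr \<rho>)}"
      proof
        fix x assume "x \<in> B N"
        then have "s\<^sup>2 < U N x" by (simp add: B_def)
        then have "(s\<^sup>2) powr \<rho> < U N x powr \<rho>" using \<rho> by (intro powr_less_mono2) auto
        moreover have "(s\<^sup>2) powr \<rho> = s powr (2 * \<rho>)" using powr_powr[of s 2 \<rho>] s by (simp add: powr_numeral)
        ultimately show "x \<in> {x. ennreal (s powr (2 * \<rho>)) < ennreal (U N x powr \<rho>)}" by (simp add: ennreal_less_iff)
      qed
      moreover have "{x. ennreal (s powr (2 * \<rho>)) < ennreal (U N x powr \<rho>)} \<in> sets lebesgue"
        by (intro superlevel_sets) measurable
      ultimately have "emeasure lebesgue (B N) \<le> emeasure lebesgue {x. ennreal (s powr (2 * \<rho>)) < ennreal (U N x powr \<rho>)}"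
        by (rule emeasure_mono)
      then have "ennreal (s powr (2 * \<rho>)) * emeasure lebesgue (B N)
          \<le> ennreal (s powr (2 * \<rho>)) * emeasure lebesgue {x. ennreal (s powr (2 * \<rho>)) < ennreal (U N x powr \<rho>)}"
        by (rule mult_left_mono) simp
      also have "\<dots> \<le> (\<integral>\<^sup>+x. ennreal (U N x powr \<rho>) \<partial>lebesgue)" by (rule markov) measurable
      also have "\<dots> \<le> ennreal C * (\<integral>\<^sup>+x. ennreal (\<bar>f x\<bar> powr (2 * \<rho>)) \<partial>lebesgue)"
        unfolding U_def a_def by (rule C(2)[OF finF f fin])
      finally show ?thesis .
    qed
    have "emeasure lebesgue {x. ennreal (s\<^sup>2) < sq_fun \<alpha> f x} \<le> emeasure lebesgue (\<Union>N. B N)"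
      using B_sets by (intro emeasure_mono sub) auto
    also have "\<dots> = (SUP N. emeasure lebesgue (B N))"
      using B_sets incB by (intro SUP_emeasure_incseq[symmetric]) auto
    finally have "ennreal (s powr (2 * \<rho>)) * emeasure lebesgue {x. ennreal (s\<^sup>2) < sq_fun \<alpha> f x}
       \<le> ennreal (s powr (2 * \<rho>)) * (SUP N. emeasure lebesgue (B N))" by (rule mult_left_mono) simp
    also have "\<dots> = (SUP N. ennreal (s powr (2 * \<rho>)) * emeasure lebesgue (B N))"
      by (rule SUP_mult_left_ennreal)
    also have "\<dots> \<le> ennreal C * (\<integral>\<^sup>+x. ennreal (\<bar>f x\<bar> powr (2 * \<rho>)) \<partial>lebesgue)"
      by (rule SUP_least) (rule each)
    also have "\<dots> \<le> ennreal (C + 1) * (\<integral>\<^sup>+x. ennreal (\<bar>f x\<bar> powr (2 * \<rho>)) \<partial>lebesgue)"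
      by (intro mult_right_mono ennreal_leI) auto
    finally show ?thesis .
  qed
  then show ?thesis using C(1) by (intro that[of "C + 1"]) auto
qed

section \<open>The modular estimate\<close>

lemma ennreal_less_square_iff: "(a::ennreal)\<^sup>2 < b\<^sup>2 \<longleftrightarrow> a < b"
proof (cases a; cases b)
  fix r s assume "a = ennreal r" "0 \<le> r" "b = ennreal s" "0 \<le> s"
  then show ?thesis
    by (simp add: ennreal_power ennreal_less_iff power_mono_iff abs_square_less_1 power2_less_imp_less power_strict_mono less_le)
qed (auto simp: ennreal_power ennreal_less_top)

lemma ennreal_sqrt_square [simp]: "(ennreal_sqrt a)\<^sup>2 = a"
  by (cases a) (auto simp: ennreal_sqrt_def ennreal_power top_ennreal_def[symmetric] infinity_ennreal_def)

lemma less_ennreal_sqrt_iff: "0 \<le> c \<Longrightarrow> ennreal c < ennreal_sqrt a \<longleftrightarrow> ennreal (c\<^sup>2) < a"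
  using ennreal_less_square_iff[of "ennreal c" "ennreal_sqrt a"] by (simp add: ennreal_power)

lemma ennreal_sqrt_le: "a \<le> b\<^sup>2 \<Longrightarrow> ennreal_sqrt a \<le> b"
  using ennreal_less_square_iff[of b "ennreal_sqrt a"] by (simp add: not_less[symmetric])

lemma borel_measurable_ennreal_sqrt [measurable]: "ennreal_sqrt \<in> borel_measurable borel"
  unfolding ennreal_sqrt_def by measurable

lemma less_ennreal_mult_iff:
  assumes "0 < \<mu>"
  shows "ennreal s < ennreal (1 / \<mu>) * a \<longleftrightarrow> ennreal (\<mu> * s) < a"
proof (cases a)
  case (real r)
  then show ?thesis using assms
    by (cases "0 \<le> s") (auto simp: ennreal_mult[symmetric] ennreal_less_iff field_simps ennreal_neg mult_le_0_iff
        mult_nonneg_nonpos zero_less_mult_iff)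
next
  case top
  then show ?thesis using assms by (simp add: ennreal_mult_top)
qed

lemma borel_measurable_mono_ennreal:
  fixes h :: "real \<Rightarrow> ennreal"
  assumes "mono h" shows "h \<in> borel_measurable borel"
proof (rule borel_measurableI_greater)
  fix c
  have "is_interval {x. c < h x}"
    unfolding is_interval_1 using monoD[OF assms] by (fastforce intro: less_le_trans)
  then show "{x \<in> space borel. c < h x} \<in> sets borel" by (simp add: real_interval_borel_measurable)
qed

text \<open>\<Phi> is unconstrained at negative arguments, so it is first made monotone on the whole
  line by composition with \<open>max 0\<close>.\<close>

lemma borel_measurable_young_abs:
  fixes \<Phi> :: "real \<Rightarrow> ennreal"
  assumes mono: "\<And>s t. 0 \<le> s \<Longrightarrow> s \<le> t \<Longrightarrow> \<Phi> s \<le> \<Phi> t" and f: "f \<in> borel_measurable M"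
  shows "(\<lambda>x. \<Phi> \<bar>f x\<bar>) \<in> borel_measurable M"
proof -
  have "mono (\<lambda>t. \<Phi> (max 0 t))" using mono by (intro monoI) auto
  then have "(\<lambda>t. \<Phi> (max 0 t)) \<in> borel_measurable borel" by (rule borel_measurable_mono_ennreal)
  moreover have "(\<lambda>x. \<bar>f x\<bar>) \<in> borel_measurable M" using f by measurable
  ultimately have "(\<lambda>x. \<Phi> (max 0 \<bar>f x\<bar>)) \<in> borel_measurable M" by (rule measurable_compose[rotated])
  then show ?thesis by simp
qed

text \<open>At each level f is cut at the height \<open>\<mu> * sz k\<close>: weak type (1,1) is
  applied to the large values and weak type (q,q) to the small ones. Both pieces are bounded by |f|
  and thus remain locally integrable, as \<open>sq_fun_add\<close> requires.\<close>

theorem sq_fun_modular: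
  fixes \<Phi> :: "real \<Rightarrow> ennreal"
  assumes \<alpha>: "0 < \<alpha>" and lower: "lower_type \<Phi> p\<^sub>0" and upper: "upper_type \<Phi> p\<^sub>1" and p0: "1 < p\<^sub>0"
    and mono: "\<And>s t. 0 \<le> s \<Longrightarrow> s \<le> t \<Longrightarrow> \<Phi> s \<le> \<Phi> t"
  obtains C where "0 \<le> C" "\<And>(f :: real ^ 'n \<Rightarrow> real) \<mu>. locally_integrable f \<Longrightarrow> 0 < \<mu> \<Longrightarrow>
    (\<integral>\<^sup>+x. layers \<Phi> (ennreal (1 / \<mu>) * ennreal_sqrt (sq_fun \<alpha> f x)) \<partial>lebesgue)
      \<le> ennreal C * (\<integral>\<^sup>+x. \<Phi> (\<bar>f x\<bar> / \<mu>) \<partial>lebesgue)"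
proof -
  \<comment> \<open>The maximum with 2 ensures \<rho> > 1, and doubling then gives q above
    \<open>p\<^sub>1\<close>.\<close>
  define \<rho> where "\<rho> = max 2 p\<^sub>1"
  define q where "q = 2 * \<rho>"
  have \<rho>: "1 < \<rho>" and q: "p\<^sub>1 < q" by (auto simp: \<rho>_def q_def)
  have one: "0 < (1::real)" by simp
  obtain C1 where C1: "0 \<le> C1" "\<And>(f :: real ^ 'n \<Rightarrow> real) s. integrable lebesgue f \<Longrightarrow> 0 < s \<Longrightarrow>
    ennreal s * emeasure lebesgue {x. ennreal (s\<^sup>2) < sq_fun \<alpha> f x} \<le> ennreal C1 * (\<integral>\<^sup>+z. ennreal \<bar>f z\<bar> \<partial>lebesgue)"
    by (rule weak_type_1_1[where 'n='n, OF \<alpha>], rule that)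
  obtain C2 where C2: "0 \<le> C2" "\<And>(f :: real ^ 'n \<Rightarrow> real) s. f \<in> borel_measurable lebesgue \<Longrightarrow> 0 < s \<Longrightarrow>
    ennreal (s powr (2 * \<rho>)) * emeasure lebesgue {x. ennreal (s\<^sup>2) < sq_fun \<alpha> f x}
      \<le> ennreal C2 * (\<integral>\<^sup>+x. ennreal (\<bar>f x\<bar> powr (2 * \<rho>)) \<partial>lebesgue)"
    by (rule weak_type_large[where 'n='n, OF \<alpha> \<rho>], rule that)
  obtain C where C: "0 \<le> C" "\<And>K (g :: real ^ 'n \<Rightarrow> ennreal) (f :: real ^ 'n \<Rightarrow> real). 0 \<le> K \<Longrightarrow> g \<in> borel_measurable lebesgue \<Longrightarrow>
    f \<in> borel_measurable lebesgue \<Longrightarrow> (\<lambda>x. \<Phi> \<bar>f x\<bar>) \<in> borel_measurable lebesgue \<Longrightarrow>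
    \<forall>k. emeasure lebesgue {x. ennreal (sz k) < g x} \<le>
      ennreal K * ((\<integral>\<^sup>+x. ennreal (1 / sz k * \<bar>f x\<bar>) * indicator {x. 1 * sz k < \<bar>f x\<bar>} x \<partial>lebesgue) +
        (\<integral>\<^sup>+x. ennreal (sz k powr - q * \<bar>f x\<bar> powr q) * indicator {x. \<bar>f x\<bar> \<le> 1 * sz k} x \<partial>lebesgue)) \<Longrightarrow>
    (\<integral>\<^sup>+x. layers \<Phi> (g x) \<partial>lebesgue) \<le> ennreal (K * C) * (\<integral>\<^sup>+x. \<Phi> \<bar>f x\<bar> \<partial>lebesgue)"
    by (rule interpolation[where 'n='n, OF lower upper p0 q one], rule that)
  \<comment> \<open>The summand 1 keeps K1 positive, so that the bound is trivial when the large
    part of f is not integrable.\<close>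
  define K1 where "K1 = 2 * C1 + 1"
  define K2 where "K2 = 2 powr q * C2"
  define K where "K = K1 + K2"
  have K12: "0 < K1" "0 \<le> K2" using C1(1) C2(1) by (auto simp: K1_def K2_def)
  have "(\<integral>\<^sup>+x. layers \<Phi> (ennreal (1 / \<mu>) * ennreal_sqrt (sq_fun \<alpha> f x)) \<partial>lebesgue)
      \<le> ennreal (K * C) * (\<integral>\<^sup>+x. \<Phi> (\<bar>f x\<bar> / \<mu>) \<partial>lebesgue)"
    if li: "locally_integrable f" and \<mu>: "0 < \<mu>" for f :: "real ^ 'n \<Rightarrow> real" and \<mu>
  proof -
    have f [measurable]: "f \<in> borel_measurable lebesgue" using li by (simp add: locally_integrable_iff)
    have dist: "emeasure lebesgue {x. ennreal (sz k) < ennreal (1 / \<mu>) * ennreal_sqrt (sq_fun \<alpha> f x)} \<le>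
      ennreal K * ((\<integral>\<^sup>+x. ennreal (1 / sz k * \<bar>f x / \<mu>\<bar>) * indicator {x. 1 * sz k < \<bar>f x / \<mu>\<bar>} x \<partial>lebesgue) +
        (\<integral>\<^sup>+x. ennreal (sz k powr - q * \<bar>f x / \<mu>\<bar> powr q) * indicator {x. \<bar>f x / \<mu>\<bar> \<le> 1 * sz k} x \<partial>lebesgue))"
      (is "_ \<le> ennreal K * (?I1 + ?I2)") for k
    proof -
      define s where "s = \<mu> * sz k"
      have s: "0 < s" using \<mu> by (simp add: s_def)
      define A where "A = {x. s < \<bar>f x\<bar>}"
      have A_iff: "x \<in> A \<longleftrightarrow> sz k < \<bar>f x / \<mu>\<bar>" for x using \<mu> by (simp add: A_def s_def field_simps)
      have [measurable]: "A \<in> sets lebesgue"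
      proof -
        have "{x \<in> space lebesgue. s < \<bar>f x\<bar>} \<in> sets lebesgue" by measurable
        then show ?thesis by (simp add: A_def)
      qed
      have [measurable]: "- A \<in> sets lebesgue" using \<open>A \<in> sets lebesgue\<close> by (simp add: Compl_eq_Diff_UNIV sets.Diff)
      define f1 where "f1 x = f x * indicator A x" for x
      define f2 where "f2 x = f x * indicator (- A) x" for x
      have f1_meas [measurable]: "f1 \<in> borel_measurable lebesgue" unfolding f1_def by measurable
      have f2_meas [measurable]: "f2 \<in> borel_measurable lebesgue" unfolding f2_def by measurable
      have li1: "locally_integrable f1"
        by (rule locally_integrable_bound[OF li f1_meas]) (simp add: f1_def split: split_indicator)
      have li2: "locally_integrable f2"
        by (rule locally_integrable_bound[OF li f2_meas]) (simp add: f2_def split: split_indicator)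
      have f12: "f = (\<lambda>x. f1 x + f2 x)" by (auto simp: f1_def f2_def split: split_indicator)
      have "{x. ennreal (sz k) < ennreal (1 / \<mu>) * ennreal_sqrt (sq_fun \<alpha> f x)}
         \<subseteq> {x. ennreal ((s / 2)\<^sup>2) < sq_fun \<alpha> f1 x} \<union> {x. ennreal ((s / 2)\<^sup>2) < sq_fun \<alpha> f2 x}"
      proof
        fix x assume "x \<in> {x. ennreal (sz k) < ennreal (1 / \<mu>) * ennreal_sqrt (sq_fun \<alpha> f x)}"
        then have *: "ennreal (s\<^sup>2) < sq_fun \<alpha> f x"
          using \<mu> s by (simp add: less_ennreal_mult_iff less_ennreal_sqrt_iff s_def[symmetric])
        show "x \<in> {x. ennreal ((s / 2)\<^sup>2) < sq_fun \<alpha> f1 x} \<union> {x. ennreal ((s / 2)\<^sup>2) < sq_fun \<alpha> f2 x}"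
        proof (rule ccontr)
          assume "\<not> ?thesis"
          then have le: "sq_fun \<alpha> f1 x \<le> ennreal ((s / 2)\<^sup>2)" "sq_fun \<alpha> f2 x \<le> ennreal ((s / 2)\<^sup>2)"
            by (auto simp: not_less)
          have "sq_fun \<alpha> f x \<le> 2 * (sq_fun \<alpha> f1 x + sq_fun \<alpha> f2 x)"
            unfolding f12 by (rule sq_fun_add[OF \<alpha> li1[unfolded f12] li2[unfolded f12]])
          also have "\<dots> \<le> 2 * (ennreal ((s / 2)\<^sup>2) + ennreal ((s / 2)\<^sup>2))" using le by (intro mult_left_mono add_mono) auto
          also have "\<dots> = ennreal (s\<^sup>2)"
            by (simp add: ennreal_plus[symmetric] numeral_mult_ennreal power_divide del: ennreal_plus)
          finally show False using * by simp
        qed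
      qed
      then have "emeasure lebesgue {x. ennreal (sz k) < ennreal (1 / \<mu>) * ennreal_sqrt (sq_fun \<alpha> f x)}
        \<le> emeasure lebesgue ({x. ennreal ((s / 2)\<^sup>2) < sq_fun \<alpha> f1 x} \<union> {x. ennreal ((s / 2)\<^sup>2) < sq_fun \<alpha> f2 x})"
        by (intro emeasure_mono sets.Un superlevel_sets borel_measurable_sq_fun)
      also have "\<dots> \<le> emeasure lebesgue {x. ennreal ((s / 2)\<^sup>2) < sq_fun \<alpha> f1 x} + emeasure lebesgue {x. ennreal ((s / 2)\<^sup>2) < sq_fun \<alpha> f2 x}"
        by (intro emeasure_subadditive superlevel_sets borel_measurable_sq_fun)
      also have "\<dots> \<le> ennreal K1 * ?I1 + ennreal K2 * ?I2"
      proof (rule add_mono)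
        have I1: "?I1 = ennreal (1 / s) * (\<integral>\<^sup>+x. ennreal \<bar>f1 x\<bar> \<partial>lebesgue)"
          using s \<mu> by (subst nn_integral_cmult[symmetric], measurable, intro nn_integral_cong)
            (auto simp: f1_def A_iff s_def ennreal_mult[symmetric] abs_divide split: split_indicator)
        show "emeasure lebesgue {x. ennreal ((s / 2)\<^sup>2) < sq_fun \<alpha> f1 x} \<le> ennreal K1 * ?I1"
        proof (cases "(\<integral>\<^sup>+x. ennreal \<bar>f1 x\<bar> \<partial>lebesgue) < \<infinity>")
          case True
          then have int: "integrable lebesgue f1" by (simp add: integrable_iff_bounded)
          have "emeasure lebesgue {x. ennreal ((s / 2)\<^sup>2) < sq_fun \<alpha> f1 x} =
             ennreal (2 / s) * (ennreal (s / 2) * emeasure lebesgue {x. ennreal ((s / 2)\<^sup>2) < sq_fun \<alpha> f1 x})"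
            using s by (simp add: mult.assoc[symmetric] ennreal_mult[symmetric])
          also have "\<dots> \<le> ennreal (2 / s) * (ennreal C1 * (\<integral>\<^sup>+z. ennreal \<bar>f1 z\<bar> \<partial>lebesgue))"
            using s by (intro mult_left_mono C1(2) int) auto
          also have "\<dots> = ennreal (2 * C1) * ?I1"
            unfolding I1 using s C1(1) by (simp add: mult.assoc[symmetric] ennreal_mult[symmetric])
          also have "\<dots> \<le> ennreal K1 * ?I1" by (intro mult_right_mono ennreal_leI) (auto simp: K1_def)
          finally show ?thesis .
        next
          case False
          then have "(\<integral>\<^sup>+x. ennreal \<bar>f1 x\<bar> \<partial>lebesgue) = top" by (simp add: less_top[symmetric])
          then have "?I1 = top" using s unfolding I1 by (simp add: ennreal_mult_top)
          then show ?thesis using K12 by (simp add: ennreal_mult_top)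
        qed
        have I2: "?I2 = ennreal (s powr - q) * (\<integral>\<^sup>+x. ennreal (\<bar>f2 x\<bar> powr q) \<partial>lebesgue)"
          using s \<mu> q by (subst nn_integral_cmult[symmetric], measurable, intro nn_integral_cong)
            (auto simp: f2_def A_iff s_def ennreal_mult[symmetric] abs_divide powr_divide powr_mult powr_minus_divide split: split_indicator)
        have "emeasure lebesgue {x. ennreal ((s / 2)\<^sup>2) < sq_fun \<alpha> f2 x} =
             ennreal ((s / 2) powr - q) * (ennreal ((s / 2) powr q) * emeasure lebesgue {x. ennreal ((s / 2)\<^sup>2) < sq_fun \<alpha> f2 x})"
          using s by (simp add: mult.assoc[symmetric] ennreal_mult[symmetric] powr_add[symmetric])
        also have "\<dots> \<le> ennreal ((s / 2) powr - q) * (ennreal C2 * (\<integral>\<^sup>+z. ennreal (\<bar>f2 z\<bar> powr q) \<partial>lebesgue))"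
          using s unfolding q_def by (intro mult_left_mono C2(2) f2_meas) auto
        also have "\<dots> = ennreal ((s / 2) powr - q * C2) * (\<integral>\<^sup>+z. ennreal (\<bar>f2 z\<bar> powr q) \<partial>lebesgue)"
          using C2(1) by (simp add: ennreal_mult mult.assoc)
        also have "(s / 2) powr - q * C2 = K2 * s powr - q"
          using s by (simp add: K2_def powr_divide powr_minus_divide)
        also have "ennreal (K2 * s powr - q) * (\<integral>\<^sup>+z. ennreal (\<bar>f2 z\<bar> powr q) \<partial>lebesgue) = ennreal K2 * ?I2"
          unfolding I2 using K12 by (simp add: ennreal_mult mult.assoc)
        finally show "emeasure lebesgue {x. ennreal ((s / 2)\<^sup>2) < sq_fun \<alpha> f2 x} \<le> ennreal K2 * ?I2" .
      qed
      also have "\<dots> \<le> ennreal K * ?I1 + ennreal K * ?I2"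
        using K12 by (intro add_mono mult_right_mono ennreal_leI) (auto simp: K_def)
      finally show ?thesis by (simp add: distrib_left)
    qed
    have fm: "(\<lambda>x. f x / \<mu>) \<in> borel_measurable lebesgue" by measurable
    have gm: "(\<lambda>x. ennreal (1 / \<mu>) * ennreal_sqrt (sq_fun \<alpha> f x)) \<in> borel_measurable lebesgue" by measurable
    have "(\<integral>\<^sup>+x. layers \<Phi> (ennreal (1 / \<mu>) * ennreal_sqrt (sq_fun \<alpha> f x)) \<partial>lebesgue)
      \<le> ennreal (K * C) * (\<integral>\<^sup>+x. \<Phi> \<bar>f x / \<mu>\<bar> \<partial>lebesgue)"
      using dist K12 mono by (intro C(2) gm fm borel_measurable_young_abs) (auto simp: K_def)
    then show ?thesis using \<mu> by (simp add: abs_divide)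
  qed
  then show ?thesis using C(1) K12 by (intro that[of "K * C"]) (auto simp: K_def)
qed

section \<open>Discretization of the intrinsic square function\<close>

text \<open>For |u| = 2 the points x + u and x - u are at distance 4, so one of them lies outside
  the unit ball, where \<psi> vanishes. Hoelder continuity over the distance 2 gives the bound
  \<open>2 powr \<alpha> \<le> 2\<close>.\<close>

lemma intrinsic_family_bound:
  fixes \<psi> :: "real ^ 'n \<Rightarrow> real"
  assumes \<psi>: "\<psi> \<in> intrinsic_family \<alpha>" and \<alpha>: "0 < \<alpha>" "\<alpha> \<le> 1"
  shows "\<bar>\<psi> x\<bar> \<le> 2"
proof -
  obtain u :: "real ^ 'n" where u: "norm u = 2" using vector_choose_size[of 2] by auto
  have "4 \<le> norm (x + u) + norm (x - u)"
  proof -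
    have "norm ((x + u) - (x - u)) \<le> norm (x + u) + norm (x - u)" by (rule norm_triangle_ineq4)
    moreover have "(x + u) - (x - u) = 2 *\<^sub>R u" by (simp add: scaleR_2)
    ultimately show ?thesis using u by simp
  qed
  then have "1 < norm (x + u) \<or> 1 < norm (x - u)" by linarith
  then obtain x' where x': "1 < norm x'" "norm (x - x') = 2"
    using u by (metis add_diff_cancel_left' diff_diff_eq2 diff_add_cancel norm_minus_commute add.commute)
  have "\<bar>\<psi> x - \<psi> x'\<bar> \<le> norm (x - x') powr \<alpha>" using \<psi> by (simp add: intrinsic_family_def)
  also have "\<dots> \<le> 2 powr 1" unfolding x'(2) using \<alpha> by (intro powr_mono) auto
  finally show ?thesis using \<psi> x'(1) by (simp add: intrinsic_family_def)
qed

lemma intrinsic_family_continuous: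
  assumes \<psi>: "\<psi> \<in> intrinsic_family \<alpha>" and \<alpha>: "0 < \<alpha>"
  shows "continuous_on UNIV \<psi>"
  by (rule holder_continuous[OF \<alpha>, of 1 _ 1]) (use \<psi> in \<open>auto simp: intrinsic_family_def\<close>)

text \<open>The affine substitution z = y - t x, which preserves vanishing of the integral.\<close>

lemma integral_reflect_dilate:
  fixes \<psi> :: "real ^ 'n \<Rightarrow> real"
  assumes [measurable]: "\<psi> \<in> borel_measurable borel" and t: "0 < t" and 0: "(LINT x|lebesgue. \<psi> x) = 0"
  shows "(LINT z|lebesgue. \<psi> ((y - z) /\<^sub>R t)) = 0"
proof -
  have "(LINT z|lebesgue. \<psi> ((y - z) /\<^sub>R t)) = (LINT z|lborel. \<psi> ((y - z) /\<^sub>R t))"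
    by (rule integral_completion) measurable
  also have "\<dots> = (LINT z|density (distr lborel borel (\<lambda>x. y + (- t) *\<^sub>R x)) (\<lambda>_. \<bar>- t\<bar> ^ DIM(real ^ 'n)). \<psi> ((y - z) /\<^sub>R t))"
    using t by (subst lborel_affine[of "- t" y]) auto
  also have "\<dots> = (LINT x|lborel. \<bar>- t\<bar> ^ DIM(real ^ 'n) *\<^sub>R \<psi> ((y - (y + (- t) *\<^sub>R x)) /\<^sub>R t))"
    by (subst integral_density) (auto simp: integral_distr)
  also have "\<dots> = (LINT x|lborel. \<bar>- t\<bar> ^ DIM(real ^ 'n) *\<^sub>R \<psi> x)"
    using t by simp
  also have "\<dots> = \<bar>- t\<bar> ^ DIM(real ^ 'n) *\<^sub>R (LINT x|lebesgue. \<psi> x)"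
    by (simp add: integral_completion)
  finally show ?thesis using 0 by simp
qed

text \<open>The support radius consists of n sides for the position of y in its cube and of t, at
  most one side. Replacing t by the side costs \<open>2 ^ n\<close> in the normalisation; another
  factor 2 comes from the bound on \<psi>, or from \<open>2 powr \<alpha>\<close> in the Hoelder
  condition. This is the divisor \<open>2 ^ (n + 1)\<close>.\<close>

lemma intrinsic_bump:
  fixes \<psi> :: "real ^ 'n \<Rightarrow> real"
  assumes \<alpha>: "0 < \<alpha>" "\<alpha> \<le> 1" and \<psi>: "\<psi> \<in> intrinsic_family \<alpha>"
    and t: "sz k / 2 < t" "t \<le> sz k" and y: "y \<in> dcube k m"
  shows "(\<lambda>z. dilate t \<psi> (y - z) / 2 ^ (CARD('n) + 1)) \<in> bump \<alpha> (k, m)"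
proof -
  let ?n = "CARD('n)"
  have t0: "0 < t" using t(1) sz_pos[of k] by linarith
  have dil: "dilate t \<psi> w = \<psi> (w /\<^sub>R t) / t ^ ?n" for w
    by (simp add: dilate_def power_int_minus divide_inverse mult.commute)
  have tn: "1 / t ^ ?n \<le> 2 ^ ?n / sz k ^ ?n"
  proof -
    have "(sz k / 2) ^ ?n \<le> t ^ ?n" using t by (intro power_mono) auto
    then have "1 / t ^ ?n \<le> 1 / (sz k / 2) ^ ?n" using t0 by (intro divide_left_mono) auto
    then show ?thesis by (simp add: power_divide)
  qed
  show ?thesis
    unfolding bump_def
  proof (rule CollectI, intro conjI allI impI)
    fix z assume z: "(real ?n + 1) * sz (fst (k, m)) < norm (z - corner (fst (k, m)) (snd (k, m)))"
    have "norm (y - corner k m) \<le> real ?n * sz k" using y by (rule dcube_dist) simp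
    moreover have "norm (z - corner k m) \<le> norm (z - y) + norm (y - corner k m)"
      using norm_triangle_ineq[of "z - y" "y - corner k m"] by simp
    ultimately have "sz k < norm (z - y)" using z by (simp add: algebra_simps)
    then have "t < norm (y - z)" using t by (simp add: norm_minus_commute)
    moreover have "norm ((y - z) /\<^sub>R t) = norm (y - z) / t" using t0 by (simp add: divide_inverse mult.commute del: scaleR_diff_right)
    ultimately have "1 < norm ((y - z) /\<^sub>R t)" using t0 by simp
    then have "\<psi> ((y - z) /\<^sub>R t) = 0" using \<psi> by (auto simp: intrinsic_family_def)
    then show "dilate t \<psi> (y - z) / 2 ^ (?n + 1) = 0" by (simp add: dil)
  next
    fix z
    have "\<bar>dilate t \<psi> (y - z)\<bar> = \<bar>\<psi> ((y - z) /\<^sub>R t)\<bar> * (1 / t ^ ?n)" using t0 by (simp add: dil)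
    also have "\<dots> \<le> 2 * (2 ^ ?n / sz k ^ ?n)"
      using tn t0 by (intro mult_mono intrinsic_family_bound[OF \<psi> \<alpha>]) auto
    finally show "\<bar>dilate t \<psi> (y - z) / 2 ^ (?n + 1)\<bar> \<le> 1 / sz (fst (k, m)) ^ ?n"
      by (simp add: abs_divide field_simps)
  next
    fix z z'
    have "\<bar>\<psi> ((y - z) /\<^sub>R t) - \<psi> ((y - z') /\<^sub>R t)\<bar> \<le> norm ((y - z) /\<^sub>R t - (y - z') /\<^sub>R t) powr \<alpha>"
      using \<psi> by (simp add: intrinsic_family_def)
    also have "norm ((y - z) /\<^sub>R t - (y - z') /\<^sub>R t) = norm (z - z') / t"
    proof -
      have "(y - z) /\<^sub>R t - (y - z') /\<^sub>R t = (z' - z) /\<^sub>R t" by (simp add: scaleR_diff_right[symmetric])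
      then show ?thesis using t0 by (simp add: norm_minus_commute divide_inverse mult.commute)
    qed
    also have "norm (z - z') / t \<le> 2 * (norm (z - z') / sz k)"
    proof -
      have "norm (z - z') / t \<le> norm (z - z') / (sz k / 2)" using t t0 by (intro divide_left_mono) auto
      then show ?thesis by (simp add: mult.commute)
    qed
    then have "(norm (z - z') / t) powr \<alpha> \<le> (2 * (norm (z - z') / sz k)) powr \<alpha>"
      using \<alpha> t0 by (intro powr_mono2) auto
    also have "\<dots> = 2 powr \<alpha> * (norm (z - z') / sz k) powr \<alpha>" by (rule powr_mult)
    also have "\<dots> \<le> 2 powr 1 * (norm (z - z') / sz k) powr \<alpha>" using \<alpha> by (intro mult_right_mono powr_mono) auto
    finally have "\<bar>\<psi> ((y - z) /\<^sub>R t) - \<psi> ((y - z') /\<^sub>R t)\<bar> \<le> 2 * (norm (z - z') / sz k) powr \<alpha>" by simp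
    then have "\<bar>\<psi> ((y - z) /\<^sub>R t) - \<psi> ((y - z') /\<^sub>R t)\<bar> * (1 / t ^ ?n) \<le> 2 * (norm (z - z') / sz k) powr \<alpha> * (2 ^ ?n / sz k ^ ?n)"
      using tn t0 by (intro mult_mono) auto
    moreover have "\<bar>dilate t \<psi> (y - z) - dilate t \<psi> (y - z')\<bar> = \<bar>\<psi> ((y - z) /\<^sub>R t) - \<psi> ((y - z') /\<^sub>R t)\<bar> * (1 / t ^ ?n)"
      using t0 by (simp add: dil diff_divide_distrib[symmetric] abs_divide)
    ultimately have "\<bar>dilate t \<psi> (y - z) - dilate t \<psi> (y - z')\<bar> \<le> 2 * (norm (z - z') / sz k) powr \<alpha> * (2 ^ ?n / sz k ^ ?n)"
      by (simp only:)
    then have "\<bar>dilate t \<psi> (y - z) - dilate t \<psi> (y - z')\<bar> / 2 ^ (?n + 1)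
        \<le> 2 * (norm (z - z') / sz k) powr \<alpha> * (2 ^ ?n / sz k ^ ?n) / 2 ^ (?n + 1)"
      by (rule divide_right_mono) simp
    also have "\<dots> = (norm (z - z') / sz k) powr \<alpha> / sz k ^ ?n" by simp
    finally show "\<bar>dilate t \<psi> (y - z) / 2 ^ (?n + 1) - dilate t \<psi> (y - z') / 2 ^ (?n + 1)\<bar>
       \<le> (norm (z - z') / sz (fst (k, m))) powr \<alpha> / sz (fst (k, m)) ^ ?n"
      unfolding fst_conv diff_divide_distrib[symmetric] abs_divide by simp
  next
    have "(LINT z|lebesgue. \<psi> ((y - z) /\<^sub>R t)) = 0"
    proof (rule integral_reflect_dilate[OF _ t0])
      show "\<psi> \<in> borel_measurable borel"
        by (intro borel_measurable_continuous_onI intrinsic_family_continuous[OF \<psi> \<alpha>(1)])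
    qed (use \<psi> in \<open>simp add: intrinsic_family_def\<close>)
    then show "(LINT z|lebesgue. dilate t \<psi> (y - z) / 2 ^ (?n + 1)) = 0" by (simp add: dil)
  qed
qed

lemma intrinsic_sup_le_coef:
  fixes f :: "real ^ 'n \<Rightarrow> real"
  assumes \<alpha>: "0 < \<alpha>" "\<alpha> \<le> 1" and t: "sz k / 2 < t" "t \<le> sz k" and y: "y \<in> dcube k m"
  shows "intrinsic_sup \<alpha> f t y \<le> ennreal (2 ^ (CARD('n) + 1)) * coef \<alpha> f (k, m)"
  unfolding intrinsic_sup_def
proof (rule SUP_least)
  fix \<psi> :: "real ^ 'n \<Rightarrow> real" assume \<psi>: "\<psi> \<in> intrinsic_family \<alpha>"
  let ?\<eta> = "\<lambda>z. dilate t \<psi> (y - z) / 2 ^ (CARD('n) + 1)"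
  have "convolution f (dilate t \<psi>) y = (LINT z|lebesgue. 2 ^ (CARD('n) + 1) * (f z * ?\<eta> z))"
    unfolding convolution_def by (rule Bochner_Integration.integral_cong) auto
  also have "\<dots> = 2 ^ (CARD('n) + 1) * (LINT z|lebesgue. f z * ?\<eta> z)" by simp
  finally have "convolution f (dilate t \<psi>) y = 2 ^ (CARD('n) + 1) * (LINT z|lebesgue. f z * ?\<eta> z)" .
  moreover have "ennreal \<bar>2 ^ (CARD('n) + 1) * I\<bar> = ennreal (2 ^ (CARD('n) + 1)) * ennreal \<bar>I\<bar>" for I :: real
    by (simp add: abs_mult ennreal_mult)
  ultimately have "ennreal \<bar>convolution f (dilate t \<psi>) y\<bar> = ennreal (2 ^ (CARD('n) + 1)) * ennreal \<bar>LINT z|lebesgue. f z * ?\<eta> z\<bar>"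
    by (simp only:)
  also have "\<dots> \<le> ennreal (2 ^ (CARD('n) + 1)) * coef \<alpha> f (k, m)"
    unfolding coef_def by (intro mult_left_mono SUP_upper intrinsic_bump[OF \<alpha> \<psi> t y]) simp
  finally show "ennreal \<bar>convolution f (dilate t \<psi>) y\<bar> \<le> ennreal (2 ^ (CARD('n) + 1)) * coef \<alpha> f (k, m)" .
qed

text \<open>The interval of heights is open below and closed above, so that the boxes tile the half
  space.\<close>

definition whitney_box :: "int \<times> (int ^ 'n) \<Rightarrow> ((real ^ 'n) \<times> real) set" where
  "whitney_box p = dcube (fst p) (snd p) \<times> {sz (fst p) / 2 <.. sz (fst p)}"

lemma whitney_box_lebesgue [measurable]: "whitney_box p \<in> sets lebesgue"
  unfolding whitney_box_def by (intro lebesgue_of_borel borel_Times) auto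

lemma emeasure_whitney_box: "emeasure lebesgue (whitney_box (p :: int \<times> (int ^ 'n))) \<le> ennreal (sz (fst p) ^ (CARD('n) + 1))"
proof -
  have "emeasure lebesgue (whitney_box p) = emeasure (lborel \<Otimes>\<^sub>M lborel) (whitney_box p)"
    by (simp add: lborel_prod emeasure_completion whitney_box_def borel_Times)
  also have "\<dots> = emeasure lborel (dcube (fst p) (snd p)) * emeasure lborel {sz (fst p) / 2 <.. sz (fst p)}"
    unfolding whitney_box_def by (rule lborel.emeasure_pair_measure_Times) auto
  also have "\<dots> = ennreal (sz (fst p) ^ CARD('n)) * ennreal (sz (fst p) / 2)"
    using emeasure_dcube[of "fst p" "snd p"] by (simp add: emeasure_completion)
  also have "\<dots> \<le> ennreal (sz (fst p) ^ (CARD('n) + 1))"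
    by (subst ennreal_mult[symmetric]) (auto intro!: ennreal_leI)
  finally show ?thesis .
qed

text \<open>The quotient increases with t, and moving y to the corner of its cube costs at most the
  factor n + 1. As the quotient is at most 1, its exponent may be lowered to 2 n + 1, twice that of
  \<open>ker (1/2)\<close>.\<close>

lemma gstar_kernel_le:
  fixes x y :: "real ^ 'n"
  assumes l: "2 * real CARD('n) + 1 \<le> real CARD('n) * l"
    and t: "0 < t" "t \<le> sz k" and y: "y \<in> dcube k m"
  shows "(t / (t + norm (x - y))) powr (real CARD('n) * l) \<le>
    (real CARD('n) + 1) powr (2 * real CARD('n) + 1) * (ker (1/2) (k, m) x)\<^sup>2"
proof -
  let ?n = "real CARD('n)"
  let ?u = "t / (t + norm (x - y))" and ?v = "sz k / (sz k + norm (x - corner k m))"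
  have u: "0 \<le> ?u" "?u \<le> 1" using t by (auto simp: divide_le_eq add_pos_nonneg)
  have "?u \<le> sz k / (sz k + norm (x - y))"
  proof -
    have "t * (sz k + norm (x - y)) \<le> sz k * (t + norm (x - y))"
      using t by (simp add: algebra_simps mult_right_mono)
    then show ?thesis using t by (simp add: divide_le_eq le_divide_eq add_pos_nonneg mult.commute frac_le_eq field_simps)
  qed
  also have "\<dots> \<le> (?n + 1) * ?v"
  proof -
    have "norm (y - corner k m) \<le> ?n * sz k" using y by (rule dcube_dist) simp
    then have "sz k + norm (x - corner k m) \<le> (?n + 1) * sz k + norm (x - y)"
      using norm_triangle_ineq[of "x - y" "y - corner k m"] by (simp add: algebra_simps)
    also have "\<dots> \<le> (?n + 1) * (sz k + norm (x - y))" by (simp add: algebra_simps)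
    finally have "sz k / ((?n + 1) * (sz k + norm (x - y))) \<le> ?v"
      by (intro divide_left_mono) (auto intro!: mult_pos_pos add_pos_nonneg)
    then have "(?n + 1) * (sz k / ((?n + 1) * (sz k + norm (x - y)))) \<le> (?n + 1) * ?v"
      by (intro mult_left_mono) auto
    moreover have "(?n + 1) * (sz k / ((?n + 1) * (sz k + norm (x - y)))) = sz k / (sz k + norm (x - y))"
      by (simp add: add_pos_nonneg)
    ultimately show ?thesis by simp
  qed
  finally have uv: "?u \<le> (?n + 1) * ?v" .
  have "?u powr (?n * l) \<le> ?u powr (2 * ?n + 1)" using u l by (intro powr_mono') auto
  also have "\<dots> \<le> ((?n + 1) * ?v) powr (2 * ?n + 1)" using uv u by (intro powr_mono2) auto
  also have "\<dots> = (?n + 1) powr (2 * ?n + 1) * ?v powr (2 * ?n + 1)" by (rule powr_mult)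
  also have "?v powr (2 * ?n + 1) = (ker (1/2) (k, m) x)\<^sup>2"
    unfolding ker_def power2_eq_square powr_add[symmetric] by simp
  finally show ?thesis .
qed

text \<open>On each box the integrand is bounded by a constant, and the density
  \<open>1 / t ^ (n + 1)\<close> cancels the measure of the box, so that each cube contributes a
  multiple of its own term of \<open>sq_fun\<close>.\<close>

theorem gstar_le_sq_fun:
  assumes \<alpha>: "0 < \<alpha>" "\<alpha> \<le> 1" and l: "2 * real CARD('n) + 1 \<le> real CARD('n) * l"
  obtains C where "0 \<le> C" "\<And>(f :: real ^ 'n \<Rightarrow> real) x. intrinsic_gstar l \<alpha> f x \<le> ennreal C * ennreal_sqrt (sq_fun \<alpha> f x)"
proof -
  let ?n = "CARD('n)"
  \<comment> \<open>The three factors come from the comparison of kernels, from the squared constant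
    of \<open>intrinsic_sup_le_coef\<close>, and from replacing \<open>t ^ (n + 1)\<close> by the
    power of the side.\<close>
  define A where "A = (real ?n + 1) powr (2 * real ?n + 1) * (2 ^ (?n + 1))\<^sup>2 * 2 ^ (?n + 1)"
  have A: "0 \<le> A" by (simp add: A_def)
  have "intrinsic_gstar l \<alpha> f x \<le> ennreal (sqrt A) * ennreal_sqrt (sq_fun \<alpha> f x)" for f :: "real ^ 'n \<Rightarrow> real" and x
    unfolding intrinsic_gstar_def
  proof (rule ennreal_sqrt_le)
    let ?h = "\<lambda>(y, t). ennreal ((t / (t + norm (x - y))) powr (real ?n * l)) *
        (intrinsic_sup \<alpha> f t y)\<^sup>2 / ennreal (t ^ (?n + 1))"
    let ?c = "\<lambda>p. ennreal (A / sz (fst p) ^ (?n + 1)) * (coef \<alpha> f p * ennreal (ker (1/2) p x))\<^sup>2"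
    have pw: "?h q * indicator (UNIV \<times> {0<..}) q \<le> (\<Sum>\<^sup>+p. ?c p * indicator (whitney_box p) q)" for q :: "(real ^ 'n) \<times> real"
    proof (cases "0 < snd q")
      case True
      obtain y t where q: "q = (y, t)" by (cases q)
      have t0: "0 < t" using True by (simp add: q)
      obtain k where k: "sz k / 2 < t" "t \<le> sz k"
      proof -
        obtain k where k: "sz k \<le> t" "t < 2 * sz k" using t0 by (rule sz_bracket)
        show ?thesis
        proof (cases "sz k = t")
          case True
          then show ?thesis using t0 by (intro that[of k]) auto
        next
          case False
          then show ?thesis using k by (intro that[of "k + 1"]) (auto simp: sz_Suc)
        qed
      qed
      define m where "m = cidx k y"
      have y: "y \<in> dcube k m" by (simp add: m_def dcube_def)
      have box: "q \<in> whitney_box (k, m)" using k y by (simp add: q whitney_box_def)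
      have tn: "1 / t ^ (?n + 1) \<le> 2 ^ (?n + 1) / sz k ^ (?n + 1)"
      proof -
        have "(sz k / 2) ^ (?n + 1) \<le> t ^ (?n + 1)" using k by (intro power_mono) auto
        then have "1 / t ^ (?n + 1) \<le> 1 / (sz k / 2) ^ (?n + 1)" using t0 by (intro divide_left_mono) auto
        then show ?thesis by (simp add: power_divide)
      qed
      have "?h q = ennreal ((t / (t + norm (x - y))) powr (real ?n * l)) * (intrinsic_sup \<alpha> f t y)\<^sup>2 * ennreal (1 / t ^ (?n + 1))"
        using t0 by (simp add: q divide_ennreal_def inverse_ennreal inverse_eq_divide)
      also have "\<dots> \<le> ennreal ((real ?n + 1) powr (2 * real ?n + 1) * (ker (1/2) (k, m) x)\<^sup>2) *
          (ennreal (2 ^ (?n + 1)) * coef \<alpha> f (k, m))\<^sup>2 * ennreal (2 ^ (?n + 1) / sz k ^ (?n + 1))"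
        using tn by (intro mult_mono power_mono ennreal_leI gstar_kernel_le[OF l t0 k(2) y] intrinsic_sup_le_coef[OF \<alpha> k y]) auto
      also have "\<dots> = ?c (k, m)"
      proof -
        have "ennreal ((real ?n + 1) powr (2 * real ?n + 1) * (ker (1/2) (k, m) x)\<^sup>2) *
          (ennreal (2 ^ (?n + 1)) * coef \<alpha> f (k, m))\<^sup>2 * ennreal (2 ^ (?n + 1) / sz k ^ (?n + 1))
          = (ennreal ((real ?n + 1) powr (2 * real ?n + 1)) * ennreal ((2 ^ (?n + 1))\<^sup>2) * ennreal (2 ^ (?n + 1) / sz k ^ (?n + 1))) *
            (coef \<alpha> f (k, m) * ennreal (ker (1/2) (k, m) x))\<^sup>2"
        proof -
          have 1: "ennreal ((real ?n + 1) powr (2 * real ?n + 1) * (ker (1/2) (k, m) x)\<^sup>2) =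
              ennreal ((real ?n + 1) powr (2 * real ?n + 1)) * (ennreal (ker (1/2) (k, m) x))\<^sup>2"
            by (simp add: ennreal_mult ennreal_power)
          have 2: "(ennreal (2 ^ (?n + 1)))\<^sup>2 = ennreal ((2 ^ (?n + 1))\<^sup>2)" by (rule ennreal_power) simp
          show ?thesis unfolding 1 power_mult_distrib 2 by (simp only: mult_ac)
        qed
        also have "ennreal ((real ?n + 1) powr (2 * real ?n + 1)) * ennreal ((2 ^ (?n + 1))\<^sup>2) * ennreal (2 ^ (?n + 1) / sz k ^ (?n + 1))
          = ennreal (A / sz k ^ (?n + 1))"
          by (simp add: ennreal_mult[symmetric] A_def)
        finally show ?thesis by simp
      qed
      also have "\<dots> = ?c (k, m) * indicator (whitney_box (k, m)) q" using box by simp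
      also have "\<dots> \<le> (\<Sum>\<^sup>+p. ?c p * indicator (whitney_box p) q)" by (rule nsum_upper)
      finally show ?thesis using t0 by (simp add: q)
    qed (auto simp: indicator_def)
    have "(\<integral>\<^sup>+q\<in>UNIV \<times> {0<..}. ?h q \<partial>lebesgue) \<le> (\<integral>\<^sup>+q. (\<Sum>\<^sup>+p. ?c p * indicator (whitney_box p) q) \<partial>lebesgue)"
      by (intro nn_integral_mono pw)
    also have "\<dots> = (\<Sum>\<^sup>+p. \<integral>\<^sup>+q. ?c p * indicator (whitney_box p) q \<partial>lebesgue)"
      by (rule nn_integral_nsum) measurable
    also have "\<dots> = (\<Sum>\<^sup>+p. ?c p * emeasure lebesgue (whitney_box p))"
      by (intro nn_integral_cong nn_integral_cmult_indicator whitney_box_lebesgue)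
    also have "\<dots> \<le> (\<Sum>\<^sup>+p. ennreal A * (coef \<alpha> f p * ennreal (ker (1/2) p x))\<^sup>2)"
    proof (rule nsum_mono)
      fix p :: "int \<times> (int ^ 'n)"
      have "?c p * emeasure lebesgue (whitney_box p) \<le> ?c p * ennreal (sz (fst p) ^ (?n + 1))"
        by (rule mult_left_mono[OF emeasure_whitney_box]) simp
      also have "\<dots> = (ennreal (A / sz (fst p) ^ (?n + 1)) * ennreal (sz (fst p) ^ (?n + 1))) * (coef \<alpha> f p * ennreal (ker (1/2) p x))\<^sup>2"
        by (simp only: mult_ac)
      also have "ennreal (A / sz (fst p) ^ (?n + 1)) * ennreal (sz (fst p) ^ (?n + 1)) = ennreal A"
        using A by (subst ennreal_mult[symmetric]) auto
      finally show "?c p * emeasure lebesgue (whitney_box p) \<le> ennreal A * (coef \<alpha> f p * ennreal (ker (1/2) p x))\<^sup>2" .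
    qed
    also have "\<dots> = ennreal A * sq_fun \<alpha> f x" unfolding sq_fun_def by (rule nn_integral_cmult) simp
    also have "\<dots> = (ennreal (sqrt A) * ennreal_sqrt (sq_fun \<alpha> f x))\<^sup>2"
      using A by (simp add: power_mult_distrib ennreal_power)
    finally show "(\<integral>\<^sup>+q\<in>UNIV \<times> {0<..}. ?h q \<partial>lebesgue) \<le> (ennreal (sqrt A) * ennreal_sqrt (sq_fun \<alpha> f x))\<^sup>2" .
  qed
  then show ?thesis using A by (intro that[of "sqrt A"]) auto
qed

section \<open>The part of the function away from a ball\<close>

text \<open>Let d be the distance of x and z; at each scale boundedly many cubes see z. Cubes of
  side at most d contribute \<open>side powr (1/2) * d powr - (n + 1/2)\<close> by the decay of the
  kernel, larger ones \<open>side powr - n\<close> by the normalisation alone. Both sums are of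
  order \<open>d powr - n\<close>.\<close>

lemma far_kernel:
  obtains C where "0 \<le> C" "\<And>x z :: real ^ 'n. x \<noteq> z \<Longrightarrow>
    (\<Sum>\<^sup>+q. ennreal (1 / sz (fst q) ^ CARD('n)) * indicator (supp q) z * ennreal (ker (1/2) q x))
      \<le> ennreal (C / norm (x - z) ^ CARD('n))"
proof -
  let ?n = "real CARD('n)"
  have N: "0 \<le> ?n + 1" and half: "0 < (1/2::real)" and n: "0 < ?n" by simp_all
  obtain C1 where C1: "0 \<le> C1" "\<And>k (x :: real ^ 'n).
    (\<Sum>\<^sup>+m. indicator {m. norm (corner k m - x) \<le> (?n + 1) * sz k} m) \<le> ennreal C1"
    by (rule near_count[where 'n='n, OF N], rule that)
  obtain Ca where Ca: "0 \<le> Ca" "\<And>d. 0 < d \<Longrightarrow>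
    (\<Sum>\<^sup>+k. ennreal (sz k powr (1/2)) * indicator {k. sz k \<le> d} k) \<le> ennreal (Ca * d powr (1/2))"
    by (rule geometric_sum_below[OF half], rule that)
  obtain Cb where Cb: "0 \<le> Cb" "\<And>d. 0 < d \<Longrightarrow>
    (\<Sum>\<^sup>+k. ennreal (sz k powr - ?n) * indicator {k. d \<le> sz k} k) \<le> ennreal (Cb * d powr - ?n)"
    by (rule geometric_sum_above[OF n], rule that)
  define B where "B = (?n + 2) powr (?n + 1/2)"
  have B: "0 \<le> B" by (simp add: B_def)
  have "(\<Sum>\<^sup>+q. ennreal (1 / sz (fst q) ^ CARD('n)) * indicator (supp q) z * ennreal (ker (1/2) q x))
      \<le> ennreal (B * (Ca + Cb) * C1 / norm (x - z) ^ CARD('n))" if "x \<noteq> z" for x z :: "real ^ 'n"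
  proof -
    define d where "d = norm (x - z)"
    have d: "0 < d" using that by (simp add: d_def)
    define t where "t k = ennreal (B * d powr - (?n + 1/2)) * (ennreal (sz k powr (1/2)) * indicator {k. sz k \<le> d} k) +
        ennreal B * (ennreal (sz k powr - ?n) * indicator {k. d \<le> sz k} k)" for k
    have tm: "ennreal (1 / sz (fst q) ^ CARD('n)) * indicator (supp q) z * ennreal (ker (1/2) q x)
       \<le> t (fst q) * indicator {m. norm (corner (fst q) m - z) \<le> (?n + 1) * sz (fst q)} (snd q)" for q
    proof (cases "z \<in> supp q")
      case True
      let ?s = "sz (fst q)" and ?c = "corner (fst q) (snd q)"
      have near: "norm (?c - z) \<le> (?n + 1) * ?s" using True by (simp add: supp_def dist_norm)
      have "d \<le> norm (x - ?c) + norm (?c - z)" unfolding d_def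
        using norm_triangle_ineq[of "x - ?c" "?c - z"] by simp
      with near have "?s + d \<le> (?n + 2) * ?s + norm (x - ?c)" by (simp add: algebra_simps)
      also have "\<dots> \<le> (?n + 2) * (?s + norm (x - ?c))"
        using mult_right_mono[of 1 "?n + 2" "norm (x - ?c)"] by (simp add: distrib_left)
      finally have le: "?s + d \<le> (?n + 2) * (?s + norm (x - ?c))" .
      have "?s / (?s + norm (x - ?c)) \<le> (?n + 2) * (?s / (?s + d))"
      proof -
        have "?s * (?s + d) \<le> ?s * ((?n + 2) * (?s + norm (x - ?c)))" using le by (intro mult_left_mono) auto
        then show ?thesis using d by (simp add: divide_le_eq le_divide_eq add_pos_nonneg add_pos_pos mult_ac)
      qed
      then have "ker (1/2) q x \<le> ((?n + 2) * (?s / (?s + d))) powr (?n + 1/2)"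
        unfolding ker_def by (intro powr_mono2) auto
      also have "\<dots> = B * (?s / (?s + d)) powr (?n + 1/2)" unfolding B_def by (rule powr_mult)
      finally have k1: "ker (1/2) q x \<le> B * (?s / (?s + d)) powr (?n + 1/2)" .
      have "ennreal (1 / ?s ^ CARD('n)) * ennreal (ker (1/2) q x) \<le> t (fst q)"
      proof (cases "?s \<le> d")
        case True
        have "ker (1/2) q x \<le> B * (?s / d) powr (?n + 1/2)"
        proof (rule order_trans[OF k1], rule mult_left_mono[OF _ B], rule powr_mono2)
          show "?s / (?s + d) \<le> ?s / d" using d by (intro divide_left_mono mult_pos_pos add_pos_pos) auto
        qed (use d in auto)
        then have "1 / ?s ^ CARD('n) * ker (1/2) q x \<le> 1 / ?s ^ CARD('n) * (B * (?s / d) powr (?n + 1/2))"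
          by (rule mult_left_mono) simp
        also have "\<dots> = B * d powr - (?n + 1/2) * ?s powr (1/2)"
        proof -
          have "d powr - (?n + 1/2) = 1 / (d ^ CARD('n) * d powr (1/2))"
            using d by (simp add: powr_minus_divide[of d "?n + 1/2"] powr_add powr_realpow del: minus_add_distrib)
          then show ?thesis using d by (simp add: powr_divide powr_add powr_realpow)
        qed
        finally have "ennreal (1 / ?s ^ CARD('n)) * ennreal (ker (1/2) q x) \<le> ennreal (B * d powr - (?n + 1/2) * ?s powr (1/2))"
          by (subst ennreal_mult[symmetric]) (auto intro: ennreal_leI)
        also have "\<dots> \<le> t (fst q)" using B True by (simp add: t_def ennreal_mult)
        finally show ?thesis .
      next
        case False
        have "ker (1/2) q x \<le> B * 1"
          by (rule order_trans[OF k1], rule mult_left_mono[OF _ B], rule powr_le1)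
             (use d add_pos_pos[OF sz_pos[of "fst q"] d] in \<open>auto simp: divide_le_eq\<close>)
        then have "1 / ?s ^ CARD('n) * ker (1/2) q x \<le> 1 / ?s ^ CARD('n) * (B * 1)"
          by (rule mult_left_mono) simp
        also have "\<dots> = B * ?s powr - ?n" by (simp add: powr_minus_divide powr_realpow)
        finally have "ennreal (1 / ?s ^ CARD('n)) * ennreal (ker (1/2) q x) \<le> ennreal (B * ?s powr - ?n)"
          by (subst ennreal_mult[symmetric]) (auto intro: ennreal_leI)
        also have "\<dots> \<le> t (fst q)" using B False by (simp add: t_def ennreal_mult)
        finally show ?thesis .
      qed
      then show ?thesis using True near by simp
    qed simp
    have "(\<Sum>\<^sup>+q. ennreal (1 / sz (fst q) ^ CARD('n)) * indicator (supp q) z * ennreal (ker (1/2) q x))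
      \<le> (\<Sum>\<^sup>+q::int \<times> (int ^ 'n). t (fst q) * indicator {m. norm (corner (fst q) m - z) \<le> (?n + 1) * sz (fst q)} (snd q))"
      by (rule nsum_mono) (rule tm)
    also have "\<dots> = (\<Sum>\<^sup>+k. \<Sum>\<^sup>+m. t k * indicator {m. norm (corner k m - z) \<le> (?n + 1) * sz k} m)"
      by (simp add: nsum_pair)
    also have "\<dots> = (\<Sum>\<^sup>+k. t k * (\<Sum>\<^sup>+m. indicator {m. norm (corner k m - z) \<le> (?n + 1) * sz k} m))"
      by (intro nn_integral_cong nn_integral_cmult) simp
    also have "\<dots> \<le> (\<Sum>\<^sup>+k. t k * ennreal C1)" by (intro nsum_mono mult_left_mono C1) simp
    also have "\<dots> = (\<Sum>\<^sup>+k. t k) * ennreal C1" by (rule nn_integral_multc) simp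
    also have "(\<Sum>\<^sup>+k. t k) = ennreal (B * d powr - (?n + 1/2)) * (\<Sum>\<^sup>+k. ennreal (sz k powr (1/2)) * indicator {k. sz k \<le> d} k) +
        ennreal B * (\<Sum>\<^sup>+k. ennreal (sz k powr - ?n) * indicator {k. d \<le> sz k} k)"
      unfolding t_def by (subst nn_integral_add) (simp_all add: nn_integral_cmult del: sz_le_iff)
    also have "\<dots> * ennreal C1 \<le> (ennreal (B * d powr - (?n + 1/2)) * ennreal (Ca * d powr (1/2)) +
        ennreal B * ennreal (Cb * d powr - ?n)) * ennreal C1"
      by (intro mult_right_mono add_mono mult_left_mono Ca Cb d) auto
    also have "\<dots> = ennreal ((B * d powr - (?n + 1/2) * (Ca * d powr (1/2)) + B * (Cb * d powr - ?n)) * C1)"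
      using B Ca(1) Cb(1) C1(1) by (simp add: ennreal_mult[symmetric] ennreal_plus[symmetric] del: ennreal_plus)
    also have "B * d powr - (?n + 1/2) * (Ca * d powr (1/2)) = B * (Ca * d powr - ?n)"
    proof -
      have "d powr - (?n + 1/2) * d powr (1/2) = d powr - ?n" unfolding powr_add[symmetric] by simp
      then show ?thesis by (metis mult.assoc mult.commute)
    qed
    also have "(B * (Ca * d powr - ?n) + B * (Cb * d powr - ?n)) * C1 = B * (Ca + Cb) * C1 / d ^ CARD('n)"
      using d by (simp add: powr_minus_divide powr_realpow field_simps)
    finally show ?thesis by (simp add: d_def)
  qed
  then show ?thesis using B Ca(1) Cb(1) C1(1) by (intro that[of "B * (Ca + Cb) * C1"]) auto
qed

text \<open>The l^1 bound for the sum over cubes is affordable because the summed kernel is still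
  finite off the diagonal. A point z outside the doubled ball is at least half as far from x as from
  x0, hence the factor \<open>2 ^ n\<close>.\<close>

theorem sq_fun_far:
  obtains C where "0 \<le> C" "\<And>\<alpha> (f :: real ^ 'n \<Rightarrow> real) x0 r x. f \<in> borel_measurable lebesgue \<Longrightarrow> 0 < r \<Longrightarrow>
    (\<And>z. z \<in> ball x0 (2 * r) \<Longrightarrow> f z = 0) \<Longrightarrow> x \<in> ball x0 r \<Longrightarrow>
    ennreal_sqrt (sq_fun \<alpha> f x) \<le> ennreal C * (\<integral>\<^sup>+z. ennreal (\<bar>f z\<bar> / norm (z - x0) ^ CARD('n)) \<partial>lebesgue)"
proof -
  obtain C where C: "0 \<le> C" "\<And>x z :: real ^ 'n. x \<noteq> z \<Longrightarrow>
    (\<Sum>\<^sup>+q. ennreal (1 / sz (fst q) ^ CARD('n)) * indicator (supp q) z * ennreal (ker (1/2) q x))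
      \<le> ennreal (C / norm (x - z) ^ CARD('n))"
    by (rule far_kernel[where 'n='n], rule that)
  have "ennreal_sqrt (sq_fun \<alpha> f x) \<le> ennreal (2 ^ CARD('n) * C) * (\<integral>\<^sup>+z. ennreal (\<bar>f z\<bar> / norm (z - x0) ^ CARD('n)) \<partial>lebesgue)"
    if f [measurable]: "f \<in> borel_measurable lebesgue" and r: "0 < r" and 0: "\<And>z. z \<in> ball x0 (2 * r) \<Longrightarrow> f z = 0"
      and x: "x \<in> ball x0 r" for \<alpha> and f :: "real ^ 'n \<Rightarrow> real" and x0 r x
  proof -
    have "ennreal_sqrt (sq_fun \<alpha> f x) \<le> (\<Sum>\<^sup>+q. coef \<alpha> f q * ennreal (ker (1/2) q x))"
      by (rule ennreal_sqrt_le[OF sq_fun_le_sum])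
    also have "\<dots> \<le> (\<Sum>\<^sup>+q. (\<integral>\<^sup>+z. ennreal \<bar>f z\<bar> * (ennreal (1 / sz (fst q) ^ CARD('n)) * indicator (supp q) z) \<partial>lebesgue) * ennreal (ker (1/2) q x))"
      by (intro nsum_mono mult_right_mono coef_le f) simp
    also have "\<dots> = (\<Sum>\<^sup>+q. \<integral>\<^sup>+z. ennreal \<bar>f z\<bar> * (ennreal (1 / sz (fst q) ^ CARD('n)) * indicator (supp q) z) * ennreal (ker (1/2) q x) \<partial>lebesgue)"
      by (intro nn_integral_cong nn_integral_multc[symmetric]) measurable
    also have "\<dots> = (\<integral>\<^sup>+z. (\<Sum>\<^sup>+q. ennreal \<bar>f z\<bar> * (ennreal (1 / sz (fst q) ^ CARD('n)) * indicator (supp q) z) * ennreal (ker (1/2) q x)) \<partial>lebesgue)"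
      by (rule nn_integral_nsum[symmetric]) measurable
    also have "\<dots> \<le> (\<integral>\<^sup>+z. ennreal (2 ^ CARD('n) * C) * ennreal (\<bar>f z\<bar> / norm (z - x0) ^ CARD('n)) \<partial>lebesgue)"
    proof (rule nn_integral_mono)
      fix z
      have "(\<Sum>\<^sup>+q. ennreal \<bar>f z\<bar> * (ennreal (1 / sz (fst q) ^ CARD('n)) * indicator (supp q) z) * ennreal (ker (1/2) q x))
         = ennreal \<bar>f z\<bar> * (\<Sum>\<^sup>+q. ennreal (1 / sz (fst q) ^ CARD('n)) * indicator (supp q) z * ennreal (ker (1/2) q x))"
        by (simp add: nn_integral_cmult[symmetric] mult.assoc)
      also have "\<dots> \<le> ennreal (2 ^ CARD('n) * C) * ennreal (\<bar>f z\<bar> / norm (z - x0) ^ CARD('n))"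
      proof (cases "z \<in> ball x0 (2 * r)")
        case True
        then show ?thesis using 0 by simp
      next
        case False
        then have z: "2 * r \<le> norm (z - x0)" by (simp add: dist_norm norm_minus_commute)
        have "norm (x - x0) < r" using x by (simp add: dist_norm norm_minus_commute)
        then have d: "norm (z - x0) / 2 \<le> norm (x - z)"
          using z norm_triangle_ineq[of "z - x" "x - x0"] by (simp add: norm_minus_commute)
        have pos: "0 < norm (z - x0)" using z r by linarith
        have "x \<noteq> z" using d pos by auto
        then have "ennreal \<bar>f z\<bar> * (\<Sum>\<^sup>+q. ennreal (1 / sz (fst q) ^ CARD('n)) * indicator (supp q) z * ennreal (ker (1/2) q x))
           \<le> ennreal \<bar>f z\<bar> * ennreal (C / norm (x - z) ^ CARD('n))" by (intro mult_left_mono C) auto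
        also have "\<dots> \<le> ennreal \<bar>f z\<bar> * ennreal (C / (norm (z - x0) / 2) ^ CARD('n))"
          using d pos C(1) by (intro mult_left_mono ennreal_leI divide_left_mono power_mono mult_pos_pos zero_less_power) auto
        also have "\<dots> = ennreal (2 ^ CARD('n) * C) * ennreal (\<bar>f z\<bar> / norm (z - x0) ^ CARD('n))"
          using C(1) by (simp add: ennreal_mult[symmetric] power_divide mult_ac)
        finally show ?thesis .
      qed
      finally show "(\<Sum>\<^sup>+q. ennreal \<bar>f z\<bar> * (ennreal (1 / sz (fst q) ^ CARD('n)) * indicator (supp q) z) * ennreal (ker (1/2) q x))
        \<le> ennreal (2 ^ CARD('n) * C) * ennreal (\<bar>f z\<bar> / norm (z - x0) ^ CARD('n))" .
    qed
    also have "\<dots> = ennreal (2 ^ CARD('n) * C) * (\<integral>\<^sup>+z. ennreal (\<bar>f z\<bar> / norm (z - x0) ^ CARD('n)) \<partial>lebesgue)"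
    proof (rule nn_integral_cmult)
      have [measurable]: "(\<lambda>z. norm (z - x0) ^ CARD('n)) \<in> borel_measurable lebesgue"
        by (intro borel_measurable_lebesgue) measurable
      show "(\<lambda>z. ennreal (\<bar>f z\<bar> / norm (z - x0) ^ CARD('n))) \<in> borel_measurable lebesgue" by measurable
    qed
    finally show ?thesis .
  qed
  then show ?thesis using C(1) by (intro that[of "2 ^ CARD('n) * C"]) auto
qed

section \<open>Young functions of finite type\<close>

lemma young_scale:
  assumes "young_function \<Phi>" "0 \<le> u" "u \<le> 1" "0 \<le> x"
  shows "\<Phi> (u * x) \<le> ennreal u * \<Phi> x"
proof (cases "u = 0 \<or> u = 1")
  case True
  then show ?thesis using assms(1) by (auto simp: young_function_def)
next
  case False
  then have u: "u \<in> {0<..<1}" using assms by auto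
  have "\<Phi> ((1 - u) * 0 + u * x) \<le> ennreal (1 - u) * \<Phi> 0 + ennreal u * \<Phi> x"
    using assms(1,4) u unfolding young_function_def by blast
  then show ?thesis using assms(1) by (simp add: young_function_def)
qed

lemma young_mono:
  assumes "young_function \<Phi>" "0 \<le> s" "s \<le> t"
  shows "\<Phi> s \<le> \<Phi> t"
proof (cases "t = 0")
  case False
  then have t: "0 < t" using assms by auto
  have "\<Phi> (s / t * t) \<le> ennreal (s / t) * \<Phi> t" using assms t by (intro young_scale) auto
  also have "\<dots> \<le> 1 * \<Phi> t" using assms t by (intro mult_right_mono) (auto simp: ennreal_le_1)
  finally show ?thesis using t by simp
qed (use assms in auto)

lemma young_limit: "young_function \<Phi> \<Longrightarrow> (\<Phi> \<longlongrightarrow> top) at_top"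
  by (simp add: young_function_def)

lemma young_small:
  assumes "young_function \<Phi>" "0 < s"
  obtains r where "0 < r" "\<Phi> r < s"
proof -
  have "(\<Phi> \<longlongrightarrow> 0) (at_right 0)" using assms by (simp add: young_function_def)
  then have "\<forall>\<^sub>F r in at_right 0. \<Phi> r < s" using assms(2) by (rule order_tendstoD(2))
  then obtain b where b: "0 < b" "\<And>r. 0 < r \<Longrightarrow> r < b \<Longrightarrow> \<Phi> r < s" by (auto simp: eventually_at_right_field)
  then show ?thesis by (intro that[of "b / 2"]) auto
qed

lemma young_large:
  assumes "young_function \<Phi>" "s < top"
  obtains r where "0 < r" "s < \<Phi> r"
proof -
  have "\<forall>\<^sub>F r in at_top. s < \<Phi> r" using young_limit[OF assms(1)] assms(2) by (rule order_tendstoD(1))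
  then obtain b where "\<And>r. b \<le> r \<Longrightarrow> s < \<Phi> r" by (auto simp: eventually_at_top_linorder)
  then show ?thesis by (intro that[of "max 1 b"]) auto
qed

text \<open>Near 0 the function is below 1, and upper type carries finiteness from there to every
  argument.\<close>

lemma young_finite:
  assumes Y: "young_function \<Phi>" and U: "upper_type \<Phi> p\<^sub>1" and x: "0 \<le> x"
  shows "\<Phi> x < top"
proof -
  obtain C where C: "0 < C" "\<And>t s. 1 \<le> t \<Longrightarrow> 0 \<le> s \<Longrightarrow> \<Phi> (s * t) \<le> ennreal (C * t powr p\<^sub>1) * \<Phi> s"
    using U unfolding upper_type_def by auto
  obtain r where r: "0 < r" "\<Phi> r < 1" using young_small[OF Y, of 1] by auto
  have "\<Phi> x \<le> \<Phi> (r * max 1 (x / r))"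
    using r x by (intro young_mono[OF Y]) (auto simp: max_def field_simps)
  also have "\<dots> \<le> ennreal (C * max 1 (x / r) powr p\<^sub>1) * \<Phi> r" using r by (intro C) auto
  also have "\<dots> < top" using r(2) by (simp add: ennreal_mult_less_top less_trans[OF _ ennreal_one_less_top])
  finally show ?thesis .
qed

text \<open>Convexity makes the quotient of \<Phi> v by v nondecreasing, which settles v > a.
  Integrated over a ball, the inequality takes the place of Jensen's inequality, or of Hoelder's
  with the complementary function.\<close>

lemma young_average:
  assumes Y: "young_function \<Phi>" and a: "0 < a" and v: "0 \<le> v"
  shows "ennreal v * \<Phi> a \<le> ennreal a * \<Phi> v + ennreal a * \<Phi> a"
proof (cases "v \<le> a")
  case True
  then have "ennreal v * \<Phi> a \<le> ennreal a * \<Phi> a" by (intro mult_right_mono ennreal_leI) auto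
  then show ?thesis by (simp add: add_increasing)
next
  case False
  have "\<Phi> (a / v * v) \<le> ennreal (a / v) * \<Phi> v" using False a v by (intro young_scale[OF Y]) auto
  then have "ennreal v * \<Phi> a \<le> ennreal v * (ennreal (a / v) * \<Phi> v)" using False a by (intro mult_left_mono) auto
  also have "\<dots> = ennreal a * \<Phi> v" using False a by (simp add: mult.assoc[symmetric] ennreal_mult[symmetric])
  finally show ?thesis by (simp add: add_increasing2)
qed

section \<open>The generalized inverse of a Young function\<close>

lemma young_inv_mono: "s \<le> s' \<Longrightarrow> young_inv \<Phi> s \<le> young_inv \<Phi> s'"
  unfolding young_inv_def by (rule INF_superset_mono) auto

lemma young_inv_pos:
  assumes Y: "young_function \<Phi>" and s: "0 < s"
  shows "0 < young_inv \<Phi> s"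
proof -
  obtain r where r: "0 < r" "\<Phi> r < s" using young_small[OF Y s] .
  have "ennreal r \<le> young_inv \<Phi> s"
    unfolding young_inv_def
  proof (rule INF_greatest)
    fix t assume "t \<in> {t. 0 \<le> t \<and> s < \<Phi> t}"
    then have t: "0 \<le> t" "s < \<Phi> t" by auto
    show "ennreal r \<le> ennreal t"
    proof (rule ccontr)
      assume "\<not> ennreal r \<le> ennreal t"
      then have "t \<le> r" using ennreal_leI[of r t] by linarith
      then have "\<Phi> t \<le> \<Phi> r" by (rule young_mono[OF Y t(1)])
      with less_trans[OF r(2) t(2)] show False by simp
    qed
  qed
  moreover have "0 < ennreal r" using r by simp
  ultimately show ?thesis by (rule less_le_trans[rotated])
qed

lemma young_inv_finite:
  assumes Y: "young_function \<Phi>" and s: "s < top"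
  shows "young_inv \<Phi> s < top"
proof -
  obtain r where r: "0 < r" "s < \<Phi> r" using young_large[OF Y s] .
  then have "young_inv \<Phi> s \<le> ennreal r" unfolding young_inv_def by (intro INF_lower) auto
  also have "\<dots> < top" by simp
  finally show ?thesis .
qed

text \<open>The infimum defining the inverse need not satisfy the strict inequality itself. As it is
  positive and finite, a factor 2 leaves room for a point that does.\<close>

lemma young_inv_near:
  assumes Y: "young_function \<Phi>" and s: "0 < s" "s < top"
  obtains a where "0 < a" "s < \<Phi> a" "ennreal a \<le> 2 * young_inv \<Phi> s"
proof -
  have "young_inv \<Phi> s * 1 < young_inv \<Phi> s * 2"
    using young_inv_pos[OF Y s(1)] young_inv_finite[OF Y s(2)]
    by (intro ennreal_mult_strict_left_mono) auto
  then have "young_inv \<Phi> s < 2 * young_inv \<Phi> s" by (simp add: mult.commute)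
  then obtain a where a: "0 \<le> a" "s < \<Phi> a" "ennreal a < 2 * young_inv \<Phi> s"
    unfolding young_inv_def INF_less_iff by auto
  moreover have "a \<noteq> 0" using a(2) Y by (auto simp: young_function_def)
  ultimately show ?thesis by (intro that[of a]) auto
qed

lemma young_below_inv:
  assumes "0 \<le> b" "ennreal b < young_inv \<Phi> s"
  shows "\<Phi> b \<le> s"
proof (rule ccontr)
  assume "\<not> \<Phi> b \<le> s"
  then have "young_inv \<Phi> s \<le> ennreal b" unfolding young_inv_def using assms(1) by (intro INF_lower) auto
  with assms(2) show False by simp
qed

text \<open>The convexity of \<Phi> in the form of concavity of its inverse.\<close>

lemma young_inv_scale:
  assumes Y: "young_function \<Phi>" and c: "0 < c" "c \<le> 1"
  shows "ennreal c * young_inv \<Phi> s \<le> young_inv \<Phi> (ennreal c * s)"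
  unfolding young_inv_def[of \<Phi> "ennreal c * s"]
proof (rule INF_greatest)
  fix r assume "r \<in> {r. 0 \<le> r \<and> ennreal c * s < \<Phi> r}"
  then have r: "0 \<le> r" "ennreal c * s < \<Phi> r" by auto
  have "\<Phi> (c * (r / c)) \<le> ennreal c * \<Phi> (r / c)" using c r by (intro young_scale[OF Y]) auto
  then have "ennreal c * s < ennreal c * \<Phi> (r / c)" using r(2) c by simp
  then have "s < \<Phi> (r / c)" by (metis mult_left_mono not_less zero_le)
  then have "young_inv \<Phi> s \<le> ennreal (r / c)" unfolding young_inv_def using r c by (intro INF_lower) auto
  then have "ennreal c * young_inv \<Phi> s \<le> ennreal c * ennreal (r / c)" by (rule mult_left_mono) simp
  also have "\<dots> = ennreal r" using c r by (simp add: ennreal_mult[symmetric])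
  finally show "ennreal c * young_inv \<Phi> s \<le> ennreal r" .
qed

text \<open>The weight occurring in the Morrey norm. The type argument supplies the dimension, which
  no other argument determines.\<close>

definition inv_scale :: "'n::finite itself \<Rightarrow> (real \<Rightarrow> ennreal) \<Rightarrow> real \<Rightarrow> ennreal" where
  "inv_scale n \<Phi> t = young_inv \<Phi> (ennreal (t powi (- int CARD('n))))"

lemma powi_minus_card: "t powi (- int N) = 1 / t ^ N" for t :: real
  by (simp add: power_int_minus inverse_eq_divide)

lemma inv_scale_pos:
  assumes Y: "young_function \<Phi>" and "0 < t"
  shows "0 < inv_scale TYPE('n::finite) \<Phi> t" "inv_scale TYPE('n) \<Phi> t < top"
  unfolding inv_scale_def powi_minus_card
  using assms by (auto intro!: young_inv_pos young_inv_finite)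

lemma inv_scale_antimono:
  assumes "0 < s" "s \<le> t"
  shows "inv_scale TYPE('n::finite) \<Phi> t \<le> inv_scale TYPE('n) \<Phi> s"
  unfolding inv_scale_def powi_minus_card
  using assms by (intro young_inv_mono ennreal_leI divide_left_mono power_mono) auto

text \<open>Doubling the radius divides the argument of the inverse by \<open>2 ^ n\<close>, and
  \<open>young_inv_scale\<close> pulls this factor out.\<close>

lemma inv_scale_double:
  assumes Y: "young_function \<Phi>" and t: "0 < t"
  shows "inv_scale TYPE('n::finite) \<Phi> t \<le> ennreal (2 ^ CARD('n)) * inv_scale TYPE('n) \<Phi> (2 * t)"
proof -
  have "ennreal (1 / 2 ^ CARD('n)) * inv_scale TYPE('n) \<Phi> t \<le> young_inv \<Phi> (ennreal (1 / 2 ^ CARD('n)) * ennreal (1 / t ^ CARD('n)))"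
    unfolding inv_scale_def powi_minus_card using Y by (intro young_inv_scale) auto
  also have "ennreal (1 / 2 ^ CARD('n)) * ennreal (1 / t ^ CARD('n)) = ennreal (1 / (2 * t) ^ CARD('n))"
    using t by (simp add: ennreal_mult[symmetric] power_mult_distrib)
  also have "young_inv \<Phi> \<dots> = inv_scale TYPE('n) \<Phi> (2 * t)" by (simp add: inv_scale_def powi_minus_card)
  finally have "ennreal (2 ^ CARD('n)) * (ennreal (1 / 2 ^ CARD('n)) * inv_scale TYPE('n) \<Phi> t)
     \<le> ennreal (2 ^ CARD('n)) * inv_scale TYPE('n) \<Phi> (2 * t)" by (rule mult_left_mono) simp
  then show ?thesis by (simp add: mult.assoc[symmetric] ennreal_mult[symmetric])
qed

section \<open>Luxemburg norms over balls\<close>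

definition ball_norm :: "(real \<Rightarrow> ennreal) \<Rightarrow> (real ^ 'n \<Rightarrow> real) \<Rightarrow> real ^ 'n \<Rightarrow> real \<Rightarrow> ennreal" where
  "ball_norm \<Phi> f x r = luxemburg_norm \<Phi> (\<lambda>y. f y * indicator (ball x r) y)"

text \<open>The norm is an infimum that need not be attained; the bound is checked at every
  admissible \<mu>, and D is subtracted before passing to the infimum.\<close>

lemma le_mult_luxemburg:
  assumes "0 < c" "\<And>\<mu>. 0 < \<mu> \<Longrightarrow> (\<integral>\<^sup>+x. \<Phi> (\<bar>f x\<bar> / \<mu>) \<partial>lebesgue) \<le> 1 \<Longrightarrow> X \<le> ennreal c * ennreal \<mu> + D"
  shows "X \<le> ennreal c * luxemburg_norm \<Phi> f + D"
proof (cases "D = top")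
  case False
  have "ennreal (1 / c) * (X - D) \<le> luxemburg_norm \<Phi> f"
    unfolding luxemburg_norm_def
  proof (rule INF_greatest)
    fix \<mu> assume "\<mu> \<in> {\<mu>. 0 < \<mu> \<and> (\<integral>\<^sup>+x. \<Phi> (\<bar>f x\<bar> / \<mu>) \<partial>lebesgue) \<le> 1}"
    then have \<mu>: "0 < \<mu>" "X \<le> ennreal c * ennreal \<mu> + D" using assms(2) by auto
    have "X - D \<le> ennreal c * ennreal \<mu>" using \<mu>(2) by (simp add: ennreal_minus_le_iff False add.commute)
    then have "ennreal (1 / c) * (X - D) \<le> ennreal (1 / c) * (ennreal c * ennreal \<mu>)" by (rule mult_left_mono) simp
    then show "ennreal (1 / c) * (X - D) \<le> ennreal \<mu>"
      using assms(1) \<mu> by (simp add: mult.assoc[symmetric] ennreal_mult[symmetric])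
  qed
  then have "ennreal c * (ennreal (1 / c) * (X - D)) \<le> ennreal c * luxemburg_norm \<Phi> f" by (rule mult_left_mono) simp
  then have "X - D \<le> ennreal c * luxemburg_norm \<Phi> f"
    using assms(1) by (simp add: mult.assoc[symmetric] ennreal_mult[symmetric])
  then show ?thesis by (simp add: ennreal_minus_le_iff False add.commute)
qed simp

lemma ball_norm_mono:
  assumes Y: "young_function \<Phi>" and "r \<le> s"
  shows "ball_norm \<Phi> f x r \<le> ball_norm \<Phi> f x s"
  unfolding ball_norm_def luxemburg_norm_def
proof (rule INF_superset_mono)
  show "{\<mu>. 0 < \<mu> \<and> (\<integral>\<^sup>+y. \<Phi> (\<bar>f y * indicator (ball x s) y\<bar> / \<mu>) \<partial>lebesgue) \<le> 1}
     \<subseteq> {\<mu>. 0 < \<mu> \<and> (\<integral>\<^sup>+y. \<Phi> (\<bar>f y * indicator (ball x r) y\<bar> / \<mu>) \<partial>lebesgue) \<le> 1}"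
  proof safe
    fix \<mu> :: real assume \<mu>: "0 < \<mu>" "(\<integral>\<^sup>+y. \<Phi> (\<bar>f y * indicator (ball x s) y\<bar> / \<mu>) \<partial>lebesgue) \<le> 1"
    have "(\<integral>\<^sup>+y. \<Phi> (\<bar>f y * indicator (ball x r) y\<bar> / \<mu>) \<partial>lebesgue) \<le> (\<integral>\<^sup>+y. \<Phi> (\<bar>f y * indicator (ball x s) y\<bar> / \<mu>) \<partial>lebesgue)"
      using \<mu>(1) assms(2)
      by (intro nn_integral_mono young_mono[OF Y] divide_right_mono) (auto split: split_indicator)
    then show "(\<integral>\<^sup>+y. \<Phi> (\<bar>f y * indicator (ball x r) y\<bar> / \<mu>) \<partial>lebesgue) \<le> 1" using \<mu>(2) by (rule order_trans)
  qed
qed simp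

text \<open>By convexity, scaling the argument by u = 1 / (M + 1) scales the modular by at most u,
  which brings it below 1.\<close>

lemma luxemburg_finite:
  assumes Y: "young_function \<Phi>" and k: "0 < k" and f: "f \<in> borel_measurable lebesgue"
    and fin: "(\<integral>\<^sup>+x. \<Phi> (k * \<bar>f x\<bar>) \<partial>lebesgue) < \<infinity>"
  obtains \<mu> where "0 < \<mu>" "(\<integral>\<^sup>+x. \<Phi> (\<bar>f x\<bar> / \<mu>) \<partial>lebesgue) \<le> 1"
proof -
  obtain M where M: "(\<integral>\<^sup>+x. \<Phi> (k * \<bar>f x\<bar>) \<partial>lebesgue) = ennreal M" "0 \<le> M"
    using fin by (cases "\<integral>\<^sup>+x. \<Phi> (k * \<bar>f x\<bar>) \<partial>lebesgue") auto
  define u where "u = 1 / (M + 1)"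
  have u: "0 < u" "u \<le> 1" using M by (auto simp: u_def)
  have "(\<lambda>x. \<Phi> \<bar>k * f x\<bar>) \<in> borel_measurable lebesgue"
    using f by (intro borel_measurable_young_abs young_mono[OF Y]) measurable
  then have [measurable]: "(\<lambda>x. \<Phi> (k * \<bar>f x\<bar>)) \<in> borel_measurable lebesgue" using k by (simp add: abs_mult)
  have "(\<integral>\<^sup>+x. \<Phi> (\<bar>f x\<bar> / (1 / (u * k))) \<partial>lebesgue) \<le> (\<integral>\<^sup>+x. ennreal u * \<Phi> (k * \<bar>f x\<bar>) \<partial>lebesgue)"
  proof (rule nn_integral_mono)
    fix x
    have "\<Phi> (u * (k * \<bar>f x\<bar>)) \<le> ennreal u * \<Phi> (k * \<bar>f x\<bar>)" using u k by (intro young_scale[OF Y]) auto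
    then show "\<Phi> (\<bar>f x\<bar> / (1 / (u * k))) \<le> ennreal u * \<Phi> (k * \<bar>f x\<bar>)" by (simp add: mult_ac)
  qed
  also have "\<dots> = ennreal (u * M)" using u M by (subst nn_integral_cmult) (auto simp: ennreal_mult)
  also have "\<dots> \<le> 1" using M by (simp add: u_def ennreal_le_1 field_simps)
  finally show ?thesis using u k by (intro that[of "1 / (u * k)"]) auto
qed

text \<open>Take a near the inverse at \<open>r powi - n\<close> such that 1 is at most \<Phi> a
  times \<open>r ^ n\<close>. The inequality of \<open>young_average\<close> for |f| / \<mu> is
  integrated over the ball and divided by \<Phi> a, which is finite by upper type. In the constant,
  2 is the slack in a, and 1 + V stems from the modular and the volume of the ball.\<close>

lemma integral_ball_le_norm:
  obtains C where "0 < C" "\<And>\<Phi> p\<^sub>1 (f :: real ^ 'n \<Rightarrow> real) x r. young_function \<Phi> \<Longrightarrow> upper_type \<Phi> p\<^sub>1 \<Longrightarrow> f \<in> borel_measurable lebesgue \<Longrightarrow> 0 < r \<Longrightarrow>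
    (\<integral>\<^sup>+z\<in>ball x r. ennreal \<bar>f z\<bar> \<partial>lebesgue) \<le> ennreal (C * r ^ CARD('n)) * inv_scale TYPE('n) \<Phi> r * ball_norm \<Phi> f x r"
proof
  define V where "V = unit_ball_vol (real CARD('n))"
  have V: "0 \<le> V" by (simp add: V_def unit_ball_vol_nonneg)
  show "0 < 2 * (1 + V)" using V by simp
  fix \<Phi> p\<^sub>1 and f :: "real ^ 'n \<Rightarrow> real" and x :: "real ^ 'n" and r :: real
  assume Y: "young_function \<Phi>" and U: "upper_type \<Phi> p\<^sub>1" and f [measurable]: "f \<in> borel_measurable lebesgue" and r: "0 < r"
  let ?B = "ball x r" and ?s = "1 / r ^ CARD('n)"
  have [measurable]: "?B \<in> sets lebesgue" by (intro lebesgue_of_borel) simp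
  have s: "0 < ennreal ?s" "ennreal ?s < top" using r by auto
  obtain a where a: "0 < a" "ennreal ?s < \<Phi> a" "ennreal a \<le> 2 * young_inv \<Phi> (ennreal ?s)"
    using young_inv_near[OF Y s] .
  have inv: "inv_scale TYPE('n) \<Phi> r = young_inv \<Phi> (ennreal ?s)" by (simp add: inv_scale_def powi_minus_card)
  obtain i where i: "inv_scale TYPE('n) \<Phi> r = ennreal i" "0 < i"
    using inv_scale_pos[OF Y r, where 'n='n] by (cases "inv_scale TYPE('n) \<Phi> r") auto
  have a2: "a \<le> 2 * i"
  proof -
    have "ennreal a \<le> ennreal (2 * i)" using a(3) i by (simp add: inv[symmetric] ennreal_mult)
    then show ?thesis using i by (subst (asm) ennreal_le_iff) auto
  qed
  have Ball: "emeasure lebesgue ?B = ennreal (V * r ^ CARD('n))"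
    using r by (simp add: emeasure_completion emeasure_ball V_def)
  have "(\<integral>\<^sup>+z\<in>?B. ennreal \<bar>f z\<bar> \<partial>lebesgue) \<le> ennreal (2 * (1 + V) * r ^ CARD('n) * i) * luxemburg_norm \<Phi> (\<lambda>y. f y * indicator ?B y) + 0"
  proof (rule le_mult_luxemburg)
    show "0 < 2 * (1 + V) * r ^ CARD('n) * i" using V r i by simp
    fix \<mu> :: real assume \<mu>: "0 < \<mu>" and le1: "(\<integral>\<^sup>+y. \<Phi> (\<bar>f y * indicator ?B y\<bar> / \<mu>) \<partial>lebesgue) \<le> 1"
    have "(\<lambda>y. \<Phi> \<bar>f y * indicator ?B y / \<mu>\<bar>) \<in> borel_measurable lebesgue"
      by (intro borel_measurable_young_abs young_mono[OF Y]) measurable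
    then have [measurable]: "(\<lambda>y. \<Phi> (\<bar>f y * indicator ?B y\<bar> / \<mu>)) \<in> borel_measurable lebesgue"
      using \<mu> by (simp add: abs_divide)
    have "(\<integral>\<^sup>+z\<in>?B. ennreal (\<bar>f z\<bar> / \<mu>) \<partial>lebesgue) * \<Phi> a = (\<integral>\<^sup>+z\<in>?B. ennreal (\<bar>f z\<bar> / \<mu>) * \<Phi> a \<partial>lebesgue)"
      by (subst nn_integral_multc[symmetric]) (auto simp: mult_ac)
    also have "\<dots> \<le> (\<integral>\<^sup>+z. ennreal a * \<Phi> (\<bar>f z * indicator ?B z\<bar> / \<mu>) + ennreal a * \<Phi> a * indicator ?B z \<partial>lebesgue)"
    proof (rule nn_integral_mono)
      fix z
      show "ennreal (\<bar>f z\<bar> / \<mu>) * \<Phi> a * indicator ?B z \<le> ennreal a * \<Phi> (\<bar>f z * indicator ?B z\<bar> / \<mu>) + ennreal a * \<Phi> a * indicator ?B z"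
        using young_average[OF Y a(1), of "\<bar>f z\<bar> / \<mu>"] \<mu> by (cases "z \<in> ?B") auto
    qed
    also have "\<dots> = ennreal a * (\<integral>\<^sup>+z. \<Phi> (\<bar>f z * indicator ?B z\<bar> / \<mu>) \<partial>lebesgue) + ennreal a * \<Phi> a * emeasure lebesgue ?B"
      by (simp add: nn_integral_add nn_integral_cmult nn_integral_cmult_indicator del: emeasure_completion)
    also have "\<dots> \<le> ennreal a * 1 + ennreal a * \<Phi> a * ennreal (V * r ^ CARD('n))"
      unfolding Ball by (intro add_mono mult_left_mono le1) auto
    also have "\<dots> \<le> ennreal a * (\<Phi> a * ennreal (r ^ CARD('n))) + ennreal a * \<Phi> a * ennreal (V * r ^ CARD('n))"
    proof (intro add_right_mono mult_left_mono)
      have "1 = ennreal ?s * ennreal (r ^ CARD('n))" using r by (simp add: ennreal_mult[symmetric])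
      also have "\<dots> \<le> \<Phi> a * ennreal (r ^ CARD('n))" using a(2) by (intro mult_right_mono) auto
      finally show "1 \<le> \<Phi> a * ennreal (r ^ CARD('n))" .
    qed simp
    also have "\<dots> = \<Phi> a * (ennreal a * (ennreal (r ^ CARD('n)) + ennreal (V * r ^ CARD('n))))"
      by (simp add: distrib_left mult_ac)
    also have "\<dots> = \<Phi> a * ennreal (a * ((1 + V) * r ^ CARD('n)))"
      using V r a by (simp add: ennreal_plus[symmetric] ennreal_mult[symmetric] distrib_right del: ennreal_plus)
    finally have *: "\<Phi> a * (\<integral>\<^sup>+z\<in>?B. ennreal (\<bar>f z\<bar> / \<mu>) \<partial>lebesgue) \<le> \<Phi> a * ennreal (a * ((1 + V) * r ^ CARD('n)))"
      by (simp add: mult.commute)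
    show "(\<integral>\<^sup>+z\<in>?B. ennreal \<bar>f z\<bar> \<partial>lebesgue) \<le> ennreal (2 * (1 + V) * r ^ CARD('n) * i) * ennreal \<mu> + 0"
    proof -
      have "\<Phi> a \<noteq> top" using young_finite[OF Y U, of a] a(1) by auto
      then have "(\<integral>\<^sup>+z\<in>?B. ennreal (\<bar>f z\<bar> / \<mu>) \<partial>lebesgue) \<le> ennreal (a * ((1 + V) * r ^ CARD('n)))"
        using * a(2) by (subst (asm) ennreal_mult_le_mult_iff) auto
      also have "\<dots> \<le> ennreal (2 * i * ((1 + V) * r ^ CARD('n)))"
        using a2 V r by (intro ennreal_leI mult_right_mono) auto
      finally have "ennreal \<mu> * (\<integral>\<^sup>+z\<in>?B. ennreal (\<bar>f z\<bar> / \<mu>) \<partial>lebesgue) \<le> ennreal \<mu> * ennreal (2 * i * ((1 + V) * r ^ CARD('n)))"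
        by (rule mult_left_mono) simp
      also have "ennreal \<mu> * (\<integral>\<^sup>+z\<in>?B. ennreal (\<bar>f z\<bar> / \<mu>) \<partial>lebesgue) = (\<integral>\<^sup>+z\<in>?B. ennreal \<bar>f z\<bar> \<partial>lebesgue)"
        using \<mu> by (subst nn_integral_cmult[symmetric]) (auto simp: mult.assoc[symmetric] ennreal_mult[symmetric])
      also have "ennreal \<mu> * ennreal (2 * i * ((1 + V) * r ^ CARD('n))) = ennreal (2 * (1 + V) * r ^ CARD('n) * i) * ennreal \<mu>"
        using \<mu> V r i by (simp add: ennreal_mult[symmetric] mult_ac)
      finally show ?thesis by simp
    qed
  qed
  then show "(\<integral>\<^sup>+z\<in>?B. ennreal \<bar>f z\<bar> \<partial>lebesgue) \<le> ennreal (2 * (1 + V) * r ^ CARD('n)) * inv_scale TYPE('n) \<Phi> r * ball_norm \<Phi> f x r"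
    using V r i by (simp add: i(1) ball_norm_def ennreal_mult)
qed


section \<open>Measurability of the intrinsic square function\<close>

text \<open>Dominated convergence along sequences. Eventually the dilation stays between t / 2 and 2
  t and the centre within distance 1 of y, so all the translated test functions live in one ball of
  radius 2 t + 1 and share a bound.\<close>

lemma convolution_dilate_continuous:
  fixes f :: "real ^ 'n \<Rightarrow> real"
  assumes li: "locally_integrable f" and \<alpha>: "0 < \<alpha>" "\<alpha> \<le> 1" and \<psi>: "\<psi> \<in> intrinsic_family \<alpha>"
  shows "continuous_on (UNIV \<times> {0<..}) (\<lambda>(y, t). convolution f (dilate t \<psi>) y)"
  unfolding continuous_on_sequentially
proof (intro allI ballI impI)
  fix w :: "nat \<Rightarrow> (real ^ 'n) \<times> real" and b :: "(real ^ 'n) \<times> real"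
  assume b: "b \<in> UNIV \<times> {0<..}" and w: "(\<forall>j. w j \<in> UNIV \<times> {0<..}) \<and> w \<longlonglongrightarrow> b"
  obtain y t where yt: "b = (y, t)" "0 < t" using b by auto
  have wy: "(\<lambda>j. fst (w j)) \<longlonglongrightarrow> y" and wt: "(\<lambda>j. snd (w j)) \<longlonglongrightarrow> t"
    using w tendsto_fst[of w b sequentially] tendsto_snd[of w b sequentially] by (auto simp: yt)
  have cont: "continuous_on UNIV \<psi>" by (rule intrinsic_family_continuous[OF \<psi> \<alpha>(1)])
  have [measurable]: "\<psi> \<in> borel_measurable borel" using cont by (rule borel_measurable_continuous_onI)
  have [measurable]: "f \<in> borel_measurable lebesgue" using li by (simp add: locally_integrable_iff)
  have "\<forall>\<^sub>F j in sequentially. dist (fst (w j)) y < 1" using wy by (rule tendstoD) simp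
  moreover have "\<forall>\<^sub>F j in sequentially. t / 2 < snd (w j)" using wt by (rule order_tendstoD) (use yt in simp)
  moreover have "\<forall>\<^sub>F j in sequentially. snd (w j) < 2 * t" using wt by (rule order_tendstoD) (use yt in simp)
  ultimately have "\<forall>\<^sub>F j in sequentially. dist (fst (w j)) y < 1 \<and> t / 2 < snd (w j) \<and> snd (w j) < 2 * t"
    by eventually_elim simp
  then obtain M where M: "\<And>j. M \<le> j \<Longrightarrow> dist (fst (w j)) y < 1 \<and> t / 2 < snd (w j) \<and> snd (w j) < 2 * t"
    by (auto simp: eventually_sequentially)
  define a where "a j = fst (w (j + M))" for j
  define \<tau> where "\<tau> j = snd (w (j + M))" for j
  have a: "a \<longlonglongrightarrow> y" "\<And>j. dist (a j) y < 1" and \<tau>: "\<tau> \<longlonglongrightarrow> t" "\<And>j. t / 2 < \<tau> j" "\<And>j. \<tau> j < 2 * t"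
    using LIMSEQ_ignore_initial_segment[OF wy, of M] LIMSEQ_ignore_initial_segment[OF wt, of M] M
    by (auto simp: a_def[abs_def] \<tau>_def[abs_def])
  have \<tau>0: "0 < \<tau> j" for j using \<tau>(2)[of j] yt(2) by linarith
  have dil: "dilate s \<psi> u = \<psi> (u /\<^sub>R s) / s ^ CARD('n)" for s and u :: "real ^ 'n"
    by (simp add: dilate_def power_int_minus divide_inverse mult.commute)
  let ?A = "2 / (t / 2) ^ CARD('n)"
  have "(\<lambda>j. LINT z|lebesgue. f z * dilate (\<tau> j) \<psi> (a j - z)) \<longlonglongrightarrow> (LINT z|lebesgue. f z * dilate t \<psi> (y - z))"
  proof (rule integral_dominated_convergence[where w="\<lambda>z. ?A * (indicator (cball y (2 * t + 1)) z *\<^sub>R \<bar>f z\<bar>)"])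
    have m: "(\<lambda>z. \<psi> ((u - z) /\<^sub>R s)) \<in> borel_measurable lebesgue" for u s
      by (intro borel_measurable_lebesgue) measurable
    then show "(\<lambda>z. f z * dilate t \<psi> (y - z)) \<in> borel_measurable lebesgue"
      "(\<lambda>z. f z * dilate (\<tau> j) \<psi> (a j - z)) \<in> borel_measurable lebesgue" for j
      unfolding dil by measurable
    have "set_integrable lebesgue (cball y (2 * t + 1)) f"
      using li unfolding locally_integrable_def by (meson compact_cball)
    then have "set_integrable lebesgue (cball y (2 * t + 1)) (\<lambda>z. \<bar>f z\<bar>)" by (rule set_integrable_abs)
    then show "integrable lebesgue (\<lambda>z. ?A * (indicator (cball y (2 * t + 1)) z *\<^sub>R \<bar>f z\<bar>))"
      unfolding set_integrable_def by (rule integrable_mult_right)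
    show "AE z in lebesgue. (\<lambda>j. f z * dilate (\<tau> j) \<psi> (a j - z)) \<longlonglongrightarrow> f z * dilate t \<psi> (y - z)"
    proof (rule AE_I2)
      fix z
      have "(\<lambda>j. (a j - z) /\<^sub>R \<tau> j) \<longlonglongrightarrow> (y - z) /\<^sub>R t"
        using yt(2) by (intro tendsto_scaleR tendsto_inverse tendsto_diff a \<tau> tendsto_const) auto
      then have "(\<lambda>j. \<psi> ((a j - z) /\<^sub>R \<tau> j)) \<longlonglongrightarrow> \<psi> ((y - z) /\<^sub>R t)"
        by (rule continuous_on_tendsto_compose[OF cont]) auto
      then show "(\<lambda>j. f z * dilate (\<tau> j) \<psi> (a j - z)) \<longlonglongrightarrow> f z * dilate t \<psi> (y - z)"
        unfolding dil using yt(2) by (intro tendsto_mult tendsto_divide tendsto_power \<tau> tendsto_const) auto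
    qed
    show "AE z in lebesgue. norm (f z * dilate (\<tau> j) \<psi> (a j - z)) \<le> ?A * (indicator (cball y (2 * t + 1)) z *\<^sub>R \<bar>f z\<bar>)" for j
    proof (rule AE_I2)
      fix z
      show "norm (f z * dilate (\<tau> j) \<psi> (a j - z)) \<le> ?A * (indicator (cball y (2 * t + 1)) z *\<^sub>R \<bar>f z\<bar>)"
      proof (cases "z \<in> cball y (2 * t + 1)")
        case True
        have "\<bar>dilate (\<tau> j) \<psi> (a j - z)\<bar> = \<bar>\<psi> ((a j - z) /\<^sub>R \<tau> j)\<bar> / \<tau> j ^ CARD('n)" using \<tau>0[of j] by (simp add: dil)
        also have "\<dots> \<le> ?A"
          using \<tau>(2)[of j] yt(2) by (intro frac_le intrinsic_family_bound[OF \<psi> \<alpha>] power_mono) auto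
        finally have "\<bar>dilate (\<tau> j) \<psi> (a j - z)\<bar> * \<bar>f z\<bar> \<le> ?A * \<bar>f z\<bar>" by (rule mult_right_mono) simp
        then show ?thesis using True by (simp add: abs_mult mult.commute)
      next
        case False
        then have "2 * t + 1 < norm (y - z)" by (simp add: dist_norm)
        moreover have "norm (y - z) \<le> norm (y - a j) + norm (a j - z)"
          using norm_triangle_ineq[of "y - a j" "a j - z"] by simp
        moreover have "norm (y - a j) < 1" using a(2)[of j] by (simp add: dist_norm norm_minus_commute)
        ultimately have "\<tau> j < norm (a j - z)" using \<tau>(3)[of j] by linarith
        then have "1 < norm (a j - z) / \<tau> j" using \<tau>0[of j] by simp
        moreover have "norm ((a j - z) /\<^sub>R \<tau> j) = norm (a j - z) / \<tau> j"
          using \<tau>0[of j] by (simp add: divide_inverse mult.commute del: scaleR_diff_right)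
        ultimately have "\<psi> ((a j - z) /\<^sub>R \<tau> j) = 0" using \<psi> by (auto simp: intrinsic_family_def)
        then show ?thesis using False by (simp add: dil)
      qed
    qed
  qed
  then have "(\<lambda>j. (\<lambda>j. convolution f (dilate (snd (w j)) \<psi>) (fst (w j))) (j + M)) \<longlonglongrightarrow> convolution f (dilate t \<psi>) y"
    by (simp add: convolution_def a_def \<tau>_def)
  then have "(\<lambda>j. convolution f (dilate (snd (w j)) \<psi>) (fst (w j))) \<longlonglongrightarrow> convolution f (dilate t \<psi>) y"
    by (rule LIMSEQ_offset)
  then show "((\<lambda>(y, t). convolution f (dilate t \<psi>) y) \<circ> w) \<longlonglongrightarrow> (\<lambda>(y, t). convolution f (dilate t \<psi>) y) b"
    by (simp add: comp_def case_prod_beta yt)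
qed

text \<open>For a fixed test function the convolution is continuous on the half space, so the superlevel
  sets of the supremum are open there.\<close>

lemma borel_measurable_intrinsic_sup:
  fixes f :: "real ^ 'n \<Rightarrow> real"
  assumes li: "locally_integrable f" and \<alpha>: "0 < \<alpha>" "\<alpha> \<le> 1"
  shows "(\<lambda>(y, t). intrinsic_sup \<alpha> f t y * indicator {0<..} t) \<in> borel_measurable borel"
proof (rule borel_measurableI_greater)
  fix c :: ennreal
  let ?H = "UNIV \<times> {0<..} :: ((real ^ 'n) \<times> real) set"
  let ?F = "\<lambda>\<psi> (y, t). ennreal \<bar>convolution f (dilate t \<psi>) y\<bar>"
  have op: "open (?H \<inter> ?F \<psi> -` {c<..})" if "\<psi> \<in> intrinsic_family \<alpha>" for \<psi>
  proof -
    have "continuous_on ?H (\<lambda>q. ennreal \<bar>(\<lambda>(y, t). convolution f (dilate t \<psi>) y) q\<bar>)"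
      by (intro continuous_on_ennreal continuous_intros convolution_dilate_continuous[OF li \<alpha> that])
    moreover have eq: "?F \<psi> = (\<lambda>q. ennreal \<bar>(\<lambda>(y, t). convolution f (dilate t \<psi>) y) q\<bar>)" by auto
    ultimately have "continuous_on ?H (?F \<psi>)" by (simp only: eq)
    moreover have "open ?H" by (intro open_Times) auto
    ultimately show ?thesis by (rule continuous_open_preimage) simp
  qed
  have "{q \<in> space borel. c < (\<lambda>(y, t). intrinsic_sup \<alpha> f t y * indicator {0<..} t) q}
      = (\<Union>\<psi>\<in>intrinsic_family \<alpha>. ?H \<inter> ?F \<psi> -` {c<..})"
    by (auto simp: intrinsic_sup_def less_SUP_iff split: split_indicator_asm)
  also have "\<dots> \<in> sets borel" using op by (intro borel_open open_UN) auto
  finally show "{q \<in> space borel. c < (\<lambda>(y, t). intrinsic_sup \<alpha> f t y * indicator {0<..} t) q} \<in> sets borel" .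
qed

text \<open>Membership in an Orlicz space includes measurability through local integrability. The
  restriction to t > 0 is moved into the integrand, which is then Borel on the product; Tonelli
  applies to the Borel measure, and integrals for its completion have the same value.\<close>

theorem borel_measurable_gstar:
  fixes f :: "real ^ 'n \<Rightarrow> real"
  assumes li: "locally_integrable f" and \<alpha>: "0 < \<alpha>" "\<alpha> \<le> 1"
  shows "intrinsic_gstar l \<alpha> f \<in> borel_measurable lebesgue"
proof -
  let ?A = "\<lambda>q :: (real ^ 'n) \<times> real. (\<lambda>(y, t). intrinsic_sup \<alpha> f t y * indicator {0<..} t) q"
  let ?G = "\<lambda>x q. ennreal ((snd q / (snd q + norm (x - fst q))) powr (real CARD('n) * l)) *
      (?A q)\<^sup>2 / ennreal (snd q ^ (CARD('n) + 1)) * indicator {0<..} (snd q)"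
  have [measurable]: "?A \<in> borel_measurable (borel :: ((real ^ 'n) \<times> real) measure)"
    by (rule borel_measurable_intrinsic_sup[OF li \<alpha>])
  have [measurable]: "(\<lambda>z. ?A (snd z)) \<in> borel_measurable ((borel :: (real ^ 'n) measure) \<Otimes>\<^sub>M (lborel :: ((real ^ 'n) \<times> real) measure))"
    by (rule measurable_compose[OF measurable_snd]) simp
  have [measurable]: "(fst :: (real ^ 'n) \<times> real \<Rightarrow> _) \<in> borel_measurable borel" "(snd :: (real ^ 'n) \<times> real \<Rightarrow> _) \<in> borel_measurable borel"
    by (intro borel_measurable_continuous_onI continuous_intros)+
  have "(\<lambda>z. ?G (fst z) (snd z)) \<in> borel_measurable ((borel :: (real ^ 'n) measure) \<Otimes>\<^sub>M (lborel :: ((real ^ 'n) \<times> real) measure))"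
    by measurable
  then have "(\<lambda>x. \<integral>\<^sup>+q. ?G x q \<partial>lborel) \<in> borel_measurable borel"
    using lborel.borel_measurable_nn_integral[of "?G" borel] by (simp add: case_prod_beta')
  moreover have "intrinsic_gstar l \<alpha> f x = ennreal_sqrt (\<integral>\<^sup>+q. ?G x q \<partial>lborel)" for x
    unfolding intrinsic_gstar_def nn_integral_completion
    by (intro arg_cong[where f=ennreal_sqrt] nn_integral_cong) (auto split: split_indicator)
  ultimately have "intrinsic_gstar l \<alpha> f \<in> borel_measurable borel"
    by (simp cong: measurable_cong)
  then show ?thesis by (rule borel_measurable_lebesgue)
qed

section \<open>The local estimate\<close>

definition tail_integral :: "(real \<Rightarrow> ennreal) \<Rightarrow> (real ^ 'n \<Rightarrow> real) \<Rightarrow> real ^ 'n \<Rightarrow> real \<Rightarrow> ennreal" where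
  "tail_integral \<Phi> f x r = (\<integral>\<^sup>+t\<in>{r<..}. ball_norm \<Phi> f x t * inv_scale TYPE('n) \<Phi> t / ennreal t \<partial>lebesgue)"

text \<open>On the interval from R to 2 R the ball norm is at least its value at R, the inverse at
  least its value at 2 R, and 1 / t at least 1 / (2 R). As the interval has length R, half of the
  product survives; going back from 2 R to R in the inverse costs \<open>2 ^ n\<close>, so the
  constant is \<open>2 ^ (n + 1)\<close>.\<close>

lemma dyadic_sum_le_tail:
  fixes f :: "real ^ 'n \<Rightarrow> real"
  assumes Y: "young_function \<Phi>" and r: "0 < r" "r \<le> \<rho>"
  shows "(\<Sum>\<^sup>+j::nat. inv_scale TYPE('n) \<Phi> (2 ^ j * \<rho>) * ball_norm \<Phi> f x (2 ^ j * \<rho>))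
    \<le> ennreal (2 ^ (CARD('n) + 1)) * tail_integral \<Phi> f x r"
proof -
  let ?R = "\<lambda>j::nat. 2 ^ j * \<rho>"
  let ?I = "\<lambda>j. {?R j<..<2 * ?R j}"
  let ?i = "inv_scale TYPE('n) \<Phi>" and ?N = "ball_norm \<Phi> f x"
  have \<rho>: "0 < \<rho>" using r by linarith
  have R: "0 < ?R j" for j using \<rho> by simp
  define c where "c j = ?N (?R j) * ?i (2 * ?R j) * ennreal (1 / (2 * ?R j))" for j
  have [measurable]: "?I j \<in> sets lebesgue" for j by (intro lebesgue_of_borel) simp
  have unique: "i = j" if "t \<in> ?I i" "t \<in> ?I j" for t :: real and i j
  proof -
    have *: "\<not> i < j" if "t \<in> ?I i" "t \<in> ?I j" for t :: real and i j
    proof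
      assume "i < j"
      then have "2 ^ Suc i * \<rho> \<le> 2 ^ j * \<rho>" using \<rho> by (intro mult_right_mono power_increasing) auto
      with that show False by simp
    qed
    from *[OF that] *[OF that(2,1)] show ?thesis by simp
  qed
  have pw: "(\<Sum>\<^sup>+j. c j * indicator (?I j) t) \<le> ?N t * ?i t / ennreal t * indicator {r<..} t" for t
  proof (cases "\<exists>j. t \<in> ?I j")
    case True
    then obtain j where j: "t \<in> ?I j" ..
    have "(\<Sum>\<^sup>+k. c k * indicator (?I k) t) = (\<Sum>\<^sup>+k. c k * indicator {j} k)"
    proof (rule nn_integral_cong)
      fix k
      have "t \<in> ?I k \<longleftrightarrow> k = j" using unique[OF _ j] j by blast
      then have "indicator (?I k) t = (indicator {j} k :: ennreal)" by (simp only: indicator_def singleton_iff)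
      then show "c k * indicator (?I k) t = c k * indicator {j} k" by (simp only:)
    qed
    also have "\<dots> = c j" by (subst nn_integral_count_space'[of "{j}"]) (auto simp: indicator_def)
    also have "\<dots> \<le> ?N t * ?i t * ennreal (1 / t)"
    proof -
      have t: "?R j \<le> t" "t \<le> 2 * ?R j" "0 < t"
        using j R[of j] unfolding greaterThanLessThan_iff by linarith+
      have "?N (?R j) \<le> ?N t" by (rule ball_norm_mono[OF Y t(1)])
      moreover have "?i (2 * ?R j) \<le> ?i t" by (rule inv_scale_antimono[OF t(3,2)])
      moreover have "ennreal (1 / (2 * ?R j)) \<le> ennreal (1 / t)"
        by (rule ennreal_leI, rule divide_left_mono[OF t(2)]) (use t R[of j] in auto)
      ultimately show ?thesis unfolding c_def by (rule mult_mono[OF mult_mono[OF _ _ zero_le zero_le] _ zero_le zero_le])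
    qed
    also have "\<dots> = ?N t * ?i t / ennreal t"
      using j R[of j] by (simp add: divide_ennreal_def inverse_ennreal inverse_eq_divide)
    also have "r < t"
    proof -
      have "1 * \<rho> \<le> 2 ^ j * \<rho>" using \<rho> by (intro mult_right_mono) auto
      then show ?thesis using r(2) j by simp
    qed
    then have "?N t * ?i t / ennreal t = ?N t * ?i t / ennreal t * indicator {r<..} t" by simp
    finally show ?thesis .
  next
    case False
    then have "(\<Sum>\<^sup>+j. c j * indicator (?I j) t) = (\<Sum>\<^sup>+(j::nat). 0)"
      by (intro nn_integral_cong) (auto simp: indicator_def)
    then show ?thesis by simp
  qed
  have "(\<Sum>\<^sup>+j. c j * ennreal (?R j)) = (\<Sum>\<^sup>+j. \<integral>\<^sup>+t. c j * indicator (?I j) t \<partial>lebesgue)"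
  proof (rule nn_integral_cong)
    fix j
    have "emeasure lebesgue (?I j) = ennreal (2 * ?R j - ?R j)"
    proof -
      have "emeasure lborel (?I j) = ennreal (2 * ?R j - ?R j)"
        by (rule emeasure_lborel_Ioo) (use R[of j] in linarith)
      moreover have "emeasure lebesgue (?I j) = emeasure lborel (?I j)" by simp
      ultimately show ?thesis by (simp only:)
    qed
    also have "2 * ?R j - ?R j = ?R j" by simp
    finally have "emeasure lebesgue (?I j) = ennreal (?R j)" .
    moreover have "(\<integral>\<^sup>+t. c j * indicator (?I j) t \<partial>lebesgue) = c j * emeasure lebesgue (?I j)"
      by (rule nn_integral_cmult_indicator) measurable
    ultimately show "c j * ennreal (?R j) = (\<integral>\<^sup>+t. c j * indicator (?I j) t \<partial>lebesgue)" by (simp only:)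
  qed
  also have "\<dots> = (\<integral>\<^sup>+t. (\<Sum>\<^sup>+j. c j * indicator (?I j) t) \<partial>lebesgue)"
    by (rule nn_integral_nsum[symmetric]) measurable
  also have "\<dots> \<le> tail_integral \<Phi> f x r"
    unfolding tail_integral_def by (intro nn_integral_mono pw)
  finally have main: "(\<Sum>\<^sup>+j. c j * ennreal (?R j)) \<le> tail_integral \<Phi> f x r" .
  have "(\<Sum>\<^sup>+j. ?i (?R j) * ?N (?R j)) \<le> (\<Sum>\<^sup>+j. ennreal (2 ^ (CARD('n) + 1)) * (c j * ennreal (?R j)))"
  proof (rule nsum_mono)
    fix j
    have "?i (?R j) * ?N (?R j) \<le> (ennreal (2 ^ CARD('n)) * ?i (2 * ?R j)) * ?N (?R j)"
      by (intro mult_right_mono inv_scale_double[OF Y R]) simp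
    also have "\<dots> = ennreal (2 ^ CARD('n)) * (?i (2 * ?R j) * ?N (?R j))" by (simp only: mult.assoc)
    also have "ennreal (2 ^ CARD('n)) = ennreal (2 ^ (CARD('n) + 1)) * (ennreal (1 / (2 * ?R j)) * ennreal (?R j))"
    proof -
      have "ennreal (2 ^ (CARD('n) + 1)) * (ennreal (1 / (2 * ?R j)) * ennreal (?R j))
          = ennreal (2 ^ (CARD('n) + 1) * (1 / (2 * ?R j) * ?R j))"
        using R[of j] by (simp only: ennreal_mult[symmetric] zero_le_power zero_le_numeral less_imp_le mult_nonneg_nonneg divide_nonneg_nonneg zero_le_one)
      also have "2 ^ (CARD('n) + 1) * (1 / (2 * ?R j) * ?R j) = 2 ^ CARD('n)" using R[of j] \<rho> by simp
      finally show ?thesis by simp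
    qed
    also have "\<dots> * (?i (2 * ?R j) * ?N (?R j)) = ennreal (2 ^ (CARD('n) + 1)) * (c j * ennreal (?R j))"
      unfolding c_def by (simp only: mult_ac)
    finally show "?i (?R j) * ?N (?R j) \<le> ennreal (2 ^ (CARD('n) + 1)) * (c j * ennreal (?R j))" .
  qed
  also have "\<dots> = ennreal (2 ^ (CARD('n) + 1)) * (\<Sum>\<^sup>+j. c j * ennreal (?R j))" by (rule nn_integral_cmult) simp
  also have "\<dots> \<le> ennreal (2 ^ (CARD('n) + 1)) * tail_integral \<Phi> f x r" by (rule mult_left_mono[OF main]) simp
  finally show ?thesis .
qed

text \<open>On the shell where |z - x| lies between \<open>2 ^ j * (2 * r)\<close> and twice that
  radius, the denominator is fixed up to \<open>2 ^ n\<close>, and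
  \<open>integral_ball_le_norm\<close> on the larger ball cancels it. The outcome is the dyadic sum
  starting at radius 4 r.\<close>

lemma far_integral_le_tail:
  obtains C where "0 \<le> C" "\<And>\<Phi> p\<^sub>1 (f :: real ^ 'n \<Rightarrow> real) x r. young_function \<Phi> \<Longrightarrow> upper_type \<Phi> p\<^sub>1 \<Longrightarrow>
    f \<in> borel_measurable lebesgue \<Longrightarrow> 0 < r \<Longrightarrow>
    (\<integral>\<^sup>+z. ennreal (\<bar>f z * indicator (- ball x (2 * r)) z\<bar> / norm (z - x) ^ CARD('n)) \<partial>lebesgue)
      \<le> ennreal C * tail_integral \<Phi> f x r"
proof -
  let ?n = "CARD('n)"
  obtain C where C: "0 < C" "\<And>\<Phi> p\<^sub>1 (f :: real ^ 'n \<Rightarrow> real) x r. young_function \<Phi> \<Longrightarrow> upper_type \<Phi> p\<^sub>1 \<Longrightarrow> f \<in> borel_measurable lebesgue \<Longrightarrow> 0 < r \<Longrightarrow>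
    (\<integral>\<^sup>+z\<in>ball x r. ennreal \<bar>f z\<bar> \<partial>lebesgue) \<le> ennreal (C * r ^ CARD('n)) * inv_scale TYPE('n) \<Phi> r * ball_norm \<Phi> f x r"
    by (rule integral_ball_le_norm[where 'n='n], rule that)
  have "(\<integral>\<^sup>+z. ennreal (\<bar>f z * indicator (- ball x (2 * r)) z\<bar> / norm (z - x) ^ ?n) \<partial>lebesgue)
      \<le> ennreal (2 ^ ?n * C * 2 ^ (?n + 1)) * tail_integral \<Phi> f x r"
    if Y: "young_function \<Phi>" and U: "upper_type \<Phi> p\<^sub>1" and f [measurable]: "f \<in> borel_measurable lebesgue" and r: "0 < r"
    for \<Phi> p\<^sub>1 and f :: "real ^ 'n \<Rightarrow> real" and x r
  proof -
    let ?S = "\<lambda>j::nat. 2 ^ j * (2 * r)" and ?R = "\<lambda>j::nat. 2 ^ j * (4 * r)"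
    have [measurable]: "ball x s \<in> sets lebesgue" for s by (intro lebesgue_of_borel) simp
    have SR: "?R j = 2 * ?S j" "0 < ?S j" "0 < ?R j" for j using r by auto
    have pw: "ennreal (\<bar>f z * indicator (- ball x (2 * r)) z\<bar> / norm (z - x) ^ ?n) \<le>
       (\<Sum>\<^sup>+j. ennreal (1 / ?S j ^ ?n) * (ennreal \<bar>f z\<bar> * indicator (ball x (?R j)) z))" (is "_ \<le> (\<Sum>\<^sup>+j. ?t j)") for z
    proof (cases "z \<in> ball x (2 * r)")
      case False
      then have d: "2 * r \<le> norm (z - x)" by (simp add: dist_norm norm_minus_commute)
      have "0 < norm (z - x)" using d r by linarith
      then have "0 < norm (z - x) / (2 * r)" using r by (intro divide_pos_pos) linarith+
      then obtain i where i: "sz i \<le> norm (z - x) / (2 * r)" "norm (z - x) / (2 * r) < 2 * sz i" by (rule sz_bracket)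
      have "1 \<le> norm (z - x) / (2 * r)" using d r by simp
      then have "sz 0 < sz (i + 1)" using i(2) unfolding sz_Suc sz_0 by linarith
      then have "0 \<le> i" unfolding sz_less_iff by simp
      then obtain j where j: "i = int j" by (metis nonneg_int_cases)
      have S: "?S j \<le> norm (z - x)" using i(1) r by (simp add: j sz_of_nat field_simps)
      have "norm (z - x) < ?R j" using i(2) r by (simp add: j sz_of_nat field_simps)
      then have ind: "z \<in> ball x (?R j)" by (simp add: dist_norm norm_minus_commute)
      have "\<bar>f z\<bar> / norm (z - x) ^ ?n \<le> \<bar>f z\<bar> / ?S j ^ ?n"
      proof (rule divide_left_mono)
        have "0 < norm (z - x)" using S SR(2)[of j] by linarith
        then show "0 < norm (z - x) ^ ?n * ?S j ^ ?n" by (rule mult_pos_pos[OF zero_less_power zero_less_power[OF SR(2)]])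
        show "?S j ^ ?n \<le> norm (z - x) ^ ?n" by (rule power_mono[OF S less_imp_le[OF SR(2)]])
      qed simp
      then have "ennreal (\<bar>f z\<bar> / norm (z - x) ^ ?n) \<le> ennreal (1 / ?S j ^ ?n * \<bar>f z\<bar>)" by (intro ennreal_leI) simp
      also have "\<dots> = ennreal (1 / ?S j ^ ?n) * ennreal \<bar>f z\<bar>"
        by (rule ennreal_mult[OF divide_nonneg_nonneg[OF zero_le_one zero_le_power[OF less_imp_le[OF SR(2)]]] abs_ge_zero])
      also have "\<dots> = ?t j" using ind by (simp only: indicator_simps mult_1_right)
      also have "\<dots> \<le> (\<Sum>\<^sup>+j. ?t j)" by (rule nsum_upper)
      finally show ?thesis using False by simp
    qed simp
    have "(\<integral>\<^sup>+z. ennreal (\<bar>f z * indicator (- ball x (2 * r)) z\<bar> / norm (z - x) ^ ?n) \<partial>lebesgue)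
       \<le> (\<integral>\<^sup>+z. (\<Sum>\<^sup>+j. ennreal (1 / ?S j ^ ?n) * (ennreal \<bar>f z\<bar> * indicator (ball x (?R j)) z)) \<partial>lebesgue)"
      by (intro nn_integral_mono pw)
    also have "\<dots> = (\<Sum>\<^sup>+j. \<integral>\<^sup>+z. ennreal (1 / ?S j ^ ?n) * (ennreal \<bar>f z\<bar> * indicator (ball x (?R j)) z) \<partial>lebesgue)"
      by (rule nn_integral_nsum) measurable
    also have "\<dots> = (\<Sum>\<^sup>+j. ennreal (1 / ?S j ^ ?n) * (\<integral>\<^sup>+z\<in>ball x (?R j). ennreal \<bar>f z\<bar> \<partial>lebesgue))"
      by (intro nn_integral_cong nn_integral_cmult) measurable
    also have "\<dots> \<le> (\<Sum>\<^sup>+j. ennreal (1 / ?S j ^ ?n) * (ennreal (C * ?R j ^ ?n) * inv_scale TYPE('n) \<Phi> (?R j) * ball_norm \<Phi> f x (?R j)))"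
      using r by (intro nsum_mono mult_left_mono C(2)[OF Y U f]) auto
    also have "\<dots> = (\<Sum>\<^sup>+j. ennreal (2 ^ ?n * C) * (inv_scale TYPE('n) \<Phi> (?R j) * ball_norm \<Phi> f x (?R j)))"
    proof (rule nn_integral_cong)
      fix j :: nat
      have "ennreal (1 / ?S j ^ ?n) * ennreal (C * ?R j ^ ?n) = ennreal (1 / ?S j ^ ?n * (C * ?R j ^ ?n))"
        using C(1) SR(2,3)[of j] by (intro ennreal_mult[symmetric]) auto
      also have "1 / ?S j ^ ?n * (C * ?R j ^ ?n) = 2 ^ ?n * C"
        unfolding SR(1) power_mult_distrib[of 2 "?S j"] using SR(2)[of j] r by simp
      finally have "ennreal (1 / ?S j ^ ?n) * ennreal (C * ?R j ^ ?n) = ennreal (2 ^ ?n * C)" .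
      then show "ennreal (1 / ?S j ^ ?n) * (ennreal (C * ?R j ^ ?n) * inv_scale TYPE('n) \<Phi> (?R j) * ball_norm \<Phi> f x (?R j)) =
        ennreal (2 ^ ?n * C) * (inv_scale TYPE('n) \<Phi> (?R j) * ball_norm \<Phi> f x (?R j))"
        by (simp only: mult.assoc[symmetric])
    qed
    also have "\<dots> = ennreal (2 ^ ?n * C) * (\<Sum>\<^sup>+j. inv_scale TYPE('n) \<Phi> (?R j) * ball_norm \<Phi> f x (?R j))"
      by (rule nn_integral_cmult) simp
    also have "\<dots> \<le> ennreal (2 ^ ?n * C) * (ennreal (2 ^ (?n + 1)) * tail_integral \<Phi> f x r)"
      using r by (intro mult_left_mono dyadic_sum_le_tail[OF Y]) auto
    also have "\<dots> = ennreal (2 ^ ?n * C * 2 ^ (?n + 1)) * tail_integral \<Phi> f x r"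
      using C(1) by (simp add: ennreal_mult mult.assoc)
    finally show ?thesis .
  qed
  then show ?thesis using C(1) by (intro that[of "2 ^ ?n * C * 2 ^ (?n + 1)"]) auto
qed

lemma orlicz_loc_locally_integrable:
  fixes f :: "real ^ 'n \<Rightarrow> real"
  assumes "f \<in> orlicz_loc \<Phi>" shows "locally_integrable f"
  unfolding locally_integrable_iff
proof safe
  have li: "locally_integrable (\<lambda>y. f y * indicator (ball x r) y)" if "0 < r" for x r
    using assms that unfolding orlicz_loc_def orlicz_space_def by auto
  show "f \<in> borel_measurable lebesgue"
  proof (rule borel_measurable_LIMSEQ_real)
    show "(\<lambda>z. f z * indicator (ball 0 (real (Suc j))) z) \<in> borel_measurable lebesgue" for j
      using li[of "real (Suc j)" 0] unfolding locally_integrable_iff by simp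
    fix z :: "real ^ 'n"
    obtain j0 where "norm z < real j0" using reals_Archimedean2 by blast
    then show "(\<lambda>j. f z * indicator (ball 0 (real (Suc j))) z) \<longlonglongrightarrow> f z"
      by (intro tendsto_eventually) (auto intro!: eventually_sequentiallyI[of j0])
  qed
  fix x :: "real ^ 'n" and r
  have "(\<integral>\<^sup>+z\<in>cball x r. ennreal \<bar>f z\<bar> \<partial>lebesgue) = (\<integral>\<^sup>+z\<in>cball x r. ennreal \<bar>f z * indicator (ball x (max 0 r + 1)) z\<bar> \<partial>lebesgue)"
    by (intro nn_integral_cong) (auto split: split_indicator)
  also have "\<dots> < \<infinity>" using li[of "max 0 r + 1" x] unfolding locally_integrable_iff by simp
  finally show "(\<integral>\<^sup>+z\<in>cball x r. ennreal \<bar>f z\<bar> \<partial>lebesgue) < \<infinity>" .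
qed

lemma ennreal_sqrt_sq_fun_add:
  assumes "0 < \<alpha>" "locally_integrable f" "locally_integrable g"
  shows "ennreal_sqrt (sq_fun \<alpha> (\<lambda>x. f x + g x) x) \<le> 2 * (ennreal_sqrt (sq_fun \<alpha> f x) + ennreal_sqrt (sq_fun \<alpha> g x))"
proof (rule ennreal_sqrt_le)
  let ?a = "ennreal_sqrt (sq_fun \<alpha> f x)" and ?b = "ennreal_sqrt (sq_fun \<alpha> g x)"
  have "sq_fun \<alpha> (\<lambda>x. f x + g x) x \<le> 2 * (?a\<^sup>2 + ?b\<^sup>2)" using sq_fun_add[OF assms, of x] by simp
  also have "\<dots> \<le> 4 * (?a + ?b)\<^sup>2"
  proof -
    have "?a\<^sup>2 + ?b\<^sup>2 \<le> (?a + ?b)\<^sup>2" by (simp add: power2_sum add_increasing2)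
    then show ?thesis by (intro mult_mono) auto
  qed
  also have "\<dots> = (2 * (?a + ?b))\<^sup>2" by (subst power_mult_distrib) simp
  finally show "sq_fun \<alpha> (\<lambda>x. f x + g x) x \<le> (2 * (?a + ?b))\<^sup>2" .
qed

text \<open>For each \<mu> admissible for f on the doubled ball,
  \<open>L * (\<mu> + \<kappa> / i)\<close> is shown to be admissible for the g-star function on the
  ball, where \<kappa> is the far integral and i the inverse at \<open>r powi - n\<close>. The
  infimum over \<mu> gives the norm bound; multiplication by i turns \<kappa> / i back into the far
  integral.\<close>

theorem gstar_local_estimate:
  fixes \<Phi> :: "real \<Rightarrow> ennreal"
  assumes \<alpha>: "0 < \<alpha>" "\<alpha> \<le> 1" and Y: "young_function \<Phi>" and lower: "lower_type \<Phi> p\<^sub>0" and upper: "upper_type \<Phi> p\<^sub>1"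
    and p0: "1 < p\<^sub>0" and l: "2 * real CARD('n) + 1 \<le> real CARD('n) * l"
  obtains C where "0 \<le> C" "\<And>(f :: real ^ 'n \<Rightarrow> real) x r. f \<in> orlicz_loc \<Phi> \<Longrightarrow> 0 < r \<Longrightarrow> tail_integral \<Phi> f x r < \<infinity> \<Longrightarrow>
    (AE y in lebesgue. y \<in> ball x r \<longrightarrow> intrinsic_gstar l \<alpha> f y < \<infinity>) \<and>
    (\<lambda>y. enn2real (intrinsic_gstar l \<alpha> f y) * indicator (ball x r) y) \<in> orlicz_space \<Phi> \<and>
    inv_scale TYPE('n) \<Phi> r * ball_norm \<Phi> (\<lambda>y. enn2real (intrinsic_gstar l \<alpha> f y)) x r \<le> ennreal C * tail_integral \<Phi> f x r"
proof -
  let ?n = "CARD('n)" and ?inv = "inv_scale TYPE('n) \<Phi>"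
  have mono: "\<And>s t. 0 \<le> s \<Longrightarrow> s \<le> t \<Longrightarrow> \<Phi> s \<le> \<Phi> t" by (rule young_mono[OF Y])
  obtain C0 where C0: "0 \<le> C0" "\<And>(f :: real ^ 'n \<Rightarrow> real) x. intrinsic_gstar l \<alpha> f x \<le> ennreal C0 * ennreal_sqrt (sq_fun \<alpha> f x)"
    by (rule gstar_le_sq_fun[where 'n='n, OF \<alpha> l], rule that)
  obtain C1 where C1: "0 \<le> C1" "\<And>\<alpha> (f :: real ^ 'n \<Rightarrow> real) x0 r x. f \<in> borel_measurable lebesgue \<Longrightarrow> 0 < r \<Longrightarrow>
    (\<And>z. z \<in> ball x0 (2 * r) \<Longrightarrow> f z = 0) \<Longrightarrow> x \<in> ball x0 r \<Longrightarrow>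
    ennreal_sqrt (sq_fun \<alpha> f x) \<le> ennreal C1 * (\<integral>\<^sup>+z. ennreal (\<bar>f z\<bar> / norm (z - x0) ^ CARD('n)) \<partial>lebesgue)"
    using sq_fun_far[where 'n='n] by blast
  obtain C2 where C2: "0 \<le> C2" "\<And>(f :: real ^ 'n \<Rightarrow> real) \<mu>. locally_integrable f \<Longrightarrow> 0 < \<mu> \<Longrightarrow>
    (\<integral>\<^sup>+x. layers \<Phi> (ennreal (1 / \<mu>) * ennreal_sqrt (sq_fun \<alpha> f x)) \<partial>lebesgue)
      \<le> ennreal C2 * (\<integral>\<^sup>+x. \<Phi> (\<bar>f x\<bar> / \<mu>) \<partial>lebesgue)"
    by (rule sq_fun_modular[where 'n='n, OF \<alpha>(1) lower upper p0 mono], assumption, assumption, rule that)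
  obtain C3 where C3: "0 < C3" "\<And>\<Phi> p\<^sub>1 (f :: real ^ 'n \<Rightarrow> real) x r. young_function \<Phi> \<Longrightarrow> upper_type \<Phi> p\<^sub>1 \<Longrightarrow> f \<in> borel_measurable lebesgue \<Longrightarrow> 0 < r \<Longrightarrow>
    (\<integral>\<^sup>+z\<in>ball x r. ennreal \<bar>f z\<bar> \<partial>lebesgue) \<le> ennreal (C3 * r ^ CARD('n)) * inv_scale TYPE('n) \<Phi> r * ball_norm \<Phi> f x r"
    by (rule integral_ball_le_norm[where 'n='n], rule that)
  obtain C5 where C5: "0 \<le> C5" "\<And>\<Phi> p\<^sub>1 (f :: real ^ 'n \<Rightarrow> real) x r. young_function \<Phi> \<Longrightarrow> upper_type \<Phi> p\<^sub>1 \<Longrightarrow>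
    f \<in> borel_measurable lebesgue \<Longrightarrow> 0 < r \<Longrightarrow>
    (\<integral>\<^sup>+z. ennreal (\<bar>f z * indicator (- ball x (2 * r)) z\<bar> / norm (z - x) ^ CARD('n)) \<partial>lebesgue)
      \<le> ennreal C5 * tail_integral \<Phi> f x r"
    by (rule far_integral_le_tail[where 'n='n], rule that)
  define V where "V = unit_ball_vol (real ?n)"
  have V: "0 \<le> V" by (simp add: V_def unit_ball_vol_nonneg)
  \<comment> \<open>The contributions to the modular are at most C2 from the near part and V from
    the far part; by convexity, shrinking the argument by \<epsilon> brings their sum below
    1.\<close>
  define \<epsilon> where "\<epsilon> = 1 / (C2 + V + 1)"
  have \<epsilon>: "0 < \<epsilon>" "\<epsilon> \<le> 1" using C2(1) V by (auto simp: \<epsilon>_def divide_le_eq intro!: add_nonneg_pos)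
  \<comment> \<open>Fixed by the requirement \<open>L * \<beta> = 2 * (C0 + 1)\<close> for the
    \<beta> introduced below.\<close>
  define L where "L = 8 * (C0 + 1) * (1 + C1) / \<epsilon>"
  have L: "0 < L" using C0(1) C1(1) \<epsilon> by (auto simp: L_def intro!: mult_pos_pos add_nonneg_pos add_pos_nonneg divide_pos_pos)
  define C where "C = L * 2 ^ ?n * 2 ^ (?n + 1) + L * C5"
  have C: "0 \<le> C" using L C5(1) by (simp add: C_def)
  have "(AE y in lebesgue. y \<in> ball x r \<longrightarrow> intrinsic_gstar l \<alpha> f y < \<infinity>) \<and>
    (\<lambda>y. enn2real (intrinsic_gstar l \<alpha> f y) * indicator (ball x r) y) \<in> orlicz_space \<Phi> \<and>
    ?inv r * ball_norm \<Phi> (\<lambda>y. enn2real (intrinsic_gstar l \<alpha> f y)) x r \<le> ennreal C * tail_integral \<Phi> f x r"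
    if f: "f \<in> orlicz_loc \<Phi>" and r: "0 < r" and J: "tail_integral \<Phi> f x r < \<infinity>" for f :: "real ^ 'n \<Rightarrow> real" and x r
  proof -
    let ?B = "ball x r" and ?B2 = "ball x (2 * r)"
    have [measurable]: "?B \<in> sets lebesgue" "?B2 \<in> sets lebesgue" "- ?B2 \<in> sets lebesgue"
      by (intro lebesgue_of_borel; simp)+
    have li: "locally_integrable f" using f by (rule orlicz_loc_locally_integrable)
    then have f_meas [measurable]: "f \<in> borel_measurable lebesgue" by (simp add: locally_integrable_iff)
    define f1 where "f1 y = f y * indicator ?B2 y" for y
    define f2 where "f2 y = f y * indicator (- ?B2) y" for y
    have f1_meas [measurable]: "f1 \<in> borel_measurable lebesgue" unfolding f1_def by measurable
    have f2_meas [measurable]: "f2 \<in> borel_measurable lebesgue" unfolding f2_def by measurable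
    have li1: "locally_integrable f1"
      by (rule locally_integrable_bound[OF li f1_meas]) (simp add: f1_def split: split_indicator)
    have li2: "locally_integrable f2"
      by (rule locally_integrable_bound[OF li f2_meas]) (simp add: f2_def split: split_indicator)
    have f12: "f = (\<lambda>y. f1 y + f2 y)" by (auto simp: f1_def f2_def split: split_indicator)
    define K where "K = (\<integral>\<^sup>+z. ennreal (\<bar>f2 z\<bar> / norm (z - x) ^ ?n) \<partial>lebesgue)"
    have K_le: "K \<le> ennreal C5 * tail_integral \<Phi> f x r"
      unfolding K_def f2_def by (rule C5(2)[OF Y upper f_meas r])
    also have "\<dots> < \<infinity>" using J by (simp add: ennreal_mult_less_top less_top)
    finally obtain \<kappa> where \<kappa>: "K = ennreal \<kappa>" "0 \<le> \<kappa>" by (cases K) auto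
    obtain i where i: "?inv r = ennreal i" "0 < i"
      using inv_scale_pos[OF Y r, where 'n='n] by (cases "?inv r") auto
    define S1 where "S1 y = ennreal_sqrt (sq_fun \<alpha> f1 y)" for y
    have [measurable]: "S1 \<in> borel_measurable lebesgue" unfolding S1_def by measurable
    define g where "g y = enn2real (intrinsic_gstar l \<alpha> f y)" for y
    have [measurable]: "intrinsic_gstar l \<alpha> f \<in> borel_measurable lebesgue" by (rule borel_measurable_gstar[OF li \<alpha>])
    have g_meas [measurable]: "g \<in> borel_measurable lebesgue" unfolding g_def by measurable
    have pointwise: "intrinsic_gstar l \<alpha> f y \<le> ennreal (2 * C0) * (S1 y + ennreal (C1 * \<kappa>))" if y: "y \<in> ?B" for y
    proof -
      have far: "ennreal_sqrt (sq_fun \<alpha> f2 y) \<le> ennreal C1 * K"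
        unfolding K_def by (rule C1(2)[OF f2_meas r _ y]) (simp add: f2_def)
      have "intrinsic_gstar l \<alpha> f y \<le> ennreal C0 * ennreal_sqrt (sq_fun \<alpha> f y)" by (rule C0(2))
      also have "ennreal_sqrt (sq_fun \<alpha> f y) = ennreal_sqrt (sq_fun \<alpha> (\<lambda>y. f1 y + f2 y) y)"
        by (simp only: f12[symmetric])
      also have "\<dots> \<le> 2 * (S1 y + ennreal_sqrt (sq_fun \<alpha> f2 y))"
        unfolding S1_def by (rule ennreal_sqrt_sq_fun_add[OF \<alpha>(1) li1 li2])
      also have "\<dots> \<le> 2 * (S1 y + ennreal C1 * K)" by (intro mult_left_mono add_left_mono far) simp
      also have "ennreal C1 * K = ennreal (C1 * \<kappa>)" using C1(1) \<kappa> by (simp add: ennreal_mult)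
      finally have "intrinsic_gstar l \<alpha> f y \<le> ennreal C0 * (2 * (S1 y + ennreal (C1 * \<kappa>)))" by (simp add: mult_left_mono)
      also have "\<dots> = ennreal (2 * C0) * (S1 y + ennreal (C1 * \<kappa>))"
        using C0(1) by (simp add: ennreal_mult mult_ac)
      finally show ?thesis .
    qed
    have key: "(AE y in lebesgue. y \<in> ?B \<longrightarrow> intrinsic_gstar l \<alpha> f y < \<infinity>) \<and>
        (\<integral>\<^sup>+y. \<Phi> (\<bar>g y * indicator ?B y\<bar> / (L * (\<mu> + \<kappa> / i))) \<partial>lebesgue) \<le> 1"
      if \<mu>: "0 < \<mu>" and adm: "(\<integral>\<^sup>+y. \<Phi> (\<bar>f1 y\<bar> / \<mu>) \<partial>lebesgue) \<le> 1" for \<mu>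
    proof -
      define X where "X y = ennreal (1 / \<mu>) * S1 y" for y
      have X_meas [measurable]: "X \<in> borel_measurable lebesgue" unfolding X_def by measurable
      have lay_meas [measurable]: "(\<lambda>y. layers \<Phi> (X y)) \<in> borel_measurable lebesgue" by (rule borel_measurable_layers[OF X_meas])
      have "(\<integral>\<^sup>+y. layers \<Phi> (X y) \<partial>lebesgue) \<le> ennreal C2 * (\<integral>\<^sup>+y. \<Phi> (\<bar>f1 y\<bar> / \<mu>) \<partial>lebesgue)"
        unfolding X_def S1_def by (rule C2(2)[OF li1 \<mu>])
      also have "\<dots> \<le> ennreal C2 * 1" by (rule mult_left_mono[OF adm]) simp
      finally have lay: "(\<integral>\<^sup>+y. layers \<Phi> (X y) \<partial>lebesgue) \<le> ennreal C2" by simp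
      have "AE y in lebesgue. layers \<Phi> (X y) \<noteq> \<infinity>"
      proof (rule nn_integral_PInf_AE[OF lay_meas])
        have "(\<integral>\<^sup>+y. layers \<Phi> (X y) \<partial>lebesgue) < \<infinity>" using lay by (rule le_less_trans) simp
        then show "(\<integral>\<^sup>+y. layers \<Phi> (X y) \<partial>lebesgue) \<noteq> \<infinity>" by simp
      qed
      \<comment> \<open>Finiteness of the near part is extracted from the modular bound, as
        \<open>layers\<close> is infinite at infinity.\<close>
      then have fin: "AE y in lebesgue. X y \<noteq> top"
      proof eventually_elim
        case (elim y)
        then show ?case using layers_top[of \<Phi>, OF mono young_limit[OF Y]] by auto
      qed
      have est: "intrinsic_gstar l \<alpha> f y < \<infinity> \<and> \<Phi> (g y / (L * (\<mu> + \<kappa> / i))) \<le> ennreal \<epsilon> * (layers \<Phi> (X y) + ennreal (1 / r ^ ?n))"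
        if y: "y \<in> ?B" and X: "X y \<noteq> top" for y
      proof -
        obtain \<xi> where \<xi>: "X y = ennreal \<xi>" "0 \<le> \<xi>" using X by (cases "X y") auto
        have "S1 y = ennreal \<mu> * X y" using \<mu> by (simp add: X_def mult.assoc[symmetric] ennreal_mult[symmetric])
        then have "S1 y = ennreal (\<mu> * \<xi>)" using \<mu> \<xi> by (simp add: ennreal_mult)
        then have "intrinsic_gstar l \<alpha> f y \<le> ennreal (2 * C0) * (ennreal (\<mu> * \<xi>) + ennreal (C1 * \<kappa>))"
          using pointwise[OF y] by simp
        also have "\<dots> = ennreal (2 * C0 * (\<mu> * \<xi> + C1 * \<kappa>))"
          using \<mu> \<xi> C0(1) C1(1) \<kappa> by (simp add: ennreal_mult[symmetric] ennreal_plus[symmetric] del: ennreal_plus)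
        finally have le: "intrinsic_gstar l \<alpha> f y \<le> ennreal (2 * C0 * (\<mu> * \<xi> + C1 * \<kappa>))" .
        then have fin: "intrinsic_gstar l \<alpha> f y < \<infinity>" by (rule le_less_trans) simp
        have nn: "0 \<le> 2 * C0 * (\<mu> * \<xi> + C1 * \<kappa>)" using \<mu> \<xi> C0(1) C1(1) \<kappa> by simp
        have gle: "g y \<le> 2 * C0 * (\<mu> * \<xi> + C1 * \<kappa>)"
          unfolding g_def using enn2real_mono[OF le] nn by simp
        \<comment> \<open>Dominates both \<mu> and \<kappa> / i, so that one scale serves the near
          and the far contribution.\<close>
        define D where "D = \<mu> + \<kappa> / i"
        have "0 \<le> \<kappa> / i" using \<kappa>(2) i(2) by simp
        then have D: "0 < D" "\<mu> \<le> D" using \<mu> unfolding D_def by linarith+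
        have "D * i = \<mu> * i + \<kappa>" using i(2) by (simp add: D_def distrib_right)
        then have D: "0 < D" "\<mu> \<le> D" "\<kappa> \<le> D * i" using D \<mu> i(2) by simp_all
        define \<beta> where "\<beta> = \<epsilon> / (4 * (1 + C1))"
        have c1: "0 < 1 + C1" using C1(1) by simp
        have \<beta>: "0 \<le> \<beta>" using \<epsilon> c1 by (simp add: \<beta>_def)
        have \<beta>_\<epsilon>: "4 * \<beta> \<le> \<epsilon>" "4 * \<beta> * C1 \<le> \<epsilon>"
          using \<epsilon> c1 C1(1) by (simp_all add: \<beta>_def field_simps)
        have "g y \<le> 2 * (C0 + 1) * (D * \<xi> + C1 * (D * i))"
        proof (rule order_trans[OF gle], rule mult_mono)
          show "\<mu> * \<xi> + C1 * \<kappa> \<le> D * \<xi> + C1 * (D * i)"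
            using D \<xi> C1(1) by (intro add_mono mult_right_mono mult_left_mono) auto
        qed (use \<mu> \<xi> C0(1) C1(1) \<kappa> in auto)
        also have "\<dots> = (L * D) * (\<beta> * (\<xi> + C1 * i))"
        proof -
          have "L * \<beta> = 2 * (C0 + 1)" using \<epsilon>(1) c1 unfolding L_def \<beta>_def by (simp add: divide_eq_eq) (simp add: algebra_simps)
          moreover have "L * D * (\<beta> * (\<xi> + C1 * i)) = (L * \<beta>) * (D * \<xi> + C1 * (D * i))" by (simp add: algebra_simps)
          ultimately show ?thesis by simp
        qed
        finally have "g y / (L * D) \<le> \<beta> * (\<xi> + C1 * i)"
          using L D by (simp add: divide_le_eq mult.commute)
        \<comment> \<open>Each of the two terms is at most half of the corresponding entry, so their
          sum is at most the maximum; \<Phi> of a maximum is then at most the sum of the two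
          values.\<close>
        also have "\<dots> \<le> max (\<epsilon> * \<xi>) (\<epsilon> * (i / 2))"
        proof -
          have "2 * (\<beta> * \<xi>) \<le> \<epsilon> * \<xi>" using mult_right_mono[OF \<beta>_\<epsilon>(1) \<xi>(2)] \<beta> \<xi>(2) mult_nonneg_nonneg[OF \<beta> \<xi>(2)] by linarith
          moreover have "4 * (\<beta> * (C1 * i)) \<le> \<epsilon> * i" using mult_right_mono[OF \<beta>_\<epsilon>(2), of i] i(2) by (simp add: mult.assoc)
          ultimately show ?thesis by (simp add: distrib_left max_def)
        qed
        finally have "\<Phi> (g y / (L * D)) \<le> \<Phi> (max (\<epsilon> * \<xi>) (\<epsilon> * (i / 2)))"
          using L D by (intro mono) (auto simp: g_def)
        also have "\<dots> \<le> \<Phi> (\<epsilon> * \<xi>) + \<Phi> (\<epsilon> * (i / 2))" by (simp add: max_def add_increasing add_increasing2)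
        also have "\<dots> \<le> ennreal \<epsilon> * \<Phi> \<xi> + ennreal \<epsilon> * \<Phi> (i / 2)"
          using \<epsilon> \<xi> i by (intro add_mono young_scale[OF Y]) auto
        also have "\<dots> \<le> ennreal \<epsilon> * layers \<Phi> (X y) + ennreal \<epsilon> * ennreal (1 / r ^ ?n)"
        proof (intro add_mono mult_left_mono)
          show "\<Phi> \<xi> \<le> layers \<Phi> (X y)"
          proof (cases "\<xi> = 0")
            case True
            then show ?thesis using Y by (simp add: young_function_def)
          next
            case False
            show ?thesis by (rule layers_ge[OF mono]) (use False \<xi> in auto)
          qed
          \<comment> \<open>Half of i lies strictly below the inverse, as
            \<open>young_below_inv\<close> demands.\<close>
          have "ennreal (i / 2) < young_inv \<Phi> (ennreal (1 / r ^ ?n))"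
            using i by (simp add: inv_scale_def powi_minus_card ennreal_less_iff)
          then show "\<Phi> (i / 2) \<le> ennreal (1 / r ^ ?n)" using i(2) by (intro young_below_inv) auto
        qed auto
        finally show ?thesis using fin by (simp add: D_def distrib_left)
      qed
      have "AE y in lebesgue. y \<in> ?B \<longrightarrow> intrinsic_gstar l \<alpha> f y < \<infinity>"
        using fin by eventually_elim (use est in blast)
      moreover have "(\<integral>\<^sup>+y. \<Phi> (\<bar>g y * indicator ?B y\<bar> / (L * (\<mu> + \<kappa> / i))) \<partial>lebesgue) \<le> 1"
      proof -
        have "(\<integral>\<^sup>+y. \<Phi> (\<bar>g y * indicator ?B y\<bar> / (L * (\<mu> + \<kappa> / i))) \<partial>lebesgue) \<le>
           (\<integral>\<^sup>+y. ennreal \<epsilon> * (layers \<Phi> (X y) + ennreal (1 / r ^ ?n) * indicator ?B y) \<partial>lebesgue)"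
        proof (rule nn_integral_mono_AE)
          show "AE y in lebesgue. \<Phi> (\<bar>g y * indicator ?B y\<bar> / (L * (\<mu> + \<kappa> / i))) \<le> ennreal \<epsilon> * (layers \<Phi> (X y) + ennreal (1 / r ^ ?n) * indicator ?B y)"
            using fin
          proof eventually_elim
            case (elim y)
            show ?case
            proof (cases "y \<in> ?B")
              case True
              then show ?thesis using est[OF True elim] by (simp add: g_def)
            next
              case False
              then show ?thesis using Y by (simp add: young_function_def)
            qed
          qed
        qed
        also have "\<dots> = ennreal \<epsilon> * ((\<integral>\<^sup>+y. layers \<Phi> (X y) \<partial>lebesgue) + ennreal (1 / r ^ ?n) * emeasure lebesgue ?B)"
          by (simp add: nn_integral_cmult nn_integral_add nn_integral_cmult_indicator del: emeasure_completion)
        also have "ennreal (1 / r ^ ?n) * emeasure lebesgue ?B = ennreal V"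
          using r V by (simp add: emeasure_completion emeasure_ball V_def ennreal_mult[symmetric])
        also have "ennreal \<epsilon> * ((\<integral>\<^sup>+y. layers \<Phi> (X y) \<partial>lebesgue) + ennreal V) \<le> ennreal \<epsilon> * (ennreal C2 + ennreal V)"
          by (intro mult_left_mono add_right_mono lay) simp
        also have "\<dots> = ennreal (\<epsilon> * (C2 + V))"
          using \<epsilon> C2(1) V by (simp add: ennreal_mult[symmetric] ennreal_plus[symmetric] del: ennreal_plus)
        also have "\<dots> \<le> 1"
          using C2(1) V add_nonneg_pos[of "C2 + V" 1] by (simp add: \<epsilon>_def ennreal_le_1 divide_le_eq)
        finally show ?thesis .
      qed
      ultimately show ?thesis ..
    qed
    have f1_orlicz: "f1 \<in> orlicz_space \<Phi>"
      using f r unfolding orlicz_loc_def f1_def[abs_def] by simp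
    then obtain k where k: "0 < k" "(\<integral>\<^sup>+y. \<Phi> (k * \<bar>f1 y\<bar>) \<partial>lebesgue) < \<infinity>" unfolding orlicz_space_def by blast
    \<comment> \<open>One admissible \<mu> has to exist for the almost everywhere finiteness and for
      membership in the Orlicz space; the infimum alone would not provide it.\<close>
    obtain \<mu>0 where \<mu>0: "0 < \<mu>0" "(\<integral>\<^sup>+y. \<Phi> (\<bar>f1 y\<bar> / \<mu>0) \<partial>lebesgue) \<le> 1"
      using luxemburg_finite[OF Y k(1) f1_meas k(2)] .
    have ratio: "0 < L * (\<mu> + \<kappa> / i)" if "0 < \<mu>" for \<mu> using that L \<kappa> i by (intro mult_pos_pos add_pos_nonneg) auto
    have norm_le: "ball_norm \<Phi> g x r \<le> ennreal (L * (\<mu> + \<kappa> / i))"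
      if "0 < \<mu>" "(\<integral>\<^sup>+y. \<Phi> (\<bar>f1 y\<bar> / \<mu>) \<partial>lebesgue) \<le> 1" for \<mu>
      unfolding ball_norm_def luxemburg_norm_def using key[OF that] ratio[OF that(1)] by (intro INF_lower) auto
    have "?inv r * ball_norm \<Phi> g x r \<le> ennreal (i * L) * luxemburg_norm \<Phi> f1 + ennreal (L * \<kappa>)"
    proof (rule le_mult_luxemburg)
      fix \<mu> :: real assume \<mu>: "0 < \<mu>" "(\<integral>\<^sup>+y. \<Phi> (\<bar>f1 y\<bar> / \<mu>) \<partial>lebesgue) \<le> 1"
      have "?inv r * ball_norm \<Phi> g x r \<le> ennreal i * ennreal (L * (\<mu> + \<kappa> / i))"
        unfolding i(1) by (intro mult_left_mono norm_le \<mu>) simp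
      also have "\<dots> = ennreal (i * L * \<mu> + L * \<kappa>)"
      proof -
        have "i * (L * (\<mu> + \<kappa> / i)) = i * L * \<mu> + L * \<kappa>" using i(2) by (simp add: distrib_left)
        then show ?thesis using i ratio[OF \<mu>(1)] by (simp only: ennreal_mult[symmetric] less_imp_le)
      qed
      also have "\<dots> = ennreal (i * L) * ennreal \<mu> + ennreal (L * \<kappa>)"
        using i L \<mu> \<kappa> by (simp add: ennreal_mult)
      finally show "?inv r * ball_norm \<Phi> g x r \<le> ennreal (i * L) * ennreal \<mu> + ennreal (L * \<kappa>)" .
    qed (use i L in simp)
    also have "ennreal (i * L) * luxemburg_norm \<Phi> f1 = ennreal L * (?inv r * ball_norm \<Phi> f x (2 * r))"
      unfolding ball_norm_def f1_def[abs_def] i(1) using i L by (simp add: ennreal_mult mult_ac)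
    also have "ennreal (L * \<kappa>) = ennreal L * K" using L \<kappa> by (simp add: ennreal_mult)
    also have "ennreal L * (?inv r * ball_norm \<Phi> f x (2 * r)) + ennreal L * K \<le>
        ennreal L * (ennreal (2 ^ ?n) * (ennreal (2 ^ (?n + 1)) * tail_integral \<Phi> f x r)) + ennreal L * (ennreal C5 * tail_integral \<Phi> f x r)"
    proof (intro add_mono mult_left_mono K_le)
      \<comment> \<open>The norm on the doubled ball is the term j = 0 of the dyadic sum starting at
        2 r; one doubling step of the inverse adjusts the radius.\<close>
      have "?inv r * ball_norm \<Phi> f x (2 * r) \<le> ennreal (2 ^ ?n) * ?inv (2 * r) * ball_norm \<Phi> f x (2 * r)"
        by (intro mult_right_mono inv_scale_double[OF Y r]) simp
      also have "\<dots> = ennreal (2 ^ ?n) * (?inv (2 ^ 0 * (2 * r)) * ball_norm \<Phi> f x (2 ^ 0 * (2 * r)))" by (simp add: mult.assoc)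
      also have "\<dots> \<le> ennreal (2 ^ ?n) * (\<Sum>\<^sup>+j::nat. ?inv (2 ^ j * (2 * r)) * ball_norm \<Phi> f x (2 ^ j * (2 * r)))"
        by (rule mult_left_mono[OF nsum_upper]) simp
      also have "\<dots> \<le> ennreal (2 ^ ?n) * (ennreal (2 ^ (?n + 1)) * tail_integral \<Phi> f x r)"
        using r by (intro mult_left_mono dyadic_sum_le_tail[OF Y]) auto
      finally show "?inv r * ball_norm \<Phi> f x (2 * r) \<le> ennreal (2 ^ ?n) * (ennreal (2 ^ (?n + 1)) * tail_integral \<Phi> f x r)" .
    qed auto
    also have "\<dots> = ennreal C * tail_integral \<Phi> f x r"
    proof -
      have "ennreal C = ennreal L * (ennreal (2 ^ ?n) * ennreal (2 ^ (?n + 1))) + ennreal L * ennreal C5"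
        using L C5(1) by (simp add: C_def ennreal_mult[symmetric] ennreal_plus[symmetric] mult.assoc del: ennreal_plus)
      then show ?thesis by (simp only: distrib_right mult.assoc)
    qed
    finally have norm: "?inv r * ball_norm \<Phi> g x r \<le> ennreal C * tail_integral \<Phi> f x r" .
    have "(\<lambda>y. g y * indicator ?B y) \<in> orlicz_space \<Phi>"
      unfolding orlicz_space_def
    proof (rule CollectI, rule conjI)
      have "ball_norm \<Phi> g x r < top" using norm_le[OF \<mu>0] by (rule le_less_trans) simp
      then have "(\<integral>\<^sup>+z\<in>?B. ennreal \<bar>g z\<bar> \<partial>lebesgue) < top"
        using le_less_trans[OF C3(2)[OF Y upper g_meas r, of x]] inv_scale_pos[OF Y r, where 'n='n]
        by (simp add: ennreal_mult_less_top)
      then have fin: "(\<integral>\<^sup>+z\<in>?B. ennreal \<bar>g z\<bar> \<partial>lebesgue) < \<infinity>" by simp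
      show "locally_integrable (\<lambda>y. g y * indicator ?B y)"
      proof (rule locally_integrable_L1)
        show "integrable lebesgue (\<lambda>y. g y * indicator ?B y)"
          unfolding integrable_iff_bounded
        proof
          have "(\<integral>\<^sup>+y. ennreal (norm (g y * indicator ?B y)) \<partial>lebesgue) = (\<integral>\<^sup>+z\<in>?B. ennreal \<bar>g z\<bar> \<partial>lebesgue)"
            by (intro nn_integral_cong) (auto split: split_indicator)
          then show "(\<integral>\<^sup>+y. ennreal (norm (g y * indicator ?B y)) \<partial>lebesgue) < \<infinity>" using fin by simp
        qed measurable
      qed
      show "\<exists>k>0. (\<integral>\<^sup>+y. \<Phi> (k * \<bar>g y * indicator ?B y\<bar>) \<partial>lebesgue) < \<infinity>"
      proof (intro exI[of _ "1 / (L * (\<mu>0 + \<kappa> / i))"] conjI)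
        show "0 < 1 / (L * (\<mu>0 + \<kappa> / i))" using ratio[OF \<mu>0(1)] by simp
        have "(\<integral>\<^sup>+y. \<Phi> (1 / (L * (\<mu>0 + \<kappa> / i)) * \<bar>g y * indicator ?B y\<bar>) \<partial>lebesgue) \<le> 1"
          using key[OF \<mu>0] by simp
        then show "(\<integral>\<^sup>+y. \<Phi> (1 / (L * (\<mu>0 + \<kappa> / i)) * \<bar>g y * indicator ?B y\<bar>) \<partial>lebesgue) < \<infinity>"
          by (rule le_less_trans) simp
      qed
    qed
    then show ?thesis using key[OF \<mu>0] norm unfolding g_def by blast
  qed
  then show ?thesis using C that by blast
qed

section \<open>Orlicz-Morrey spaces\<close>

lemma ball_norm_le_morrey:
  fixes f :: "real ^ 'n \<Rightarrow> real"
  assumes Y: "young_function \<Phi>" and \<phi>: "0 < \<phi> x s" and s: "0 < s"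
  shows "ball_norm \<Phi> f x s \<le> orlicz_morrey_norm \<Phi> \<phi> f * (ennreal (\<phi> x s) / inv_scale TYPE('n) \<Phi> s)"
proof -
  obtain i where i: "inv_scale TYPE('n) \<Phi> s = ennreal i" "0 < i"
    using inv_scale_pos[OF Y s, where 'n='n] by (cases "inv_scale TYPE('n) \<Phi> s") auto
  have "ennreal (inverse (\<phi> x s)) * inv_scale TYPE('n) \<Phi> s * ball_norm \<Phi> f x s \<le> orlicz_morrey_norm \<Phi> \<phi> f"
    unfolding orlicz_morrey_norm_def inv_scale_def ball_norm_def using s by (intro SUP_upper2[of "(x, s)"]) auto
  then have "ennreal (\<phi> x s / i) * (ennreal (inverse (\<phi> x s)) * ennreal i * ball_norm \<Phi> f x s) \<le> ennreal (\<phi> x s / i) * orlicz_morrey_norm \<Phi> \<phi> f"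
    unfolding i by (rule mult_left_mono) simp
  also have "ennreal (\<phi> x s / i) * (ennreal (inverse (\<phi> x s)) * ennreal i * ball_norm \<Phi> f x s) = ball_norm \<Phi> f x s"
    using \<phi> i by (simp add: mult.assoc[symmetric] ennreal_mult[symmetric])
  also have "ennreal (\<phi> x s / i) = ennreal (\<phi> x s) / inv_scale TYPE('n) \<Phi> s"
    unfolding i using \<phi> i by (simp add: divide_ennreal)
  finally show ?thesis by (simp add: mult.commute)
qed

lemma tail_integral_le_morrey:
  fixes f :: "real ^ 'n \<Rightarrow> real"
  assumes Y: "young_function \<Phi>" and \<phi>: "\<And>x s. 0 < s \<Longrightarrow> 0 < \<phi> x s" and r: "0 < r"
    and F: "orlicz_morrey_norm \<Phi> \<phi> f < \<infinity>"
  shows "tail_integral \<Phi> f x r \<le> orlicz_morrey_norm \<Phi> \<phi> f *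
    (\<integral>\<^sup>+t\<in>{r<..}. ess_inf_on {t<..} (\<lambda>s. ennreal (\<phi> x s) / inv_scale TYPE('n) \<Phi> s) *
       inv_scale TYPE('n) \<Phi> t / ennreal t \<partial>lebesgue)"
proof -
  let ?F = "orlicz_morrey_norm \<Phi> \<phi> f" and ?inv = "inv_scale TYPE('n) \<Phi>"
  let ?h = "\<lambda>s. ennreal (\<phi> x s) / ?inv s"
  let ?e = "\<lambda>t. ess_inf_on {t<..} ?h"
  have bound: "ball_norm \<Phi> f x t \<le> ?F * ?e t" if t: "r < t" for t
  \<comment> \<open>The norm is divided out below; when it is 0, every ball norm vanishes.\<close>
  proof (cases "?F = 0")
    case True
    have "0 < t" using r t by linarith
    then show ?thesis using ball_norm_le_morrey[where \<phi>=\<phi> and x=x and s=t and f=f, OF Y] \<phi> True by simp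
  next
    case False
    obtain F where F: "?F = ennreal F" "0 < F" using F False by (cases ?F) (auto simp: less_le)
    have "ennreal (1 / F) * ball_norm \<Phi> f x t \<le> ?e t"
      unfolding ess_inf_on_def
    proof (rule Sup_upper, rule CollectI, rule AE_I2, rule impI)
      fix s assume "s \<in> {t<..}"
      then have s: "t < s" "0 < s" using r t by auto
      have "ball_norm \<Phi> f x t \<le> ball_norm \<Phi> f x s" using s by (intro ball_norm_mono[OF Y]) simp
      also have "\<dots> \<le> ennreal F * ?h s" using ball_norm_le_morrey[where \<phi>=\<phi> and x=x and s=s and f=f, OF Y \<phi>[OF s(2)] s(2)] by (simp add: F(1))
      finally have "ennreal (1 / F) * ball_norm \<Phi> f x t \<le> ennreal (1 / F) * (ennreal F * ?h s)" by (rule mult_left_mono) simp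
      then show "ennreal (1 / F) * ball_norm \<Phi> f x t \<le> ?h s"
        using F(2) by (simp add: mult.assoc[symmetric] ennreal_mult[symmetric])
    qed
    then have "ennreal F * (ennreal (1 / F) * ball_norm \<Phi> f x t) \<le> ennreal F * ?e t" by (rule mult_left_mono) simp
    then show ?thesis using F by (simp add: mult.assoc[symmetric] ennreal_mult[symmetric])
  qed
  \<comment> \<open>Shrinking the half line can only add essential lower bounds. Monotonicity gives
    Borel measurability in t, whatever the sections of \<phi> look like.\<close>
  have "mono ?e"
  proof (rule monoI)
    fix s t :: real assume "s \<le> t"
    then show "?e s \<le> ?e t"
      unfolding ess_inf_on_def by (intro Sup_subset_mono) (auto elim!: eventually_mono)
  qed
  then have [measurable]: "?e \<in> borel_measurable borel" by (rule borel_measurable_mono_ennreal)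
  have [measurable]: "?inv \<in> borel_measurable borel"
  proof -
    have "mono (\<lambda>s. young_inv \<Phi> (ennreal s))" by (intro monoI young_inv_mono ennreal_leI)
    then have "(\<lambda>s. young_inv \<Phi> (ennreal s)) \<in> borel_measurable borel" by (rule borel_measurable_mono_ennreal)
    moreover have "(\<lambda>t::real. 1 / t ^ CARD('n)) \<in> borel_measurable borel" by measurable
    ultimately have "(\<lambda>t. young_inv \<Phi> (ennreal (1 / t ^ CARD('n)))) \<in> borel_measurable borel"
      by (rule measurable_compose[rotated])
    then show ?thesis by (simp add: inv_scale_def[abs_def] powi_minus_card)
  qed
  have meas: "(\<lambda>t. ?e t * ?inv t / ennreal t * indicator {r<..} t) \<in> borel_measurable lebesgue"
    by (intro borel_measurable_lebesgue) measurable
  have "tail_integral \<Phi> f x r \<le> (\<integral>\<^sup>+t. ?F * (?e t * ?inv t / ennreal t * indicator {r<..} t) \<partial>lebesgue)"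
    unfolding tail_integral_def
  proof (rule nn_integral_mono)
    fix t :: real
    show "ball_norm \<Phi> f x t * ?inv t / ennreal t * indicator {r<..} t \<le> ?F * (?e t * ?inv t / ennreal t * indicator {r<..} t)"
    proof (cases "r < t")
      case True
      have "ball_norm \<Phi> f x t * ?inv t * inverse (ennreal t) \<le> ?F * ?e t * ?inv t * inverse (ennreal t)"
        by (intro mult_right_mono bound True) auto
      then show ?thesis using True by (simp add: divide_ennreal_def mult.assoc)
    qed simp
  qed
  also have "\<dots> = ?F * (\<integral>\<^sup>+t. ?e t * ?inv t / ennreal t * indicator {r<..} t \<partial>lebesgue)"
    by (rule nn_integral_cmult[OF meas])
  finally show ?thesis .
qed

text \<open>\<open>intrinsic_gstar\<close> takes values in \<open>ennreal\<close>, while Morrey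
  spaces consist of real functions. The almost everywhere finiteness in the conclusion ensures that
  \<open>enn2real\<close> alters the values only on a null set.\<close>

theorem theorem3p8:
  fixes \<Phi> :: "real \<Rightarrow> ennreal"
    and \<phi>\<^sub>1 \<phi>\<^sub>2 :: "real ^ 'n \<Rightarrow> real \<Rightarrow> real"
    and \<alpha> p\<^sub>0 p\<^sub>1 l :: real
  assumes "0 < \<alpha>" and "\<alpha> \<le> 1"
    and "young_function \<Phi>"
    and "lower_type \<Phi> p\<^sub>0" and "upper_type \<Phi> p\<^sub>1"
    and "1 < p\<^sub>0" and "p\<^sub>0 \<le> p\<^sub>1"
    and "positive_measurable \<phi>\<^sub>1" and "positive_measurable \<phi>\<^sub>2"
    and "\<exists>C\<ge>0. \<forall>x. \<forall>r>0.
      (\<integral>\<^sup>+ t \<in> {r<..}.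
         ess_inf_on {t<..}
           (\<lambda>s. ennreal (\<phi>\<^sub>1 x s) / young_inv \<Phi> (ennreal (s powi (- int CARD('n))))) *
         young_inv \<Phi> (ennreal (t powi (- int CARD('n)))) / ennreal t \<partial>lebesgue)
      \<le> ennreal (C * \<phi>\<^sub>2 x r)"
    and "l > 3 + 2 * \<alpha> / real CARD('n)"
  shows "\<exists>C'\<ge>0. \<forall>f \<in> orlicz_morrey_space \<Phi> \<phi>\<^sub>1.
    (AE x in lebesgue. intrinsic_gstar l \<alpha> f x < \<infinity>) \<and>
    (\<lambda>x. enn2real (intrinsic_gstar l \<alpha> f x)) \<in> orlicz_morrey_space \<Phi> \<phi>\<^sub>2 \<and>
    orlicz_morrey_norm \<Phi> \<phi>\<^sub>2 (\<lambda>x. enn2real (intrinsic_gstar l \<alpha> f x))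
      \<le> ennreal C' * orlicz_morrey_norm \<Phi> \<phi>\<^sub>1 f"
proof -
  note Y = assms(3)
  have \<phi>1: "0 < \<phi>\<^sub>1 x s" and \<phi>2: "0 < \<phi>\<^sub>2 x s" if "0 < s" for x s
    using assms(8,9) that by (auto simp: positive_measurable_def)
  obtain H where H: "0 \<le> H" "\<And>x r. 0 < r \<Longrightarrow>
      (\<integral>\<^sup>+t\<in>{r<..}. ess_inf_on {t<..} (\<lambda>s. ennreal (\<phi>\<^sub>1 x s) / inv_scale TYPE('n) \<Phi> s) *
         inv_scale TYPE('n) \<Phi> t / ennreal t \<partial>lebesgue) \<le> ennreal (H * \<phi>\<^sub>2 x r)"
    using assms(10) unfolding inv_scale_def by blast
  \<comment> \<open>The hypothesis gives the lower bound 3 n + 2 \<alpha>, which is at least 2 n + 1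
    because n is at least 1.\<close>
  have l: "2 * real CARD('n) + 1 \<le> real CARD('n) * l"
  proof -
    have "real CARD('n) * (3 + 2 * \<alpha> / real CARD('n)) \<le> real CARD('n) * l" using assms(11) by (intro mult_left_mono) auto
    then have "3 * real CARD('n) + 2 * \<alpha> \<le> real CARD('n) * l" by (simp add: distrib_left)
    moreover have "1 \<le> real CARD('n)" by (simp add: Suc_leI)
    ultimately show ?thesis using assms(1) by linarith
  qed
  obtain C where C: "0 \<le> C" "\<And>(f :: real ^ 'n \<Rightarrow> real) x r. f \<in> orlicz_loc \<Phi> \<Longrightarrow> 0 < r \<Longrightarrow> tail_integral \<Phi> f x r < \<infinity> \<Longrightarrow>
    (AE y in lebesgue. y \<in> ball x r \<longrightarrow> intrinsic_gstar l \<alpha> f y < \<infinity>) \<and>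
    (\<lambda>y. enn2real (intrinsic_gstar l \<alpha> f y) * indicator (ball x r) y) \<in> orlicz_space \<Phi> \<and>
    inv_scale TYPE('n) \<Phi> r * ball_norm \<Phi> (\<lambda>y. enn2real (intrinsic_gstar l \<alpha> f y)) x r \<le> ennreal C * tail_integral \<Phi> f x r"
    by (rule gstar_local_estimate[where 'n='n, OF assms(1,2) Y assms(4,5,6) l], rule that)
  show ?thesis
  proof (intro exI[of _ "C * H"] conjI ballI)
    show "0 \<le> C * H" using C(1) H(1) by simp
  next
    fix f assume f: "f \<in> orlicz_morrey_space \<Phi> \<phi>\<^sub>1"
    let ?F = "orlicz_morrey_norm \<Phi> \<phi>\<^sub>1 f"
    let ?g = "\<lambda>x. enn2real (intrinsic_gstar l \<alpha> f x)"
    have loc: "f \<in> orlicz_loc \<Phi>" and F: "?F < \<infinity>" using f by (auto simp: orlicz_morrey_space_def)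
    have tail: "tail_integral \<Phi> f x r \<le> ?F * ennreal (H * \<phi>\<^sub>2 x r)" if r: "0 < r" for x r
    proof -
      have "tail_integral \<Phi> f x r \<le> ?F * (\<integral>\<^sup>+t\<in>{r<..}. ess_inf_on {t<..} (\<lambda>s. ennreal (\<phi>\<^sub>1 x s) / inv_scale TYPE('n) \<Phi> s) *
         inv_scale TYPE('n) \<Phi> t / ennreal t \<partial>lebesgue)"
        by (rule tail_integral_le_morrey[OF Y \<phi>1 r F])
      also have "\<dots> \<le> ?F * ennreal (H * \<phi>\<^sub>2 x r)" by (intro mult_left_mono H r) simp
      finally show ?thesis .
    qed
    have fin: "tail_integral \<Phi> f x r < \<infinity>" if r: "0 < r" for x r
      using tail[OF r, of x] F by (simp add: ennreal_mult_less_top le_less_trans)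
    note est = C(2)[OF loc _ fin]
    show "AE x in lebesgue. intrinsic_gstar l \<alpha> f x < \<infinity>"
    proof -
      \<comment> \<open>The local estimate gives finiteness on one ball at a time; countably many
        balls exhaust the space.\<close>
      have "AE y in lebesgue. \<forall>j::nat. y \<in> ball 0 (real (Suc j)) \<longrightarrow> intrinsic_gstar l \<alpha> f y < \<infinity>"
        unfolding AE_all_countable
      proof
        fix j
        show "AE y in lebesgue. y \<in> ball 0 (real (Suc j)) \<longrightarrow> intrinsic_gstar l \<alpha> f y < \<infinity>"
          by (rule conjunct1[OF est]) simp_all
      qed
      then show ?thesis
      proof eventually_elim
        case (elim y)
        obtain j where "norm y < real j" using reals_Archimedean2 by blast
        then have "y \<in> ball 0 (real (Suc j))" by simp
        with elim show ?case by blast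
      qed
    qed
    have norm: "orlicz_morrey_norm \<Phi> \<phi>\<^sub>2 ?g \<le> ennreal (C * H) * ?F"
      unfolding orlicz_morrey_norm_def[of \<Phi> \<phi>\<^sub>2]
    proof (rule SUP_least)
      fix xr :: "(real ^ 'n) \<times> real" assume "xr \<in> UNIV \<times> {0<..}"
      then obtain x r where xr: "xr = (x, r)" and r: "0 < r" by auto
      have "inv_scale TYPE('n) \<Phi> r * ball_norm \<Phi> ?g x r \<le> ennreal C * tail_integral \<Phi> f x r"
        using est[OF r r] by blast
      also have "\<dots> \<le> ennreal C * (?F * ennreal (H * \<phi>\<^sub>2 x r))" by (intro mult_left_mono tail r) simp
      finally have "ennreal (inverse (\<phi>\<^sub>2 x r)) * (inv_scale TYPE('n) \<Phi> r * ball_norm \<Phi> ?g x r)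
          \<le> ennreal (inverse (\<phi>\<^sub>2 x r)) * (ennreal C * (?F * ennreal (H * \<phi>\<^sub>2 x r)))" by (rule mult_left_mono) simp
      also have "\<dots> = (ennreal (inverse (\<phi>\<^sub>2 x r)) * ennreal C * ennreal (H * \<phi>\<^sub>2 x r)) * ?F" by (simp only: mult_ac)
      also have "ennreal (inverse (\<phi>\<^sub>2 x r)) * ennreal C * ennreal (H * \<phi>\<^sub>2 x r) = ennreal (C * H)"
        using \<phi>2[OF r, of x] C(1) H(1) by (simp add: ennreal_mult[symmetric] field_simps)
      finally show "(case xr of (x, r) \<Rightarrow> ennreal (inverse (\<phi>\<^sub>2 x r)) * young_inv \<Phi> (ennreal (r powi (- int CARD('n)))) *
          luxemburg_norm \<Phi> (\<lambda>y. ?g y * indicator (ball x r) y)) \<le> ennreal (C * H) * ?F"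
        by (simp add: xr inv_scale_def ball_norm_def mult.assoc)
    qed
    show "orlicz_morrey_norm \<Phi> \<phi>\<^sub>2 ?g \<le> ennreal (C * H) * ?F" by (rule norm)
    show "?g \<in> orlicz_morrey_space \<Phi> \<phi>\<^sub>2"
      unfolding orlicz_morrey_space_def
    proof (rule CollectI, rule conjI)
      show "?g \<in> orlicz_loc \<Phi>" unfolding orlicz_loc_def using est by simp
      have "ennreal (C * H) * ?F < \<infinity>" using F by (simp add: ennreal_mult_less_top)
      with norm show "orlicz_morrey_norm \<Phi> \<phi>\<^sub>2 ?g < \<infinity>" by (rule le_less_trans)
    qed
  qed
qed

end
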